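(* Let $k\in\mathbb{N}$, $N\in[1,\infty)$ with $k\le N$, and $D>0$. Assume that $\{(X_i,p_i,d_i,\mathfrak{m}_i)\}$ is a sequence of pointed $\mathrm{RCD}(-1,N)$ spaces satisfying $b_1(X_i)=k$ and $\mathrm{diam}(X_i)\le D$. Let $(\hat X_i,\hat p_i,\hat d_i,H_i)$ be the normal covering space of $(X_i,p_i,d_i)$ whose deck transformation group is the first homology group $$H_i=\pi_1(X_i,p_i)\big/[\pi_1(X_i,p_i),\pi_1(X_i,p_i)].$$ If $$(\hat X_i,\hat p_i,\hat d_i,H_i)\xrightarrow{\mathrm{GH}}(Y,\hat p,d,H),\qquad H=\mathbb{R}^{k_1}\times\mathbb{Z}^{k_2}\times C,$$ in the equivariant Gromov–Hausdorff sense, where $C$ is a compact group, then $k=k_1+k_2$.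
   Context: $b_1(X)$ is the first Betti number, i.e. the rank of the abelianization of $\pi_1(X)$. The covering $\hat X_i$ carries the lifted metric $\hat d_i$, $\hat p_i$ is a lift of $p_i$, and $H_i$ acts isometrically on $\hat X_i$ with $\hat X_i/H_i=X_i$. Equivariant Gromov–Hausdorff convergence: for a pointed metric space $(X,p)$ and a closed subgroup $H\le\mathrm{Isom}(X)$ put $H(r)=\{h\in H: d(hp,p)<r\}$. For pointed metric spaces $(X,p),(Y,q)$ with closed subgroups $H\le\mathrm{Isom}(X)$, $K\le\mathrm{Isom}(Y)$, a pointed $\epsilon$-equivariant Gromov–Hausdorff approximation is a triple of maps $f:B_{1/\epsilon}(p)\to B_{1/\epsilon+\epsilon}(q)$, $\phi:H(1/\epsilon)\to K(1/\epsilon)$, $\psi:K(1/\epsilon)\to H(1/\epsilon)$ such that (1) $f(p)=q$, $f(B_{1/\epsilon}(p))$ is $2\epsilon$-dense in $B_{1/\epsilon+\epsilon}(q)$ and $|d(f(x_1),f(x_2))-d(x_1,x_2)|\le\epsilon$ for all $x_1,x_2\in B_{1/\epsilon}(p)$; (2) $d(\phi(h)f(x),f(hx))<\epsilon$ for all $h\in H(1/\epsilon)$, $x\in B_{1/\epsilon}(p)$; (3) $d(kf(x),f(\psi(k)x))<\epsilon$ for all $k\in K(1/\epsilon)$, $x\in B_{1/\epsilon}(p)$. The equivariant GH distance is the infimum of such $\epsilon$, and $(X_i,p_i,G_i)\xrightarrow{\mathrm{GH}}(X,p,G)$ means that this distance tends to $0$; the limit group $G$ is a closed subgroup of $\mathrm{Isom}(X)$.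 *)

theory Defs
  imports
    "HOL-Probability.Probability"
    "HOL-Algebra.Bij"
    "HOL-Algebra.FiniteProduct"
    "HOL-Algebra.Generated_Groups"
    "HOL-Algebra.Product_Groups"
    "HOL-Library.Extended_Nat"
begin

section \<open>Metric measure spaces and optimal transport\<close>

definition borel_on :: "'a topology \<Rightarrow> 'a measure" where
  "borel_on T = sigma (topspace T) {U. openin T U}"

definition metric_measure_space :: "'a metric \<Rightarrow> 'a measure \<Rightarrow> bool" where
  "metric_measure_space X m \<longleftrightarrow>
     mspace X \<noteq> {} \<and> mcomplete_of X \<and> separable_space (mtopology_of X) \<and>
     sets m = sets (borel_on (mtopology_of X)) \<and>
     (\<forall>x\<in>mspace X. \<forall>r>0. 0 < emeasure m (mball_of X x r) \<and> emeasure m (mball_of X x r) < \<infinity>)"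

definition couplings :: "'a measure \<Rightarrow> 'a measure \<Rightarrow> ('a \<times> 'a) measure set" where
  "couplings \<mu> \<nu> =
     {\<pi>. sets \<pi> = sets (\<mu> \<Otimes>\<^sub>M \<nu>) \<and> distr \<pi> \<mu> fst = \<mu> \<and> distr \<pi> \<nu> snd = \<nu>}"

definition transport_cost :: "'a metric \<Rightarrow> ('a \<times> 'a) measure \<Rightarrow> ennreal" where
  "transport_cost X \<pi> = (\<integral>\<^sup>+ z. ennreal ((mdist X (fst z) (snd z))\<^sup>2) \<partial>\<pi>)"

definition wasserstein_sq :: "'a metric \<Rightarrow> 'a measure \<Rightarrow> 'a measure \<Rightarrow> ennreal" where
  "wasserstein_sq X \<mu> \<nu> = (INF \<pi>\<in>couplings \<mu> \<nu>. transport_cost X \<pi>)"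

text \<open>Used only on measures with finite second moment, where the squared distance is finite.\<close>

definition wasserstein_dist :: "'a metric \<Rightarrow> 'a measure \<Rightarrow> 'a measure \<Rightarrow> real" where
  "wasserstein_dist X \<mu> \<nu> = sqrt (enn2real (wasserstein_sq X \<mu> \<nu>))"

definition optimal_couplings :: "'a metric \<Rightarrow> 'a measure \<Rightarrow> 'a measure \<Rightarrow> ('a \<times> 'a) measure set" where
  "optimal_couplings X \<mu> \<nu> =
     {\<pi>\<in>couplings \<mu> \<nu>. transport_cost X \<pi> = wasserstein_sq X \<mu> \<nu>}"

text \<open>The space \<open>P\<^sub>2(X, d, m)\<close> of absolutely continuous probability measures with finite second moment.\<close>

definition P2_ac :: "'a metric \<Rightarrow> 'a measure \<Rightarrow> 'a measure set" where
  "P2_ac X m =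
     {\<mu>. prob_space \<mu> \<and> sets \<mu> = sets m \<and> absolutely_continuous m \<mu> \<and>
         (\<exists>x0\<in>mspace X. (\<integral>\<^sup>+ x. ennreal ((mdist X x0 x)\<^sup>2) \<partial>\<mu>) < \<infinity>)}"

definition P2_geodesic :: "'a metric \<Rightarrow> 'a measure \<Rightarrow> (real \<Rightarrow> 'a measure) \<Rightarrow> bool" where
  "P2_geodesic X m \<Gamma> \<longleftrightarrow>
     (\<forall>t\<in>{0..1}. \<Gamma> t \<in> P2_ac X m) \<and>
     (\<forall>s\<in>{0..1}. \<forall>t\<in>{0..1}.
        wasserstein_dist X (\<Gamma> s) (\<Gamma> t) = \<bar>s - t\<bar> * wasserstein_dist X (\<Gamma> 0) (\<Gamma> 1))"


section \<open>The curvature-dimension condition of Lott--Sturm--Villani\<close>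

text \<open>
  The distortion coefficients \<open>\<sigma>\<^bsub>K,N\<^esub>\<^bsup>(t)\<^esup>(\<theta>)\<close> and
  \<open>\<tau>\<^bsub>K,N\<^esub>\<^bsup>(t)\<^esup>(\<theta>) = t\<^bsup>1/N\<^esup> \<sigma>\<^bsub>K,N-1\<^esub>\<^bsup>(t)\<^esup>(\<theta>)\<^bsup>1-1/N\<^esup>\<close>.
  The coefficient \<open>\<sigma>\<close> with \<open>N = 0\<close> only serves to give \<open>\<tau>\<^bsub>K,1\<^esub>\<^bsup>(t)\<^esup>(\<theta>) = t\<close> for \<open>K \<le> 0\<close>.
\<close>

definition sigma_coeff :: "real \<Rightarrow> real \<Rightarrow> real \<Rightarrow> real \<Rightarrow> ennreal" where
  "sigma_coeff K N t \<theta> =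
     (if K * \<theta>\<^sup>2 = 0 \<or> (K * \<theta>\<^sup>2 < 0 \<and> N = 0) then ennreal t
      else if K * \<theta>\<^sup>2 < 0 then
        ennreal (sinh (t * \<theta> * sqrt (- K / N)) / sinh (\<theta> * sqrt (- K / N)))
      else if K * \<theta>\<^sup>2 < N * pi\<^sup>2 then
        ennreal (sin (t * \<theta> * sqrt (K / N)) / sin (\<theta> * sqrt (K / N)))
      else \<infinity>)"

definition tau_coeff :: "real \<Rightarrow> real \<Rightarrow> real \<Rightarrow> real \<Rightarrow> ennreal" where
  "tau_coeff K N t \<theta> =
     ennreal (t powr (1 / N)) *
     (if sigma_coeff K (N - 1) t \<theta> = \<infinity> then \<infinity>
      else ennreal (enn2real (sigma_coeff K (N - 1) t \<theta>) powr (1 - 1 / N)))"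

definition dens :: "'a measure \<Rightarrow> 'a measure \<Rightarrow> 'a \<Rightarrow> real" where
  "dens m \<mu> x = enn2real (RN_deriv m \<mu> x)"

text \<open>
  Minus the Renyi entropy, \<open>- S\<^sub>N(\<mu> | m) = \<integral> \<rho>\<^bsup>1-1/N\<^esup> dm\<close>.
  For \<open>N = 1\<close> the convention \<open>0 powr 0 = 0\<close> makes this \<open>m {\<rho> > 0}\<close>, as it should be.
\<close>

definition renyi :: "real \<Rightarrow> 'a measure \<Rightarrow> 'a measure \<Rightarrow> ennreal" where
  "renyi N m \<mu> = (\<integral>\<^sup>+ x. ennreal (dens m \<mu> x powr (1 - 1 / N)) \<partial>m)"

text \<open>
  Sturm's condition CD(K,N). The displayed inequality is the usual one multiplied by \<open>-1\<close>, so that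
  both sides are integrals of nonnegative functions. The values of \<open>powr\<close> at zero density are
  irrelevant, since zero density occurs only on a \<open>\<pi>\<close>-null set.
\<close>

definition CD :: "real \<Rightarrow> real \<Rightarrow> 'a metric \<Rightarrow> 'a measure \<Rightarrow> bool" where
  "CD K N X m \<longleftrightarrow>
     (\<forall>\<mu>0\<in>P2_ac X m. \<forall>\<mu>1\<in>P2_ac X m.
        \<exists>\<pi>\<in>optimal_couplings X \<mu>0 \<mu>1. \<exists>\<Gamma>.
          P2_geodesic X m \<Gamma> \<and> \<Gamma> 0 = \<mu>0 \<and> \<Gamma> 1 = \<mu>1 \<and>
          (\<forall>t\<in>{0..1}. \<forall>N'\<ge>N.
             (\<integral>\<^sup>+ z. tau_coeff K N' (1 - t) (mdist X (fst z) (snd z))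
                        * ennreal (dens m \<mu>0 (fst z) powr (- 1 / N'))
                    + tau_coeff K N' t (mdist X (fst z) (snd z))
                        * ennreal (dens m \<mu>1 (snd z) powr (- 1 / N')) \<partial>\<pi>)
             \<le> renyi N' m (\<Gamma> t)))"


section \<open>Infinitesimally Hilbertian spaces and RCD(K,N)\<close>

text \<open>The filter \<open>atin\<close> is trivial at isolated points, where the limes superior in \<open>ennreal\<close> is \<open>0\<close>.\<close>

definition local_lip :: "'a metric \<Rightarrow> ('a \<Rightarrow> real) \<Rightarrow> 'a \<Rightarrow> ennreal" where
  "local_lip X f x =
     Limsup (atin (mtopology_of X) x) (\<lambda>y. ennreal (\<bar>f y - f x\<bar> / mdist X x y))"

definition L2_functions :: "'a measure \<Rightarrow> ('a \<Rightarrow> real) set" where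
  "L2_functions m = {f\<in>borel_measurable m. (\<integral>\<^sup>+ x. ennreal ((f x)\<^sup>2) \<partial>m) < \<infinity>}"

text \<open>The Cheeger energy: the relaxation in \<open>L\<^sup>2\<close> of \<open>f \<mapsto> 1/2 \<integral> (lip f)\<^sup>2 dm\<close> on Lipschitz functions.\<close>

definition cheeger :: "'a metric \<Rightarrow> 'a measure \<Rightarrow> ('a \<Rightarrow> real) \<Rightarrow> ennreal" where
  "cheeger X m f =
     (INF g\<in>{g :: nat \<Rightarrow> 'a \<Rightarrow> real.
              (\<forall>n. Lipschitz_continuous_map X euclidean_metric (g n) \<and> g n \<in> L2_functions m) \<and>
              (\<lambda>n. \<integral>\<^sup>+ x. ennreal ((g n x - f x)\<^sup>2) \<partial>m) \<longlonglongrightarrow> 0}.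
        liminf (\<lambda>n. (\<integral>\<^sup>+ x. (local_lip X (g n) x)\<^sup>2 \<partial>m) / 2))"

text \<open>
  The Sobolev space \<open>W\<^bsup>1,2\<^esup> = {f \<in> L\<^sup>2. Ch f < \<infinity>}\<close>, normed by \<open>\<parallel>f\<parallel>\<^sup>2 = \<parallel>f\<parallel>\<^sub>2\<^sup>2 + 2 Ch f\<close>, is a
  Hilbert space if and only if \<open>Ch\<close> is a quadratic form, which is the customary definition:
\<close>

definition infinitesimally_Hilbertian :: "'a metric \<Rightarrow> 'a measure \<Rightarrow> bool" where
  "infinitesimally_Hilbertian X m \<longleftrightarrow>
     (\<forall>f\<in>L2_functions m. \<forall>g\<in>L2_functions m.
        cheeger X m (\<lambda>x. f x + g x) + cheeger X m (\<lambda>x. f x - g x)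
          = 2 * cheeger X m f + 2 * cheeger X m g)"

definition RCD :: "real \<Rightarrow> real \<Rightarrow> 'a metric \<Rightarrow> 'a measure \<Rightarrow> bool" where
  "RCD K N X m \<longleftrightarrow>
     metric_measure_space X m \<and> CD K N X m \<and> infinitesimally_Hilbertian X m"


section \<open>Fundamental group, first homology and Betti number\<close>

definition loops_at :: "'a topology \<Rightarrow> 'a \<Rightarrow> (real \<Rightarrow> 'a) set" where
  "loops_at T p = {g. pathin T g \<and> g 0 = p \<and> g 1 = p}"

definition loop_homotopic :: "'a topology \<Rightarrow> 'a \<Rightarrow> ((real \<Rightarrow> 'a) \<times> (real \<Rightarrow> 'a)) set" where
  "loop_homotopic T p =
     {(f, g). f \<in> loops_at T p \<and> g \<in> loops_at T p \<and>
        homotopic_with (\<lambda>h. h 0 = p \<and> h 1 = p) (top_of_set {0..1}) T f g}"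

text \<open>The library's \<open>joinpaths\<close> is restricted to the type class of topological spaces.\<close>

definition join_loops :: "(real \<Rightarrow> 'a) \<Rightarrow> (real \<Rightarrow> 'a) \<Rightarrow> real \<Rightarrow> 'a" where
  "join_loops f g = (\<lambda>t. if t \<le> 1 / 2 then f (2 * t) else g (2 * t - 1))"

definition fundamental_group :: "'a topology \<Rightarrow> 'a \<Rightarrow> (real \<Rightarrow> 'a) set monoid" where
  "fundamental_group T p =
     \<lparr>carrier = loops_at T p // loop_homotopic T p,
      mult = (\<lambda>A B. \<Union>f\<in>A. \<Union>g\<in>B. loop_homotopic T p `` {join_loops f g}),
      one = loop_homotopic T p `` {\<lambda>t. p}\<rparr>"

definition abelianization :: "('a, 'b) monoid_scheme \<Rightarrow> 'a set monoid" where
  "abelianization G = G Mod derived G (carrier G)"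

definition first_homology :: "'a topology \<Rightarrow> 'a \<Rightarrow> (real \<Rightarrow> 'a) set set monoid" where
  "first_homology T p = abelianization (fundamental_group T p)"

definition Z_independent :: "('a, 'b) monoid_scheme \<Rightarrow> 'a set \<Rightarrow> bool" where
  "Z_independent G S \<longleftrightarrow>
     finite S \<and> S \<subseteq> carrier G \<and>
     (\<forall>c :: 'a \<Rightarrow> int. finprod G (\<lambda>s. s [^]\<^bsub>G\<^esub> c s) S = \<one>\<^bsub>G\<^esub> \<longrightarrow> (\<forall>s\<in>S. c s = 0))"

definition abelian_group_rank :: "('a, 'b) monoid_scheme \<Rightarrow> enat" where
  "abelian_group_rank G = (SUP S\<in>{S. Z_independent G S}. enat (card S))"

text \<open>For path connected spaces this does not depend on the base point \<open>p\<close>.\<close>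

definition first_betti :: "'a topology \<Rightarrow> 'a \<Rightarrow> enat" where
  "first_betti T p = abelian_group_rank (first_homology T p)"


section \<open>Coverings with the lifted metric\<close>

text \<open>The counterpart of the library's \<open>covering_space\<close> for abstract topologies.\<close>

definition covering_map :: "'b topology \<Rightarrow> 'a topology \<Rightarrow> ('b \<Rightarrow> 'a) \<Rightarrow> bool" where
  "covering_map E B q \<longleftrightarrow>
     continuous_map E B q \<and> q ` topspace E = topspace B \<and>
     (\<forall>x\<in>topspace B. \<exists>U. x \<in> U \<and> openin B U \<and>
        (\<exists>\<V>. \<Union>\<V> = {y\<in>topspace E. q y \<in> U} \<and> (\<forall>V\<in>\<V>. openin E V) \<and> pairwise disjnt \<V> \<and>
             (\<forall>V\<in>\<V>. homeomorphic_map (subtopology E V) (subtopology B U) q)))"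

text \<open>As in \<open>BijGroup\<close>, self-maps of a space are extensional functions.\<close>

definition deck_transformations :: "'b topology \<Rightarrow> ('b \<Rightarrow> 'a) \<Rightarrow> ('b \<Rightarrow> 'b) set" where
  "deck_transformations E q =
     {h\<in>Bij (topspace E). homeomorphic_map E E h \<and> (\<forall>y\<in>topspace E. q (h y) = q y)}"

definition deck_group :: "'b topology \<Rightarrow> ('b \<Rightarrow> 'a) \<Rightarrow> ('b \<Rightarrow> 'b) monoid" where
  "deck_group E q = BijGroup (topspace E) \<lparr>carrier := deck_transformations E q\<rparr>"

definition normal_covering :: "'b topology \<Rightarrow> 'a topology \<Rightarrow> ('b \<Rightarrow> 'a) \<Rightarrow> bool" where
  "normal_covering E B q \<longleftrightarrow>
     covering_map E B q \<and> connected_space E \<and>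
     (\<forall>y\<in>topspace E. \<forall>z\<in>topspace E. q y = q z \<longrightarrow> (\<exists>h\<in>deck_transformations E q. h y = z))"

definition curve_length :: "'a metric \<Rightarrow> (real \<Rightarrow> 'a) \<Rightarrow> ennreal" where
  "curve_length X c =
     (SUP (n, t)\<in>{(n :: nat, t :: nat \<Rightarrow> real). mono_on {..n} t \<and> t ` {..n} \<subseteq> {0..1}}.
        \<Sum>j<n. ennreal (mdist X (c (t j)) (c (t (Suc j)))))"

text \<open>The lifted metric: the distance upstairs is the infimum of the lengths of projected paths.\<close>

definition lifted_metric :: "'b metric \<Rightarrow> 'a metric \<Rightarrow> ('b \<Rightarrow> 'a) \<Rightarrow> bool" where
  "lifted_metric Xh X q \<longleftrightarrow>
     (\<forall>y\<in>mspace Xh. \<forall>z\<in>mspace Xh.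
        ennreal (mdist Xh y z) =
          (INF c\<in>{c. pathin (mtopology_of Xh) c \<and> c 0 = y \<and> c 1 = z}. curve_length X (q \<circ> c)))"

text \<open>
  The pointed normal covering whose deck transformation group is the first homology group,
  with the lifted metric.
\<close>

definition homology_cover ::
    "'b metric \<Rightarrow> 'b \<Rightarrow> 'a metric \<Rightarrow> 'a \<Rightarrow> ('b \<Rightarrow> 'a) \<Rightarrow> bool" where
  "homology_cover Xh ph X p q \<longleftrightarrow>
     normal_covering (mtopology_of Xh) (mtopology_of X) q \<and>
     deck_group (mtopology_of Xh) q \<cong> first_homology (mtopology_of X) p \<and>
     lifted_metric Xh X q \<and> ph \<in> mspace Xh \<and> q ph = p"


section \<open>Isometry groups and equivariant Gromov--Hausdorff convergence\<close>

definition isometries :: "'a metric \<Rightarrow> ('a \<Rightarrow> 'a) set" where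
  "isometries X =
     {h\<in>Bij (mspace X). \<forall>x\<in>mspace X. \<forall>y\<in>mspace X. mdist X (h x) (h y) = mdist X x y}"

definition isometry_group :: "'a metric \<Rightarrow> ('a \<Rightarrow> 'a) monoid" where
  "isometry_group X = BijGroup (mspace X) \<lparr>carrier := isometries X\<rparr>"

text \<open>The compact-open topology.\<close>

definition isometry_topology :: "'a metric \<Rightarrow> ('a \<Rightarrow> 'a) topology" where
  "isometry_topology X =
     topology_generated_by
       {{h\<in>isometries X. h ` K \<subseteq> U} | K U. compactin (mtopology_of X) K \<and> openin (mtopology_of X) U}"

definition closed_isometry_subgroup :: "('a \<Rightarrow> 'a) set \<Rightarrow> 'a metric \<Rightarrow> bool" where
  "closed_isometry_subgroup H X \<longleftrightarrow>
     subgroup H (isometry_group X) \<and> closedin (isometry_topology X) H"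

definition small_displacement :: "'a metric \<Rightarrow> 'a \<Rightarrow> ('a \<Rightarrow> 'a) set \<Rightarrow> real \<Rightarrow> ('a \<Rightarrow> 'a) set" where
  "small_displacement X p H r = {h\<in>H. mdist X (h p) p < r}"

text \<open>
  Since \<open>f\<close> is a map on the ball \<open>B\<^bsub>1/\<epsilon>\<^esub>(p)\<close> only, the two equivariance conditions are imposed
  where the moved point \<open>h x\<close> (respectively \<open>\<psi> k x\<close>) lies in this ball.
\<close>

definition eGH_approximation ::
    "real \<Rightarrow> 'a metric \<Rightarrow> 'a \<Rightarrow> ('a \<Rightarrow> 'a) set \<Rightarrow> 'c metric \<Rightarrow> 'c \<Rightarrow> ('c \<Rightarrow> 'c) set \<Rightarrow>
     ('a \<Rightarrow> 'c) \<Rightarrow> (('a \<Rightarrow> 'a) \<Rightarrow> ('c \<Rightarrow> 'c)) \<Rightarrow> (('c \<Rightarrow> 'c) \<Rightarrow> ('a \<Rightarrow> 'a)) \<Rightarrow> bool" where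
  "eGH_approximation \<epsilon> X p H Y q K f \<phi> \<psi> \<longleftrightarrow>
     (let B = mball_of X p (1 / \<epsilon>); B' = mball_of Y q (1 / \<epsilon> + \<epsilon>);
          H\<^sub>\<epsilon> = small_displacement X p H (1 / \<epsilon>); K\<^sub>\<epsilon> = small_displacement Y q K (1 / \<epsilon>)
      in f \<in> B \<rightarrow> B' \<and> \<phi> \<in> H\<^sub>\<epsilon> \<rightarrow> K\<^sub>\<epsilon> \<and> \<psi> \<in> K\<^sub>\<epsilon> \<rightarrow> H\<^sub>\<epsilon> \<and>
         f p = q \<and>
         (\<forall>y\<in>B'. \<exists>x\<in>B. mdist Y (f x) y < 2 * \<epsilon>) \<and>
         (\<forall>x1\<in>B. \<forall>x2\<in>B. \<bar>mdist Y (f x1) (f x2) - mdist X x1 x2\<bar> \<le> \<epsilon>) \<and>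
         (\<forall>h\<in>H\<^sub>\<epsilon>. \<forall>x\<in>B. h x \<in> B \<longrightarrow> mdist Y (\<phi> h (f x)) (f (h x)) < \<epsilon>) \<and>
         (\<forall>k\<in>K\<^sub>\<epsilon>. \<forall>x\<in>B. \<psi> k x \<in> B \<longrightarrow> mdist Y (k (f x)) (f (\<psi> k x)) < \<epsilon>))"

definition eGH_dist ::
    "'a metric \<Rightarrow> 'a \<Rightarrow> ('a \<Rightarrow> 'a) set \<Rightarrow> 'c metric \<Rightarrow> 'c \<Rightarrow> ('c \<Rightarrow> 'c) set \<Rightarrow> ereal" where
  "eGH_dist X p H Y q K =
     Inf {ereal \<epsilon> | \<epsilon>. 0 < \<epsilon> \<and> (\<exists>f \<phi> \<psi>. eGH_approximation \<epsilon> X p H Y q K f \<phi> \<psi>)}"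

definition eGH_converges ::
    "(nat \<Rightarrow> 'a metric) \<Rightarrow> (nat \<Rightarrow> 'a) \<Rightarrow> (nat \<Rightarrow> ('a \<Rightarrow> 'a) set) \<Rightarrow>
     'c metric \<Rightarrow> 'c \<Rightarrow> ('c \<Rightarrow> 'c) set \<Rightarrow> bool" where
  "eGH_converges X p H Y q K \<longleftrightarrow> (\<lambda>i. eGH_dist (X i) (p i) (H i) Y q K) \<longlonglongrightarrow> 0"


section \<open>Topological groups\<close>

definition topological_group :: "('a, 'b) monoid_scheme \<Rightarrow> 'a topology \<Rightarrow> bool" where
  "topological_group G T \<longleftrightarrow>
     group G \<and> topspace T = carrier G \<and>
     continuous_map (prod_topology T T) T (\<lambda>(x, y). x \<otimes>\<^bsub>G\<^esub> y) \<and>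
     continuous_map T T (\<lambda>x. inv\<^bsub>G\<^esub> x)"

definition compact_group :: "('a, 'b) monoid_scheme \<Rightarrow> 'a topology \<Rightarrow> bool" where
  "compact_group G T \<longleftrightarrow> topological_group G T \<and> compact_space T \<and> Hausdorff_space T"

definition topological_group_isomorphic ::
    "('a, 'b) monoid_scheme \<Rightarrow> 'a topology \<Rightarrow> ('c, 'd) monoid_scheme \<Rightarrow> 'c topology \<Rightarrow> bool" where
  "topological_group_isomorphic G S H T \<longleftrightarrow> (\<exists>\<Phi>\<in>iso G H. homeomorphic_map S T \<Phi>)"

definition real_group :: "real monoid" where
  "real_group = \<lparr>carrier = UNIV, mult = (+), one = 0\<rparr>"

text \<open>The group \<open>\<real>\<^bsup>k1\<^esup> \<times> \<int>\<^bsup>k2\<^esup> \<times> C\<close> and its topology.\<close>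

definition RZC_group ::
    "nat \<Rightarrow> nat \<Rightarrow> 'g monoid \<Rightarrow> ((nat \<Rightarrow> real) \<times> (nat \<Rightarrow> int) \<times> 'g) monoid" where
  "RZC_group k1 k2 C =
     product_group {..<k1} (\<lambda>_. real_group) \<times>\<times> (product_group {..<k2} (\<lambda>_. integer_group) \<times>\<times> C)"

definition RZC_topology ::
    "nat \<Rightarrow> nat \<Rightarrow> 'g topology \<Rightarrow> ((nat \<Rightarrow> real) \<times> (nat \<Rightarrow> int) \<times> 'g) topology" where
  "RZC_topology k1 k2 T =
     prod_topology (product_topology (\<lambda>_. euclideanreal) {..<k1})
       (prod_topology (product_topology (\<lambda>_. discrete_topology UNIV) {..<k2}) T)"

end

theory Submission
  imports Defs
begin

text \<open>
  Let \<open>d = k1 + k2\<close> and let \<open>\<rho>\<close> be the projection of \<open>H\<close> to \<open>\<real>\<^sup>d\<close>. For one sufficiently good equivariant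
  approximation, the elements of \<open>H\<close> over the unit vectors correspond to elements of the (abelian) deck
  transformation group of bounded displacement, which generate a subgroup \<open>E\<close>. Rounding \<open>\<rho>\<close> to integers
  shows that a deck transformation of bounded displacement is a product of an element of \<open>E\<close> with
  bounded exponents and an element of the finite set \<open>T\<close> of those of small displacement.

  The deck transformations of displacement at most \<open>2 D + 3\<close> generate, so \<open>E\<close> and \<open>T\<close> generate and the rank
  is at most \<open>d\<close>. Conversely, \<open>E\<close> is only known to be free at bounded scale, so it is not clear that its
  generators are independent in the group. But the transfer from the group to \<open>E\<close> makes sense at bounded
  scale and is a partial homomorphism to \<open>\<int>\<^sup>d\<close>. A partial homomorphism is a local cocycle on \<open>X\<close>, hence a
  homomorphism \<open>\<pi>\<^sub>1(X) \<rightarrow> \<int>\<^sup>d\<close>; it has finite cokernel, which gives \<open>d\<close> independent homology classes.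

  From the RCD condition one only needs that \<open>X\<close> is a compact length space. The curvature-dimension
  inequality, applied to geodesics between the uniform measures of small balls, yields approximate
  midpoints; applied to geodesics from small balls to the whole space, it yields total boundedness.
\<close>

text \<open>A single member of the sequence is used, and about its deck group only displacements of
  order at most \<open>1 / \<epsilon>\<close> are controlled. A function that is additive on a ball
  of the deck group need not extend to that group. It extends to the group presented by the ball and
  its multiplication table, which may be larger. The lower bound survives because a homotopy in X
  can be cut into squares below any prescribed size, so that \<open>\<pi>\<^sub>1(X)\<close> acts
  through this larger group. The transfer is the classical one for a subgroup of finite index. On
  the subgroup it is multiplication by the index \<open>n\<close>, here the number of coset
  representatives, so the periods of the loops over the generators form \<open>n\<close> times the
  identity matrix, and that gives independence in homology. The covering is only assumed to have a
  deck group abstractly isomorphic to the first homology. The upper bound carries independent sets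
  through this isomorphism, while the lower bound works with loops in X and never has to identify
  it.\<close>

section \<open>Transfer of bounded translations\<close>

text \<open>The map \<open>E\<close> of \<open>\<int>\<^sup>d\<close> is not assumed to be injective: only bounded coefficients can be controlled,
  and the gap between \<open>A\<close> and \<open>8 * A\<close> in the last assumption is what rules out torsion and lets
  sums of bounded coefficients be bounded again.\<close>

locale bounded_translates = comm_group G for G (structure) +
  fixes d :: nat and E :: "(nat \<Rightarrow> int) \<Rightarrow> 'a" and A :: int and T :: "'a set"
  assumes E_closed: "E a \<in> carrier G"
    and E_add: "E (\<lambda>j. a j + b j) = E a \<otimes> E b"
    and E_cong: "(\<And>j. j < d \<Longrightarrow> a j = b j) \<Longrightarrow> E a = E b"
    and T_carrier: "T \<subseteq> carrier G" and finite_T: "finite T" and one_T: "\<one> \<in> T"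
    and A_pos: "1 \<le> A"
    and E_free: "\<lbrakk>t \<in> T; E a \<otimes> t \<in> T; \<forall>j<d. \<bar>a j\<bar> \<le> 8 * A\<rbrakk> \<Longrightarrow> \<forall>j<d. \<bar>a j\<bar> \<le> A"
begin

lemma E_zero: "E (\<lambda>j. 0) = \<one>"
  using E_add[of "\<lambda>j. 0" "\<lambda>j. 0"] E_closed by (simp add: l_cancel_one')

lemma E_uminus: "E (\<lambda>j. - a j) = inv (E a)"
  using E_add[of "\<lambda>j. - a j" a] E_zero E_closed by (simp add: inv_equality)

lemma E_diff: "E (\<lambda>j. a j - b j) = E a \<otimes> inv (E b)"
  using E_add[of a "\<lambda>j. - b j"] E_uminus by simp

lemma E_mult: "E (\<lambda>j. int n * a j) = E a [^] n"
proof (induction n)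
  case 0
  then show ?case using E_zero by simp
next
  case (Suc n)
  have "E (\<lambda>j. int (Suc n) * a j) = E (\<lambda>j. int n * a j + a j)"
    by (rule arg_cong[of _ _ E]) (auto simp: algebra_simps)
  then show ?case using Suc E_add by simp
qed

text \<open>A nonzero \<open>a\<close> with trivial image has entries at most \<open>A\<close> by
  \<open>E_free\<close>. A suitable multiple, again with trivial image, then has largest entry in
  the gap between \<open>A\<close> and \<open>8 * A\<close>, which \<open>E_free\<close>
  excludes.\<close>

lemma E_eq_one_imp:
  assumes one: "E a = \<one>" and bd: "\<And>j. j < d \<Longrightarrow> \<bar>a j\<bar> \<le> 8 * A" and j: "j < d"
  shows "a j = 0"
proof (rule ccontr)
  assume nz: "a j \<noteq> 0"
  have bdA: "\<bar>a l\<bar> \<le> A" if "l < d" for l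
    using E_free[OF one_T, of a] one one_T bd that by simp
  define M where "M = Max ((\<lambda>l. \<bar>a l\<bar>) ` {..<d})"
  have M: "\<bar>a l\<bar> \<le> M" if "l < d" for l unfolding M_def using that by (intro Max_ge) auto
  have "M \<in> (\<lambda>l. \<bar>a l\<bar>) ` {..<d}" unfolding M_def using j by (intro Max_in) auto
  then obtain l where l: "l < d" "M = \<bar>a l\<bar>" by auto
  have Mpos: "0 < M" using M[OF j] nz by linarith
  have MA: "M \<le> A" using bdA l by auto
  \<comment> \<open>The least \<open>n\<close> with \<open>n * M > A\<close>; since
    \<open>M \<le> A\<close>, this overshoots to at most \<open>2 * A\<close>.\<close>
  define n where "n = nat (A div M + 1)"
  have n: "int n = A div M + 1" unfolding n_def using A_pos Mpos
    by (simp add: pos_imp_zdiv_nonneg_iff add_nonneg_nonneg)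
  have dm: "(A div M) * M + A mod M = A" "0 \<le> A mod M" "A mod M < M" using Mpos by simp_all
  have nM: "int n * M = (A div M) * M + M" using n by (simp add: algebra_simps)
  have up: "int n * M \<le> 2 * A" and lo: "A < int n * M" using nM dm MA by linarith+
  have one': "E (\<lambda>j. int n * a j) = \<one>" using E_mult one by simp
  have "\<bar>int n * a l'\<bar> \<le> 8 * A" if "l' < d" for l'
  proof -
    have "\<bar>int n * a l'\<bar> \<le> int n * M" using M[OF that] by (simp add: abs_mult mult_left_mono)
    then show ?thesis using up A_pos by linarith
  qed
  with E_free[OF one_T, of "\<lambda>j. int n * a j"] one' one_T l(1)
  have "\<bar>int n * a l\<bar> \<le> A" by simp
  with lo l show False by (simp add: abs_mult)
qed

text \<open>Being in the same coset of the image of \<open>E\<close>, as far as bounded coefficients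
  can tell. Transitivity depends on \<open>E_free\<close>, which improves the bound
  \<open>2 * A\<close> of a composite back to \<open>A\<close>.\<close>

definition trel where
  "trel t s \<longleftrightarrow> (\<exists>a. (\<forall>j<d. \<bar>a j\<bar> \<le> A) \<and> t = E a \<otimes> s)"

lemma trel_refl: "t \<in> T \<Longrightarrow> trel t t"
  unfolding trel_def using A_pos T_carrier E_zero by (intro exI[of _ "\<lambda>j. 0"]) auto

lemma trel_sym: "t \<in> T \<Longrightarrow> s \<in> T \<Longrightarrow> trel t s \<Longrightarrow> trel s t"
proof -
  assume "t \<in> T" "s \<in> T" "trel t s"
  then obtain a where a: "\<forall>j<d. \<bar>a j\<bar> \<le> A" "t = E a \<otimes> s" unfolding trel_def by auto
  have "s = E (\<lambda>j. - a j) \<otimes> t" using a E_uminus E_closed T_carrier \<open>s \<in> T\<close>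
    by (simp add: m_assoc[symmetric] subset_iff)
  then show ?thesis unfolding trel_def using a by (intro exI[of _ "\<lambda>j. - a j"]) auto
qed

lemma trelI:
  assumes "t \<in> T" "s \<in> T" "t = E a \<otimes> s" "\<And>j. j < d \<Longrightarrow> \<bar>a j\<bar> \<le> 8 * A"
  shows "trel t s"
  unfolding trel_def using E_free[of s a] assms by (intro exI[of _ a]) auto

lemma trel_trans: "t \<in> T \<Longrightarrow> s \<in> T \<Longrightarrow> u \<in> T \<Longrightarrow> trel t s \<Longrightarrow> trel s u \<Longrightarrow> trel t u"
proof -
  assume T: "t \<in> T" "s \<in> T" "u \<in> T" and "trel t s" "trel s u"
  then obtain a b where ab: "\<forall>j<d. \<bar>a j\<bar> \<le> A" "t = E a \<otimes> s" "\<forall>j<d. \<bar>b j\<bar> \<le> A" "s = E b \<otimes> u"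
    unfolding trel_def by auto
  show ?thesis
  proof (rule trelI[OF T(1,3)])
    show "t = E (\<lambda>j. a j + b j) \<otimes> u" using ab E_add E_closed T T_carrier by (simp add: m_assoc subset_iff)
    show "\<bar>a j + b j\<bar> \<le> 8 * A" if "j < d" for j
      using ab that A_pos by (smt (verit))
  qed
qed

definition trep where "trep t = (SOME s. s \<in> T \<and> trel t s)"

lemma trep: "t \<in> T \<Longrightarrow> trep t \<in> T \<and> trel t (trep t)"
  unfolding trep_def by (rule someI[of _ t]) (auto simp: trel_refl)

lemma trep_eq:
  assumes "t \<in> T" "s \<in> T" "trel t s" shows "trep t = trep s"
proof -
  have "(\<lambda>u. u \<in> T \<and> trel t u) = (\<lambda>u. u \<in> T \<and> trel s u)"
    using assms trel_trans trel_sym by blast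
  then show ?thesis unfolding trep_def by simp
qed

definition reps where "reps = trep ` T"

lemma reps_T: "reps \<subseteq> T" unfolding reps_def using trep by auto

lemma reps_eq: "u \<in> reps \<Longrightarrow> v \<in> reps \<Longrightarrow> trel u v \<Longrightarrow> u = v"
  unfolding reps_def using trep_eq trep by (metis (no_types, lifting) imageE)

text \<open>Uniqueness of coset decompositions, for coefficients that are not too far apart. The
  largest difference met in the transfer is \<open>6 * A\<close>, where additivity compares three
  coefficients of size \<open>2 * A\<close>.\<close>

lemma reps_unique:
  assumes u: "u \<in> reps" "v \<in> reps" and eq: "E a \<otimes> u = E b \<otimes> v"
    and bd: "\<And>j. j < d \<Longrightarrow> \<bar>a j - b j\<bar> \<le> 8 * A"
  shows "u = v \<and> (\<forall>j<d. a j = b j)"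
proof -
  have uv: "u \<in> T" "v \<in> T" "u \<in> carrier G" "v \<in> carrier G" using u reps_T T_carrier by auto
  have v: "v = E (\<lambda>j. a j - b j) \<otimes> u"
  proof -
    have "E (\<lambda>j. a j - b j) \<otimes> u = inv (E b) \<otimes> (E a \<otimes> u)"
      using E_diff E_closed uv by (simp add: m_ac)
    also have "\<dots> = v" unfolding eq using E_closed uv by (simp add: m_assoc[symmetric])
    finally show ?thesis by simp
  qed
  have "trel v u" by (rule trelI[OF uv(2,1) v bd])
  then have vu: "v = u" using reps_eq u by blast
  then have "E (\<lambda>j. a j - b j) = \<one>" using v uv E_closed by (metis r_cancel_one')
  from E_eq_one_imp[OF this bd] have "\<forall>j<d. a j = b j" by auto
  with vu show ?thesis by auto
qed

text \<open>The transfer: \<open>x\<close> permutes the representatives up to translations \<open>E a\<close>, and the sum of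
  these translations is additive in \<open>x\<close>.\<close>

lemma transfer:
  assumes S: "S \<subseteq> carrier G"
    and cover: "\<And>x u. x \<in> S \<Longrightarrow> u \<in> T \<Longrightarrow> \<exists>a t. t \<in> T \<and> (\<forall>j<d. \<bar>a j\<bar> \<le> A) \<and> x \<otimes> u = E a \<otimes> t"
  obtains F :: "'a \<Rightarrow> nat \<Rightarrow> int" and n :: nat where "0 < n"
    "\<And>x y j. x \<in> S \<Longrightarrow> y \<in> S \<Longrightarrow> x \<otimes> y \<in> S \<Longrightarrow> j < d \<Longrightarrow> F (x \<otimes> y) j = F x j + F y j"
    "\<And>a j. E a \<in> S \<Longrightarrow> (\<And>j. j < d \<Longrightarrow> \<bar>a j\<bar> \<le> A) \<Longrightarrow> j < d \<Longrightarrow> F (E a) j = int n * a j"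
proof -
  \<comment> \<open>One \<open>A\<close> comes from \<open>cover\<close>, the other from replacing
    \<open>t\<close> by the representative of its class.\<close>
  have ex: "\<exists>c v. v \<in> reps \<and> (\<forall>j<d. \<bar>c j\<bar> \<le> 2 * A) \<and> x \<otimes> u = E c \<otimes> v"
    if x: "x \<in> S" and u: "u \<in> reps" for x u
  proof -
    obtain a t where at: "t \<in> T" "\<forall>j<d. \<bar>a j\<bar> \<le> A" "x \<otimes> u = E a \<otimes> t"
      using cover[OF x] u reps_T by blast
    obtain b where b: "\<forall>j<d. \<bar>b j\<bar> \<le> A" "t = E b \<otimes> trep t"
      using trep[OF at(1)] unfolding trel_def by auto
    have tc: "trep t \<in> carrier G" using trep[OF at(1)] T_carrier by auto
    have "x \<otimes> u = E a \<otimes> (E b \<otimes> trep t)" using at b(2) by simp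
    also have "\<dots> = E (\<lambda>j. a j + b j) \<otimes> trep t"
      using E_add E_closed tc by (simp add: m_assoc)
    finally have *: "x \<otimes> u = E (\<lambda>j. a j + b j) \<otimes> trep t" .
    have "\<bar>a j + b j\<bar> \<le> 2 * A" if "j < d" for j using at(2) b(1) that by (smt (verit))
    moreover have "trep t \<in> reps" using at(1) unfolding reps_def by auto
    ultimately show ?thesis using *
      by (intro exI[of _ "\<lambda>j. a j + b j"] exI[of _ "trep t"]) auto
  qed
  then have "\<forall>z \<in> S \<times> reps. \<exists>cv. snd cv \<in> reps \<and> (\<forall>j<d. \<bar>fst cv j\<bar> \<le> 2 * A)
      \<and> fst z \<otimes> snd z = E (fst cv) \<otimes> snd cv"
    by (auto; metis fst_conv snd_conv)
  then obtain cv where cv: "\<And>z. z \<in> S \<times> reps \<Longrightarrow> snd (cv z) \<in> reps \<and> (\<forall>j<d. \<bar>fst (cv z) j\<bar> \<le> 2 * A)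
      \<and> fst z \<otimes> snd z = E (fst (cv z)) \<otimes> snd (cv z)" by metis
  define c where "c x u = fst (cv (x, u))" for x u
  define \<pi> where "\<pi> x u = snd (cv (x, u))" for x u
  have \<pi>: "\<pi> x u \<in> reps" and c: "j < d \<Longrightarrow> \<bar>c x u j\<bar> \<le> 2 * A" and eq: "x \<otimes> u = E (c x u) \<otimes> \<pi> x u"
    if "x \<in> S" "u \<in> reps" for x u j
    using cv[of "(x,u)"] that unfolding c_def \<pi>_def by auto
  have rc: "u \<in> carrier G" if "u \<in> reps" for u using that reps_T T_carrier by auto
  have fin: "finite reps" unfolding reps_def using finite_T by simp
  have bij: "bij_betw (\<pi> x) reps reps" if x: "x \<in> S" for x
  proof -
    have "inj_on (\<pi> x) reps"
    proof (rule inj_onI)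
      fix u v assume u: "u \<in> reps" and v: "v \<in> reps" and uv: "\<pi> x u = \<pi> x v"
      have xc: "x \<in> carrier G" using x S by auto
      \<comment> \<open>Multiplying the equation for \<open>u\<close> by the translation of
        \<open>v\<close>, and conversely, makes the right-hand sides agree; then \<open>x\<close>
        cancels.\<close>
      have "x \<otimes> (E (c x v) \<otimes> u) = E (c x v) \<otimes> (E (c x u) \<otimes> \<pi> x u)"
        using eq[OF x u] xc rc u E_closed by (metis m_lcomm)
      also have "\<dots> = E (c x u) \<otimes> (E (c x v) \<otimes> \<pi> x v)"
        using uv E_closed rc[OF \<pi>[OF x v]] by (simp add: m_lcomm)
      also have "\<dots> = x \<otimes> (E (c x u) \<otimes> v)"
        using eq[OF x v] xc rc v E_closed by (metis m_lcomm)
      finally have *: "E (c x v) \<otimes> u = E (c x u) \<otimes> v" using xc rc u v E_closed by simp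
      have "\<bar>c x v j - c x u j\<bar> \<le> 8 * A" if "j < d" for j
        using c[OF x u that] c[OF x v that] A_pos by linarith
      from reps_unique[OF u v * this] show "u = v" by simp
    qed
    moreover have "\<pi> x ` reps \<subseteq> reps" using \<pi> x by auto
    ultimately show ?thesis using fin by (simp add: bij_betw_def endo_inj_surj)
  qed
  define F where "F x j = (\<Sum>u\<in>reps. c x u j)" for x j
  show ?thesis
  proof (rule that[of "card reps" F])
    have "trep \<one> \<in> reps" unfolding reps_def using one_T by auto
    then show "0 < card reps" using fin card_gt_0_iff by blast
  next
    fix x y j assume x: "x \<in> S" and y: "y \<in> S" and xy: "x \<otimes> y \<in> S" and j: "j < d"
    have xc: "x \<in> carrier G" "y \<in> carrier G" using x y S by auto
    have "c (x \<otimes> y) u j = c y u j + c x (\<pi> y u) j" if u: "u \<in> reps" for u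
    proof -
      have "E (c (x \<otimes> y) u) \<otimes> \<pi> (x \<otimes> y) u = x \<otimes> (y \<otimes> u)"
        using eq[OF xy u] xc rc[OF u] by (simp add: m_assoc)
      also have "\<dots> = E (c y u) \<otimes> (x \<otimes> \<pi> y u)"
        using eq[OF y u] xc rc[OF \<pi>[OF y u]] E_closed by (simp add: m_lcomm)
      also have "\<dots> = E (\<lambda>j. c y u j + c x (\<pi> y u) j) \<otimes> \<pi> x (\<pi> y u)"
        using eq[OF x \<pi>[OF y u]] E_add E_closed rc[OF \<pi>[OF x \<pi>[OF y u]]] by (simp add: m_assoc)
      finally have *: "E (c (x \<otimes> y) u) \<otimes> \<pi> (x \<otimes> y) u
          = E (\<lambda>j. c y u j + c x (\<pi> y u) j) \<otimes> \<pi> x (\<pi> y u)" .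
      have "\<bar>c (x \<otimes> y) u j - (c y u j + c x (\<pi> y u) j)\<bar> \<le> 8 * A" if "j < d" for j
        using c[OF xy u that] c[OF y u that] c[OF x \<pi>[OF y u] that] A_pos by linarith
      from reps_unique[OF \<pi>[OF xy u] \<pi>[OF x \<pi>[OF y u]] * this] j show ?thesis by simp
    qed
    then have "F (x \<otimes> y) j = (\<Sum>u\<in>reps. c y u j) + (\<Sum>u\<in>reps. c x (\<pi> y u) j)"
      unfolding F_def by (simp add: sum.distrib)
    \<comment> \<open>Since \<open>y\<close> permutes the representatives, the sum over the moved
      representatives is the sum over all of them.\<close>
    also have "(\<Sum>u\<in>reps. c x (\<pi> y u) j) = (\<Sum>u\<in>reps. c x u j)"
      by (rule sum.reindex_bij_betw[OF bij[OF y]])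
    finally show "F (x \<otimes> y) j = F x j + F y j" unfolding F_def by simp
  next
    fix a j assume aS: "E a \<in> S" and a: "\<And>j. j < d \<Longrightarrow> \<bar>a j\<bar> \<le> A" and j: "j < d"
    have "c (E a) u j = a j" if u: "u \<in> reps" for u
    proof -
      have "\<bar>c (E a) u j - a j\<bar> \<le> 8 * A" if "j < d" for j
        using c[OF aS u that] a[OF that] A_pos by linarith
      from reps_unique[OF \<pi>[OF aS u] u eq[OF aS u, symmetric] this] j show ?thesis by simp
    qed
    then show "F (E a) j = int (card reps) * a j" unfolding F_def by simp
  qed
qed

end

section \<open>The rank is bounded by the number of translation parameters\<close>

text \<open>Gaussian elimination without division. Coordinate \<open>d\<close> is cleared by cross
  multiplication with a pivot \<open>s0\<close>; a relation among the resulting vectors becomes one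
  among the original vectors after scaling by the pivot entry, the coefficient of \<open>s0\<close>
  being forced.\<close>

lemma integer_relation:
  fixes v :: "'s \<Rightarrow> nat \<Rightarrow> int"
  assumes "finite S" "d < card S"
  shows "\<exists>c. (\<exists>s\<in>S. c s \<noteq> 0) \<and> (\<forall>j<d. (\<Sum>s\<in>S. c s * v s j) = 0)"
  using assms
proof (induction d arbitrary: S v)
  case 0
  then have "S \<noteq> {}" by auto
  then show ?case by (intro exI[of _ "\<lambda>_. 1"]) auto
next
  case (Suc d)
  show ?case
  proof (cases "\<forall>s\<in>S. v s d = 0")
    case True
    obtain c where c: "\<exists>s\<in>S. c s \<noteq> 0" "\<forall>j<d. (\<Sum>s\<in>S. c s * v s j) = 0"
      using Suc.IH[OF Suc.prems(1), of v] Suc.prems(2) by auto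
    have "(\<Sum>s\<in>S. c s * v s d) = 0" using True by simp
    then show ?thesis using c by (intro exI[of _ c]) (auto simp: less_Suc_eq)
  next
    case False
    then obtain s0 where s0: "s0 \<in> S" "v s0 d \<noteq> 0" by auto
    let ?S = "S - {s0}"
    have S: "S = insert s0 ?S" "s0 \<notin> ?S" "finite ?S" using s0 Suc.prems(1) by auto
    have "d < card ?S" using s0 Suc.prems by (simp add: card_Diff_singleton)
    from Suc.IH[OF S(3) this, of "\<lambda>s j. v s0 d * v s j - v s d * v s0 j"]
    obtain c where c: "\<exists>s\<in>?S. c s \<noteq> 0"
      "\<forall>j<d. (\<Sum>s\<in>?S. c s * (v s0 d * v s j - v s d * v s0 j)) = 0" by auto
    define c' where "c' s = (if s = s0 then - (\<Sum>s\<in>?S. c s * v s d) else c s * v s0 d)" for s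
    have sum: "(\<Sum>s\<in>S. c' s * v s j) = (\<Sum>s\<in>?S. c s * (v s0 d * v s j - v s d * v s0 j))" for j
    proof -
      have "(\<Sum>s\<in>S. c' s * v s j) = c' s0 * v s0 j + (\<Sum>s\<in>?S. c' s * v s j)"
        by (subst S(1), subst sum.insert[OF S(3,2)]) (rule refl)
      also have "(\<Sum>s\<in>?S. c' s * v s j) = (\<Sum>s\<in>?S. c s * v s0 d * v s j)"
        by (rule sum.cong) (auto simp: c'_def)
      also have "c' s0 * v s0 j = - (\<Sum>s\<in>?S. c s * v s d * v s0 j)"
        by (simp add: c'_def sum_distrib_right)
      finally show ?thesis by (simp add: algebra_simps sum_subtractf)
    qed
    have "\<exists>s\<in>S. c' s \<noteq> 0" using c(1) s0 by (auto simp: c'_def)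
    moreover have "(\<Sum>s\<in>S. c' s * v s d) = 0" unfolding sum by (simp add: algebra_simps)
    moreover have "\<forall>j<d. (\<Sum>s\<in>S. c' s * v s j) = 0" unfolding sum using c(2) by auto
    ultimately show ?thesis by (intro exI[of _ c']) (auto simp: less_Suc_eq)
  qed
qed

context bounded_translates
begin

lemma E_int_mult: "E (\<lambda>j. n * a j) = E a [^] (n::int)"
proof (cases n rule: int_cases2)
  case (nonneg m)
  then show ?thesis using E_mult[of m a] by (simp add: int_pow_int)
next
  case (nonpos m)
  have "E (\<lambda>j. n * a j) = E (\<lambda>j. - (int m * a j))" unfolding nonpos by simp
  also have "\<dots> = inv (E a [^] m)" by (subst E_uminus, subst E_mult) (rule refl)
  finally show ?thesis using E_closed unfolding nonpos by (simp add: int_pow_neg_int)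
qed

lemma E_sum: "finite S \<Longrightarrow> E (\<lambda>j. \<Sum>s\<in>S. v s j) = finprod G (\<lambda>s. E (v s)) S"
proof (induction S rule: finite_induct)
  case empty
  then show ?case using E_zero by simp
next
  case (insert s S)
  have "finprod G (\<lambda>s. E (v s)) (insert s S) = E (v s) \<otimes> finprod G (\<lambda>s. E (v s)) S"
    by (rule finprod_insert) (use insert E_closed in auto)
  then show ?case using insert E_add[of "v s" "\<lambda>j. \<Sum>s\<in>S. v s j"] by simp
qed

text \<open>By pigeonhole in the finite set \<open>T\<close>, two powers of an element have the same
  remainder, so a positive power of it is some \<open>E v\<close>. More than \<open>d\<close> such
  vectors are linearly dependent, and \<open>E\<close>, injective or not, carries the dependence to
  a relation in the group.\<close>

lemma card_Z_independent_le:
  assumes cover: "\<And>g. g \<in> carrier G \<Longrightarrow> \<exists>a t. t \<in> T \<and> g = E a \<otimes> t"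
    and ind: "Z_independent G S"
  shows "card S \<le> d"
proof (rule ccontr)
  assume "\<not> card S \<le> d"
  then have d: "d < card S" by simp
  have S: "finite S" "S \<subseteq> carrier G" using ind unfolding Z_independent_def by auto
  have "\<exists>M v. M > 0 \<and> s [^] (M::int) = E v" if s: "s \<in> S" for s
  proof -
    have sc: "s \<in> carrier G" using s S by auto
    then have "\<exists>a t. t \<in> T \<and> s [^] (n::nat) = E a \<otimes> t" for n using cover by simp
    then obtain a t where at: "\<And>n::nat. t n \<in> T" "\<And>n. s [^] n = E (a n) \<otimes> t n" by metis
    have "\<not> inj t"
    proof
      assume "inj t"
      then have "infinite (range t)" by (simp add: finite_image_iff)
      moreover have "range t \<subseteq> T" using at(1) by auto
      ultimately show False using finite_T finite_subset by blast
    qed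
    then obtain x y where xy: "t x = t y" "x \<noteq> y" unfolding inj_def by auto
    have main: "\<exists>M v. M > 0 \<and> s [^] (M::int) = E v" if "t x = t y" "x < y" for x y
    proof -
      have tc: "t y \<in> carrier G" using at(1) T_carrier by auto
      have "s [^] (int y - int x) = s [^] y \<otimes> inv (s [^] x)"
        using int_pow_diff[OF sc, of "int y" "int x"] by (simp add: int_pow_int)
      also have "\<dots> = E (a y) \<otimes> t y \<otimes> inv (E (a x) \<otimes> t y)" using at(2)[of x] at(2)[of y] that by simp
      also have "\<dots> = E (a y) \<otimes> (t y \<otimes> inv (t y)) \<otimes> inv (E (a x))"
        using E_closed[of "a x"] E_closed[of "a y"] tc by (simp only: inv_mult_group m_assoc inv_closed m_closed)
      also have "\<dots> = E (a y) \<otimes> inv (E (a x))"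
        using E_closed[of "a x"] E_closed[of "a y"] tc by simp
      also have "\<dots> = E (\<lambda>j. a y j - a x j)" using E_diff by simp
      finally have "s [^] (int y - int x) = E (\<lambda>j. a y j - a x j)" .
      then show ?thesis using that(2) by (intro exI[of _ "int y - int x"]) auto
    qed
    show ?thesis
    proof (cases "x < y")
      case True
      show ?thesis by (rule main[OF xy(1) True])
    next
      case False
      then have "y < x" using xy(2) by simp
      then show ?thesis by (rule main[OF xy(1)[symmetric]])
    qed
  qed
  then obtain M v where Mv: "\<And>s. s \<in> S \<Longrightarrow> M s > 0 \<and> s [^] (M s::int) = E (v s)" by metis
  obtain c where c: "\<exists>s\<in>S. c s \<noteq> 0" "\<forall>j<d. (\<Sum>s\<in>S. c s * v s j) = 0"
    using integer_relation[OF S(1) d, of v] by auto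
  have "finprod G (\<lambda>s. s [^] (M s * c s)) S = finprod G (\<lambda>s. E (\<lambda>j. c s * v s j)) S"
  proof (rule finprod_cong')
    fix s assume s: "s \<in> S"
    have sc: "s \<in> carrier G" using s S by auto
    have "s [^] (M s * c s) = (s [^] M s) [^] c s" using int_pow_pow[OF sc, of "M s" "c s"] by simp
    also have "\<dots> = E (\<lambda>j. c s * v s j)" using Mv[OF s] E_int_mult by simp
    finally show "s [^] (M s * c s) = E (\<lambda>j. c s * v s j)" .
  qed (use E_closed in auto)
  also have "\<dots> = E (\<lambda>j. \<Sum>s\<in>S. c s * v s j)" using E_sum[OF S(1), of "\<lambda>s j. c s * v s j"] by simp
  also have "\<dots> = E (\<lambda>j. 0)" by (rule E_cong) (use c(2) in auto)
  finally have "finprod G (\<lambda>s. s [^] (M s * c s)) S = \<one>" using E_zero by simp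
  moreover have "finprod G (\<lambda>s. s [^] (M s * c s)) S = \<one> \<longrightarrow> (\<forall>s\<in>S. M s * c s = 0)"
    using ind unfolding Z_independent_def by (elim conjE allE[of _ "\<lambda>s. M s * c s"])
  ultimately have z: "\<forall>s\<in>S. M s * c s = 0" by simp
  obtain s where s: "s \<in> S" "c s \<noteq> 0" using c(1) by auto
  have "M s * c s = 0" using z s(1) by blast
  then show False using s(2) Mv[OF s(1)] by simp
qed

end

section \<open>Local cocycles and the fundamental group\<close>

text \<open>An integral 1-cocycle on the Vietoris-Rips complex of scale \<kappa>. The degenerate
  triangle forces \<open>\<omega> x x = 0\<close>.\<close>

definition local_cocycle :: "'a metric \<Rightarrow> real \<Rightarrow> ('a \<Rightarrow> 'a \<Rightarrow> int) \<Rightarrow> bool" where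
  "local_cocycle X \<kappa> \<omega> \<longleftrightarrow> 0 < \<kappa> \<and>
     (\<forall>x\<in>mspace X. \<forall>y\<in>mspace X. \<forall>z\<in>mspace X.
        mdist X x y < \<kappa> \<longrightarrow> mdist X y z < \<kappa> \<longrightarrow> mdist X x z < \<kappa> \<longrightarrow> \<omega> x z = \<omega> x y + \<omega> y z)"

text \<open>A primitive of \<omega> near the diagonal. The scale \<eta> is existentially bound so
  that restrictions and reparametrisations need no bookkeeping.\<close>

definition potential_on :: "'v::metric_space set \<Rightarrow> ('v \<Rightarrow> 'v \<Rightarrow> int) \<Rightarrow> ('v \<Rightarrow> int) \<Rightarrow> bool" where
  "potential_on K \<omega> u \<longleftrightarrow> (\<exists>\<eta>>0. \<forall>x\<in>K. \<forall>y\<in>K. dist x y < \<eta> \<longrightarrow> u y - u x = \<omega> x y)"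

lemma local_cocycleD:
  assumes "local_cocycle X \<kappa> \<omega>" "x \<in> mspace X" "y \<in> mspace X" "z \<in> mspace X"
    "mdist X x y < \<kappa>" "mdist X y z < \<kappa>" "mdist X x z < \<kappa>"
  shows "\<omega> x z = \<omega> x y + \<omega> y z"
  using assms unfolding local_cocycle_def by simp

text \<open>A discrete Poincare lemma: \<omega> is summed along the radial segment, cut into steps
  shorter than \<open>\<eta> / 2\<close>. For nearby \<open>x\<close> and \<open>y\<close> the two
  segments form a ladder of squares, each split by a diagonal shorter than \<eta> into two triangles
  to which the cocycle rule applies. It serves for the unit interval and the unit square.\<close>

lemma star_shaped_potential:
  fixes K :: "'v::real_normed_vector set" and \<omega> :: "'v \<Rightarrow> 'v \<Rightarrow> int"
  assumes star: "\<And>x s. x \<in> K \<Longrightarrow> 0 \<le> s \<Longrightarrow> s \<le> 1 \<Longrightarrow> s *\<^sub>R x \<in> K"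
    and bd: "\<And>x. x \<in> K \<Longrightarrow> norm x \<le> B"
    and \<eta>: "0 < \<eta>"
    and coc: "\<And>x y z. \<lbrakk>x \<in> K; y \<in> K; z \<in> K; dist x y < \<eta>; dist y z < \<eta>; dist x z < \<eta>\<rbrakk>
      \<Longrightarrow> \<omega> x z = \<omega> x y + \<omega> y z"
  shows "\<exists>u. potential_on K \<omega> u"
proof -
  obtain m :: nat where m: "B / (\<eta> / 2) < real m" using reals_Archimedean2 by blast
  define n where "n = Suc m"
  have n: "0 < real n" "B / real n < \<eta> / 2"
  proof -
    have "B / (\<eta> / 2) < real n" using m unfolding n_def by simp
    then have "B < real n * (\<eta> / 2)" using \<eta> by (simp add: pos_divide_less_eq)
    then show "B / real n < \<eta> / 2" by (simp add: n_def pos_divide_less_eq mult.commute)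
  qed (simp add: n_def)
  define p where "p x j = (real j / real n) *\<^sub>R x" for x :: 'v and j
  have pK: "p x j \<in> K" if "x \<in> K" "j \<le> n" for x j
    unfolding p_def using that star[OF that(1)] n(1) by simp
  define u where "u x = (\<Sum>j<n. \<omega> (p x j) (p x (Suc j)))" for x
  have step: "dist (p x j) (p x (Suc j)) < \<eta> / 2" if "x \<in> K" for x j
  proof -
    have "p x j - p x (Suc j) = - ((1 / real n) *\<^sub>R x)"
      unfolding p_def by (simp add: scaleR_left_diff_distrib[symmetric] diff_divide_distrib[symmetric])
    then have "dist (p x j) (p x (Suc j)) = norm x / real n"
      by (simp add: dist_norm)
    also have "\<dots> \<le> B / real n" using bd[OF that] n by (intro divide_right_mono) auto
    finally show ?thesis using n(2) by linarith
  qed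
  have shrink: "dist (p x j) (p y j) \<le> dist x y" if "j \<le> n" for x y j
  proof -
    have "dist (p x j) (p y j) = (real j / real n) * dist x y"
      unfolding p_def dist_norm by (simp add: scaleR_right_diff_distrib[symmetric])
    also have "\<dots> \<le> 1 * dist x y" using that n(1) by (intro mult_right_mono) auto
    finally show ?thesis by simp
  qed
  have main: "u y - u x = \<omega> x y" if x: "x \<in> K" and y: "y \<in> K" and xy: "dist x y < \<eta> / 2" for x y
  proof -
    define v where "v j = \<omega> (p x j) (p y j)" for j
    have sq: "\<omega> (p x j) (p x (Suc j)) + v (Suc j) = v j + \<omega> (p y j) (p y (Suc j))" if j: "j < n" for j
    proof -
      have K: "p x j \<in> K" "p y j \<in> K" "p x (Suc j) \<in> K" "p y (Suc j) \<in> K"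
        using pK x y j by auto
      have d: "dist (p x j) (p x (Suc j)) < \<eta> / 2" "dist (p y j) (p y (Suc j)) < \<eta> / 2"
        "dist (p x j) (p y j) < \<eta> / 2" "dist (p x (Suc j)) (p y (Suc j)) < \<eta> / 2"
        using step x y shrink[of j x y] shrink[of "Suc j" x y] j xy by auto
      then have "dist (p x j) (p y (Suc j)) < \<eta>"
        using dist_triangle[of "p x j" "p y (Suc j)" "p y j"] by linarith
      then have "\<omega> (p x j) (p y (Suc j)) = \<omega> (p x j) (p x (Suc j)) + \<omega> (p x (Suc j)) (p y (Suc j))"
        "\<omega> (p x j) (p y (Suc j)) = \<omega> (p x j) (p y j) + \<omega> (p y j) (p y (Suc j))"
        using d \<eta> by (auto intro!: coc K)
      then show ?thesis unfolding v_def by simp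
    qed
    have "u y - u x = (\<Sum>j<n. v (Suc j) - v j)"
      unfolding u_def sum_subtractf[symmetric] using sq by (intro sum.cong) (auto, smt (verit))
    also have "\<dots> = v n - v 0" by (rule sum_lessThan_telescope)
    \<comment> \<open>The lowest rung of the ladder is degenerate at the centre, the highest joins
      \<open>x\<close> to \<open>y\<close>.\<close>
    also have "v 0 = \<omega> 0 0" unfolding v_def p_def by simp
    also have "\<omega> 0 0 = 0" using coc[of 0 0 0] star[OF x, of 0] \<eta> by simp
    also have "v n = \<omega> x y" unfolding v_def p_def using n(1) by simp
    finally show ?thesis by simp
  qed
  show ?thesis
    unfolding potential_on_def by (intro exI[of _ u] exI[of _ "\<eta> / 2"]) (use main \<eta> in auto)
qed

lemma locally_constant_interval:
  fixes f :: "real \<Rightarrow> int"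
  assumes "0 < \<eta>" and loc: "\<And>x y. \<lbrakk>x \<in> {0..1}; y \<in> {0..1}; dist x y < \<eta>\<rbrakk> \<Longrightarrow> f x = f y"
  shows "f 0 = f 1"
proof -
  obtain m :: nat where m: "1 / \<eta> < real m" using reals_Archimedean2 by blast
  have m0: "0 < real m" using m assms(1) by (meson less_trans zero_less_divide_1_iff)
  have step: "1 / real m < \<eta>" using m m0 assms(1) by (simp add: field_simps)
  have "f (real j / real m) = f 0" if "j \<le> m" for j
    using that
  proof (induction j)
    case (Suc j)
    have "f (real (Suc j) / real m) = f (real j / real m)"
    proof (rule loc)
      have "real (Suc j) / real m - real j / real m = 1 / real m"
        by (simp add: diff_divide_distrib[symmetric])
      then show "dist (real (Suc j) / real m) (real j / real m) < \<eta>" using step m0 by (simp add: dist_real_def)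
    qed (use Suc.prems m0 in auto)
    then show ?case using Suc by simp
  qed simp
  from this[of m] m0 show ?thesis by simp
qed

lemma potential_unique:
  fixes u w :: "real \<Rightarrow> int"
  assumes "potential_on {0..1} \<omega> u" "potential_on {0..1} \<omega> w"
  shows "u 1 - u 0 = w 1 - w 0"
proof -
  obtain \<eta>1 where 1: "\<eta>1 > 0" "\<And>x y. \<lbrakk>x \<in> {0..1}; y \<in> {0..1}; dist x y < \<eta>1\<rbrakk> \<Longrightarrow> u y - u x = \<omega> x y"
    using assms(1) unfolding potential_on_def by blast
  obtain \<eta>2 where 2: "\<eta>2 > 0" "\<And>x y. \<lbrakk>x \<in> {0..1}; y \<in> {0..1}; dist x y < \<eta>2\<rbrakk> \<Longrightarrow> w y - w x = \<omega> x y"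
    using assms(2) unfolding potential_on_def by blast
  have "(\<lambda>x. u x - w x) 0 = (\<lambda>x. u x - w x) 1"
  proof (rule locally_constant_interval[of "min \<eta>1 \<eta>2"])
    fix x y :: real assume "x \<in> {0..1}" "y \<in> {0..1}" "dist x y < min \<eta>1 \<eta>2"
    then have "u y - u x = w y - w x" using 1(2)[of x y] 2(2)[of x y] by simp
    then show "u x - w x = u y - w y" by simp
  qed (use 1 2 in auto)
  then show ?thesis by simp
qed

lemma uniform_continuity_into_metric:
  assumes K: "compact K" and h: "continuous_map (top_of_set K) (mtopology_of X) h" and "0 < \<kappa>"
  shows "\<exists>\<eta>>0. \<forall>x\<in>K. \<forall>y\<in>K. dist x y < \<eta> \<longrightarrow> mdist X (h x) (h y) < \<kappa>"
proof -
  have top: "mtopology_of (submetric euclidean_metric K) = top_of_set K"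
    by (simp add: mtopology_of_submetric)
  have "compact_space (top_of_set K)" using K by (simp add: compact_space_subtopology)
  then have "uniformly_continuous_map (submetric euclidean_metric K) X h"
    using continuous_imp_uniformly_continuous_map[of "submetric euclidean_metric K" X h] h top by simp
  then obtain \<eta> where "\<eta> > 0" "\<forall>x\<in>K. \<forall>y\<in>K. dist y x < \<eta> \<longrightarrow> mdist X (h y) (h x) < \<kappa>"
    using \<open>0 < \<kappa>\<close> unfolding uniformly_continuous_map_def by auto
  then show ?thesis by blast
qed

lemma pullback_potential:
  fixes K :: "'v::real_normed_vector set"
  assumes \<omega>: "local_cocycle X \<kappa> \<omega>" and K: "compact K"
    and star: "\<And>x s. x \<in> K \<Longrightarrow> 0 \<le> s \<Longrightarrow> s \<le> 1 \<Longrightarrow> s *\<^sub>R x \<in> K"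
    and h: "continuous_map (top_of_set K) (mtopology_of X) h"
  shows "\<exists>u. potential_on K (\<lambda>x y. \<omega> (h x) (h y)) u"
proof -
  obtain \<eta> where \<eta>: "\<eta> > 0" "\<And>x y. x \<in> K \<Longrightarrow> y \<in> K \<Longrightarrow> dist x y < \<eta> \<Longrightarrow> mdist X (h x) (h y) < \<kappa>"
    using uniform_continuity_into_metric[OF K h, of \<kappa>] \<omega> unfolding local_cocycle_def by metis
  obtain B where B: "\<And>x. x \<in> K \<Longrightarrow> norm x \<le> B"
    using compact_imp_bounded[OF K] unfolding bounded_iff by auto
  have hX: "h x \<in> mspace X" if "x \<in> K" for x
    using h that unfolding continuous_map_def by (auto simp: Pi_iff)
  show ?thesis
  proof (rule star_shaped_potential[OF star B \<eta>(1)])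
    fix x y z assume "x \<in> K" "y \<in> K" "z \<in> K" "dist x y < \<eta>" "dist y z < \<eta>" "dist x z < \<eta>"
    then show "\<omega> (h x) (h z) = \<omega> (h x) (h y) + \<omega> (h y) (h z)"
      by (intro local_cocycleD[OF \<omega>] hX \<eta>(2))
  qed
qed

text \<open>The total change along a path of a potential of the cocycle; it does not depend on the choice.\<close>

definition period :: "('a \<Rightarrow> 'a \<Rightarrow> int) \<Rightarrow> (real \<Rightarrow> 'a) \<Rightarrow> int" where
  "period \<omega> f = (SOME z. \<exists>u. potential_on {0..1} (\<lambda>s t. \<omega> (f s) (f t)) u \<and> z = u 1 - u 0)"

lemma period_eq:
  assumes "potential_on {0..1} (\<lambda>s t. \<omega> (f s) (f t)) u"
  shows "period \<omega> f = u 1 - u 0"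
proof -
  have "\<exists>w. potential_on {0..1} (\<lambda>s t. \<omega> (f s) (f t)) w \<and> period \<omega> f = w 1 - w 0"
    unfolding period_def by (rule someI[of _ "u 1 - u 0"]) (use assms in blast)
  then show ?thesis using potential_unique assms by metis
qed

lemma path_potential:
  assumes "local_cocycle X \<kappa> \<omega>" and "pathin (mtopology_of X) f"
  shows "\<exists>u. potential_on {0..1} (\<lambda>s t. \<omega> (f s) (f t)) u"
proof (rule pullback_potential[OF assms(1), of "{0..1::real}" f])
  fix x s :: real assume "x \<in> {0..1}" "0 \<le> s" "s \<le> 1"
  then show "s *\<^sub>R x \<in> {0..1}" by (auto intro: mult_le_one)
qed (use assms(2) in \<open>auto simp: pathin_def\<close>)

lemma potential_on_lipschitz_comp:
  assumes "potential_on K \<omega> u" and g: "\<And>x. x \<in> L \<Longrightarrow> g x \<in> K"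
    and lip: "\<And>x y. x \<in> L \<Longrightarrow> y \<in> L \<Longrightarrow> dist (g x) (g y) \<le> dist x y"
  shows "potential_on L (\<lambda>x y. \<omega> (g x) (g y)) (u \<circ> g)"
  using assms unfolding potential_on_def o_def by (meson order.strict_trans1)

text \<open>A potential on the whole square of the homotopy restricts to potentials of
  \<open>f\<close> and \<open>g\<close> on two opposite sides. Along the other two sides the
  homotopy stays at \<open>p\<close>, so the potential is constant there and the total changes
  agree.\<close>

lemma period_homotopic:
  assumes \<omega>: "local_cocycle X \<kappa> \<omega>" and p: "p \<in> mspace X"
    and fg: "(f, g) \<in> loop_homotopic (mtopology_of X) p"
  shows "period \<omega> f = period \<omega> g"
proof -
  obtain h where h: "continuous_map (prod_topology (top_of_set {0..1::real}) (top_of_set {0..1::real})) (mtopology_of X) h"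
    "\<And>x. h (0, x) = f x" "\<And>x. h (1, x) = g x"
    "\<And>t. t \<in> {0..1} \<Longrightarrow> h (t, 0) = p \<and> h (t, 1) = p"
    using fg unfolding loop_homotopic_def homotopic_with_def by auto
  let ?K = "{0..1::real} \<times> {0..1::real}"
  have "\<exists>u. potential_on ?K (\<lambda>x y. \<omega> (h x) (h y)) u"
  proof (rule pullback_potential[OF \<omega>])
    show "compact ?K" by (intro compact_Times compact_Icc)
    show "s *\<^sub>R x \<in> ?K" if "x \<in> ?K" "0 \<le> s" "s \<le> 1" for x s
      using that by (auto intro: mult_le_one)
    show "continuous_map (top_of_set ?K) (mtopology_of X) h" using h(1) by simp
  qed
  then obtain u where u: "potential_on ?K (\<lambda>x y. \<omega> (h x) (h y)) u" by blast
  have s1: "potential_on {0..1} (\<lambda>s t. \<omega> (f s) (f t)) (u \<circ> (\<lambda>s. (0, s)))"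
    using potential_on_lipschitz_comp[OF u, of "{0..1}" "\<lambda>s. (0, s)"] h(2) by (simp add: dist_Pair_Pair)
  have s2: "potential_on {0..1} (\<lambda>s t. \<omega> (g s) (g t)) (u \<circ> (\<lambda>s. (1, s)))"
    using potential_on_lipschitz_comp[OF u, of "{0..1}" "\<lambda>s. (1, s)"] h(3) by (simp add: dist_Pair_Pair)
  have const: "u (0, c) = u (1, c)" if c: "c = 0 \<or> c = 1" for c
  proof -
    obtain \<eta> where \<eta>: "\<eta> > 0" "\<And>x y. x \<in> ?K \<Longrightarrow> y \<in> ?K \<Longrightarrow> dist x y < \<eta> \<Longrightarrow> u y - u x = \<omega> (h x) (h y)"
      using u unfolding potential_on_def by blast
    have "0 < \<kappa>" using \<omega> unfolding local_cocycle_def by simp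
    moreover have "mdist X p p = 0" using Metric_space.mdist_zero[OF Metric_space_mspace_mdist p] .
    ultimately have pp: "\<omega> p p = 0" using local_cocycleD[OF \<omega> p p p] by simp
    show ?thesis
    proof (rule locally_constant_interval[OF \<eta>(1), of "\<lambda>t. u (t, c)"])
      fix x y :: real assume xy: "x \<in> {0..1}" "y \<in> {0..1}" "dist x y < \<eta>"
      then have "u (y, c) - u (x, c) = \<omega> (h (x, c)) (h (y, c))"
        using c by (intro \<eta>(2)) (auto simp: dist_Pair_Pair)
      also have "\<dots> = 0" using h(4) xy c pp by auto
      finally show "u (x, c) = u (y, c)" by simp
    qed
  qed
  show ?thesis using period_eq[of \<omega> f, OF s1] period_eq[of \<omega> g, OF s2] const by simp
qed

text \<open>One potential along the concatenation restricts to a potential of each half. The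
  junction belongs to the first half in \<open>join_loops\<close>, which is where
  \<open>f 1 = g 0\<close> enters.\<close>

lemma period_join:
  assumes \<omega>: "local_cocycle X \<kappa> \<omega>"
    and jn: "pathin (mtopology_of X) (join_loops f g)" and fg: "f 1 = g 0"
  shows "period \<omega> (join_loops f g) = period \<omega> f + period \<omega> g"
proof -
  obtain u where u: "potential_on {0..1} (\<lambda>s t. \<omega> (join_loops f g s) (join_loops f g t)) u"
    using path_potential[OF \<omega> jn] by blast
  have "potential_on {0..1} (\<lambda>s t. \<omega> (join_loops f g (s / 2)) (join_loops f g (t / 2))) (u \<circ> (\<lambda>s. s / 2))"
    by (rule potential_on_lipschitz_comp[OF u]) (auto simp: dist_real_def)
  then have 1: "potential_on {0..1} (\<lambda>s t. \<omega> (f s) (f t)) (u \<circ> (\<lambda>s. s / 2))"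
    by (auto simp: potential_on_def join_loops_def)
  have "potential_on {0..1} (\<lambda>s t. \<omega> (join_loops f g (s / 2 + 1 / 2)) (join_loops f g (t / 2 + 1 / 2))) (u \<circ> (\<lambda>s. s / 2 + 1 / 2))"
    by (rule potential_on_lipschitz_comp[OF u]) (auto simp: dist_real_def)
  moreover have "join_loops f g (s / 2 + 1 / 2) = g s" if "s \<in> {0..1}" for s :: real
  proof (cases "s = 0")
    case True
    then show ?thesis using fg unfolding join_loops_def by simp
  next
    case False
    then have "2 * (s / 2 + 1 / 2) - 1 = s" "\<not> s / 2 + 1 / 2 \<le> 1 / 2" using that by auto
    then show ?thesis by (simp only: join_loops_def if_False)
  qed
  ultimately have 2: "potential_on {0..1} (\<lambda>s t. \<omega> (g s) (g t)) (u \<circ> (\<lambda>s. s / 2 + 1 / 2))"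
    by (simp add: potential_on_def)
  show ?thesis using period_eq[of \<omega>, OF u] period_eq[of \<omega>, OF 1] period_eq[of \<omega>, OF 2] by simp
qed

section \<open>The group laws of the fundamental group\<close>

lemma pathin_reparam:
  assumes f: "pathin T f" and \<phi>: "continuous_on {0..1} \<phi>" "\<phi> ` {0..1} \<subseteq> {0..1}"
  shows "pathin T (f \<circ> \<phi>)"
proof -
  have "continuous_map (top_of_set {0..1}) (top_of_set {0..1}) \<phi>"
    using \<phi> by (auto simp: continuous_map_in_subtopology)
  then show ?thesis using f unfolding pathin_def by (rule continuous_map_compose)
qed

text \<open>The straight-line homotopy between \<phi> and \<psi> stays in the unit interval by
  convexity. Associativity, the unit law and inverses are all obtained below by writing both sides
  as reparametrisations of one path.\<close>

lemma loop_homotopic_reparam: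
  assumes f: "pathin T f" and \<phi>: "continuous_on {0..1} \<phi>" "\<phi> ` {0..1} \<subseteq> {0..1}"
    and \<psi>: "continuous_on {0..1} \<psi>" "\<psi> ` {0..1} \<subseteq> {0..1}"
    and eq: "\<phi> 0 = \<psi> 0" "\<phi> 1 = \<psi> 1" and p: "f (\<phi> 0) = p" "f (\<phi> 1) = p"
  shows "(f \<circ> \<phi>, f \<circ> \<psi>) \<in> loop_homotopic T p"
proof -
  let ?k = "\<lambda>z. (1 - fst z) * \<phi> (snd z) + fst z * \<psi> (snd z)"
  have "continuous_on ({0..1} \<times> {0..1}) ?k"
    by (intro continuous_intros continuous_on_compose2[OF \<phi>(1)] continuous_on_compose2[OF \<psi>(1)]) auto
  moreover have "?k ` ({0..1} \<times> {0..1}) \<subseteq> {0..1}"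
  proof clarify
    fix t x :: real assume t: "t \<in> {0..1}" and x: "x \<in> {0..1}"
    have "\<phi> x \<in> {0..1}" by (rule subsetD[OF \<phi>(2) imageI[OF x]])
    moreover have "\<psi> x \<in> {0..1}" by (rule subsetD[OF \<psi>(2) imageI[OF x]])
    ultimately have "(1 - t) *\<^sub>R \<phi> x + t *\<^sub>R \<psi> x \<in> {0..1}"
      using t by (intro convexD convex_real_interval) auto
    then show "?k (t, x) \<in> {0..1}" by simp
  qed
  ultimately have "continuous_map (top_of_set ({0..1} \<times> {0..1})) (top_of_set {0..1}) ?k"
    by (simp add: continuous_map_in_subtopology image_subset_iff_funcset)
  from continuous_map_compose[OF this f[unfolded pathin_def]]
  have fk: "continuous_map (prod_topology (top_of_set {0..1}) (top_of_set {0..1})) T (f \<circ> ?k)"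
    by simp
  have k: "?k (t, 0) = \<phi> 0" "?k (t, 1) = \<phi> 1" for t
    by (simp_all add: eq[symmetric] algebra_simps)
  have "homotopic_with (\<lambda>h. h 0 = p \<and> h 1 = p) (top_of_set {0..1}) T (f \<circ> \<phi>) (f \<circ> \<psi>)"
    unfolding homotopic_with_def
  proof (intro exI[of _ "f \<circ> ?k"] conjI fk ballI allI)
    show "(f \<circ> ?k) (t, 0) = p" "(f \<circ> ?k) (t, 1) = p" for t
      unfolding o_apply k p by simp_all
  qed simp_all
  then show ?thesis
    using pathin_reparam[OF f \<phi>] pathin_reparam[OF f \<psi>] eq p
    by (simp add: loop_homotopic_def loops_at_def)
qed

text \<open>The parameter space \<open>Z\<close> allows two uses: a point gives concatenation of
  paths, an interval gives concatenation of homotopies.\<close>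

lemma continuous_map_halves:
  fixes f g :: "'z \<times> real \<Rightarrow> 'a"
  assumes f: "continuous_map (prod_topology Z (top_of_set {0..1})) T f"
    and g: "continuous_map (prod_topology Z (top_of_set {0..1})) T g"
    and fg: "\<And>t. t \<in> topspace Z \<Longrightarrow> f (t, 1) = g (t, 0)"
  shows "continuous_map (prod_topology Z (top_of_set {0..1})) T
    (\<lambda>z. if snd z \<le> 1 / 2 then f (fst z, 2 * snd z) else g (fst z, 2 * snd z - 1))"
proof (rule continuous_map_cases_le[where p = snd and q = "\<lambda>_. 1 / 2"
      and f = "\<lambda>z. f (fst z, 2 * snd z)" and g = "\<lambda>z. g (fst z, 2 * snd z - 1)"])
  let ?P = "prod_topology Z (top_of_set {0..1::real})"
  have snd: "continuous_map ?P euclideanreal snd"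
    by (rule continuous_map_into_fulltopology[OF continuous_map_snd])
  show "continuous_map ?P euclideanreal snd" by (rule snd)
  show "continuous_map ?P euclideanreal (\<lambda>z. 1 / 2)" by simp
  let ?A = "subtopology ?P {x \<in> topspace ?P. snd x \<le> 1 / 2}"
  let ?B = "subtopology ?P {x \<in> topspace ?P. 1 / 2 \<le> snd x}"
  have sndA: "continuous_map ?A euclideanreal snd" "continuous_map ?B euclideanreal snd"
    and fstA: "continuous_map ?A Z fst" "continuous_map ?B Z fst"
    by (intro continuous_map_from_subtopology snd continuous_map_fst)+
  have "continuous_map ?A ?P (\<lambda>z. (fst z, 2 * snd z))"
    using fstA sndA by (auto simp: continuous_map_paired continuous_map_in_subtopology
        intro!: continuous_map_real_mult)
  from continuous_map_compose[OF this f]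
  show "continuous_map ?A T (\<lambda>z. f (fst z, 2 * snd z))" by (simp add: o_def)
  have "continuous_map ?B ?P (\<lambda>z. (fst z, 2 * snd z - 1))"
    using fstA sndA by (auto simp: continuous_map_paired continuous_map_in_subtopology
        intro!: continuous_map_real_mult continuous_map_diff)
  from continuous_map_compose[OF this g]
  show "continuous_map ?B T (\<lambda>z. g (fst z, 2 * snd z - 1))" by (simp add: o_def)
  show "f (fst x, 2 * snd x) = g (fst x, 2 * snd x - 1)"
    if "x \<in> topspace ?P" "snd x = 1 / 2" for x
    unfolding that(2) using that(1) fg[of "fst x"] by (simp add: mem_Times_iff)
qed

lemma join_loops_pathin:
  assumes f: "pathin T f" and g: "pathin T g" and fg: "f 1 = g 0"
  shows "pathin T (join_loops f g)"
proof -
  let ?Z = "top_of_set {0::real}"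
  have sndZ: "continuous_map (prod_topology ?Z (top_of_set {0..1::real})) (top_of_set {0..1::real}) snd"
    by (rule continuous_map_snd)
  have 1: "continuous_map (prod_topology ?Z (top_of_set {0..1})) T
      (\<lambda>z. if snd z \<le> 1 / 2 then (f \<circ> snd) (fst z, 2 * snd z) else (g \<circ> snd) (fst z, 2 * snd z - 1))"
    by (rule continuous_map_halves[OF continuous_map_compose[OF sndZ f[unfolded pathin_def]]
          continuous_map_compose[OF sndZ g[unfolded pathin_def]]]) (simp add: fg)
  have "continuous_map (top_of_set {0..1}) (prod_topology ?Z (top_of_set {0..1::real})) (\<lambda>x. (0, x))"
    by (auto intro!: continuous_intros)
  from continuous_map_compose[OF this 1] show ?thesis
    unfolding pathin_def join_loops_def by (simp only: o_def fst_conv snd_conv)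
qed

lemma join_loops_in: "f \<in> loops_at T p \<Longrightarrow> g \<in> loops_at T p \<Longrightarrow> join_loops f g \<in> loops_at T p"
  unfolding loops_at_def by (auto intro: join_loops_pathin) (auto simp: join_loops_def)

lemma equiv_loop_homotopic: "equiv (loops_at T p) (loop_homotopic T p)"
proof (rule equivI)
  show "loop_homotopic T p \<subseteq> loops_at T p \<times> loops_at T p" by (auto simp: loop_homotopic_def)
  show "refl_on (loops_at T p) (loop_homotopic T p)"
    by (auto simp: refl_on_def loop_homotopic_def loops_at_def pathin_def)
  show "sym (loop_homotopic T p)"
    by (auto simp: sym_def loop_homotopic_def intro: homotopic_with_symD)
  show "trans (loop_homotopic T p)"
    by (auto simp: trans_def loop_homotopic_def intro: homotopic_with_trans)
qed

lemma join_loops_homotopic: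
  assumes ff: "(f, f') \<in> loop_homotopic T p" and gg: "(g, g') \<in> loop_homotopic T p"
  shows "(join_loops f g, join_loops f' g') \<in> loop_homotopic T p"
proof -
  let ?I = "top_of_set {0..1::real}"
  obtain h where h: "continuous_map (prod_topology ?I ?I) T h"
    "\<And>x. h (0, x) = f x" "\<And>x. h (1, x) = f' x"
    "\<And>t. t \<in> {0..1} \<Longrightarrow> h (t, 0) = p \<and> h (t, 1) = p"
    using ff unfolding loop_homotopic_def homotopic_with_def by auto
  obtain k where k: "continuous_map (prod_topology ?I ?I) T k"
    "\<And>x. k (0, x) = g x" "\<And>x. k (1, x) = g' x"
    "\<And>t. t \<in> {0..1} \<Longrightarrow> k (t, 0) = p \<and> k (t, 1) = p"
    using gg unfolding loop_homotopic_def homotopic_with_def by auto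
  let ?m = "\<lambda>z. if snd z \<le> 1 / 2 then h (fst z, 2 * snd z) else k (fst z, 2 * snd z - 1)"
  have "continuous_map (prod_topology ?I ?I) T ?m"
    by (rule continuous_map_halves[OF h(1) k(1)]) (use h(4) k(4) in auto)
  then have "homotopic_with (\<lambda>h. h 0 = p \<and> h 1 = p) ?I T (join_loops f g) (join_loops f' g')"
    unfolding homotopic_with_def
    by (intro exI[of _ ?m]) (auto simp: join_loops_def h k)
  then show ?thesis using join_loops_in ff gg by (auto simp: loop_homotopic_def)
qed

lemma join_loops_assoc:
  assumes "f \<in> loops_at T p" "g \<in> loops_at T p" "h \<in> loops_at T p"
  shows "(join_loops (join_loops f g) h, join_loops f (join_loops g h)) \<in> loop_homotopic T p"
proof -
  \<comment> \<open>Slopes 2, 1, 1/2 on the intervals ending at 1/4, 1/2, 1. The slopes decrease, so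
    the map is concave and equals the minimum of its three affine pieces, which makes continuity
    immediate.\<close>
  define \<phi> :: "real \<Rightarrow> real" where "\<phi> t = min (2 * t) (min (t + 1 / 4) (t / 2 + 1 / 2))" for t
  have "continuous_on {0..1} \<phi>" unfolding \<phi>_def
    by (intro continuous_intros) auto
  moreover have "\<phi> ` {0..1} \<subseteq> {0..1}" by (auto simp: \<phi>_def)
  moreover have "\<phi> 0 = 0" "\<phi> 1 = 1" by (simp_all add: \<phi>_def)
  moreover have "join_loops f (join_loops g h) \<in> loops_at T p"
    by (intro join_loops_in assms)
  ultimately have "(join_loops f (join_loops g h) \<circ> \<phi>, join_loops f (join_loops g h) \<circ> id) \<in> loop_homotopic T p"
    by (intro loop_homotopic_reparam[of T _ \<phi> id p]) (simp_all add: loops_at_def)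
  moreover have "join_loops f (join_loops g h) \<circ> \<phi> = join_loops (join_loops f g) h"
  proof
    fix t :: real
    consider "t \<le> 1 / 4" | "1 / 4 < t" "t \<le> 1 / 2" | "1 / 2 < t" by linarith
    then show "(join_loops f (join_loops g h) \<circ> \<phi>) t = join_loops (join_loops f g) h t"
    proof cases
      case 1
      then have "\<phi> t = 2 * t" by (simp add: \<phi>_def)
      then show ?thesis using 1 by (simp add: join_loops_def)
    next
      case 2
      then have \<phi>: "\<phi> t = t + 1 / 4" by (simp add: \<phi>_def)
      have "2 * (2 * (t + 1 / 4) - 1) = 2 * (2 * t) - 1" by (simp add: algebra_simps)
      then show ?thesis using 2 by (simp add: join_loops_def \<phi>)
    next
      case 3
      then have \<phi>: "\<phi> t = t / 2 + 1 / 2" by (simp add: \<phi>_def)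
      have "2 * (t / 2 + 1 / 2) - 1 = t" by (simp add: algebra_simps)
      then show ?thesis using 3 by (simp add: join_loops_def \<phi>)
    qed
  qed
  ultimately show ?thesis by simp
qed

lemma join_loops_const:
  assumes "f \<in> loops_at T p"
  shows "(join_loops (\<lambda>t. p) f, f) \<in> loop_homotopic T p"
proof -
  define \<phi> :: "real \<Rightarrow> real" where "\<phi> t = max 0 (2 * t - 1)" for t
  have "continuous_on {0..1} \<phi>" unfolding \<phi>_def
    by (intro continuous_intros)
  moreover have "\<phi> ` {0..1} \<subseteq> {0..1}" by (auto simp: \<phi>_def)
  moreover have "\<phi> 0 = 0" "\<phi> 1 = 1" by (simp_all add: \<phi>_def)
  ultimately have "(f \<circ> \<phi>, f \<circ> id) \<in> loop_homotopic T p"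
    using assms by (intro loop_homotopic_reparam[of T f \<phi> id p]) (simp_all add: loops_at_def)
  moreover have "f \<circ> \<phi> = join_loops (\<lambda>t. p) f"
    using assms by (auto simp: join_loops_def \<phi>_def loops_at_def fun_eq_iff)
  ultimately show ?thesis by simp
qed

lemma const_loop: "p \<in> topspace T \<Longrightarrow> (\<lambda>t. p) \<in> loops_at T p"
  by (simp add: loops_at_def pathin_def)

lemma join_loops_reverse:
  assumes "f \<in> loops_at T p"
  shows "(\<lambda>t. f (1 - t)) \<in> loops_at T p" "(join_loops (\<lambda>t. f (1 - t)) f, (\<lambda>t. p)) \<in> loop_homotopic T p"
proof -
  have f: "pathin T f" "f 0 = p" "f 1 = p" using assms by (auto simp: loops_at_def)
  have "pathin T (f \<circ> (\<lambda>t. 1 - t))" by (rule pathin_reparam[OF f(1)]) (auto intro!: continuous_intros)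
  then show "(\<lambda>t. f (1 - t)) \<in> loops_at T p" using f by (simp add: loops_at_def o_def)
  \<comment> \<open>Runs from 1 down to 0 and back; contracting it to the constant 1 undoes the
    reversed loop followed by the loop.\<close>
  define \<phi> :: "real \<Rightarrow> real" where "\<phi> t = \<bar>1 - 2 * t\<bar>" for t
  have "continuous_on {0..1} \<phi>" unfolding \<phi>_def
    by (intro continuous_intros)
  moreover have "\<phi> ` {0..1} \<subseteq> {0..1}" by (auto simp: \<phi>_def)
  moreover have "\<phi> 0 = 1" "\<phi> 1 = 1" by (simp_all add: \<phi>_def)
  ultimately have "(f \<circ> \<phi>, f \<circ> (\<lambda>t. 1)) \<in> loop_homotopic T p"
    using f by (intro loop_homotopic_reparam[of T f \<phi> "\<lambda>t. 1" p]) (simp_all add: image_subset_iff)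
  moreover have "(\<lambda>t. f (\<phi> t)) = join_loops (\<lambda>t. f (1 - t)) f"
    by (auto simp: join_loops_def \<phi>_def fun_eq_iff)
  ultimately show "(join_loops (\<lambda>t. f (1 - t)) f, (\<lambda>t. p)) \<in> loop_homotopic T p"
    using f(3) unfolding o_def by simp
qed

lemma fundamental_group_mult:
  assumes "f \<in> loops_at T p" "g \<in> loops_at T p"
  shows "loop_homotopic T p `` {f} \<otimes>\<^bsub>fundamental_group T p\<^esub> loop_homotopic T p `` {g}
    = loop_homotopic T p `` {join_loops f g}"
proof -
  let ?R = "loop_homotopic T p"
  have "congruent2 ?R ?R (\<lambda>f g. ?R `` {join_loops f g})"
  proof (rule congruent2I')
    fix f f' g g' assume "(f, f') \<in> ?R" "(g, g') \<in> ?R"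
    then show "?R `` {join_loops f g} = ?R `` {join_loops f' g'}"
      by (intro equiv_class_eq[OF equiv_loop_homotopic] join_loops_homotopic)
  qed
  from UN_equiv_class2[OF equiv_loop_homotopic equiv_loop_homotopic this assms]
  show ?thesis by (simp add: fundamental_group_def)
qed

lemma carrier_fundamental_group:
  "carrier (fundamental_group T p) = (\<lambda>f. loop_homotopic T p `` {f}) ` loops_at T p"
  by (auto simp: fundamental_group_def quotient_def)

lemma fundamental_group_multI:
  assumes "f \<in> loops_at T p" "g \<in> loops_at T p" "(join_loops f g, h) \<in> loop_homotopic T p"
  shows "loop_homotopic T p `` {f} \<otimes>\<^bsub>fundamental_group T p\<^esub> loop_homotopic T p `` {g}
    = loop_homotopic T p `` {h}"
  unfolding fundamental_group_mult[OF assms(1,2)] by (rule equiv_class_eq[OF equiv_loop_homotopic assms(3)])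

lemma group_fundamental_group:
  assumes p: "p \<in> topspace T"
  shows "group (fundamental_group T p)"
proof (rule groupI)
  let ?G = "fundamental_group T p" and ?R = "loop_homotopic T p"
  have one: "\<one>\<^bsub>?G\<^esub> = ?R `` {\<lambda>t. p}" by (simp add: fundamental_group_def)
  have inG: "?R `` {f} \<in> carrier ?G" if "f \<in> loops_at T p" for f
    unfolding carrier_fundamental_group using that by (rule imageI)
  show "\<one>\<^bsub>?G\<^esub> \<in> carrier ?G" unfolding one by (rule inG[OF const_loop[OF p]])
  fix x assume "x \<in> carrier ?G"
  then obtain f where f: "f \<in> loops_at T p" and x: "x = ?R `` {f}"
    unfolding carrier_fundamental_group by (elim imageE)
  show "\<one>\<^bsub>?G\<^esub> \<otimes>\<^bsub>?G\<^esub> x = x"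
    unfolding one x by (rule fundamental_group_multI[OF const_loop[OF p] f join_loops_const[OF f]])
  show "\<exists>y\<in>carrier ?G. y \<otimes>\<^bsub>?G\<^esub> x = \<one>\<^bsub>?G\<^esub>"
    unfolding one x
    by (intro bexI[of _ "?R `` {\<lambda>t. f (1 - t)}"] inG
        fundamental_group_multI[OF join_loops_reverse(1)[OF f] f join_loops_reverse(2)[OF f]]
        join_loops_reverse(1)[OF f])
  fix y assume "y \<in> carrier ?G"
  then obtain g where g: "g \<in> loops_at T p" and y: "y = ?R `` {g}"
    unfolding carrier_fundamental_group by (elim imageE)
  show "x \<otimes>\<^bsub>?G\<^esub> y \<in> carrier ?G"
    unfolding x y fundamental_group_mult[OF f g] by (rule inG[OF join_loops_in[OF f g]])
  fix z assume "z \<in> carrier ?G"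
  then obtain h where h: "h \<in> loops_at T p" and z: "z = ?R `` {h}"
    unfolding carrier_fundamental_group by (elim imageE)
  show "x \<otimes>\<^bsub>?G\<^esub> y \<otimes>\<^bsub>?G\<^esub> z = x \<otimes>\<^bsub>?G\<^esub> (y \<otimes>\<^bsub>?G\<^esub> z)"
    unfolding x y z fundamental_group_mult[OF f g] fundamental_group_mult[OF g h]
      fundamental_group_mult[OF f join_loops_in[OF g h]]
    by (rule fundamental_group_multI[OF join_loops_in[OF f g] h join_loops_assoc[OF f g h]])
qed

lemma period_hom:
  assumes \<omega>: "local_cocycle X \<kappa> \<omega>" and p: "p \<in> mspace X"
  shows "\<exists>\<theta>\<in>hom (fundamental_group (mtopology_of X) p) integer_group.
    \<forall>f\<in>loops_at (mtopology_of X) p. \<theta> (loop_homotopic (mtopology_of X) p `` {f}) = period \<omega> f"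
proof -
  let ?T = "mtopology_of X"
  let ?R = "loop_homotopic ?T p"
  define \<theta> where "\<theta> A = period \<omega> (SOME f. f \<in> A)" for A
  have \<theta>: "\<theta> (?R `` {f}) = period \<omega> f" if "f \<in> loops_at ?T p" for f
  proof -
    have "f \<in> ?R `` {f}" using equiv_class_self[OF equiv_loop_homotopic that] .
    then have "(SOME g. g \<in> ?R `` {f}) \<in> ?R `` {f}" by (rule someI[of "\<lambda>g. g \<in> ?R `` {f}"])
    then have "(f, SOME g. g \<in> ?R `` {f}) \<in> ?R" by (rule ImageE) simp
    from period_homotopic[OF \<omega> p this] show ?thesis unfolding \<theta>_def by (rule sym)
  qed
  have "\<theta> \<in> hom (fundamental_group ?T p) integer_group"
  proof (rule homI)
    fix x y assume "x \<in> carrier (fundamental_group ?T p)" "y \<in> carrier (fundamental_group ?T p)"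
    then obtain f g where fg: "f \<in> loops_at ?T p" "x = ?R `` {f}" "g \<in> loops_at ?T p" "y = ?R `` {g}"
      by (auto simp: carrier_fundamental_group)
    have "\<theta> (x \<otimes>\<^bsub>fundamental_group ?T p\<^esub> y) = period \<omega> (join_loops f g)"
      using fg fundamental_group_mult[OF fg(1,3)] \<theta> join_loops_in[OF fg(1,3)] by simp
    also have "\<dots> = period \<omega> f + period \<omega> g"
      using fg join_loops_in[OF fg(1,3)] by (intro period_join[OF \<omega>]) (auto simp: loops_at_def)
    finally show "\<theta> (x \<otimes>\<^bsub>fundamental_group ?T p\<^esub> y) = \<theta> x \<otimes>\<^bsub>integer_group\<^esub> \<theta> y"
      using \<theta> fg by simp
  qed (simp add: integer_group_def)
  then show ?thesis using \<theta> by blast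
qed

section \<open>Homomorphisms to the integers on the abelianization\<close>

lemma (in group) hom_integer_group_derived:
  assumes c: "c \<in> hom G integer_group" and x: "x \<in> derived G (carrier G)"
  shows "c x = 0"
proof -
  interpret c: group_hom G integer_group c
    by (simp add: group_hom_def group_hom_axioms_def c is_group group_integer_group)
  have "derived G (carrier G) \<subseteq> kernel G integer_group c"
    unfolding derived_def
  proof (rule generate_subgroup_incl[OF _ c.subgroup_kernel])
    show "derived_set G (carrier G) \<subseteq> kernel G integer_group c"
      by (auto simp: kernel_def c.hom_inv)
  qed
  then show ?thesis using x by (auto simp: kernel_def)
qed

lemma (in group) abelianization_hom:
  assumes c: "c \<in> hom G integer_group"
  shows "\<exists>c'\<in>hom (abelianization G) integer_group.
    \<forall>x\<in>carrier G. c' (derived G (carrier G) #> x) = c x"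
proof -
  let ?N = "derived G (carrier G)"
  interpret N: normal ?N G by (rule derived_is_normal[OF normal_self])
  define c' where "c' C = c (SOME x. x \<in> C)" for C
  have c': "c' (?N #> x) = c x" if x: "x \<in> carrier G" for x
  proof -
    have "x \<in> ?N #> x" by (rule rcos_self[OF x N.subgroup_axioms])
    then have "(SOME y. y \<in> ?N #> x) \<in> ?N #> x" by (rule someI[of "\<lambda>y. y \<in> ?N #> x"])
    then obtain h where h: "h \<in> ?N" "(SOME y. y \<in> ?N #> x) = h \<otimes> x"
      unfolding r_coset_def by auto
    have "c (h \<otimes> x) = c h + c x"
      using hom_mult[OF c subsetD[OF N.subset h(1)] x] by simp
    then show ?thesis unfolding c'_def h(2) using hom_integer_group_derived[OF c h(1)] by simp
  qed
  have "c' \<in> hom (abelianization G) integer_group"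
  proof (rule homI)
    fix A B assume "A \<in> carrier (abelianization G)" "B \<in> carrier (abelianization G)"
    then obtain x y where xy: "x \<in> carrier G" "A = ?N #> x" "y \<in> carrier G" "B = ?N #> y"
      unfolding abelianization_def FactGroup_def RCOSETS_def by auto
    have "c' (A \<otimes>\<^bsub>abelianization G\<^esub> B) = c (x \<otimes> y)"
      using xy c' by (simp add: abelianization_def FactGroup_def N.rcos_sum)
    then show "c' (A \<otimes>\<^bsub>abelianization G\<^esub> B) = c' A \<otimes>\<^bsub>integer_group\<^esub> c' B"
      using hom_mult[OF c xy(1,3)] c' xy by simp
  qed simp
  then show ?thesis using c' by (intro bexI[of _ c']) simp_all
qed

lemma (in comm_group) hom_integer_group_finprod:
  assumes c: "c \<in> hom G integer_group" and "finite S" "f \<in> S \<rightarrow> carrier G"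
  shows "c (finprod G f S) = (\<Sum>s\<in>S. c (f s))"
  using assms(2,3)
proof (induction S rule: finite_induct)
  case empty
  then show ?case using hom_one[OF c is_group group_integer_group] by simp
next
  case (insert s S)
  have cl: "f s \<in> carrier G" "finprod G f S \<in> carrier G" using insert by auto
  have "finprod G f (insert s S) = f s \<otimes> finprod G f S"
    by (rule finprod_insert) (use insert in auto)
  then show ?case using hom_mult[OF c cl] insert by simp
qed

lemma (in group) hom_integer_group_int_pow:
  assumes c: "c \<in> hom G integer_group" and x: "x \<in> carrier G"
  shows "c (x [^] (n::int)) = n * c x"
proof -
  interpret c: group_hom G integer_group c
    by (simp add: group_hom_def group_hom_axioms_def c is_group group_integer_group)
  show ?thesis using c.hom_int_pow[OF x] by (simp add: )
qed

text \<open>Up to the factor \<open>n\<close> the \<open>c l\<close> are a dual family: applied to a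
  relation, the \<open>l\<close>-th one isolates \<open>n\<close> times the \<open>l\<close>-th
  exponent. It also separates the classes, so no two of them coincide.\<close>

lemma Z_independent_abelianization:
  assumes G: "group G" and n: "(0::int) < n"
    and c: "\<And>l. l < d \<Longrightarrow> c l \<in> hom G integer_group"
    and x: "\<And>j. j < d \<Longrightarrow> x j \<in> carrier G"
    and cx: "\<And>l j. l < d \<Longrightarrow> j < d \<Longrightarrow> c l (x j) = (if l = j then n else 0)"
  shows "\<exists>S. Z_independent (abelianization G) S \<and> card S = (d::nat)"
proof -
  interpret G: group G by fact
  let ?A = "abelianization G" and ?N = "derived G (carrier G)"
  interpret A: comm_group ?A unfolding abelianization_def by (rule G.derived_quot_is_comm_group)
  obtain c' where c': "\<And>l. l < d \<Longrightarrow> c' l \<in> hom ?A integer_group"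
    "\<And>l y. l < d \<Longrightarrow> y \<in> carrier G \<Longrightarrow> c' l (?N #>\<^bsub>G\<^esub> y) = c l y"
    using G.abelianization_hom[OF c] by metis
  define s where "s j = ?N #>\<^bsub>G\<^esub> x j" for j
  have sA: "s j \<in> carrier ?A" if "j < d" for j
    using x[OF that] by (auto simp: s_def abelianization_def FactGroup_def RCOSETS_def)
  have cs: "c' l (s j) = (if l = j then n else 0)" if "l < d" "j < d" for l j
    unfolding s_def using c'(2) x cx that by simp
  have inj: "inj_on s {..<d}"
  proof (rule inj_onI)
    fix i j assume ij: "i \<in> {..<d}" "j \<in> {..<d}" "s i = s j"
    then have "c' i (s i) = c' i (s j)" by simp
    then show "i = j" using cs[of i i] cs[of i j] ij n by (auto split: if_splits)
  qed
  let ?S = "s ` {..<d}"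
  have "Z_independent ?A ?S"
    unfolding Z_independent_def
  proof (intro conjI allI impI ballI)
    show "finite ?S" by simp
    show SA: "?S \<subseteq> carrier ?A" using sA by auto
    fix e :: "'a set \<Rightarrow> int" and z
    assume one: "finprod ?A (\<lambda>s. s [^]\<^bsub>?A\<^esub> e s) ?S = \<one>\<^bsub>?A\<^esub>" and "z \<in> ?S"
    then obtain l where l: "l < d" "z = s l" by auto
    have "0 = c' l (finprod ?A (\<lambda>s. s [^]\<^bsub>?A\<^esub> e s) ?S)"
      using hom_one[OF c'(1)[OF l(1)] A.is_group group_integer_group] one by simp
    also have "\<dots> = (\<Sum>y\<in>?S. c' l (y [^]\<^bsub>?A\<^esub> e y))"
      by (rule A.hom_integer_group_finprod[OF c'(1)[OF l(1)]]) (use sA in auto)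
    also have "\<dots> = (\<Sum>j<d. c' l (s j [^]\<^bsub>?A\<^esub> e (s j)))"
      using sum.reindex[OF inj, of "\<lambda>y. c' l (y [^]\<^bsub>?A\<^esub> e y)"] by (simp add: o_def)
    also have "\<dots> = (\<Sum>j<d. if j = l then e (s l) * n else 0)"
      by (rule sum.cong) (use A.hom_integer_group_int_pow[OF c'(1)[OF l(1)] sA] cs l(1) in auto)
    also have "\<dots> = e (s l) * n" using l(1) by simp
    finally show "e z = 0" using n l(2) by simp
  qed
  then show ?thesis using card_image[OF inj] by (intro exI[of _ ?S]) simp
qed

section \<open>Consequences of the curvature-dimension condition\<close>

lemma mdist_self: "x \<in> mspace X \<Longrightarrow> mdist X x x = 0"
  by (rule Metric_space.mdist_zero[OF Metric_space_mspace_mdist])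

lemma mdist_triangle_le:
  "x \<in> mspace X \<Longrightarrow> y \<in> mspace X \<Longrightarrow> z \<in> mspace X \<Longrightarrow> mdist X x z \<le> mdist X x y + mdist X y z"
  by (rule Metric_space.triangle[OF Metric_space_mspace_mdist])

lemma mdist_sym: "mdist X x y = mdist X y x"
  by (rule Metric_space.commute[OF Metric_space_mspace_mdist])

lemma mdist_ge_0: "0 \<le> mdist X x y"
  by (rule Metric_space.nonneg[OF Metric_space_mspace_mdist])

lemma in_mball_of: "y \<in> mball_of X x r \<longleftrightarrow> x \<in> mspace X \<and> y \<in> mspace X \<and> mdist X x y < r"
  unfolding mball_of_def by (rule Metric_space.in_mball[OF Metric_space_mspace_mdist])

lemma openin_mball_of: "openin (mtopology_of X) (mball_of X x r)"
  unfolding mball_of_def mtopology_of_def by (rule Metric_space.openin_mball[OF Metric_space_mspace_mdist])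

context
  fixes X :: "'a metric" and m :: "'a measure"
  assumes mms: "metric_measure_space X m"
begin

lemma sets_mms: "sets m = sigma_sets (mspace X) {U. openin (mtopology_of X) U}"
proof -
  have "{U. openin (mtopology_of X) U} \<subseteq> Pow (mspace X)"
    using openin_subset by fastforce
  then show ?thesis using mms unfolding metric_measure_space_def borel_on_def by simp
qed

lemma space_mms: "space m = mspace X"
proof -
  have "sets m = sets (borel_on (mtopology_of X))" using mms unfolding metric_measure_space_def by simp
  then have "space m = space (borel_on (mtopology_of X))" by (rule sets_eq_imp_space_eq)
  then show ?thesis by (simp add: borel_on_def space_measure_of_conv)
qed

lemma openin_sets_mms: "openin (mtopology_of X) U \<Longrightarrow> U \<in> sets m"
  unfolding sets_mms by (rule sigma_sets.Basic) simp

lemma mball_sets_mms: "mball_of X x r \<in> sets m"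
  by (rule openin_sets_mms[OF openin_mball_of])

lemma mdist_borel_mms:
  assumes x: "x \<in> mspace X"
  shows "mdist X x \<in> borel_measurable m"
proof (rule borel_measurableI)
  fix S :: "real set" assume S: "open S"
  have "continuous_map (mtopology_of X) euclideanreal (\<lambda>z. mdist X x z)"
    by (rule continuous_map_mdist) (use x in simp_all)
  from openin_continuous_map_preimage[OF this, of S]
  have "openin (mtopology_of X) {z \<in> mspace X. mdist X x z \<in> S}" using S by simp
  then show "mdist X x -` S \<inter> space m \<in> sets m"
    using openin_sets_mms by (simp add: space_mms vimage_def Int_def conj_commute)
qed

end

section \<open>Estimates for the Wasserstein distance\<close>

lemma P2_acD:
  assumes "\<mu> \<in> P2_ac X m"
  shows "prob_space \<mu>" "sets \<mu> = sets m" "absolutely_continuous m \<mu>"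
  using assms unfolding P2_ac_def by auto

lemma P2_acI_bounded:
  assumes mms: "metric_measure_space X m"
    and D: "\<And>x y. x \<in> mspace X \<Longrightarrow> y \<in> mspace X \<Longrightarrow> mdist X x y \<le> D"
    and "prob_space \<mu>" "sets \<mu> = sets m" "absolutely_continuous m \<mu>"
  shows "\<mu> \<in> P2_ac X m"
proof -
  interpret prob_space \<mu> by fact
  have sp: "space \<mu> = mspace X" using sets_eq_imp_space_eq[OF assms(4)] space_mms[OF mms] by simp
  obtain x where x: "x \<in> mspace X" using not_empty sp by auto
  have "(\<integral>\<^sup>+ y. ennreal ((mdist X x y)\<^sup>2) \<partial>\<mu>) \<le> (\<integral>\<^sup>+ y. ennreal (D\<^sup>2) \<partial>\<mu>)"
    by (rule nn_integral_mono) (use D[OF x] sp mdist_ge_0 in \<open>auto intro!: ennreal_leI power_mono\<close>)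
  also have "\<dots> < \<infinity>" by (simp add: emeasure_space_1)
  finally show ?thesis unfolding P2_ac_def using assms x by auto
qed

lemma uniform_measure_P2_ac:
  assumes mms: "metric_measure_space X m"
    and D: "\<And>x y. x \<in> mspace X \<Longrightarrow> y \<in> mspace X \<Longrightarrow> mdist X x y \<le> D"
    and B: "B \<in> sets m" "0 < emeasure m B" "emeasure m B < \<infinity>"
  shows "uniform_measure m B \<in> P2_ac X m"
proof (rule P2_acI_bounded[OF mms D])
  show "prob_space (uniform_measure m B)"
    by (rule prob_space_uniform_measure) (use B in auto)
  show "absolutely_continuous m (uniform_measure m B)"
    unfolding uniform_measure_def by (rule absolutely_continuousI_density) (use B in measurable)
qed auto

lemma AE_coupling:
  assumes \<pi>: "\<pi> \<in> couplings \<mu> \<nu>"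
  shows "AE x in \<mu>. P x \<Longrightarrow> AE z in \<pi>. P (fst z)" "AE y in \<nu>. Q y \<Longrightarrow> AE z in \<pi>. Q (snd z)"
proof -
  have \<pi>: "sets \<pi> = sets (\<mu> \<Otimes>\<^sub>M \<nu>)" "distr \<pi> \<mu> fst = \<mu>" "distr \<pi> \<nu> snd = \<nu>"
    using \<pi> unfolding couplings_def by auto
  have f: "fst \<in> measurable \<pi> \<mu>" and s: "snd \<in> measurable \<pi> \<nu>"
    unfolding measurable_cong_sets[OF \<pi>(1) refl] by measurable
  show "AE z in \<pi>. P (fst z)" if "AE x in \<mu>. P x"
    by (rule AE_distrD[OF f]) (simp only: \<pi>(2) that)
  show "AE z in \<pi>. Q (snd z)" if "AE y in \<nu>. Q y"
    by (rule AE_distrD[OF s]) (simp only: \<pi>(3) that)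
qed

lemma coupling_prob_space:
  assumes \<pi>: "\<pi> \<in> couplings \<mu> \<nu>" and \<mu>: "prob_space \<mu>"
  shows "prob_space \<pi>"
proof -
  have \<pi>: "sets \<pi> = sets (\<mu> \<Otimes>\<^sub>M \<nu>)" "distr \<pi> \<mu> fst = \<mu>"
    using \<pi> unfolding couplings_def by auto
  have f: "fst \<in> measurable \<pi> \<mu>" unfolding measurable_cong_sets[OF \<pi>(1) refl] by measurable
  show ?thesis by (rule prob_space_distrD[OF f]) (simp only: \<pi>(2) \<mu>)
qed

lemma pair_measure_coupling:
  assumes \<mu>: "prob_space \<mu>" and \<nu>: "prob_space \<nu>"
  shows "\<mu> \<Otimes>\<^sub>M \<nu> \<in> couplings \<mu> \<nu>"
proof -
  interpret \<mu>: prob_space \<mu> by fact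
  interpret \<nu>: prob_space \<nu> by fact
  interpret P: pair_prob_space \<mu> \<nu> ..
  have 1: "distr (\<mu> \<Otimes>\<^sub>M \<nu>) \<mu> fst = \<mu>" by (rule \<nu>.distr_pair_fst)
  have "distr (\<mu> \<Otimes>\<^sub>M \<nu>) \<nu> snd = distr (distr (\<nu> \<Otimes>\<^sub>M \<mu>) (\<mu> \<Otimes>\<^sub>M \<nu>) (\<lambda>(x, y). (y, x))) \<nu> snd"
    using P.distr_pair_swap by simp
  also have "\<dots> = distr (\<nu> \<Otimes>\<^sub>M \<mu>) \<nu> (snd \<circ> (\<lambda>(x, y). (y, x)))"
    by (rule distr_distr) measurable
  also have "snd \<circ> (\<lambda>(x, y). (y, x)) = fst" by auto
  also have "distr (\<nu> \<Otimes>\<^sub>M \<mu>) \<nu> fst = \<nu>" by (rule \<mu>.distr_pair_fst)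
  finally show ?thesis using 1 unfolding couplings_def by simp
qed

text \<open>The product coupling already costs at most \<open>c\<^sup>2\<close>. The second
  conclusion records finiteness, so that the real-valued distance can be turned back into the
  extended squared one.\<close>

lemma wasserstein_dist_le:
  assumes \<mu>: "prob_space \<mu>" and \<nu>: "prob_space \<nu>" and c: "0 \<le> c"
    and A: "AE x in \<mu>. x \<in> A" and B: "AE y in \<nu>. y \<in> B"
    and AB: "\<And>x y. x \<in> A \<Longrightarrow> y \<in> B \<Longrightarrow> mdist X x y \<le> c"
  shows "wasserstein_dist X \<mu> \<nu> \<le> c" "wasserstein_sq X \<mu> \<nu> = ennreal ((wasserstein_dist X \<mu> \<nu>)\<^sup>2)"
proof -
  note pc = pair_measure_coupling[OF \<mu> \<nu>]
  interpret P: prob_space "\<mu> \<Otimes>\<^sub>M \<nu>" by (rule coupling_prob_space[OF pc \<mu>])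
  have "wasserstein_sq X \<mu> \<nu> \<le> transport_cost X (\<mu> \<Otimes>\<^sub>M \<nu>)"
    unfolding wasserstein_sq_def by (rule INF_lower[OF pc])
  also have "\<dots> \<le> (\<integral>\<^sup>+ z. ennreal (c\<^sup>2) \<partial>(\<mu> \<Otimes>\<^sub>M \<nu>))"
    unfolding transport_cost_def
  proof (rule nn_integral_mono_AE)
    show "AE z in \<mu> \<Otimes>\<^sub>M \<nu>. ennreal ((mdist X (fst z) (snd z))\<^sup>2) \<le> ennreal (c\<^sup>2)"
      using AE_coupling(1)[OF pc A] AE_coupling(2)[OF pc B]
    proof eventually_elim
      case (elim z)
      then show ?case using AB mdist_ge_0 by (intro ennreal_leI power_mono) auto
    qed
  qed
  also have "\<dots> = ennreal (c\<^sup>2)" by (simp add: P.emeasure_space_1)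
  finally have W: "wasserstein_sq X \<mu> \<nu> \<le> ennreal (c\<^sup>2)" .
  then have fin: "wasserstein_sq X \<mu> \<nu> < \<top>" by (rule le_less_trans) simp
  have "enn2real (wasserstein_sq X \<mu> \<nu>) \<le> c\<^sup>2" using W by (simp add: enn2real_leI)
  then show "wasserstein_dist X \<mu> \<nu> \<le> c" unfolding wasserstein_dist_def
    using c by (simp add: real_le_lsqrt)
  show "wasserstein_sq X \<mu> \<nu> = ennreal ((wasserstein_dist X \<mu> \<nu>)\<^sup>2)"
    unfolding wasserstein_dist_def using fin by simp
qed

text \<open>In every coupling the second point is at least \<open>h\<close> away from the set
  \<open>A\<close> that carries \<mu>. Both orders occur: a midpoint is reached from the starting
  measure and continues to the final one.\<close>

lemma wasserstein_sq_ge: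
  assumes A: "AE x in \<mu>. x \<in> A" and h: "h \<in> borel_measurable \<nu>"
    and le: "\<And>x y. x \<in> A \<Longrightarrow> y \<in> space \<nu> \<Longrightarrow> h y \<le> mdist X x y" and h0: "\<And>y. 0 \<le> h y"
  shows "(\<integral>\<^sup>+ y. ennreal ((h y)\<^sup>2) \<partial>\<nu>) \<le> wasserstein_sq X \<mu> \<nu>"
    "(\<integral>\<^sup>+ y. ennreal ((h y)\<^sup>2) \<partial>\<nu>) \<le> wasserstein_sq X \<nu> \<mu>"
proof -
  have sp: "AE y in \<nu>. y \<in> space \<nu>" by simp
  show "(\<integral>\<^sup>+ y. ennreal ((h y)\<^sup>2) \<partial>\<nu>) \<le> wasserstein_sq X \<mu> \<nu>"
    unfolding wasserstein_sq_def
  proof (rule INF_greatest)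
    fix \<pi> assume pc: "\<pi> \<in> couplings \<mu> \<nu>"
    then have \<pi>: "sets \<pi> = sets (\<mu> \<Otimes>\<^sub>M \<nu>)" "distr \<pi> \<nu> snd = \<nu>" unfolding couplings_def by auto
    have s: "snd \<in> measurable \<pi> \<nu>" unfolding measurable_cong_sets[OF \<pi>(1) refl] by measurable
    have "(\<integral>\<^sup>+ y. ennreal ((h y)\<^sup>2) \<partial>\<nu>) = (\<integral>\<^sup>+ y. ennreal ((h y)\<^sup>2) \<partial>distr \<pi> \<nu> snd)" using \<pi> by simp
    also have "\<dots> = (\<integral>\<^sup>+ z. ennreal ((h (snd z))\<^sup>2) \<partial>\<pi>)"
      by (rule nn_integral_distr[OF s]) (use h in measurable)
    also have "\<dots> \<le> transport_cost X \<pi>"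
      unfolding transport_cost_def
    proof (rule nn_integral_mono_AE)
      show "AE z in \<pi>. ennreal ((h (snd z))\<^sup>2) \<le> ennreal ((mdist X (fst z) (snd z))\<^sup>2)"
        using AE_coupling(1)[OF pc A] AE_coupling(2)[OF pc sp]
      proof eventually_elim
        case (elim z)
        then show ?case using h0 le by (intro ennreal_leI power_mono)
      qed
    qed
    finally show "(\<integral>\<^sup>+ y. ennreal ((h y)\<^sup>2) \<partial>\<nu>) \<le> transport_cost X \<pi>" .
  qed
  show "(\<integral>\<^sup>+ y. ennreal ((h y)\<^sup>2) \<partial>\<nu>) \<le> wasserstein_sq X \<nu> \<mu>"
    unfolding wasserstein_sq_def
  proof (rule INF_greatest)
    fix \<pi> assume pc: "\<pi> \<in> couplings \<nu> \<mu>"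
    then have \<pi>: "sets \<pi> = sets (\<nu> \<Otimes>\<^sub>M \<mu>)" "distr \<pi> \<nu> fst = \<nu>" unfolding couplings_def by auto
    have s: "fst \<in> measurable \<pi> \<nu>" unfolding measurable_cong_sets[OF \<pi>(1) refl] by measurable
    have "(\<integral>\<^sup>+ y. ennreal ((h y)\<^sup>2) \<partial>\<nu>) = (\<integral>\<^sup>+ y. ennreal ((h y)\<^sup>2) \<partial>distr \<pi> \<nu> fst)" using \<pi> by simp
    also have "\<dots> = (\<integral>\<^sup>+ z. ennreal ((h (fst z))\<^sup>2) \<partial>\<pi>)"
      by (rule nn_integral_distr[OF s]) (use h in measurable)
    also have "\<dots> \<le> transport_cost X \<pi>"
      unfolding transport_cost_def
    proof (rule nn_integral_mono_AE)
      show "AE z in \<pi>. ennreal ((h (fst z))\<^sup>2) \<le> ennreal ((mdist X (fst z) (snd z))\<^sup>2)"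
        using AE_coupling(1)[OF pc sp] AE_coupling(2)[OF pc A]
      proof eventually_elim
        case (elim z)
        have "h (fst z) \<le> mdist X (fst z) (snd z)" unfolding mdist_sym[of X "fst z"] by (rule le[OF elim(2,1)])
        then show ?case using h0 by (intro ennreal_leI power_mono)
      qed
    qed
    finally show "(\<integral>\<^sup>+ y. ennreal ((h y)\<^sup>2) \<partial>\<nu>) \<le> transport_cost X \<pi>" .
  qed
qed

lemma AE_uniform_measure_mem:
  assumes "B \<in> sets m" "0 < emeasure m B" "emeasure m B < \<infinity>"
  shows "AE x in uniform_measure m B. x \<in> B"
  using assms by (intro AE_uniform_measureI) auto

lemma mms_ball_emeasure:
  assumes "metric_measure_space X m" "x \<in> mspace X" "0 < r"
  shows "0 < emeasure m (mball_of X x r)" "emeasure m (mball_of X x r) < \<infinity>"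
  using assms unfolding metric_measure_space_def by auto

text \<open>The midpoint in \<open>P\<^sub>2\<close> of the uniform measures on two small balls charges approximate midpoints of
  their centres.\<close>

lemma CD_approximate_midpoint:
  assumes mms: "metric_measure_space X m" and CD: "CD K N X m"
    and D: "\<And>x y. x \<in> mspace X \<Longrightarrow> y \<in> mspace X \<Longrightarrow> mdist X x y \<le> D"
    and x: "x \<in> mspace X" and y: "y \<in> mspace X" and L: "mdist X x y < L"
  shows "\<exists>z\<in>mspace X. mdist X x z < L / 2 \<and> mdist X z y < L / 2"
proof -
  define d where "d = mdist X x y"
  define t where "t = (L - d) / 4"
  have t: "0 < t" "L = d + 4 * t" using L unfolding t_def d_def by (simp_all add: diff_divide_distrib)
  have d: "0 \<le> d" "d \<le> D" unfolding d_def using mdist_ge_0 D x y by auto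
  \<comment> \<open>Here \<open>s\<close> is the loss in passing from an average to a point and
    \<open>r\<close> the radius of the balls. In \<open>key\<close> the errors are
    \<open>4 * D * r\<close>, \<open>2 * r\<^sup>2\<close> and \<open>s\<close>, at most 1/4, 1/2
    and 1/4 of \<open>t\<^sup>2\<close>, which together exclude an excess of
    \<open>t\<close>.\<close>
  define s where "s = t\<^sup>2 / 4"
  define r where "r = min (t / 2) (t\<^sup>2 / (16 * (D + 1)))"
  have r: "0 < r" "r \<le> t / 2" "4 * D * r \<le> t\<^sup>2 / 4"
  proof -
    show "0 < r" unfolding r_def using t d by simp
    show "r \<le> t / 2" unfolding r_def by (rule min.cobounded1)
    have "4 * D * r \<le> 4 * (D + 1) * r" using \<open>0 < r\<close> by simp
    also have "\<dots> \<le> 4 * (D + 1) * (t\<^sup>2 / (16 * (D + 1)))"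
      unfolding r_def using d by (intro mult_left_mono) auto
    also have "\<dots> = t\<^sup>2 / 4" using d by (simp add: field_simps)
    finally show "4 * D * r \<le> t\<^sup>2 / 4" .
  qed
  let ?B = "\<lambda>c. mball_of X c r"
  let ?\<mu> = "\<lambda>c. uniform_measure m (?B c)"
  note Bm = mball_sets_mms[OF mms, of _ r]
  have P2: "?\<mu> c \<in> P2_ac X m" if "c \<in> mspace X" for c
    by (rule uniform_measure_P2_ac[OF mms D Bm]) (use mms_ball_emeasure[OF mms that r(1)] in auto)
  have AEB: "AE z in ?\<mu> c. z \<in> ?B c" if "c \<in> mspace X" for c
    by (rule AE_uniform_measure_mem[OF Bm]) (use mms_ball_emeasure[OF mms that r(1)] in auto)
  obtain \<Gamma> where \<Gamma>: "P2_geodesic X m \<Gamma>" "\<Gamma> 0 = ?\<mu> x" "\<Gamma> 1 = ?\<mu> y"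
    using CD P2[OF x] P2[OF y] unfolding CD_def by blast
  define \<nu> where "\<nu> = \<Gamma> (1 / 2)"
  have "\<nu> \<in> P2_ac X m" using \<Gamma>(1) unfolding P2_geodesic_def \<nu>_def by simp
  note \<nu> = P2_acD[OF this]
  interpret \<nu>: prob_space \<nu> by (rule \<nu>(1))
  have sp: "space \<nu> = mspace X" using sets_eq_imp_space_eq[OF \<nu>(2)] space_mms[OF mms] by simp
  have AE\<nu>: "AE z in \<nu>. z \<in> mspace X" using sp AE_space by metis
  have ballX: "?B c \<subseteq> mspace X" for c by (auto simp: in_mball_of)
  have W01: "wasserstein_dist X (?\<mu> x) (?\<mu> y) \<le> d + 2 * r"
  proof (rule wasserstein_dist_le(1)[OF P2_acD(1)[OF P2[OF x]] P2_acD(1)[OF P2[OF y]] _ AEB[OF x] AEB[OF y]])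
    fix a b assume ab: "a \<in> ?B x" "b \<in> ?B y"
    then have "mdist X a b \<le> mdist X a x + mdist X x b" "mdist X x b \<le> mdist X x y + mdist X y b"
      using x y by (auto intro!: mdist_triangle_le simp: in_mball_of)
    then show "mdist X a b \<le> d + 2 * r" using ab unfolding d_def
      by (simp add: in_mball_of mdist_sym[of X a x])
  qed (use d r in simp)
  \<comment> \<open>A lower bound for the distance from \<open>z\<close> to the ball about
    \<open>c\<close>.\<close>
  define h where "h c z = max 0 (mdist X c z - r)" for c z
  have h0: "0 \<le> h c z" for c z by (simp add: h_def)
  have hm: "h c \<in> borel_measurable \<nu>" if "c \<in> mspace X" for c
    unfolding h_def measurable_cong_sets[OF \<nu>(2) refl]
    using mdist_borel_mms[OF mms that] by (intro borel_measurable_max borel_measurable_diff) auto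
  have hle: "h c b \<le> mdist X a b" if "a \<in> ?B c" "b \<in> space \<nu>" for a b c
  proof -
    have "mdist X c b \<le> mdist X c a + mdist X a b"
      using that sp by (intro mdist_triangle_le) (auto simp: in_mball_of)
    then show ?thesis using that(1) mdist_ge_0[of X a b] unfolding h_def by (auto simp: in_mball_of)
  qed
  have hint: "(\<integral>\<^sup>+ z. ennreal ((h c z)\<^sup>2) \<partial>\<nu>) \<le> ennreal ((d / 2 + r)\<^sup>2)"
    if c: "c \<in> mspace X" and
      w: "wasserstein_dist X (?\<mu> c) \<nu> \<le> d / 2 + r \<or> wasserstein_dist X \<nu> (?\<mu> c) \<le> d / 2 + r" for c
  proof -
    have D0: "0 \<le> D" using d by simp
    have hlec: "\<And>a b. a \<in> ?B c \<Longrightarrow> b \<in> space \<nu> \<Longrightarrow> h c b \<le> mdist X a b" by (rule hle)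
    note s = wasserstein_sq_ge[OF AEB[OF c] hm[OF c] hlec h0]
    note e1 = wasserstein_dist_le(2)[OF P2_acD(1)[OF P2[OF c]] \<nu>(1) D0 AEB[OF c] AE\<nu>]
    note e2 = wasserstein_dist_le(2)[OF \<nu>(1) P2_acD(1)[OF P2[OF c]] D0 AE\<nu> AEB[OF c]]
    have e: "wasserstein_sq X (?\<mu> c) \<nu> = ennreal ((wasserstein_dist X (?\<mu> c) \<nu>)\<^sup>2)"
      "wasserstein_sq X \<nu> (?\<mu> c) = ennreal ((wasserstein_dist X \<nu> (?\<mu> c))\<^sup>2)"
      by (rule e1 e2; use D ballX in blast)+
    have nn: "0 \<le> wasserstein_dist X \<mu>1 \<mu>2" for \<mu>1 \<mu>2 by (simp add: wasserstein_dist_def)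
    from w show ?thesis
    proof
      assume "wasserstein_dist X (?\<mu> c) \<nu> \<le> d / 2 + r"
      then show ?thesis
        by (intro order_trans[OF s(1)[unfolded e(1)]] ennreal_leI power_mono nn)
    next
      assume "wasserstein_dist X \<nu> (?\<mu> c) \<le> d / 2 + r"
      then show ?thesis
        by (intro order_trans[OF s(2)[unfolded e(2)]] ennreal_leI power_mono nn)
    qed
  qed
  have geo: "wasserstein_dist X (\<Gamma> s) (\<Gamma> t) = \<bar>s - t\<bar> * wasserstein_dist X (?\<mu> x) (?\<mu> y)"
    if "s \<in> {0..1}" "t \<in> {0..1}" for s t
    using \<Gamma>(1)[unfolded P2_geodesic_def, THEN conjunct2, rule_format, of s t] that unfolding \<Gamma>(2,3) by blast
  have "wasserstein_dist X (?\<mu> x) \<nu> \<le> d / 2 + r"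
    using geo[of 0 "1/2"] W01 unfolding \<nu>_def \<Gamma>(2) by simp
  then have hx: "(\<integral>\<^sup>+ z. ennreal ((h x z)\<^sup>2) \<partial>\<nu>) \<le> ennreal ((d / 2 + r)\<^sup>2)" by (intro hint x disjI1)
  have "wasserstein_dist X \<nu> (?\<mu> y) \<le> d / 2 + r"
    using geo[of "1/2" 1] W01 unfolding \<nu>_def \<Gamma>(3) by simp
  then have hy: "(\<integral>\<^sup>+ z. ennreal ((h y z)\<^sup>2) \<partial>\<nu>) \<le> ennreal ((d / 2 + r)\<^sup>2)" by (intro hint y disjI2)
  \<comment> \<open>The squared distances to the two balls, added and averaged over \<nu>, are at
    most \<open>2 * (d / 2 + r)\<^sup>2\<close>, so some point nearly attains this bound for the
    sum.\<close>
  have "\<exists>z\<in>space \<nu>. (h x z)\<^sup>2 + (h y z)\<^sup>2 < 2 * (d / 2 + r)\<^sup>2 + s"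
  proof (rule ccontr)
    assume "\<not> ?thesis"
    then have ge: "2 * (d / 2 + r)\<^sup>2 + s \<le> (h x z)\<^sup>2 + (h y z)\<^sup>2" if "z \<in> space \<nu>" for z
      using that by force
    have "ennreal (2 * (d / 2 + r)\<^sup>2 + s) = (\<integral>\<^sup>+ z. ennreal (2 * (d / 2 + r)\<^sup>2 + s) \<partial>\<nu>)"
      by (simp add: \<nu>.emeasure_space_1)
    also have "\<dots> \<le> (\<integral>\<^sup>+ z. ennreal ((h x z)\<^sup>2) + ennreal ((h y z)\<^sup>2) \<partial>\<nu>)"
      by (rule nn_integral_mono) (use ge in \<open>simp add: ennreal_leI flip: ennreal_plus\<close>)
    also have "\<dots> = (\<integral>\<^sup>+ z. ennreal ((h x z)\<^sup>2) \<partial>\<nu>) + (\<integral>\<^sup>+ z. ennreal ((h y z)\<^sup>2) \<partial>\<nu>)"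
      using hm[OF x] hm[OF y] by (intro nn_integral_add) auto
    also have "\<dots> \<le> ennreal ((d / 2 + r)\<^sup>2) + ennreal ((d / 2 + r)\<^sup>2)"
      by (rule add_mono[OF hx hy])
    also have "\<dots> = ennreal (2 * (d / 2 + r)\<^sup>2)" by (simp flip: ennreal_plus)
    finally have "2 * (d / 2 + r)\<^sup>2 + s \<le> 2 * (d / 2 + r)\<^sup>2" by (simp add: ennreal_le_iff)
    then show False using t unfolding s_def by simp
  qed
  then obtain z where z: "z \<in> mspace X" "(h x z)\<^sup>2 + (h y z)\<^sup>2 < 2 * (d / 2 + r)\<^sup>2 + s" using sp by auto
  have tri: "d \<le> mdist X x z + mdist X y z"
    using mdist_triangle_le[OF x z(1) y] unfolding d_def by (simp add: mdist_sym[of X z y])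
  \<comment> \<open>When \<open>a + b\<close> is almost \<open>d\<close>, the sum of squares exceeds
    its minimum \<open>d\<^sup>2 / 2\<close> by at least \<open>(a - d / 2)\<^sup>2\<close>, up to
    errors in \<open>r\<close>. For this \<open>b\<^sup>2\<close> is replaced by its tangent at
    \<open>d / 2\<close>.\<close>
  have key: "a < d / 2 + t" if ab: "a\<^sup>2 + b\<^sup>2 < 2 * (d / 2 + r)\<^sup>2 + s" "d - 2 * r - a \<le> b" for a b :: real
  proof (rule ccontr)
    assume "\<not> ?thesis"
    then have a: "t \<le> a - d / 2" by simp
    have "0 \<le> (b - d / 2)\<^sup>2" by simp
    then have "d * b - d\<^sup>2 / 4 \<le> b\<^sup>2" by (simp add: power2_diff power_divide mult.commute)
    moreover have "d * (d - 2 * r - a) \<le> d * b" using ab(2) d by (intro mult_left_mono) auto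
    moreover have "t\<^sup>2 \<le> (a - d / 2)\<^sup>2" using a t by (intro power_mono) auto
    moreover have "(a - d / 2)\<^sup>2 = a\<^sup>2 - a * d + d\<^sup>2 / 4" by (simp add: power2_diff power_divide mult.commute)
    moreover have "2 * (d / 2 + r)\<^sup>2 = d\<^sup>2 / 2 + 2 * (d * r) + 2 * r\<^sup>2"
      by (simp add: power2_sum power_divide algebra_simps)
    moreover have "d * (d - 2 * r - a) = d\<^sup>2 - 2 * (d * r) - a * d"
      by (simp add: algebra_simps power2_eq_square)
    moreover have "d * r \<le> D * r" using d r by (intro mult_right_mono) auto
    moreover have "r\<^sup>2 \<le> (t / 2)\<^sup>2" using r by (intro power_mono) auto
    moreover have "(t / 2)\<^sup>2 = t\<^sup>2 / 4" by (simp add: power_divide)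
    ultimately have "t\<^sup>2 < 4 * (D * r) + t\<^sup>2 / 2 + s" using ab(1) by linarith
    then show False using r(3) unfolding s_def by simp
  qed
  have hs: "mdist X c z - r \<le> h c z" for c by (simp add: h_def)
  have bx: "d - 2 * r - h x z \<le> h y z" "d - 2 * r - h y z \<le> h x z" using tri hs[of x] hs[of y] by auto
  have "mdist X x z < L / 2" using key[OF z(2) bx(1)] hs[of x] r t by auto
  moreover have "mdist X y z < L / 2"
    using key[of "h y z" "h x z"] z(2) bx(2) hs[of y] r t by (auto simp: add.commute)
  ultimately show ?thesis using z(1) by (auto simp: mdist_sym[of X z y])
qed

section \<open>Distortion coefficients and the Renyi entropy\<close>

lemma sinh_le_mult_cosh:
  assumes "0 \<le> (v::real)" shows "sinh v \<le> v * cosh v"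
proof (cases "v = 0")
  case False
  then have v: "0 < v" using assms by simp
  obtain \<xi> where \<xi>: "0 < \<xi>" "\<xi> < v" "sinh v - sinh 0 = (v - 0) * cosh \<xi>"
  proof -
    have "(sinh has_real_derivative cosh x) (at x)" for x :: real
      by (auto intro!: derivative_eq_intros)
    with MVT2[OF v, of sinh cosh] show ?thesis using that by blast
  qed
  then show ?thesis using v cosh_real_nonneg_le_iff[of \<xi> v] by simp
qed simp

lemma le_sinh:
  assumes "0 \<le> (v::real)" shows "v \<le> sinh v"
proof (cases "v = 0")
  case False
  then have v: "0 < v" using assms by simp
  obtain \<xi> where \<xi>: "0 < \<xi>" "\<xi> < v" "sinh v - sinh 0 = (v - 0) * cosh \<xi>"
  proof -
    have "(sinh has_real_derivative cosh x) (at x)" for x :: real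
      by (auto intro!: derivative_eq_intros)
    with MVT2[OF v, of sinh cosh] show ?thesis using that by blast
  qed
  then show ?thesis using v cosh_real_ge_1[of \<xi>] by simp
qed simp

text \<open>For curvature -1 the ratio of hyperbolic sines is at least
  \<open>t / cosh (D * w)\<close>, by \<open>sinh (t * v) \<ge> t * v\<close> and
  \<open>sinh v \<le> v * cosh v\<close>. The bound is linear in \<open>t\<close> and uniform over
  distances up to \<open>D\<close>.\<close>

lemma tau_coeff_ge:
  assumes N: "1 < N" and D: "0 \<le> D"
  shows "\<exists>c>0. \<forall>t \<theta>. 0 < t \<longrightarrow> t \<le> 1 \<longrightarrow> 0 \<le> \<theta> \<longrightarrow> \<theta> \<le> D \<longrightarrow> ennreal (c * t) \<le> tau_coeff (-1) N t \<theta>"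
proof -
  define w where "w = sqrt (1 / (N - 1))"
  have w: "0 < w" using N unfolding w_def by simp
  define c where "c = 1 / cosh (D * w)"
  have c: "0 < c" "c \<le> 1" using cosh_real_ge_1[of "D * w"] cosh_real_pos[of "D * w"]
    by (auto simp: c_def)
  have "ennreal (c * t) \<le> tau_coeff (-1) N t \<theta>"
    if t: "0 < t" "t \<le> 1" and \<theta>: "0 \<le> \<theta>" "\<theta> \<le> D" for t \<theta>
  proof -
    obtain s where s: "sigma_coeff (-1) (N - 1) t \<theta> = ennreal s" "c * t \<le> s"
    proof (cases "\<theta> = 0")
      case True
      have "c * t \<le> 1 * t" using c t by (intro mult_right_mono) auto
      then show ?thesis using True by (intro that[of t]) (auto simp: sigma_coeff_def)
    next
      case False
      define v where "v = \<theta> * w"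
      have v: "0 < v" "v \<le> D * w" using False \<theta> w unfolding v_def by auto
      have cm: "cosh v \<le> cosh (D * w)" using v by (simp add: cosh_real_nonneg_le_iff)
      have "c * t * sinh v \<le> c * t * (v * cosh (D * w))"
        using sinh_le_mult_cosh[of v] v c t cm
        by (intro mult_left_mono order_trans[OF sinh_le_mult_cosh] mult_left_mono) auto
      also have "\<dots> = t * v" using cosh_real_pos[of "D * w"] by (simp add: c_def)
      also have "\<dots> \<le> sinh (t * v)" using t v by (intro le_sinh) simp
      finally have "c * t \<le> sinh (t * v) / sinh v" using v by (simp add: pos_le_divide_eq)
      moreover have "sigma_coeff (-1) (N - 1) t \<theta> = ennreal (sinh (t * v) / sinh v)"
        using False N by (simp add: sigma_coeff_def v_def w_def mult.assoc)
      ultimately show ?thesis by (intro that) auto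
    qed
    have s0: "0 \<le> s" using s(2) c t by (intro order_trans[OF _ s(2)]) simp
    \<comment> \<open>The two powers of \<open>t\<close> recombine to \<open>t\<close>, and
      \<open>c \<le> 1\<close> only grows under the exponent \<open>1 - 1 / N\<close>.\<close>
    have "c * t \<le> t powr (1 / N) * (c * t) powr (1 - 1 / N)"
    proof -
      have "c powr 1 \<le> c powr (1 - 1 / N)" using c N by (intro powr_mono') auto
      then have "c * t \<le> c powr (1 - 1 / N) * t" using t c by (intro mult_right_mono) auto
      also have "\<dots> = c powr (1 - 1 / N) * (t powr (1 / N) * t powr (1 - 1 / N))"
        using t by (simp flip: powr_add)
      finally show ?thesis using c t by (simp only: powr_mult mult_ac)
    qed
    also have "\<dots> \<le> t powr (1 / N) * s powr (1 - 1 / N)"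
      using s(2) c t N by (intro mult_left_mono powr_mono2) auto
    finally show ?thesis
      unfolding tau_coeff_def s(1) using s0 by (simp add: ennreal_leI flip: ennreal_mult)
  qed
  then show ?thesis using c by blast
qed

text \<open>A crude Young inequality with a free scale \<open>s\<close>: the concave power is
  dominated by an affine function whose slope \<open>s powr (- a)\<close> is small for large
  \<open>s\<close>.\<close>

lemma powr_le_young:
  fixes \<rho> s a :: real
  assumes "0 \<le> \<rho>" "0 < s" "0 < a" "a < 1"
  shows "\<rho> powr (1 - a) \<le> s powr (- a) * (\<rho> + s)"
proof (cases "\<rho> \<le> s")
  case True
  have "\<rho> powr (1 - a) \<le> s powr (1 - a)" using assms True by (intro powr_mono2) auto
  also have "\<dots> = s powr (- a) * s" using assms by (simp add: powr_diff powr_minus divide_inverse mult.commute)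
  also have "\<dots> \<le> s powr (- a) * (\<rho> + s)" using assms by (intro mult_left_mono) auto
  finally show ?thesis .
next
  case False
  have "\<rho> powr (1 - a) = \<rho> powr (- a) * \<rho>"
    using assms False by (simp add: powr_diff powr_minus divide_inverse mult.commute)
  also have "\<dots> \<le> s powr (- a) * (\<rho> + s)"
    using assms False by (intro mult_mono powr_mono2') auto
  finally show ?thesis .
qed

text \<open>Young's inequality with a separate scale on each set. On a small ball a large
  \<open>s\<close> suppresses the mass term and isolates the measure of the ball; on the complement,
  where \<mu> has little mass, a small \<open>s'\<close> suppresses the measure term.\<close>

lemma renyi_le:
  assumes fin: "finite_measure m" and \<mu>: "\<mu> \<in> P2_ac X m" and A: "A \<in> sets m" "B \<in> sets m"
    and AB: "space m \<subseteq> A \<union> B" and s: "0 < s" "0 < s'" and N: "1 < N"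
  shows "renyi N m \<mu> \<le> ennreal (s powr (- 1 / N)) * (emeasure \<mu> A + ennreal s * emeasure m A)
    + ennreal (s' powr (- 1 / N)) * (emeasure \<mu> B + ennreal s' * emeasure m B)"
proof -
  interpret finite_measure m by fact
  note \<mu> = P2_acD[OF \<mu>]
  have dn: "density m (RN_deriv m \<mu>) = \<mu>" by (rule density_RN_deriv[OF \<mu>(3,2)])
  have dm [measurable]: "dens m \<mu> \<in> borel_measurable m" unfolding dens_def[abs_def] by measurable
  define F where "F C r x = ennreal (r powr (- 1 / N)) * ((ennreal (dens m \<mu> x) + ennreal r) * indicator C x)"
    for C r x
  have Fm: "F C r \<in> borel_measurable m" if [measurable]: "C \<in> sets m" for C r
    unfolding F_def[abs_def] by measurable
  have F: "(\<integral>\<^sup>+ x. F C r x \<partial>m) \<le> ennreal (r powr (- 1 / N)) * (emeasure \<mu> C + ennreal r * emeasure m C)"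
    if C [measurable]: "C \<in> sets m" for C r
  proof -
    have "(\<integral>\<^sup>+ x. F C r x \<partial>m) = ennreal (r powr (- 1 / N)) *
        (\<integral>\<^sup>+ x. (ennreal (dens m \<mu> x) + ennreal r) * indicator C x \<partial>m)"
      unfolding F_def by (intro nn_integral_cmult) measurable
    also have "(\<integral>\<^sup>+ x. (ennreal (dens m \<mu> x) + ennreal r) * indicator C x \<partial>m)
        = (\<integral>\<^sup>+ x. ennreal (dens m \<mu> x) * indicator C x \<partial>m) + (\<integral>\<^sup>+ x. ennreal r * indicator C x \<partial>m)"
      unfolding distrib_right by (intro nn_integral_add) measurable
    also have "(\<integral>\<^sup>+ x. ennreal r * indicator C x \<partial>m) = ennreal r * emeasure m C"
      using C by (simp add: nn_integral_cmult_indicator)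
    also have "(\<integral>\<^sup>+ x. ennreal (dens m \<mu> x) * indicator C x \<partial>m) \<le> (\<integral>\<^sup>+ x. RN_deriv m \<mu> x * indicator C x \<partial>m)"
    proof (intro nn_integral_mono mult_right_mono)
      fix x show "ennreal (dens m \<mu> x) \<le> RN_deriv m \<mu> x"
        unfolding dens_def by (cases "RN_deriv m \<mu> x") auto
    qed simp
    also have "(\<integral>\<^sup>+ x. RN_deriv m \<mu> x * indicator C x \<partial>m) = emeasure \<mu> C"
      using emeasure_density[of "RN_deriv m \<mu>" m C] C dn by simp
    finally show ?thesis by (simp add: mult_left_mono)
  qed
  have "renyi N m \<mu> \<le> (\<integral>\<^sup>+ x. F A s x + F B s' x \<partial>m)"
    unfolding renyi_def
  proof (rule nn_integral_mono)
    fix x assume "x \<in> space m"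
    have *: "ennreal (dens m \<mu> x powr (1 - 1 / N)) \<le> F C r x" if "x \<in> C" "0 < r" for C r
    proof -
      have d0: "0 \<le> dens m \<mu> x" by (simp add: dens_def)
      have "dens m \<mu> x powr (1 - 1 / N) \<le> r powr (- (1 / N)) * (dens m \<mu> x + r)"
        by (rule powr_le_young[OF d0]) (use that N in auto)
      then show ?thesis using that d0
        by (simp add: F_def ennreal_leI flip: ennreal_plus ennreal_mult)
    qed
    from \<open>x \<in> space m\<close> AB have "x \<in> A \<or> x \<in> B" by auto
    then show "ennreal (dens m \<mu> x powr (1 - 1 / N)) \<le> F A s x + F B s' x"
    proof
      assume "x \<in> A"
      then show ?thesis using *[of A s] s by (simp add: add_increasing2)
    next
      assume "x \<in> B"
      then show ?thesis using *[of B s'] s by (simp add: add_increasing)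
    qed
  qed
  also have "\<dots> = (\<integral>\<^sup>+ x. F A s x \<partial>m) + (\<integral>\<^sup>+ x. F B s' x \<partial>m)"
    by (rule nn_integral_add[OF Fm[OF A(1)] Fm[OF A(2)]])
  also have "\<dots> \<le> ennreal (s powr (- 1 / N)) * (emeasure \<mu> A + ennreal s * emeasure m A)
    + ennreal (s' powr (- 1 / N)) * (emeasure \<mu> B + ennreal s' * emeasure m B)"
    by (rule add_mono[OF F[OF A(1)] F[OF A(2)]])
  finally show ?thesis .
qed

lemma bounded_mms_finite:
  assumes mms: "metric_measure_space X m"
    and D: "\<And>x y. x \<in> mspace X \<Longrightarrow> y \<in> mspace X \<Longrightarrow> mdist X x y \<le> D"
  shows "finite_measure m" "0 < emeasure m (space m)" "0 \<le> D"
proof -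
  obtain x where x: "x \<in> mspace X" using mms unfolding metric_measure_space_def by auto
  show D0: "0 \<le> D" using D[OF x x] mdist_self[OF x] by simp
  have "mdist X x y < D + 1" if "y \<in> mspace X" for y using D[OF x that] by linarith
  then have "mball_of X x (D + 1) = space m"
    unfolding space_mms[OF mms] using x by (auto simp: in_mball_of)
  then show "finite_measure m" "0 < emeasure m (space m)"
    using mms_ball_emeasure[OF mms x, of "D + 1"] D0 by (auto intro!: finite_measureI)
qed

lemma dens_uniform_measure_space:
  assumes fin: "finite_measure m" and pos: "0 < emeasure m (space m)"
  shows "AE x in m. dens m (uniform_measure m (space m)) x = 1 / measure m (space m)"
proof -
  interpret finite_measure m by fact
  let ?f = "\<lambda>x. indicator (space m) x / emeasure m (space m) :: ennreal"
  have "AE x in m. ?f x = RN_deriv m (uniform_measure m (space m)) x"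
    by (rule RN_deriv_unique) (auto simp: uniform_measure_def)
  moreover have "measure m (space m) > 0" using pos by (simp add: emeasure_eq_measure)
  ultimately show ?thesis
    by (auto simp: dens_def emeasure_eq_measure divide_ennreal ennreal_1[symmetric]
        simp del: ennreal_1 elim!: eventually_mono)
qed

text \<open>Chebyshev's inequality. Up to time \<open>t\<close> the geodesic moves by at most
  \<open>t * D\<close> in Wasserstein distance, while mass outside the ball of radius \<epsilon>
  must be at least \<open>\<epsilon> / 2\<close> away from the ball carrying the initial
  measure.\<close>

lemma geodesic_tail:
  assumes mms: "metric_measure_space X m"
    and D: "\<And>x y. x \<in> mspace X \<Longrightarrow> y \<in> mspace X \<Longrightarrow> mdist X x y \<le> D"
    and x: "x \<in> mspace X" and \<epsilon>: "0 < \<epsilon>"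
    and \<Gamma>: "P2_geodesic X m \<Gamma>" and \<Gamma>0: "AE z in \<Gamma> 0. z \<in> mball_of X x (\<epsilon> / 2)" and t: "t \<in> {0..1}"
  shows "emeasure (\<Gamma> t) {z \<in> mspace X. \<epsilon> \<le> mdist X x z} \<le> ennreal (4 * t\<^sup>2 * D\<^sup>2 / \<epsilon>\<^sup>2)"
proof -
  let ?B' = "{z \<in> mspace X. \<epsilon> \<le> mdist X x z}"
  have P2: "\<Gamma> s \<in> P2_ac X m" if "s \<in> {0..1}" for s
    using \<Gamma>[unfolded P2_geodesic_def, THEN conjunct1] that by (rule bspec)
  have pr: "prob_space (\<Gamma> s)" if "s \<in> {0..1}" for s using P2_acD(1)[OF P2[OF that]] .
  have sets: "sets (\<Gamma> t) = sets m" using P2_acD(2)[OF P2[OF t]] .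
  have sp: "AE z in \<Gamma> s. z \<in> mspace X" if "s \<in> {0..1}" for s
    using sets_eq_imp_space_eq[OF P2_acD(2)[OF P2[OF that]]] space_mms[OF mms] AE_space[of "\<Gamma> s"] by simp
  have D0: "0 \<le> D" using bounded_mms_finite(3)[OF mms D] .
  have i: "(0::real) \<in> {0..1}" "(1::real) \<in> {0..1}" by auto
  have Bm: "?B' \<in> sets (\<Gamma> t)"
  proof -
    have "{z \<in> space m. \<epsilon> \<le> mdist X x z} \<in> sets m"
      using mdist_borel_mms[OF mms x] by measurable
    then show ?thesis unfolding sets space_mms[OF mms] .
  qed
  define h where "h z = max 0 (mdist X x z - \<epsilon> / 2)" for z
  have hm [measurable]: "h \<in> borel_measurable (\<Gamma> t)"
    unfolding h_def[abs_def] measurable_cong_sets[OF sets refl]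
    using mdist_borel_mms[OF mms x] by (intro borel_measurable_max borel_measurable_diff) auto
  have le: "h b \<le> mdist X a b" if "a \<in> mball_of X x (\<epsilon> / 2)" "b \<in> space (\<Gamma> t)" for a b
  proof -
    have "b \<in> mspace X" using that(2) sets_eq_imp_space_eq[OF sets] space_mms[OF mms] by simp
    then have "mdist X x b \<le> mdist X x a + mdist X a b"
      using that(1) by (intro mdist_triangle_le) (auto simp: in_mball_of)
    then show ?thesis using that(1) mdist_ge_0[of X a b] unfolding h_def by (auto simp: in_mball_of)
  qed
  have w: "wasserstein_dist X (\<Gamma> 0) (\<Gamma> 1) \<le> D"
    by (rule wasserstein_dist_le(1)[OF pr[OF i(1)] pr[OF i(2)] D0 sp[OF i(1)] sp[OF i(2)] D])
  have wt: "wasserstein_dist X (\<Gamma> 0) (\<Gamma> t) = t * wasserstein_dist X (\<Gamma> 0) (\<Gamma> 1)"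
    using \<Gamma>[unfolded P2_geodesic_def, THEN conjunct2, rule_format, of 0 t] t by simp
  have nn: "0 \<le> wasserstein_dist X \<mu>1 \<mu>2" for \<mu>1 \<mu>2 by (simp add: wasserstein_dist_def)
  have "ennreal ((\<epsilon> / 2)\<^sup>2) * emeasure (\<Gamma> t) ?B' = (\<integral>\<^sup>+ z. ennreal ((\<epsilon> / 2)\<^sup>2) * indicator ?B' z \<partial>\<Gamma> t)"
    using Bm by (simp add: nn_integral_cmult_indicator)
  also have "\<dots> \<le> (\<integral>\<^sup>+ z. ennreal ((h z)\<^sup>2) \<partial>\<Gamma> t)"
  proof (rule nn_integral_mono)
    fix z
    show "ennreal ((\<epsilon> / 2)\<^sup>2) * indicator ?B' z \<le> ennreal ((h z)\<^sup>2)"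
      using \<epsilon> by (auto simp: indicator_def h_def intro!: ennreal_leI power_mono)
  qed
  also have "\<dots> \<le> wasserstein_sq X (\<Gamma> 0) (\<Gamma> t)"
    by (rule wasserstein_sq_ge(1)[OF \<Gamma>0 hm le]) (simp_all add: h_def)
  also have "\<dots> = ennreal ((wasserstein_dist X (\<Gamma> 0) (\<Gamma> t))\<^sup>2)"
    by (rule wasserstein_dist_le(2)[OF pr[OF i(1)] pr[OF t] D0 sp[OF i(1)] sp[OF t] D])
  also have "\<dots> \<le> ennreal ((t * D)\<^sup>2)"
    unfolding wt using w t nn by (intro ennreal_leI power_mono mult_left_mono mult_nonneg_nonneg) auto
  finally have *: "ennreal ((\<epsilon> / 2)\<^sup>2) * emeasure (\<Gamma> t) ?B' \<le> ennreal ((t * D)\<^sup>2)" .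
  interpret G: prob_space "\<Gamma> t" by (rule pr[OF t])
  from * have "(\<epsilon> / 2)\<^sup>2 * measure (\<Gamma> t) ?B' \<le> (t * D)\<^sup>2"
    by (simp add: G.emeasure_eq_measure flip: ennreal_mult)
  then have "measure (\<Gamma> t) ?B' \<le> 4 * t\<^sup>2 * D\<^sup>2 / \<epsilon>\<^sup>2"
    using \<epsilon> by (simp add: power_mult_distrib power_divide field_simps)
  then show ?thesis by (simp add: G.emeasure_eq_measure ennreal_leI)
qed

text \<open>The entropy inequality along a geodesic from the uniform measure of a small ball to the
  normalised \<open>m\<close>, at a small time \<open>t = u\<^sup>8\<close>: the mass that has left the ball of radius \<open>\<epsilon>\<close> is \<open>O(t\<^sup>2)\<close> by
  Chebyshev, too little to account for the entropy \<open>\<ge> c t\<close>. Chebyshev suffices because CD(K,N)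
  as defined includes the inequality for all \<open>N' \<ge> N\<close>, so that \<open>N' \<ge> 4\<close> may be used.\<close>

lemma CD_ball_lower_bound:
  assumes mms: "metric_measure_space X m" and CD: "CD (-1) N X m"
    and D: "\<And>x y. x \<in> mspace X \<Longrightarrow> y \<in> mspace X \<Longrightarrow> mdist X x y \<le> D" and \<epsilon>: "0 < \<epsilon>"
  shows "\<exists>\<kappa>>0. \<forall>x\<in>mspace X. ennreal \<kappa> \<le> emeasure m (mball_of X x \<epsilon>)"
proof -
  have fin: "finite_measure m" and pos: "0 < emeasure m (space m)" and D0: "0 \<le> D"
    by (rule bounded_mms_finite[OF mms D]; assumption)+
  interpret finite_measure m by (rule fin)
  define M where "M = measure m (space m)"
  have M: "0 < M" using pos unfolding M_def by (simp add: emeasure_eq_measure)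
  define N' where "N' = max N 4"
  have N': "N \<le> N'" "4 \<le> N'" by (simp_all add: N'_def)
  define a where "a = 1 / N'"
  have a: "0 < a" "a \<le> 1 / 4" using N'(2) by (simp_all add: a_def field_simps)
  obtain c where c: "0 < c" "\<And>t \<theta>. 0 < t \<Longrightarrow> t \<le> 1 \<Longrightarrow> 0 \<le> \<theta> \<Longrightarrow> \<theta> \<le> D \<Longrightarrow> ennreal (c * t) \<le> tau_coeff (-1) N' t \<theta>"
    using tau_coeff_ge[of N' D] N' D0 by force
  \<comment> \<open>A quarter of the entropy bound per unit of time, because that bound will be
    shared among four terms.\<close>
  define P where "P = c * M powr a / 4"
  have P: "0 < P" using c M by (simp add: P_def)
  define u where "u = min (1 / 2) (P / (4 * D\<^sup>2 / \<epsilon>\<^sup>2 + M + 1))"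
  have den: "0 < 4 * D\<^sup>2 / \<epsilon>\<^sup>2 + M + 1" using M by (intro add_nonneg_pos add_nonneg_nonneg) auto
  have u: "0 < u" unfolding u_def using P den by simp
  have "u \<le> 1 / 2" unfolding u_def by (rule min.cobounded1)
  with u have u: "0 < u" "u \<le> 1 / 2" by auto
  have "u \<le> P / (4 * D\<^sup>2 / \<epsilon>\<^sup>2 + M + 1)" unfolding u_def by (rule min.cobounded2)
  then have uP: "u * (4 * D\<^sup>2 / \<epsilon>\<^sup>2 + M + 1) \<le> P" using den by (simp add: pos_le_divide_eq)
  then have uP: "u * (4 * D\<^sup>2 / \<epsilon>\<^sup>2) \<le> P" "u * M \<le> P"
  proof -
    have "u * (4 * D\<^sup>2 / \<epsilon>\<^sup>2) + u * M + u \<le> P" using uP by (simp add: distrib_left)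
    moreover have "0 \<le> u * (4 * D\<^sup>2 / \<epsilon>\<^sup>2)" "0 \<le> u * M" using u M by auto
    ultimately show "u * (4 * D\<^sup>2 / \<epsilon>\<^sup>2) \<le> P" "u * M \<le> P" using u by linarith+
  qed
  define t where "t = u ^ 8"
  have t: "0 < t" "t \<le> 1" using u by (auto simp: t_def intro!: power_le_one)
  \<comment> \<open>With \<open>a \<le> 1 / 4\<close>, \<open>s' powr (- a)\<close> is at most
    \<open>1 / u ^ 3\<close>. The Chebyshev term is then of order \<open>u ^ 13 = t * u ^ 5\<close>
    and the volume term of order \<open>u ^ 9 = t * u\<close>, both small against
    \<open>t = u ^ 8\<close>.\<close>
  define s' where "s' = u ^ 12"
  have s': "0 < s'" using u by (simp add: s'_def)
  have e: "s' powr (- a) \<le> 1 / u ^ 3"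
  proof -
    have "s' powr (- a) = (u powr 12) powr (- a)" unfolding s'_def using u by (simp add: powr_numeral)
    also have "\<dots> = u powr (12 * (- a))" by (rule powr_powr)
    also have "\<dots> \<le> u powr (- 3)" using u a by (intro powr_mono') auto
    also have "\<dots> = 1 / u ^ 3" using u by (simp add: powr_minus_divide powr_numeral)
    finally show ?thesis .
  qed
  have e1: "s' powr (- a) * (4 * t\<^sup>2 * D\<^sup>2 / \<epsilon>\<^sup>2) \<le> t * P"
  proof -
    have "s' powr (- a) * (4 * t\<^sup>2 * D\<^sup>2 / \<epsilon>\<^sup>2) \<le> 1 / u ^ 3 * (4 * t\<^sup>2 * D\<^sup>2 / \<epsilon>\<^sup>2)"
      by (rule mult_right_mono[OF e]) simp
    also have "\<dots> = t * (u ^ 5 * (4 * D\<^sup>2 / \<epsilon>\<^sup>2))"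
    proof -
      have "t\<^sup>2 = u ^ 3 * (t * u ^ 5)" unfolding t_def by (simp flip: power_add power_mult)
      then show ?thesis using u by (simp only:) simp
    qed
    also have "\<dots> \<le> t * (u * (4 * D\<^sup>2 / \<epsilon>\<^sup>2))"
      using u t power_decreasing[of 1 5 u] by (intro mult_left_mono mult_right_mono) auto
    also have "\<dots> \<le> t * P" using uP t by (intro mult_left_mono) auto
    finally show ?thesis .
  qed
  have e2: "s' powr (- a) * (s' * M) \<le> t * P"
  proof -
    have "s' powr (- a) * (s' * M) \<le> 1 / u ^ 3 * (s' * M)"
      using s' M by (intro mult_right_mono[OF e]) simp
    also have "\<dots> = t * (u * M)"
    proof -
      have "s' = u ^ 3 * (t * u)" unfolding s'_def t_def by (simp flip: power_add power_Suc2)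
      then show ?thesis using u by simp
    qed
    also have "\<dots> \<le> t * P" using uP t by (intro mult_left_mono) auto
    finally show ?thesis .
  qed
  \<comment> \<open>Chosen so that \<open>s powr (- a) = t * P\<close>. Of the total
    \<open>4 * (t * P)\<close> the mass in the ball takes one part and the complement two. The
    remaining part forces \<open>s\<close> times the measure of the ball to be at least 1, whence
    \<open>\<kappa> = 1 / s\<close>.\<close>
  define s where "s = (t * P) powr (- 1 / a)"
  have tP: "0 < t * P" using t P by simp
  have s: "0 < s" using t P by (simp add: s_def)
  have es: "s powr (- a) = t * P" unfolding s_def using a t P by (simp add: powr_powr)
  define \<kappa> where "\<kappa> = 1 / s"
  have "ennreal \<kappa> \<le> emeasure m (mball_of X x \<epsilon>)" if x: "x \<in> mspace X" for x
  proof -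
    let ?B = "mball_of X x (\<epsilon> / 2)" and ?A = "mball_of X x \<epsilon>"
    let ?B' = "{z \<in> mspace X. \<epsilon> \<le> mdist X x z}"
    let ?\<mu>0 = "uniform_measure m ?B" and ?\<mu>1 = "uniform_measure m (space m)"
    have Bpos: "0 < emeasure m ?B" "emeasure m ?B < \<infinity>" using mms_ball_emeasure[OF mms x] \<epsilon> by auto
    have \<mu>0: "?\<mu>0 \<in> P2_ac X m"
      by (rule uniform_measure_P2_ac[OF mms D mball_sets_mms[OF mms] Bpos])
    have \<mu>1: "?\<mu>1 \<in> P2_ac X m"
      by (rule uniform_measure_P2_ac[OF mms D]) (use pos in \<open>auto simp: emeasure_eq_measure\<close>)
    obtain \<pi> \<Gamma> where \<pi>: "\<pi> \<in> optimal_couplings X ?\<mu>0 ?\<mu>1" and \<Gamma>: "P2_geodesic X m \<Gamma>" "\<Gamma> 0 = ?\<mu>0"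
      and ineq: "\<And>t N'. t \<in> {0..1} \<Longrightarrow> N \<le> N' \<Longrightarrow>
             (\<integral>\<^sup>+ z. tau_coeff (-1) N' (1 - t) (mdist X (fst z) (snd z))
                        * ennreal (dens m ?\<mu>0 (fst z) powr (- 1 / N'))
                    + tau_coeff (-1) N' t (mdist X (fst z) (snd z))
                        * ennreal (dens m ?\<mu>1 (snd z) powr (- 1 / N')) \<partial>\<pi>)
             \<le> renyi N' m (\<Gamma> t)"
      using CD[unfolded CD_def, rule_format, OF \<mu>0 \<mu>1] by blast
    have pc: "\<pi> \<in> couplings ?\<mu>0 ?\<mu>1" using \<pi> unfolding optimal_couplings_def by simp
    interpret \<pi>: prob_space \<pi> by (rule coupling_prob_space[OF pc P2_acD(1)[OF \<mu>0]])
    have tI: "t \<in> {0..1}" using t by simp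
    have AE0: "AE z in ?\<mu>0. z \<in> ?B" by (rule AE_uniform_measure_mem[OF mball_sets_mms[OF mms] Bpos])
    have AE1: "AE z in ?\<mu>1. z \<in> mspace X \<and> dens m ?\<mu>1 z = 1 / M"
    proof (rule absolutely_continuous_AE[OF _ P2_acD(3)[OF \<mu>1]])
      show "AE z in m. z \<in> mspace X \<and> dens m ?\<mu>1 z = 1 / M"
        using dens_uniform_measure_space[OF fin pos] AE_space[of m] unfolding M_def space_mms[OF mms]
        by eventually_elim simp
    qed simp
    have \<Gamma>t: "\<Gamma> t \<in> P2_ac X m"
      using \<Gamma>(1)[unfolded P2_geodesic_def, THEN conjunct1] tI by (rule bspec)
    have "ennreal (4 * (t * P)) = (\<integral>\<^sup>+ z. ennreal (4 * (t * P)) \<partial>\<pi>)" by (simp add: \<pi>.emeasure_space_1)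
    also have "\<dots> \<le> (\<integral>\<^sup>+ z. tau_coeff (-1) N' (1 - t) (mdist X (fst z) (snd z))
                        * ennreal (dens m ?\<mu>0 (fst z) powr (- 1 / N'))
                    + tau_coeff (-1) N' t (mdist X (fst z) (snd z))
                        * ennreal (dens m ?\<mu>1 (snd z) powr (- 1 / N')) \<partial>\<pi>)"
    proof (rule nn_integral_mono_AE)
      show "AE z in \<pi>. ennreal (4 * (t * P)) \<le> tau_coeff (-1) N' (1 - t) (mdist X (fst z) (snd z))
                        * ennreal (dens m ?\<mu>0 (fst z) powr (- 1 / N'))
                    + tau_coeff (-1) N' t (mdist X (fst z) (snd z))
                        * ennreal (dens m ?\<mu>1 (snd z) powr (- 1 / N'))"
        using AE_coupling(1)[OF pc AE0] AE_coupling(2)[OF pc AE1]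
      proof eventually_elim
        case (elim z)
        have "ennreal (c * t) \<le> tau_coeff (-1) N' t (mdist X (fst z) (snd z))"
        proof (rule c(2)[OF t mdist_ge_0])
          show "mdist X (fst z) (snd z) \<le> D" using elim by (intro D) (simp_all add: in_mball_of)
        qed
        then have "ennreal (c * t) * ennreal (M powr a) \<le> tau_coeff (-1) N' t (mdist X (fst z) (snd z))
                        * ennreal (M powr a)" by (rule mult_right_mono) simp
        moreover have "dens m ?\<mu>1 (snd z) powr (- 1 / N') = M powr a"
        proof -
          have "dens m ?\<mu>1 (snd z) = M powr (-1)" using M elim(2) by (simp add: powr_minus_divide)
          then show ?thesis by (simp only: powr_powr a_def) simp
        qed
        moreover have "ennreal (c * t) * ennreal (M powr a) = ennreal (4 * (t * P))"
        proof -
          have "c * t * (M powr a) = 4 * (t * P)" by (simp add: P_def)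
          then have "ennreal (c * t * (M powr a)) = ennreal (4 * (t * P))" by (rule arg_cong)
          moreover have "ennreal (c * t * (M powr a)) = ennreal (c * t) * ennreal (M powr a)"
            using c(1) t(1) by (intro ennreal_mult) auto
          ultimately show ?thesis by simp
        qed
        ultimately show ?case by (simp only: add_increasing zero_le)
      qed
    qed
    also have "\<dots> \<le> renyi N' m (\<Gamma> t)" by (rule ineq[OF tI N'(1)])
    also have "\<dots> \<le> ennreal (s powr (- 1 / N')) * (emeasure (\<Gamma> t) ?A + ennreal s * emeasure m ?A)
        + ennreal (s' powr (- 1 / N')) * (emeasure (\<Gamma> t) ?B' + ennreal s' * emeasure m ?B')"
    proof (rule renyi_le[OF fin _ mball_sets_mms[OF mms] _ _ s s'])
      show "\<Gamma> t \<in> P2_ac X m" by (rule \<Gamma>t)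
      show "{z \<in> mspace X. \<epsilon> \<le> mdist X x z} \<in> sets m"
        unfolding space_mms[OF mms, symmetric] using mdist_borel_mms[OF mms x] by measurable
      show "space m \<subseteq> ?A \<union> ?B'" using x by (auto simp: space_mms[OF mms] in_mball_of)
    qed (use N' in simp)
    also have "\<dots> \<le> ennreal (s powr (- a)) * (1 + ennreal s * ennreal (measure m ?A))
        + ennreal (s' powr (- a)) * (ennreal (4 * t\<^sup>2 * D\<^sup>2 / \<epsilon>\<^sup>2) + ennreal s' * ennreal M)"
    proof (intro add_mono mult_mono)
      interpret G: prob_space "\<Gamma> t"
        using P2_acD(1)[OF \<Gamma>t] .
      show "emeasure (\<Gamma> t) ?A \<le> 1" by (rule G.emeasure_le_1)
      show "emeasure (\<Gamma> t) ?B' \<le> ennreal (4 * t\<^sup>2 * D\<^sup>2 / \<epsilon>\<^sup>2)"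
        by (rule geodesic_tail[OF mms D x \<epsilon> \<Gamma>(1) AE0[folded \<Gamma>(2)] tI])
      show "emeasure m ?B' \<le> ennreal M" unfolding M_def emeasure_eq_measure[symmetric] by (rule emeasure_space)
    qed (simp_all add: a_def emeasure_eq_measure)
    also have "\<dots> = ennreal (s powr (- a) * (1 + s * measure m ?A)
        + s' powr (- a) * (4 * t\<^sup>2 * D\<^sup>2 / \<epsilon>\<^sup>2 + s' * M))"
    proof -
      have "0 \<le> 4 * t\<^sup>2 * D\<^sup>2 / \<epsilon>\<^sup>2" by simp
      then show ?thesis using s s' M
        by (simp add: ennreal_plus[symmetric] ennreal_mult[symmetric] ennreal_1[symmetric]
            del: ennreal_plus ennreal_1)
    qed
    finally have "ennreal (4 * (t * P)) \<le> \<dots>" .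
    then have "4 * (t * P) \<le> s powr (- a) * (1 + s * measure m ?A)
        + s' powr (- a) * (4 * t\<^sup>2 * D\<^sup>2 / \<epsilon>\<^sup>2 + s' * M)"
      using s s' M by (subst (asm) ennreal_le_iff) (auto intro!: add_nonneg_nonneg mult_nonneg_nonneg)
    also have "\<dots> \<le> t * P * (1 + s * measure m ?A) + 2 * (t * P)"
      unfolding es distrib_left using e1 e2 by linarith
    finally have "t * P \<le> t * P * (s * measure m ?A)" unfolding distrib_left by linarith
    then have "1 \<le> s * measure m ?A"
      using mult_le_cancel_left_pos[OF tP, of 1 "s * measure m ?A"] by simp
    then have "\<kappa> \<le> measure m ?A" unfolding \<kappa>_def using s by (simp add: field_simps)
    then show ?thesis by (simp add: emeasure_eq_measure ennreal_leI)
  qed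
  moreover have "0 < \<kappa>" using s by (simp add: \<kappa>_def)
  ultimately show ?thesis by blast
qed

section \<open>Compactness and Lipschitz paths\<close>

text \<open>Packing: balls of radius \<open>\<epsilon> / 2\<close> about an \<epsilon>-separated set
  are disjoint and each has mass at least \<kappa>, so the cardinality of separated sets is bounded.
  One of largest cardinality is an \<epsilon>-net.\<close>

lemma finite_mms_totally_bounded:
  assumes mms: "metric_measure_space X m" and fin: "finite_measure m"
    and lb: "\<And>\<epsilon>. 0 < \<epsilon> \<Longrightarrow> \<exists>\<kappa>>0. \<forall>x\<in>mspace X. ennreal \<kappa> \<le> emeasure m (mball_of X x \<epsilon>)"
  shows "Metric_space.mtotally_bounded (mspace X) (mdist X) (mspace X)"
  unfolding Metric_space.mtotally_bounded_def[OF Metric_space_mspace_mdist]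
proof (intro allI impI)
  interpret finite_measure m by fact
  fix \<epsilon> :: real assume \<epsilon>: "0 < \<epsilon>"
  then obtain \<kappa> where \<kappa>: "\<kappa> > 0" "\<And>x. x \<in> mspace X \<Longrightarrow> ennreal \<kappa> \<le> emeasure m (mball_of X x (\<epsilon> / 2))"
    using lb[of "\<epsilon> / 2"] by auto
  define sep where "sep S \<longleftrightarrow> finite S \<and> S \<subseteq> mspace X \<and> (\<forall>x\<in>S. \<forall>y\<in>S. x \<noteq> y \<longrightarrow> \<epsilon> \<le> mdist X x y)" for S
  obtain n :: nat where n: "measure m (space m) / \<kappa> < real n" using reals_Archimedean2 by blast
  have bound: "card S \<le> n" if "sep S" for S
  proof -
    let ?b = "\<lambda>x. mball_of X x (\<epsilon> / 2)"
    have S: "finite S" "S \<subseteq> mspace X" using that by (auto simp: sep_def)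
    have "disjoint_family_on ?b S"
      unfolding disjoint_family_on_def
    proof (intro ballI impI)
      fix x y assume xy: "x \<in> S" "y \<in> S" "x \<noteq> y"
      then have far: "\<epsilon> \<le> mdist X x y" using that by (auto simp: sep_def)
      have False if z: "z \<in> ?b x" "z \<in> ?b y" for z
        using mdist_triangle_le[of x X z y] z far by (auto simp: in_mball_of mdist_sym[of X z y])
      then show "?b x \<inter> ?b y = {}" by blast
    qed
    then have "(\<Sum>x\<in>S. measure m (?b x)) = measure m (\<Union>x\<in>S. ?b x)"
      using S mball_sets_mms[OF mms] by (intro finite_measure_finite_Union[symmetric]) auto
    also have "\<dots> \<le> measure m (space m)" by (rule bounded_measure)
    finally have "(\<Sum>x\<in>S. measure m (?b x)) \<le> measure m (space m)" .
    moreover have "(\<Sum>x\<in>S. \<kappa>) \<le> (\<Sum>x\<in>S. measure m (?b x))"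
      using \<kappa> S by (intro sum_mono) (auto simp: emeasure_eq_measure subset_iff)
    ultimately have "real (card S) * \<kappa> \<le> measure m (space m)" by simp
    then have "real (card S) \<le> measure m (space m) / \<kappa>" using \<kappa>(1) by (simp add: pos_le_divide_eq)
    then show ?thesis using n by linarith
  qed
  have "sep {}" by (simp add: sep_def)
  moreover have "\<forall>S. sep S \<longrightarrow> card S < Suc n" using bound by (simp add: less_Suc_eq_le)
  ultimately have "\<exists>S. sep S \<and> (\<forall>S'. sep S' \<longrightarrow> card S' \<le> card S)"
    using ex_has_greatest_nat[of sep "{}" card "Suc n"] by simp
  then obtain S where S: "sep S" "\<And>S'. sep S' \<Longrightarrow> card S' \<le> card S" by (elim exE conjE) simp
  have "mspace X \<subseteq> (\<Union>x\<in>S. mball_of X x \<epsilon>)"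
  proof
    fix y assume y: "y \<in> mspace X"
    show "y \<in> (\<Union>x\<in>S. mball_of X x \<epsilon>)"
    proof (rule ccontr)
      assume "\<not> ?thesis"
      have far: "\<epsilon> \<le> mdist X x y" if "x \<in> S" for x
      proof (rule ccontr)
        assume "\<not> \<epsilon> \<le> mdist X x y"
        moreover have "x \<in> mspace X" using that S(1) by (auto simp: sep_def)
        ultimately have "y \<in> mball_of X x \<epsilon>" using y by (simp add: in_mball_of)
        with that \<open>y \<notin> (\<Union>x\<in>S. mball_of X x \<epsilon>)\<close> show False by (elim notE) (rule UN_I)
      qed
      have "y \<notin> S"
      proof
        assume "y \<in> S"
        from far[OF this] show False using mdist_self[OF y] \<epsilon> by simp
      qed
      have "sep (insert y S)"
        unfolding sep_def
      proof (intro conjI ballI impI)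
        fix a b assume ab: "a \<in> insert y S" "b \<in> insert y S" "a \<noteq> b"
        then consider "a \<in> S" "b \<in> S" | "a \<in> S" "b = y" | "a = y" "b \<in> S" by auto
        then show "\<epsilon> \<le> mdist X a b"
        proof cases
          case 1
          then show ?thesis using S(1) ab(3) by (simp add: sep_def)
        next
          case 2
          then show ?thesis using far by simp
        next
          case 3
          then show ?thesis using far[of b] mdist_sym[of X b y] by simp
        qed
      qed (use S(1) y in \<open>simp_all add: sep_def\<close>)
      from S(2)[OF this] show False using \<open>y \<notin> S\<close> S(1) by (simp add: sep_def)
    qed
  qed
  then show "\<exists>K. finite K \<and> K \<subseteq> mspace X \<and> mspace X \<subseteq> (\<Union>x\<in>K. Metric_space.mball (mspace X) (mdist X) x \<epsilon>)"
    using S(1) unfolding sep_def mball_of_def by (intro exI[of _ S]) simp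
qed

theorem CD_compact:
  assumes mms: "metric_measure_space X m" and CD: "CD (-1) N X m"
    and D: "\<And>x y. x \<in> mspace X \<Longrightarrow> y \<in> mspace X \<Longrightarrow> mdist X x y \<le> D"
  shows "compact_space (mtopology_of X)"
proof -
  have "mcomplete_of X" using mms by (simp add: metric_measure_space_def)
  moreover have "Metric_space.mtotally_bounded (mspace X) (mdist X) (mspace X)"
    by (rule finite_mms_totally_bounded[OF mms bounded_mms_finite(1)[OF mms D] CD_ball_lower_bound[OF mms CD D]])
  ultimately show ?thesis
    unfolding mtopology_of_def mcomplete_of_def
    by (simp add: Metric_space.compact_space_eq_mcomplete_mtotally_bounded[OF Metric_space_mspace_mdist])
qed

definition approx_midpoints :: "'a metric \<Rightarrow> bool" where
  "approx_midpoints X \<longleftrightarrow> (\<forall>x\<in>mspace X. \<forall>y\<in>mspace X. \<forall>L. mdist X x y < L \<longrightarrow>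
     (\<exists>z\<in>mspace X. mdist X x z < L / 2 \<and> mdist X z y < L / 2))"

text \<open>The strict inequalities in \<open>approx_midpoints\<close> absorb the error of
  approximate midpoints: each bisection halves \<open>L\<close> exactly, and nothing
  accumulates.\<close>

lemma dyadic_chain:
  assumes mid: "approx_midpoints X"
  shows "x \<in> mspace X \<Longrightarrow> y \<in> mspace X \<Longrightarrow> mdist X x y < L \<Longrightarrow>
    \<exists>c. c 0 = x \<and> c (2 ^ k) = y \<and> range c \<subseteq> mspace X \<and> (\<forall>j<2 ^ k. mdist X (c j) (c (Suc j)) < L / 2 ^ k)"
proof (induction k arbitrary: x y L)
  case 0
  then show ?case by (intro exI[of _ "\<lambda>j. if j = 0 then x else y"]) auto
next
  case (Suc k)
  obtain z where z: "z \<in> mspace X" "mdist X x z < L / 2" "mdist X z y < L / 2"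
    using mid Suc.prems unfolding approx_midpoints_def by blast
  obtain c1 where c1: "c1 0 = x" "c1 (2 ^ k) = z" "range c1 \<subseteq> mspace X"
    "\<And>j. j < 2 ^ k \<Longrightarrow> mdist X (c1 j) (c1 (Suc j)) < L / 2 / 2 ^ k"
    using Suc.IH[OF Suc.prems(1) z(1,2)] by auto
  obtain c2 where c2: "c2 0 = z" "c2 (2 ^ k) = y" "range c2 \<subseteq> mspace X"
    "\<And>j. j < 2 ^ k \<Longrightarrow> mdist X (c2 j) (c2 (Suc j)) < L / 2 / 2 ^ k"
    using Suc.IH[OF z(1) Suc.prems(2) z(3)] by auto
  define c where "c j = (if j \<le> 2 ^ k then c1 j else c2 (j - 2 ^ k))" for j
  have "mdist X (c j) (c (Suc j)) < L / 2 ^ Suc k" if j: "j < 2 ^ Suc k" for j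
  proof (cases "j < 2 ^ k")
    case True
    then show ?thesis using c1(4)[of j] by (simp add: c_def)
  next
    case False
    define i where "i = j - 2 ^ k"
    have i: "i < 2 ^ k" "j = 2 ^ k + i" using False j unfolding i_def by auto
    have "c j = c2 i" "c (Suc j) = c2 (Suc i)" using i c1(2) c2(1) by (cases "i = 0"; simp add: c_def)+
    then show ?thesis using c2(4)[OF i(1)] by simp
  qed
  moreover have "c 0 = x" "c (2 ^ Suc k) = y" "range c \<subseteq> mspace X"
    using c1 c2 by (auto simp: c_def)
  ultimately show ?case by blast
qed

lemma chain_mdist:
  assumes c: "range c \<subseteq> mspace X" and step: "\<And>j. j < n \<Longrightarrow> mdist X (c j) (c (Suc j)) \<le> r"
    and ij: "i \<le> j" "j \<le> n"
  shows "mdist X (c i) (c j) \<le> real (j - i) * r"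
  using ij
proof (induction j)
  case 0
  have "c 0 \<in> mspace X" using c by auto
  then show ?case using 0 by (simp add: mdist_self)
next
  case (Suc j)
  show ?case
  proof (cases "i = Suc j")
    case True
    have "c i \<in> mspace X" using c by auto
    then show ?thesis using True by (simp add: mdist_self)
  next
    case False
    then have "mdist X (c i) (c (Suc j)) \<le> mdist X (c i) (c j) + mdist X (c j) (c (Suc j))"
      using c by (intro mdist_triangle_le) auto
    also have "\<dots> \<le> real (j - i) * r + r" using Suc False step[of j] by (intro add_mono) auto
    also have "\<dots> = real (Suc j - i) * r" using Suc False by (simp add: Suc_diff_le algebra_simps)
    finally show ?thesis .
  qed
qed

text \<open>By Tychonoff, the coarsely \<open>L\<close>-Lipschitz maps obtained from dyadic chains have a limit point.\<close>

lemma lipschitz_path: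
  assumes comp: "compact_space (mtopology_of X)" and mid: "approx_midpoints X"
    and x: "x \<in> mspace X" and y: "y \<in> mspace X" and L: "mdist X x y < L"
  shows "\<exists>g. g 0 = x \<and> g 1 = y \<and> g ` {0..1} \<subseteq> mspace X \<and>
    (\<forall>s\<in>{0..1}. \<forall>t\<in>{0..1}. mdist X (g s) (g t) \<le> L * \<bar>s - t\<bar>)"
proof -
  define P where "P = product_topology (\<lambda>_::real. mtopology_of X) {0..1}"
  have L0: "0 < L" using L mdist_ge_0[of X x y] by linarith
  have compP: "compact_space P" unfolding P_def using comp by (simp add: compact_space_product_topology)
  have topP: "topspace P = ({0..1} \<rightarrow>\<^sub>E mspace X)" by (simp add: P_def)
  have proj: "continuous_map P (mtopology_of X) (\<lambda>g. g s)" if "s \<in> {0..1}" for s :: real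
    unfolding P_def using that by (rule continuous_map_product_projection)
  have cl: "closedin P {g \<in> topspace P. mdist X (a g) (b g) \<le> r}"
    if "continuous_map P (mtopology_of X) a" "continuous_map P (mtopology_of X) b" for a b r
  proof -
    have "continuous_map P euclideanreal (\<lambda>g. mdist X (a g) (b g))" using that by (rule continuous_map_mdist)
    from closedin_continuous_map_preimage[OF this, of "{..r}"] show ?thesis by simp
  qed
  have cst: "continuous_map P (mtopology_of X) (\<lambda>_. z)" if "z \<in> mspace X" for z using that by simp
  \<comment> \<open>Closed, decreasing sets whose intersection consists of the Lipschitz maps with
    the right endpoints. The endpoint conditions are phrased as distances so that \<open>cl\<close>
    covers them too.\<close>
  define C where "C n = {g \<in> topspace P. mdist X (g 0) x \<le> 0} \<inter> {g \<in> topspace P. mdist X (g 1) y \<le> 0} \<inter>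
    (\<Inter>s\<in>{0..1}. \<Inter>t\<in>{0..1}. {g \<in> topspace P. mdist X (g s) (g t) \<le> L * \<bar>s - t\<bar> + L / 2 ^ n})" for n :: nat
  have inC: "g \<in> C n \<longleftrightarrow> g \<in> topspace P \<and> mdist X (g 0) x \<le> 0 \<and> mdist X (g 1) y \<le> 0 \<and>
    (\<forall>s\<in>{0..1}. \<forall>t\<in>{0..1}. mdist X (g s) (g t) \<le> L * \<bar>s - t\<bar> + L / 2 ^ n)" for g n
  proof -
    have "(0::real) \<in> {0..1}" by simp
    then show ?thesis unfolding C_def Int_iff INT_iff mem_Collect_eq by blast
  qed
  have "(\<Inter>n. C n) \<noteq> {}"
  proof (rule compact_space_imp_nest[OF compP])
    show "closedin P (C n)" for n
      unfolding C_def by (intro closedin_Int closedin_INT cl proj cst x y) auto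
    show "C n \<noteq> {}" for n
    proof -
      obtain c where c: "c 0 = x" "c (2 ^ n) = y" "range c \<subseteq> mspace X"
        "\<And>j. j < 2 ^ n \<Longrightarrow> mdist X (c j) (c (Suc j)) < L / 2 ^ n"
        using dyadic_chain[OF mid x y L, of n] by blast
      \<comment> \<open>A step function along the chain; rounding the parameter costs at most one
        extra step, which is the additive error in \<open>C n\<close>.\<close>
      define g where "g = (\<lambda>s\<in>{0..1::real}. c (nat \<lfloor>s * 2 ^ n\<rfloor>))"
      have main: "mdist X (g s) (g t) \<le> L * (t - s) + L / 2 ^ n" if "0 \<le> s" "s \<le> t" "t \<le> 1" for s t
      proof -
        let ?i = "nat \<lfloor>s * 2 ^ n\<rfloor>" and ?j = "nat \<lfloor>t * 2 ^ n\<rfloor>"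
        have st: "s * 2 ^ n \<le> t * 2 ^ n" "t * 2 ^ n \<le> 2 ^ n" using that by auto
        have "t * 2 ^ n \<le> real_of_int (2 ^ n)" using st by simp
        then have "\<lfloor>t * 2 ^ n\<rfloor> \<le> 2 ^ n" by linarith
        then have "int ?j \<le> int (2 ^ n)" using that by simp
        then have j: "?j \<le> 2 ^ n" by linarith
        have ij: "?i \<le> ?j" using st by (intro nat_mono floor_mono)
        have "mdist X (c ?i) (c ?j) \<le> real (?j - ?i) * (L / 2 ^ n)"
          using c(4) by (intro chain_mdist[OF c(3) _ ij j]) (simp add: less_imp_le)
        also have "real (?j - ?i) \<le> t * 2 ^ n - s * 2 ^ n + 1"
        proof -
          have "0 \<le> s * 2 ^ n" "0 \<le> t * 2 ^ n" using that by simp_all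
          then have "real ?j \<le> t * 2 ^ n" "s * 2 ^ n < real ?i + 1" by linarith+
          then show ?thesis using ij by (simp only: of_nat_diff)
        qed
        finally have "mdist X (c ?i) (c ?j) \<le> (t * 2 ^ n - s * 2 ^ n + 1) * (L / 2 ^ n)"
          using L0 by (simp add: mult_right_mono divide_right_mono)
        also have "\<dots> = L * (t - s) + L / 2 ^ n" by (simp add: field_simps)
        finally show ?thesis using that by (simp add: g_def)
      qed
      have "g \<in> topspace P" using c(3) by (auto simp: topP g_def)
      moreover have "g 0 = x" "g 1 = y" using c(1,2) by (simp_all add: g_def nat_power_eq)
      moreover have "mdist X (g s) (g t) \<le> L * \<bar>s - t\<bar> + L / 2 ^ n" if "s \<in> {0..1}" "t \<in> {0..1}" for s t
      proof (cases "s \<le> t")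
        case True
        then show ?thesis using main[of s t] that by simp
      next
        case False
        then show ?thesis using main[of t s] that mdist_sym[of X "g s"] by simp
      qed
      ultimately have "g \<in> C n"
        unfolding inC using mdist_self[OF x] mdist_self[OF y] by (intro conjI ballI) simp_all
      then show ?thesis by (intro notI) simp
    qed
    show "decseq C"
    proof (rule decseq_SucI)
      fix k
      have le: "L / 2 ^ Suc k \<le> L / 2 ^ k" using L0 by (intro divide_left_mono) auto
      show "C (Suc k) \<subseteq> C k"
      proof
        fix g assume g: "g \<in> C (Suc k)"
        have "mdist X (g s) (g t) \<le> L * \<bar>s - t\<bar> + L / 2 ^ k" if "s \<in> {0..1}" "t \<in> {0..1}" for s t
        proof -
          have "mdist X (g s) (g t) \<le> L * \<bar>s - t\<bar> + L / 2 ^ Suc k" using g that unfolding inC by simp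
          then show ?thesis using le by linarith
        qed
        then show "g \<in> C k" using g unfolding inC by simp
      qed
    qed
  qed
  then obtain g where "g \<in> (\<Inter>n. C n)" by (meson all_not_in_conv)
  then have g: "g \<in> C n" for n by simp
  have gP: "g \<in> topspace P" using g[of 0] unfolding inC by simp
  then have gX: "g s \<in> mspace X" if "s \<in> {0..1}" for s
    using that unfolding topP by (rule PiE_mem)
  have "mdist X (g 0) x = 0" "mdist X (g 1) y = 0"
    using g[of 0] mdist_ge_0[of X "g 0" x] mdist_ge_0[of X "g 1" y] unfolding inC by simp_all
  then have ends: "g 0 = x" "g 1 = y"
    using Metric_space.zero[OF Metric_space_mspace_mdist gX x, of 0]
      Metric_space.zero[OF Metric_space_mspace_mdist gX y, of 1] by simp_all
  have lip: "mdist X (g s) (g t) \<le> L * \<bar>s - t\<bar>" if st: "s \<in> {0..1}" "t \<in> {0..1}" for s t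
  proof (rule LIMSEQ_le_const)
    have "(\<lambda>n. L * \<bar>s - t\<bar> + L * (1 / 2) ^ n) \<longlonglongrightarrow> L * \<bar>s - t\<bar> + L * 0"
      by (intro tendsto_intros LIMSEQ_power_zero) auto
    then show "(\<lambda>n. L * \<bar>s - t\<bar> + L / 2 ^ n) \<longlonglongrightarrow> L * \<bar>s - t\<bar>" by (simp add: power_divide)
    have "mdist X (g s) (g t) \<le> L * \<bar>s - t\<bar> + L / 2 ^ n" for n
      using g[of n] st unfolding inC by simp
    then show "\<exists>n0. \<forall>n\<ge>n0. mdist X (g s) (g t) \<le> L * \<bar>s - t\<bar> + L / 2 ^ n" by simp
  qed
  have "g ` {0..1} \<subseteq> mspace X" using gX by (intro image_subsetI)
  then show ?thesis using ends lip by (intro exI[of _ g] conjI ballI)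
qed

lemma pathin_lipschitz:
  assumes "g ` {0..1} \<subseteq> mspace X"
    and "\<And>s t. s \<in> {0..1} \<Longrightarrow> t \<in> {0..1} \<Longrightarrow> mdist X (g s) (g t) \<le> L * \<bar>s - t\<bar>"
  shows "pathin (mtopology_of X) g"
proof -
  have "Lipschitz_continuous_map (submetric euclidean_metric {0..1}) X g"
    unfolding Lipschitz_continuous_map_def
  proof (intro conjI exI[of _ L] ballI)
    show "g \<in> mspace (submetric euclidean_metric {0..1}) \<rightarrow> mspace X" using assms(1) by auto
    show "mdist X (g s) (g t) \<le> L * mdist (submetric euclidean_metric {0..1}) s t"
      if "s \<in> mspace (submetric euclidean_metric {0..1})" "t \<in> mspace (submetric euclidean_metric {0..1})" for s t
      using assms(2)[of s t] that by (simp add: dist_real_def)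
  qed
  from Lipschitz_continuous_imp_continuous_map[OF this] show ?thesis
    by (simp add: pathin_def mtopology_of_submetric)
qed

lemma curve_length_le_lipschitz:
  assumes lip: "\<And>s t. s \<in> {0..1} \<Longrightarrow> t \<in> {0..1} \<Longrightarrow> mdist X (c s) (c t) \<le> L * \<bar>s - t\<bar>" and L: "0 \<le> L"
  shows "curve_length X c \<le> ennreal L"
  unfolding curve_length_def
proof (intro SUP_least, clarify)
  fix n :: nat and t :: "nat \<Rightarrow> real" assume t: "mono_on {..n} t" "t ` {..n} \<subseteq> {0..1}"
  have tI: "t j \<in> {0..1}" if "j \<le> n" for j using t(2) that by auto
  have "(\<Sum>j<n. ennreal (mdist X (c (t j)) (c (t (Suc j))))) \<le> (\<Sum>j<n. ennreal (L * (t (Suc j) - t j)))"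
  proof (intro sum_mono ennreal_leI)
    fix j assume j: "j \<in> {..<n}"
    have "t j \<le> t (Suc j)" using t(1) j by (auto simp: mono_on_def)
    then show "mdist X (c (t j)) (c (t (Suc j))) \<le> L * (t (Suc j) - t j)"
      using lip[of "t j" "t (Suc j)"] tI j by simp
  qed
  also have "\<dots> = ennreal (\<Sum>j<n. L * (t (Suc j) - t j))"
    using t(1) L by (intro sum_ennreal) (auto simp: mono_on_def intro!: mult_nonneg_nonneg)
  also have "(\<Sum>j<n. L * (t (Suc j) - t j)) = L * (t n - t 0)"
    by (simp add: sum_lessThan_telescope flip: sum_distrib_left)
  also have "\<dots> \<le> L * 1" using tI[of n] tI[of 0] L by (intro mult_left_mono) auto
  finally show "(\<Sum>j<n. ennreal (mdist X (c (t j)) (c (t (Suc j))))) \<le> ennreal L"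
    by (simp add: ennreal_leI)
qed

section \<open>Coverings with the lifted metric\<close>

lemma curve_length_cong:
  "(\<And>t. t \<in> {0..1} \<Longrightarrow> c t = c' t) \<Longrightarrow> curve_length X c = curve_length X c'"
  unfolding curve_length_def by (intro SUP_cong refl) (auto intro!: sum.cong simp: image_subset_iff)

lemma curve_length_ge_sum:
  assumes "mono_on {..n} t" "t ` {..n} \<subseteq> {0..1}"
  shows "(\<Sum>j<n. ennreal (mdist X (c (t j)) (c (t (Suc j))))) \<le> curve_length X c"
  unfolding curve_length_def by (rule SUP_upper2[of "(n, t)"]) (use assms in auto)

lemma curve_length_ge_mdist:
  assumes "s \<in> {0..1}" "t \<in> {0..1}" "s \<le> t"
  shows "ennreal (mdist X (c s) (c t)) \<le> curve_length X c"
proof -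
  let ?t = "\<lambda>j::nat. if j = 0 then s else t"
  have "mono_on {..1} ?t" "?t ` {..1} \<subseteq> {0..1}" using assms by (auto simp: mono_on_def)
  from curve_length_ge_sum[OF this, of X c] show ?thesis by simp
qed

text \<open>Partitions for the two pieces are rescaled and concatenated into a partition for the
  whole curve, then both suprema are taken.\<close>

lemma curve_length_split:
  assumes a: "0 \<le> a" "a \<le> 1"
  shows "curve_length X (\<lambda>s. c (a * s)) + curve_length X (\<lambda>s. c (a + (1 - a) * s)) \<le> curve_length X c"
proof -
  let ?I = "{(n :: nat, t :: nat \<Rightarrow> real). mono_on {..n} t \<and> t ` {..n} \<subseteq> {0..1}}"
  let ?f = "\<lambda>c (n, t). \<Sum>j<n. ennreal (mdist X (c (t j)) (c (t (Suc j))))"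
  have ne: "?I \<noteq> {}" by (auto simp: mono_on_def intro!: exI[of _ 0] exI[of _ "\<lambda>_. 0"])
  have main: "?f (\<lambda>s. c (a * s)) z1 + ?f (\<lambda>s. c (a + (1 - a) * s)) z2 \<le> curve_length X c"
    if z: "z1 \<in> ?I" "z2 \<in> ?I" for z1 z2
  proof -
    obtain n1 t1 n2 t2 where z12: "z1 = (n1, t1)" "z2 = (n2, t2)" by (metis surj_pair)
    have t1: "mono_on {..n1} t1" "\<And>j. j \<le> n1 \<Longrightarrow> 0 \<le> t1 j \<and> t1 j \<le> 1"
      and t2: "mono_on {..n2} t2" "\<And>j. j \<le> n2 \<Longrightarrow> 0 \<le> t2 j \<and> t2 j \<le> 1"
      using z unfolding z12 by (auto simp: image_subset_iff)
    \<comment> \<open>The last point of the first partition and the first point of the second are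
      kept as consecutive entries; the edge between them is nonnegative and is dropped
      below.\<close>
    define t where "t j = (if j \<le> n1 then a * t1 j else a + (1 - a) * t2 (j - Suc n1))" for j
    let ?n = "Suc n1 + n2"
    let ?d = "\<lambda>j. ennreal (mdist X (c (t j)) (c (t (Suc j))))"
    have "mono_on {..?n} t"
    proof (rule mono_onI)
      fix i j assume ij: "i \<in> {..?n}" "j \<in> {..?n}" "i \<le> j"
      consider "j \<le> n1" | "i \<le> n1" "n1 < j" | "n1 < i" using ij(3) by linarith
      then show "t i \<le> t j"
      proof cases
        case 1
        then show ?thesis using mono_onD[OF t1(1), of i j] ij a by (simp add: t_def mult_left_mono)
      next
        case 2
        have "a * t1 i \<le> a * 1" using t1(2)[OF 2(1)] a by (intro mult_left_mono) auto
        moreover have "0 \<le> (1 - a) * t2 (j - Suc n1)" using t2(2)[of "j - Suc n1"] ij 2 a by simp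
        ultimately show ?thesis using 2 by (simp add: t_def)
      next
        case 3
        then show ?thesis using mono_onD[OF t2(1), of "i - Suc n1" "j - Suc n1"] ij a
          by (simp add: t_def mult_left_mono)
      qed
    qed
    moreover have "t ` {..?n} \<subseteq> {0..1}"
    proof (rule image_subsetI)
      fix j assume j: "j \<in> {..?n}"
      show "t j \<in> {0..1}"
      proof (cases "j \<le> n1")
        case True
        then show ?thesis using t1(2)[OF True] a mult_mono[of a 1 "t1 j" 1] by (simp add: t_def)
      next
        case False
        then have b: "0 \<le> t2 (j - Suc n1)" "t2 (j - Suc n1) \<le> 1" using t2(2)[of "j - Suc n1"] j by auto
        then have "(1 - a) * t2 (j - Suc n1) \<le> (1 - a) * 1" using a by (intro mult_left_mono) auto
        then show ?thesis using False a b by (simp add: t_def)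
      qed
    qed
    ultimately have "(\<Sum>j<?n. ?d j) \<le> curve_length X c" by (rule curve_length_ge_sum)
    moreover have "(\<Sum>j<n1. ?d j) + (\<Sum>j<n2. ?d (j + Suc n1)) \<le> (\<Sum>j<?n. ?d j)"
    proof -
      have "(\<Sum>j<?n. ?d j) = (\<Sum>j<Suc n1. ?d j) + (\<Sum>j<n2. ?d (j + Suc n1))"
        by (induction n2) (simp_all add: add.commute add.left_commute)
      then show ?thesis by (simp add: add_right_mono)
    qed
    moreover have "?f (\<lambda>s. c (a * s)) z1 = (\<Sum>j<n1. ?d j)"
      unfolding z12 by (simp add: t_def)
    moreover have "?f (\<lambda>s. c (a + (1 - a) * s)) z2 = (\<Sum>j<n2. ?d (j + Suc n1))"
      unfolding z12 by (simp add: t_def)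
    ultimately show ?thesis by (simp only: order_trans)
  qed
  have "curve_length X (\<lambda>s. c (a * s)) + curve_length X (\<lambda>s. c (a + (1 - a) * s))
      = (SUP z1\<in>?I. ?f (\<lambda>s. c (a * s)) z1 + curve_length X (\<lambda>s. c (a + (1 - a) * s)))"
    unfolding curve_length_def[of X "\<lambda>s. c (a * s)"] by (rule ennreal_SUP_add_left[OF ne, symmetric])
  also have "\<dots> \<le> curve_length X c"
  proof (rule SUP_least)
    fix z1 assume z1: "z1 \<in> ?I"
    have "?f (\<lambda>s. c (a * s)) z1 + curve_length X (\<lambda>s. c (a + (1 - a) * s))
        = (SUP z2\<in>?I. ?f (\<lambda>s. c (a * s)) z1 + ?f (\<lambda>s. c (a + (1 - a) * s)) z2)"
      unfolding curve_length_def[of X "\<lambda>s. c (a + (1 - a) * s)"] by (rule ennreal_SUP_add_right[OF ne])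
    also have "\<dots> \<le> curve_length X c" using main[OF z1] by (rule SUP_least)
    finally show "?f (\<lambda>s. c (a * s)) z1 + curve_length X (\<lambda>s. c (a + (1 - a) * s)) \<le> curve_length X c" .
  qed
  finally show ?thesis .
qed

lemma pathin_affine:
  assumes c: "pathin T c" and ab: "0 \<le> a" "0 \<le> b" "a + b \<le> (1::real)"
  shows "pathin T (\<lambda>s. c (a + b * s))"
proof -
  have "continuous_map (top_of_set {0..1}) (top_of_set {0..1}) (\<lambda>s. a + b * s)"
  proof -
    have "0 \<le> a + b * s \<and> a + b * s \<le> 1" if "s \<in> {0..1}" for s
      using that ab mult_left_mono[of s 1 b] by auto
    then show ?thesis by (auto simp: continuous_map_in_subtopology intro!: continuous_intros)
  qed
  from continuous_map_compose[OF this c[unfolded pathin_def]] show ?thesis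
    unfolding pathin_def o_def .
qed

locale length_covering =
  fixes X :: "'a metric" and Xh :: "'b metric" and q :: "'b \<Rightarrow> 'a"
  assumes compact: "compact_space (mtopology_of X)"
    and mid: "approx_midpoints X"
    and cov: "normal_covering (mtopology_of Xh) (mtopology_of X) q"
    and lift: "lifted_metric Xh X q"
begin

lemma q_continuous: "continuous_map (mtopology_of Xh) (mtopology_of X) q"
  using cov unfolding normal_covering_def covering_map_def by simp

lemma q_mspace: "y \<in> mspace Xh \<Longrightarrow> q y \<in> mspace X"
  using q_continuous unfolding continuous_map_def by (simp add: Pi_iff)

lemma q_surj:
  assumes "x \<in> mspace X" shows "\<exists>y\<in>mspace Xh. q y = x"
proof -
  have "q ` mspace Xh = mspace X" using cov unfolding normal_covering_def covering_map_def by simp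
  then have "x \<in> q ` mspace Xh" using assms by simp
  then show ?thesis by (elim imageE) (intro bexI, simp_all)
qed

lemma pathin_mspace: "pathin (mtopology_of Z) c \<Longrightarrow> t \<in> {0..1} \<Longrightarrow> c t \<in> mspace Z"
  unfolding pathin_def continuous_map_def by (auto simp: Pi_iff)

lemma mdist_le_curve_length:
  assumes c: "pathin (mtopology_of Xh) c"
  shows "ennreal (mdist Xh (c 0) (c 1)) \<le> curve_length X (q \<circ> c)"
proof -
  have "c 0 \<in> mspace Xh" "c 1 \<in> mspace Xh" by (rule pathin_mspace[OF c]; simp)+
  then have "ennreal (mdist Xh (c 0) (c 1)) =
      (INF c'\<in>{c'. pathin (mtopology_of Xh) c' \<and> c' 0 = c 0 \<and> c' 1 = c 1}. curve_length X (q \<circ> c'))"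
    using lift unfolding lifted_metric_def by simp
  also have "\<dots> \<le> curve_length X (q \<circ> c)" by (rule INF_lower) (use c in simp)
  finally show ?thesis .
qed

lemma short_path:
  assumes y: "y \<in> mspace Xh" and z: "z \<in> mspace Xh" and L: "mdist Xh y z < L"
  obtains c where "pathin (mtopology_of Xh) c" "c 0 = y" "c 1 = z" "curve_length X (q \<circ> c) < ennreal L"
proof -
  have "(INF c\<in>{c. pathin (mtopology_of Xh) c \<and> c 0 = y \<and> c 1 = z}. curve_length X (q \<circ> c)) = ennreal (mdist Xh y z)"
    using lift y z unfolding lifted_metric_def by simp
  also have "\<dots> < ennreal L" using L mdist_ge_0[of Xh y z] by (simp add: ennreal_less_iff)
  finally show ?thesis using that unfolding INF_less_iff by auto
qed

lemma q_nonexpansive: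
  assumes y: "y \<in> mspace Xh" and z: "z \<in> mspace Xh"
  shows "mdist X (q y) (q z) \<le> mdist Xh y z"
proof (rule ccontr)
  assume "\<not> ?thesis"
  then have "mdist Xh y z < mdist X (q y) (q z)" by simp
  then obtain c where c: "pathin (mtopology_of Xh) c" "c 0 = y" "c 1 = z"
      "curve_length X (q \<circ> c) < ennreal (mdist X (q y) (q z))"
    by (rule short_path[OF y z])
  have "ennreal (mdist X ((q \<circ> c) 0) ((q \<circ> c) 1)) \<le> curve_length X (q \<circ> c)"
    by (rule curve_length_ge_mdist) auto
  then show False using c by simp
qed

text \<open>Prevents an almost shortest path from straying: each of its points is within the length
  of the path from the starting point.\<close>

lemma mdist_split_le:
  assumes c: "pathin (mtopology_of Xh) c" and a: "0 \<le> a" "a \<le> 1"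
  shows "ennreal (mdist Xh (c 0) (c a) + mdist Xh (c a) (c 1)) \<le> curve_length X (q \<circ> c)"
proof -
  have "pathin (mtopology_of Xh) (\<lambda>s. c (0 + a * s))" by (rule pathin_affine[OF c]) (use a in auto)
  then have 1: "ennreal (mdist Xh (c 0) (c a)) \<le> curve_length X (\<lambda>s. (q \<circ> c) (a * s))"
    using mdist_le_curve_length[of "\<lambda>s. c (0 + a * s)"] by (simp add: o_def)
  have "pathin (mtopology_of Xh) (\<lambda>s. c (a + (1 - a) * s))" by (rule pathin_affine[OF c]) (use a in auto)
  then have 2: "ennreal (mdist Xh (c a) (c 1)) \<le> curve_length X (\<lambda>s. (q \<circ> c) (a + (1 - a) * s))"
    using mdist_le_curve_length[of "\<lambda>s. c (a + (1 - a) * s)"] by (simp add: o_def)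
  have "ennreal (mdist Xh (c 0) (c a) + mdist Xh (c a) (c 1))
      = ennreal (mdist Xh (c 0) (c a)) + ennreal (mdist Xh (c a) (c 1))"
    by (rule ennreal_plus) (rule mdist_ge_0)+
  also have "\<dots> \<le> curve_length X (\<lambda>s. (q \<circ> c) (a * s)) + curve_length X (\<lambda>s. (q \<circ> c) (a + (1 - a) * s))"
    by (rule add_mono[OF 1 2])
  also have "\<dots> \<le> curve_length X (q \<circ> c)" by (rule curve_length_split[OF a])
  finally show ?thesis .
qed

definition evenly_covered :: "'a set \<Rightarrow> bool" where
  "evenly_covered U \<longleftrightarrow> openin (mtopology_of X) U \<and>
     (\<exists>\<V>. \<Union>\<V> = {y\<in>mspace Xh. q y \<in> U} \<and> (\<forall>V\<in>\<V>. openin (mtopology_of Xh) V) \<and> pairwise disjnt \<V> \<and>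
           (\<forall>V\<in>\<V>. homeomorphic_map (subtopology (mtopology_of Xh) V) (subtopology (mtopology_of X) U) q))"

lemma lebesgue_evenly_covered:
  "\<exists>\<epsilon>>0. \<forall>x\<in>mspace X. \<exists>U. evenly_covered U \<and> mball_of X x \<epsilon> \<subseteq> U"
proof -
  have "compactin (mtopology_of X) (mspace X)" using compact by (simp add: compact_space_def)
  moreover have "mspace X \<subseteq> \<Union>{U. evenly_covered U}"
  proof
    fix x assume "x \<in> mspace X"
    then have "\<exists>U. x \<in> U \<and> evenly_covered U"
      using cov unfolding normal_covering_def covering_map_def evenly_covered_def by simp
    then show "x \<in> \<Union>{U. evenly_covered U}" by blast
  qed
  moreover have "openin (mtopology_of X) U" if "U \<in> {U. evenly_covered U}" for U
    using that by (simp add: evenly_covered_def)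
  ultimately have "\<exists>\<epsilon>>0. \<forall>x\<in>mspace X. \<exists>U\<in>{U. evenly_covered U}. Metric_space.mball (mspace X) (mdist X) x \<epsilon> \<subseteq> U"
    using Metric_space.lebesgue_number[OF Metric_space_mspace_mdist, of X "mspace X" "{U. evenly_covered U}"]
    unfolding mtopology_of_def by blast
  then show ?thesis unfolding mball_of_def by auto
qed

text \<open>The sheets over \<open>U\<close> are disjoint and open, so a path over \<open>U\<close>,
  being connected, cannot leave the sheet in which it starts.\<close>

lemma sheet:
  assumes U: "evenly_covered U" and y: "y \<in> mspace Xh" "q y \<in> U"
  shows "\<exists>V. openin (mtopology_of Xh) V \<and> y \<in> V \<and>
    homeomorphic_map (subtopology (mtopology_of Xh) V) (subtopology (mtopology_of X) U) q \<and>
    (\<forall>c. pathin (mtopology_of Xh) c \<longrightarrow> c 0 = y \<longrightarrow> (\<forall>t\<in>{0..1}. q (c t) \<in> U) \<longrightarrow> c 1 \<in> V)"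
proof -
  obtain \<V> where \<V>: "\<Union>\<V> = {y\<in>mspace Xh. q y \<in> U}" "\<And>V. V \<in> \<V> \<Longrightarrow> openin (mtopology_of Xh) V"
    "pairwise disjnt \<V>"
    "\<And>V. V \<in> \<V> \<Longrightarrow> homeomorphic_map (subtopology (mtopology_of Xh) V) (subtopology (mtopology_of X) U) q"
    using U unfolding evenly_covered_def by auto
  have "y \<in> \<Union>\<V>" unfolding \<V>(1) using y by simp
  then obtain V where V: "V \<in> \<V>" "y \<in> V" by (elim UnionE)
  show ?thesis
  proof (intro exI[of _ V] conjI allI impI \<V>(2)[OF V(1)] V(2) \<V>(4)[OF V(1)])
    fix c assume c: "pathin (mtopology_of Xh) c" "c 0 = y" "\<forall>t\<in>{0..1}. q (c t) \<in> U"
    note c = c(1,2) c(3)[rule_format]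
    let ?W = "\<Union>(\<V> - {V})"
    have op: "openin (mtopology_of Xh) V" "openin (mtopology_of Xh) ?W" using \<V>(2) V(1) by auto
    have conn: "connectedin (mtopology_of Xh) (c ` {0..1})"
      using connectedin_path_image[OF c(1)] .
    have sub: "c ` {0..1} \<subseteq> V \<union> ?W"
    proof (rule image_subsetI)
      fix t :: real assume t: "t \<in> {0..1}"
      have "c t \<in> \<Union>\<V>" unfolding \<V>(1) using pathin_mspace[OF c(1) t] c(3)[OF t] by simp
      then show "c t \<in> V \<union> ?W" by blast
    qed
    have "V \<inter> ?W = {}"
      using \<V>(3) V(1) unfolding pairwise_def disjnt_def by auto
    then have "V \<inter> ?W \<inter> c ` {0..1} = {}" by simp
    moreover have "V \<inter> c ` {0..1} \<noteq> {}"
    proof -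
      have "c 0 \<in> c ` {0..1}" by (rule imageI) simp
      then have "c 0 \<in> V \<inter> c ` {0..1}" using V(2) c(2) by simp
      then show ?thesis by (intro notI) simp
    qed
    ultimately have "?W \<inter> c ` {0..1} = {}"
      using connectedinD[OF conn op sub] by metis
    moreover have c1: "c 1 \<in> c ` {0..1}" by (rule imageI) simp
    ultimately have "c 1 \<notin> ?W" by (metis IntI empty_iff)
    with subsetD[OF sub c1] show "c 1 \<in> V" by (elim UnE) simp_all
  qed
qed

text \<open>A scale, the same at all points, at which nearby base points lift without increase of
  distance and \<open>q\<close> is injective on balls. The local geometry of the covering enters
  later arguments in this form.\<close>

definition local_radius :: "real \<Rightarrow> bool" where
  "local_radius \<delta> \<longleftrightarrow> 0 < \<delta> \<and>
     (\<forall>y\<in>mspace Xh. \<forall>x\<in>mspace X. mdist X (q y) x < \<delta> \<longrightarrow>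
        (\<exists>z\<in>mspace Xh. q z = x \<and> mdist Xh y z \<le> mdist X (q y) x)) \<and>
     (\<forall>y\<in>mspace Xh. \<forall>z\<in>mspace Xh. \<forall>w\<in>mspace Xh.
        mdist Xh y z < \<delta> \<longrightarrow> mdist Xh y w < \<delta> \<longrightarrow> q z = q w \<longrightarrow> z = w)"

text \<open>Below a Lebesgue number of the evenly covered sets, a Lipschitz path downstairs stays in
  one such set and is lifted by the local inverse with the same length. Conversely, a short path
  upstairs stays in one sheet, where \<open>q\<close> is injective. The bound 1 keeps later
  displacement constants free of \<delta>.\<close>

lemma local_radius_exists: "\<exists>\<delta>. local_radius \<delta> \<and> \<delta> \<le> 1"
proof -
  obtain \<epsilon> where \<epsilon>: "\<epsilon> > 0" "\<And>x. x \<in> mspace X \<Longrightarrow> \<exists>U. evenly_covered U \<and> mball_of X x \<epsilon> \<subseteq> U"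
    using lebesgue_evenly_covered by blast
  define \<delta> where "\<delta> = min \<epsilon> 1"
  have \<delta>: "0 < \<delta>" "\<delta> \<le> \<epsilon>" "\<delta> \<le> 1" using \<epsilon>(1) by (simp_all add: \<delta>_def)
  have ex: "\<exists>z\<in>mspace Xh. q z = x \<and> mdist Xh y z \<le> mdist X (q y) x"
    if y: "y \<in> mspace Xh" and x: "x \<in> mspace X" and d: "mdist X (q y) x < \<delta>" for x y
  proof -
    obtain U where U: "evenly_covered U" "mball_of X (q y) \<epsilon> \<subseteq> U" using \<epsilon>(2)[OF q_mspace[OF y]] by blast
    have inU: "z \<in> U" if "z \<in> mspace X" "mdist X (q y) z < \<epsilon>" for z
      using U(2) that q_mspace[OF y] by (auto simp: in_mball_of)
    have qyU: "q y \<in> U" using inU[OF q_mspace[OF y]] mdist_self[OF q_mspace[OF y]] \<epsilon>(1) by simp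
    have xU: "x \<in> U" using inU[OF x] d \<delta> by simp
    obtain V where V: "openin (mtopology_of Xh) V" "y \<in> V"
      "homeomorphic_map (subtopology (mtopology_of Xh) V) (subtopology (mtopology_of X) U) q"
      "\<forall>c. pathin (mtopology_of Xh) c \<longrightarrow> c 0 = y \<longrightarrow> (\<forall>t\<in>{0..1}. q (c t) \<in> U) \<longrightarrow> c 1 \<in> V"
      using sheet[OF U(1) y qyU] by (elim exE conjE)
    have VX: "V \<subseteq> mspace Xh" using openin_subset[OF V(1)] by simp
    have UX: "U \<subseteq> mspace X" using openin_subset[OF conjunct1[OF U(1)[unfolded evenly_covered_def]]] by simp
    obtain s where s: "homeomorphic_maps (subtopology (mtopology_of Xh) V) (subtopology (mtopology_of X) U) q s"
      using V(3)[unfolded homeomorphic_map_maps] by (elim exE)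
    have scont: "continuous_map (subtopology (mtopology_of X) U) (subtopology (mtopology_of Xh) V) s"
      and sq: "\<And>v. v \<in> V \<Longrightarrow> s (q v) = v" and qs: "\<And>u. u \<in> U \<Longrightarrow> q (s u) = u"
      using s VX UX unfolding homeomorphic_maps_def by (simp_all add: Int_absorb1)
    have sU: "s u \<in> mspace Xh" if "u \<in> U" for u
      using continuous_map_image_subset_topspace[OF scont] that UX VX
      by (simp add: Int_absorb1 image_subset_iff subset_iff)
    have "mdist Xh y (s x) \<le> L" if L: "mdist X (q y) x < L" "L < \<delta>" for L
    proof -
      obtain g where g: "g 0 = q y" "g 1 = x" "g ` {0..1} \<subseteq> mspace X"
        "\<forall>s\<in>{0..1}. \<forall>t\<in>{0..1}. mdist X (g s) (g t) \<le> L * \<bar>s - t\<bar>"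
        using lipschitz_path[OF compact mid q_mspace[OF y] x L(1)] by (elim exE conjE)
      note g = g(1-3) g(4)[rule_format]
      have L0: "0 \<le> L" using L(1) mdist_ge_0[of X "q y" x] by linarith
      have gU: "g t \<in> U" if t: "t \<in> {0..1}" for t
      proof (rule inU)
        show "g t \<in> mspace X" using g(3) t by auto
        have "mdist X (q y) (g t) \<le> L * \<bar>0 - t\<bar>" using g(4)[of 0 t] g(1) t by simp
        also have "\<dots> \<le> L * 1" using L0 t by (intro mult_left_mono) auto
        finally show "mdist X (q y) (g t) < \<epsilon>" using L(2) \<delta> by simp
      qed
      have "continuous_map (top_of_set {0..1}) (subtopology (mtopology_of X) U) g"
        using pathin_lipschitz[OF g(3,4)] gU unfolding pathin_def
        by (simp add: continuous_map_in_subtopology Pi_iff)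
      from continuous_map_compose[OF this scont]
      have sg: "pathin (mtopology_of Xh) (s \<circ> g)"
        unfolding pathin_def by (simp add: continuous_map_in_subtopology)
      have "ennreal (mdist Xh ((s \<circ> g) 0) ((s \<circ> g) 1)) \<le> curve_length X (q \<circ> (s \<circ> g))"
        by (rule mdist_le_curve_length[OF sg])
      also have "curve_length X (q \<circ> (s \<circ> g)) = curve_length X g"
        by (rule curve_length_cong) (simp add: qs gU)
      also have "\<dots> \<le> ennreal L" by (rule curve_length_le_lipschitz[OF g(4) L0])
      finally show ?thesis using g(1,2) sq[OF V(2)] L0 by simp
    qed
    then have "mdist Xh y (s x) \<le> mdist X (q y) x"
      by (rule dense_ge_bounded[OF d])
    then show ?thesis using sU[OF xU] qs[OF xU] by (intro bexI[of _ "s x"] conjI)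
  qed
  have un: "z = w"
    if y: "y \<in> mspace Xh" and z: "z \<in> mspace Xh" "mdist Xh y z < \<delta>"
      and w: "w \<in> mspace Xh" "mdist Xh y w < \<delta>" and eq: "q z = q w" for y z w
  proof -
    obtain U where U: "evenly_covered U" "mball_of X (q y) \<epsilon> \<subseteq> U" using \<epsilon>(2)[OF q_mspace[OF y]] by blast
    have inU: "z \<in> U" if "z \<in> mspace X" "mdist X (q y) z < \<epsilon>" for z
      using U(2) that q_mspace[OF y] by (auto simp: in_mball_of)
    have qyU: "q y \<in> U" using inU[OF q_mspace[OF y]] mdist_self[OF q_mspace[OF y]] \<epsilon>(1) by simp
    obtain V where V: "openin (mtopology_of Xh) V" "y \<in> V"
      "homeomorphic_map (subtopology (mtopology_of Xh) V) (subtopology (mtopology_of X) U) q"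
      "\<forall>c. pathin (mtopology_of Xh) c \<longrightarrow> c 0 = y \<longrightarrow> (\<forall>t\<in>{0..1}. q (c t) \<in> U) \<longrightarrow> c 1 \<in> V"
      using sheet[OF U(1) y qyU] by (elim exE conjE)
    have VX: "V \<subseteq> mspace Xh" using openin_subset[OF V(1)] by simp
    have inV: "v \<in> V" if v: "v \<in> mspace Xh" "mdist Xh y v < \<delta>" for v
    proof -
      obtain c where c: "pathin (mtopology_of Xh) c" "c 0 = y" "c 1 = v" "curve_length X (q \<circ> c) < ennreal \<delta>"
        by (rule short_path[OF y v])
      have "q (c t) \<in> U" if t: "t \<in> {0..1}" for t
      proof (rule inU[OF q_mspace[OF pathin_mspace[OF c(1) t]]])
        have "ennreal (mdist X ((q \<circ> c) 0) ((q \<circ> c) t)) \<le> curve_length X (q \<circ> c)"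
          by (rule curve_length_ge_mdist) (use t in auto)
        then have "ennreal (mdist X (q y) (q (c t))) < ennreal \<delta>" using c(2,4) by simp
        then show "mdist X (q y) (q (c t)) < \<epsilon>" using \<delta> mdist_ge_0 by (simp add: ennreal_less_iff)
      qed
      then show ?thesis using V(4) c(1-3) by metis
    qed
    have "inj_on q V" using homeomorphic_imp_injective_map[OF V(3)] VX by (simp add: Int_absorb1)
    then show ?thesis using inV[OF z] inV[OF w] eq by (simp only: inj_onD)
  qed
  have "local_radius \<delta>" unfolding local_radius_def
  proof (intro conjI ballI impI \<delta>(1))
    show "\<exists>z\<in>mspace Xh. q z = x \<and> mdist Xh y z \<le> mdist X (q y) x"
      if "y \<in> mspace Xh" "x \<in> mspace X" "mdist X (q y) x < \<delta>" for x y by (rule ex[OF that])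
    show "z = w" if "y \<in> mspace Xh" "z \<in> mspace Xh" "w \<in> mspace Xh"
        "mdist Xh y z < \<delta>" "mdist Xh y w < \<delta>" "q z = q w" for y z w
      by (rule un[OF that(1,2,4,3,5,6)])
  qed
  then show ?thesis using \<delta>(3) by (intro exI[of _ \<delta>] conjI)
qed

end

section \<open>Deck transformations form a group of isometries\<close>

lemma deck_transformationsD:
  assumes "h \<in> deck_transformations E q"
  shows "h \<in> Bij (topspace E)" "homeomorphic_map E E h" "\<And>y. y \<in> topspace E \<Longrightarrow> q (h y) = q y"
    "\<And>y. y \<in> topspace E \<Longrightarrow> h y \<in> topspace E"
proof -
  show "h \<in> Bij (topspace E)" "homeomorphic_map E E h" "\<And>y. y \<in> topspace E \<Longrightarrow> q (h y) = q y"
    using assms unfolding deck_transformations_def by auto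
  then show "h y \<in> topspace E" if "y \<in> topspace E" for y
    using that unfolding Bij_def by (auto simp: bij_betw_def)
qed

lemma subgroup_deck_transformations:
  "subgroup (deck_transformations E q) (BijGroup (topspace E))"
proof -
  let ?S = "topspace E" and ?B = "BijGroup (topspace E)"
  interpret B: group ?B by (rule group_BijGroup)
  show ?thesis
  proof (rule subgroup.intro)
    show "deck_transformations E q \<subseteq> carrier ?B"
      using deck_transformationsD(1) by (auto simp: BijGroup_def)
    fix g h assume g: "g \<in> deck_transformations E q" and h: "h \<in> deck_transformations E q"
    note gD = deck_transformationsD[OF g] and hD = deck_transformationsD[OF h]
    have gh: "g \<otimes>\<^bsub>?B\<^esub> h = compose ?S g h" using gD(1) hD(1) by (simp add: BijGroup_def)
    have "homeomorphic_map E E (g \<circ> h)" by (rule homeomorphic_map_compose[OF hD(2) gD(2)])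
    then have "homeomorphic_map E E (compose ?S g h)"
      by (rule homeomorphic_map_eq) (simp add: compose_def)
    then show "g \<otimes>\<^bsub>?B\<^esub> h \<in> deck_transformations E q"
      unfolding gh using compose_Bij[OF gD(1) hD(1)] gD(3) hD(3,4)
      by (simp add: deck_transformations_def compose_def)
  next
    have "homeomorphic_map E E id" by simp
    then have "homeomorphic_map E E (\<lambda>x\<in>?S. x)" by (rule homeomorphic_map_eq) simp
    then show "\<one>\<^bsub>?B\<^esub> \<in> deck_transformations E q"
      by (simp add: BijGroup_def deck_transformations_def id_Bij)
  next
    fix h assume h: "h \<in> deck_transformations E q"
    note hD = deck_transformationsD[OF h]
    let ?i = "\<lambda>x\<in>?S. inv_into ?S h x"
    have inv: "inv\<^bsub>?B\<^esub> h = ?i" by (rule inv_BijGroup[OF hD(1)])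
    obtain k where k: "homeomorphic_maps E E h k" using hD(2) unfolding homeomorphic_map_maps by (elim exE)
    have bij: "bij_betw h ?S ?S" using hD(1) by (simp add: Bij_def)
    have ik: "k x = ?i x" if "x \<in> ?S" for x
    proof -
      have "k x \<in> ?S" "h (k x) = x"
        using k that unfolding homeomorphic_maps_def continuous_map_def by (auto simp: Pi_iff)
      then have "inv_into ?S h (h (k x)) = k x"
        by (intro inv_into_f_f bij_betw_imp_inj_on[OF bij])
      then show ?thesis using \<open>h (k x) = x\<close> that by simp
    qed
    have "homeomorphic_map E E k"
      using k homeomorphic_maps_sym unfolding homeomorphic_map_maps by metis
    then have hm: "homeomorphic_map E E ?i" by (rule homeomorphic_map_eq) (simp add: ik)
    have "q (?i x) = q x" if x: "x \<in> ?S" for x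
    proof -
      have "inv_into ?S h x \<in> ?S" "h (inv_into ?S h x) = x"
        using bij x by (auto simp: bij_betw_def f_inv_into_f inv_into_into)
      then show ?thesis using hD(3)[of "inv_into ?S h x"] x by simp
    qed
    then show "inv\<^bsub>?B\<^esub> h \<in> deck_transformations E q"
      unfolding inv using hm restrict_inv_into_Bij[OF hD(1)] by (simp add: deck_transformations_def)
  qed
qed

lemma group_deck_group: "group (deck_group E q)"
  unfolding deck_group_def
  by (rule group.subgroup_imp_group[OF group_BijGroup subgroup_deck_transformations])

lemma carrier_deck_group [simp]: "carrier (deck_group E q) = deck_transformations E q"
  by (simp add: deck_group_def)

lemma deck_group_mult:
  assumes "g \<in> deck_transformations E q" "h \<in> deck_transformations E q" "y \<in> topspace E"
  shows "(g \<otimes>\<^bsub>deck_group E q\<^esub> h) y = g (h y)"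
  using assms deck_transformationsD(1)[OF assms(1)] deck_transformationsD(1)[OF assms(2)]
  by (simp add: deck_group_def BijGroup_def compose_def)

lemma deck_group_one: "y \<in> topspace E \<Longrightarrow> \<one>\<^bsub>deck_group E q\<^esub> y = y"
  by (simp add: deck_group_def BijGroup_def)

lemma deck_transformation_ext:
  assumes "g \<in> deck_transformations E q" "h \<in> deck_transformations E q"
    and "\<And>y. y \<in> topspace E \<Longrightarrow> g y = h y"
  shows "g = h"
  using assms deck_transformationsD(1)[OF assms(1)] deck_transformationsD(1)[OF assms(2)]
  by (auto simp: Bij_def intro: extensionalityI)

lemma deck_group_inv:
  assumes g: "g \<in> deck_transformations E q" and y: "y \<in> topspace E"
  shows "(inv\<^bsub>deck_group E q\<^esub> g) (g y) = y" "g ((inv\<^bsub>deck_group E q\<^esub> g) y) = y"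
proof -
  interpret group "deck_group E q" by (rule group_deck_group)
  have gi: "inv\<^bsub>deck_group E q\<^esub> g \<in> deck_transformations E q" using inv_closed[of g] g by simp
  show "(inv\<^bsub>deck_group E q\<^esub> g) (g y) = y"
    using deck_group_mult[OF gi g y] l_inv[of g] g deck_group_one[OF y, of q] by simp
  show "g ((inv\<^bsub>deck_group E q\<^esub> g) y) = y"
    using deck_group_mult[OF g gi y] r_inv[of g] g deck_group_one[OF y, of q] by simp
qed

context length_covering
begin

abbreviation "G \<equiv> deck_group (mtopology_of Xh) q"

abbreviation "deck \<equiv> deck_transformations (mtopology_of Xh) q"

sublocale G: group G by (rule group_deck_group)

lemma deck_mspace: "g \<in> deck \<Longrightarrow> y \<in> mspace Xh \<Longrightarrow> g y \<in> mspace Xh"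
  using deck_transformationsD(4)[of g "mtopology_of Xh" q y] by simp

lemma deck_q: "g \<in> deck \<Longrightarrow> y \<in> mspace Xh \<Longrightarrow> q (g y) = q y"
  using deck_transformationsD(3)[of g "mtopology_of Xh" q y] by simp

lemma deck_mult: "g \<in> deck \<Longrightarrow> h \<in> deck \<Longrightarrow> y \<in> mspace Xh \<Longrightarrow> (g \<otimes>\<^bsub>G\<^esub> h) y = g (h y)"
  using deck_group_mult[of g "mtopology_of Xh" q h y] by simp

lemma deck_one: "y \<in> mspace Xh \<Longrightarrow> \<one>\<^bsub>G\<^esub> y = y"
  using deck_group_one[of y "mtopology_of Xh" q] by simp

lemma deck_inv_closed: "g \<in> deck \<Longrightarrow> inv\<^bsub>G\<^esub> g \<in> deck"
  using G.inv_closed[of g] by simp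

lemma deck_mult_closed: "g \<in> deck \<Longrightarrow> h \<in> deck \<Longrightarrow> g \<otimes>\<^bsub>G\<^esub> h \<in> deck"
  using G.m_closed[of g h] by simp

lemma deck_one_closed: "\<one>\<^bsub>G\<^esub> \<in> deck"
  using G.one_closed by simp

lemma deck_inv:
  "g \<in> deck \<Longrightarrow> y \<in> mspace Xh \<Longrightarrow> (inv\<^bsub>G\<^esub> g) (g y) = y"
  "g \<in> deck \<Longrightarrow> y \<in> mspace Xh \<Longrightarrow> g ((inv\<^bsub>G\<^esub> g) y) = y"
  using deck_group_inv[of g "mtopology_of Xh" q y] by simp_all

text \<open>The lifted metric depends only on projected paths, and a deck transformation does not
  change the projection of a path.\<close>

lemma deck_nonexpansive:
  assumes g: "g \<in> deck" and y: "y \<in> mspace Xh" and z: "z \<in> mspace Xh"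
  shows "mdist Xh (g y) (g z) \<le> mdist Xh y z"
proof (rule ccontr)
  assume "\<not> ?thesis"
  then have "mdist Xh y z < mdist Xh (g y) (g z)" by simp
  then obtain c where c: "pathin (mtopology_of Xh) c" "c 0 = y" "c 1 = z"
    "curve_length X (q \<circ> c) < ennreal (mdist Xh (g y) (g z))"
    by (rule short_path[OF y z])
  have "continuous_map (mtopology_of Xh) (mtopology_of Xh) g"
    using deck_transformationsD(2)[OF g] by (rule homeomorphic_imp_continuous_map)
  from continuous_map_compose[OF c(1)[unfolded pathin_def] this]
  have gc: "pathin (mtopology_of Xh) (g \<circ> c)" unfolding pathin_def .
  have "ennreal (mdist Xh (g y) (g z)) \<le> curve_length X (q \<circ> (g \<circ> c))"
    using mdist_le_curve_length[OF gc] c(2,3) by simp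
  also have "\<dots> = curve_length X (q \<circ> c)"
    by (rule curve_length_cong) (simp add: deck_q[OF g] pathin_mspace[OF c(1)])
  finally show False using c(4) by simp
qed

lemma deck_isometry:
  assumes g: "g \<in> deck" and y: "y \<in> mspace Xh" and z: "z \<in> mspace Xh"
  shows "mdist Xh (g y) (g z) = mdist Xh y z"
proof (rule antisym[OF deck_nonexpansive[OF assms]])
  show "mdist Xh y z \<le> mdist Xh (g y) (g z)"
    using deck_nonexpansive[OF deck_inv_closed[OF g] deck_mspace[OF g y] deck_mspace[OF g z]]
    by (simp add: deck_inv[OF g y] deck_inv[OF g z])
qed

lemma deck_transitive:
  "y \<in> mspace Xh \<Longrightarrow> z \<in> mspace Xh \<Longrightarrow> q y = q z \<Longrightarrow> \<exists>g\<in>deck. g y = z"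
  using cov unfolding normal_covering_def by simp

lemma local_radiusD:
  assumes "local_radius \<delta>"
  shows "0 < \<delta>"
    "\<And>x y. \<lbrakk>y \<in> mspace Xh; x \<in> mspace X; mdist X (q y) x < \<delta>\<rbrakk> \<Longrightarrow> \<exists>z\<in>mspace Xh. q z = x \<and> mdist Xh y z \<le> mdist X (q y) x"
    "\<And>y z w. \<lbrakk>y \<in> mspace Xh; z \<in> mspace Xh; w \<in> mspace Xh; mdist Xh y z < \<delta>; mdist Xh y w < \<delta>; q z = q w\<rbrakk> \<Longrightarrow> z = w"
  by (rule assms[unfolded local_radius_def, THEN conjunct1],
      rule assms[unfolded local_radius_def, THEN conjunct2, THEN conjunct1, rule_format], assumption+,
      rule assms[unfolded local_radius_def, THEN conjunct2, THEN conjunct2, rule_format], assumption+)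

text \<open>A point moved by less than \<delta> is fixed, since it and its image have the same
  projection. Fixed points propagate to all points within \<delta>, hence along a path to every
  point of the covering.\<close>

lemma deck_displacement:
  assumes \<delta>: "local_radius \<delta>" and g: "g \<in> deck" and y: "y \<in> mspace Xh" and d: "mdist Xh (g y) y < \<delta>"
  shows "g = \<one>\<^bsub>G\<^esub>"
proof -
  note \<delta>D = local_radiusD[OF \<delta>]
  have fix1: "g z = z" if z: "z \<in> mspace Xh" and d: "mdist Xh (g z) z < \<delta>" for z
    by (rule \<delta>D(3)[OF z deck_mspace[OF g z] z])
      (use d \<delta>D(1) mdist_self[OF z] deck_q[OF g z] mdist_sym[of Xh z "g z"] in auto)
  have step: "g w = w" if z: "z \<in> mspace Xh" "g z = z" and w: "w \<in> mspace Xh" and zw: "mdist Xh z w < \<delta>" for z w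
  proof (rule \<delta>D(3)[OF z(1) deck_mspace[OF g w] w _ zw deck_q[OF g w]])
    have "mdist Xh z (g w) = mdist Xh (g z) (g w)" using z(2) by simp
    also have "\<dots> = mdist Xh z w" by (rule deck_isometry[OF g z(1) w])
    finally show "mdist Xh z (g w) < \<delta>" using zw by simp
  qed
  have all: "g z = z" if z: "z \<in> mspace Xh" for z
  proof -
    obtain c where c: "pathin (mtopology_of Xh) c" "c 0 = y" "c 1 = z"
      "curve_length X (q \<circ> c) < ennreal (mdist Xh y z + 1)"
      by (rule short_path[OF y z, of "mdist Xh y z + 1"]) auto
    obtain \<eta> where \<eta>: "\<eta> > 0" "\<forall>s\<in>{0..1}. \<forall>t\<in>{0..1}. dist s t < \<eta> \<longrightarrow> mdist Xh (c s) (c t) < \<delta>"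
      using uniform_continuity_into_metric[OF compact_Icc c(1)[unfolded pathin_def] \<delta>D(1)] by (elim exE conjE)
    have "(if g (c 0) = c 0 then 1 else 0 :: int) = (if g (c 1) = c 1 then 1 else 0)"
    proof (rule locally_constant_interval[OF \<eta>(1), of "\<lambda>t. if g (c t) = c t then 1 else 0"])
      fix s t :: real assume st: "s \<in> {0..1}" "t \<in> {0..1}" "dist s t < \<eta>"
      then have d: "mdist Xh (c s) (c t) < \<delta>" using \<eta>(2) by simp
      note m = pathin_mspace[OF c(1) st(1)] pathin_mspace[OF c(1) st(2)]
      have "g (c s) = c s \<longleftrightarrow> g (c t) = c t"
      proof
        assume "g (c s) = c s"
        then show "g (c t) = c t" by (rule step[OF m(1) _ m(2) d])
      next
        assume "g (c t) = c t"
        then show "g (c s) = c s" by (rule step[OF m(2) _ m(1)]) (simp only: mdist_sym[of Xh "c t"] d)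
      qed
      then show "(if g (c s) = c s then 1 else 0 :: int) = (if g (c t) = c t then 1 else 0)" by simp
    qed
    then show ?thesis using c(2,3) fix1[OF y d] by (simp split: if_splits)
  qed
  show ?thesis
    by (rule deck_transformation_ext[OF g deck_one_closed]) (simp add: all deck_one)
qed

end

section \<open>Displacement of the base point\<close>

locale pointed_length_covering = length_covering +
  fixes ph :: 'b and D :: real
  assumes ph: "ph \<in> mspace Xh"
    and D: "\<And>x y. x \<in> mspace X \<Longrightarrow> y \<in> mspace X \<Longrightarrow> mdist X x y \<le> D"
begin

definition disp :: "('b \<Rightarrow> 'b) \<Rightarrow> real" where
  "disp g = mdist Xh (g ph) ph"

lemma D_nonneg: "0 \<le> D"
  using D[OF q_mspace[OF ph] q_mspace[OF ph]] mdist_ge_0[of X "q ph" "q ph"] by linarith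

lemma disp_mult: 
  assumes "g \<in> deck" "h \<in> deck" shows "disp (g \<otimes>\<^bsub>G\<^esub> h) \<le> disp g + disp h"
proof -
  have "mdist Xh (g (h ph)) ph \<le> mdist Xh (g (h ph)) (g ph) + mdist Xh (g ph) ph"
    by (rule mdist_triangle_le[OF deck_mspace[OF assms(1) deck_mspace[OF assms(2) ph]] deck_mspace[OF assms(1) ph] ph])
  also have "mdist Xh (g (h ph)) (g ph) = mdist Xh (h ph) ph"
    by (rule deck_isometry[OF assms(1) deck_mspace[OF assms(2) ph] ph])
  finally show ?thesis by (simp add: disp_def deck_mult[OF assms ph])
qed

lemma disp_inv:
  assumes g: "g \<in> deck" shows "disp (inv\<^bsub>G\<^esub> g) = disp g"
proof -
  have "mdist Xh (g ph) ph = mdist Xh ((inv\<^bsub>G\<^esub> g) (g ph)) ((inv\<^bsub>G\<^esub> g) ph)"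
    by (rule deck_isometry[OF deck_inv_closed[OF g] deck_mspace[OF g ph] ph, symmetric])
  then show ?thesis by (simp add: disp_def deck_inv[OF g ph] mdist_sym[of Xh ph])
qed

lemma disp_one: "disp \<one>\<^bsub>G\<^esub> = 0"
  by (simp add: disp_def deck_one[OF ph] mdist_self[OF ph])

text \<open>A fine chain in the base from \<open>q ph\<close> to \<open>q y\<close>, of total length
  below \<open>D + 1\<close>, is lifted step by step from \<open>ph\<close>. It ends in the fibre of
  \<open>y\<close>, and a deck transformation moves the end to \<open>y\<close>.\<close>

lemma near_orbit:
  assumes y: "y \<in> mspace Xh"
  shows "\<exists>g\<in>deck. mdist Xh y (g ph) < D + 1"
proof -
  obtain \<delta> where \<delta>: "local_radius \<delta>" using local_radius_exists by blast
  note \<delta>D = local_radiusD[OF \<delta>]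
  define L where "L = D + 1"
  have L: "mdist X (q ph) (q y) < L" using D[OF q_mspace[OF ph] q_mspace[OF y]] by (simp add: L_def)
  obtain k where k: "L / 2 ^ k < \<delta>"
  proof -
    obtain k where "L / \<delta> < 2 ^ k" using real_arch_pow[of 2 "L / \<delta>"] by auto
    then have "L / 2 ^ k < \<delta>" using \<delta>D(1) by (simp add: field_simps)
    then show ?thesis by (rule that)
  qed
  obtain c where c: "c 0 = q ph" "c (2 ^ k) = q y" "range c \<subseteq> mspace X"
    "\<forall>j<2 ^ k. mdist X (c j) (c (Suc j)) < L / 2 ^ k"
    using dyadic_chain[OF mid q_mspace[OF ph] q_mspace[OF y] L, of k] by (elim exE conjE)
  \<comment> \<open>The strict bound is carried only for positive \<open>j\<close>; at
    \<open>j = 0\<close> both sides are 0.\<close>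
  have "\<exists>z\<in>mspace Xh. q z = c j \<and> mdist Xh ph z \<le> real j * (L / 2 ^ k) \<and> (0 < j \<longrightarrow> mdist Xh ph z < real j * (L / 2 ^ k))"
    if "j \<le> 2 ^ k" for j
    using that
  proof (induction j)
    case 0
    have "mdist Xh ph ph \<le> 0" by (rule eq_refl[OF mdist_self[OF ph]])
    then show ?case using ph c(1) by (intro bexI[of _ ph]) simp_all
  next
    case (Suc j)
    then obtain z where z: "z \<in> mspace Xh" "q z = c j" "mdist Xh ph z \<le> real j * (L / 2 ^ k)" by auto
    have st: "mdist X (q z) (c (Suc j)) < L / 2 ^ k" using c(4) Suc.prems z(2) by simp
    then have "mdist X (q z) (c (Suc j)) < \<delta>" using k by simp
    then obtain w where w: "w \<in> mspace Xh" "q w = c (Suc j)" "mdist Xh z w \<le> mdist X (q z) (c (Suc j))"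
      using \<delta>D(2)[OF z(1), of "c (Suc j)"] c(3) by auto
    have "mdist Xh ph w \<le> mdist Xh ph z + mdist Xh z w" by (intro mdist_triangle_le ph z w)
    also have "\<dots> < real j * (L / 2 ^ k) + L / 2 ^ k" using z(3) w(3) st by linarith
    also have "\<dots> = real (Suc j) * (L / 2 ^ k)" by (simp only: of_nat_Suc distrib_right mult_1 add.commute)
    finally show ?case using w by (intro bexI[of _ w]) auto
  qed
  from this[of "2 ^ k"] obtain z where z: "z \<in> mspace Xh" "q z = q y" "mdist Xh ph z < L"
    using c(2) by auto
  obtain g where g: "g \<in> deck" "g z = y" using deck_transitive[OF z(1) y z(2)] by blast
  have "mdist Xh y (g ph) = mdist Xh z ph" using deck_isometry[OF g(1) z(1) ph] g(2) by simp
  then show ?thesis using z(3) g(1) by (intro bexI[of _ g]) (simp_all add: L_def mdist_sym[of Xh z])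
qed

end

section \<open>Finiteness of sets of bounded displacement\<close>

text \<open>Total boundedness of the balls about \<open>p\<close>. This weaker substitute for
  properness passes to the limit space, which is not assumed complete.\<close>

definition has_finite_nets :: "'a metric \<Rightarrow> 'a \<Rightarrow> bool" where
  "has_finite_nets Z p \<longleftrightarrow> (\<forall>R. \<forall>\<eta>>0. \<exists>F. finite F \<and> F \<subseteq> mspace Z \<and>
     (\<forall>y\<in>mspace Z. mdist Z p y < R \<longrightarrow> (\<exists>z\<in>F. mdist Z z y < \<eta>)))"

context pointed_length_covering
begin

lemma base_net: "0 < \<eta> \<Longrightarrow> \<exists>N. finite N \<and> N \<subseteq> mspace X \<and> (\<forall>x\<in>mspace X. \<exists>z\<in>N. mdist X z x < \<eta>)"
proof -
  assume \<eta>: "0 < \<eta>"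
  have "Metric_space.mtotally_bounded (mspace X) (mdist X) (mspace X)"
    using compact Metric_space.compactin_imp_mtotally_bounded[OF Metric_space_mspace_mdist, of X "mspace X"]
    unfolding mtopology_of_def compact_space_def by (simp add: Metric_space.topspace_mtopology[OF Metric_space_mspace_mdist])
  then obtain N where N: "finite N" "N \<subseteq> mspace X" "mspace X \<subseteq> (\<Union>x\<in>N. mball_of X x \<eta>)"
    using \<eta> unfolding Metric_space.mtotally_bounded_def[OF Metric_space_mspace_mdist] mball_of_def by metis
  have "\<exists>z\<in>N. mdist X z x < \<eta>" if "x \<in> mspace X" for x
  proof -
    have "x \<in> (\<Union>x\<in>N. mball_of X x \<eta>)" using N(3) that by (rule subsetD)
    then show ?thesis by (elim UN_E) (intro bexI, auto simp: in_mball_of)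
  qed
  then show ?thesis using N(1,2) by (intro exI[of _ N] conjI ballI)
qed

lemma intermediate_point:
  assumes y: "y \<in> mspace Xh" and R: "0 < R" and a: "0 < a" and d: "mdist Xh ph y < R + a"
  shows "\<exists>w\<in>mspace Xh. mdist Xh ph w < R \<and> mdist Xh w y < 2 * a"
proof (cases "mdist Xh ph y < R")
  case True
  then show ?thesis using y a by (intro bexI[of _ y] conjI) (simp_all add: mdist_self)
next
  case False
  obtain c where c: "pathin (mtopology_of Xh) c" "c 0 = ph" "c 1 = y" "curve_length X (q \<circ> c) < ennreal (R + a)"
    by (rule short_path[OF ph y d])
  \<comment> \<open>Just below \<open>R\<close>, so that the point found lies inside the ball; the
    rest of the path is then shorter than \<open>a + a / 2\<close>.\<close>
  define v where "v = max 0 (R - a / 2)"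
  have v: "0 \<le> v" "v < R" "R - a / 2 \<le> v" using R a by (auto simp: v_def)
  have "continuous_map (top_of_set {0..1}) euclideanreal (\<lambda>t. mdist Xh ph (c t))"
    using c(1) ph unfolding pathin_def by (intro continuous_map_mdist) simp_all
  then have "continuous_on {0..1} (\<lambda>t. mdist Xh ph (c t))" by simp
  moreover have "mdist Xh ph (c 0) \<le> v" unfolding c(2) mdist_self[OF ph] by (rule v(1))
  moreover have "v \<le> mdist Xh ph (c 1)" using False v c(3) by simp
  ultimately obtain t where t: "0 \<le> t" "t \<le> 1" "mdist Xh ph (c t) = v"
    using IVT'[of "\<lambda>t. mdist Xh ph (c t)" 0 v 1] by auto
  have "ennreal (mdist Xh (c 0) (c t) + mdist Xh (c t) (c 1)) < ennreal (R + a)"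
    by (rule le_less_trans[OF mdist_split_le[OF c(1) t(1,2)] c(4)])
  then have "mdist Xh (c 0) (c t) + mdist Xh (c t) (c 1) < R + a"
    by (subst (asm) ennreal_less_iff) (intro add_nonneg_nonneg mdist_ge_0)
  then have "v + mdist Xh (c t) y < R + a" unfolding c(2,3) t(3) .
  then have "mdist Xh (c t) y < 2 * a" using v(3) a by simp
  moreover have "c t \<in> mspace Xh" by (rule pathin_mspace[OF c(1)]) (use t in simp)
  ultimately show ?thesis using t(3) v(2) by (intro bexI[of _ "c t"]) simp_all
qed

text \<open>Each point of a finite net of the base has at most one lift within \<delta> of a given
  centre, and these lifts form \<open>F'\<close>. If \<open>y\<close> is within
  \<open>3 * \<delta> / 4\<close> of a centre, a base point within \<open>\<delta> / 4\<close> of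
  \<open>q y\<close> has a lift near \<open>y\<close> that is still within \<delta> of the centre,
  so it is the chosen one.\<close>

lemma net_step:
  assumes \<delta>: "local_radius \<delta>" and \<eta>: "0 < \<eta>" and F: "finite F" "F \<subseteq> mspace Xh"
  shows "\<exists>F'. finite F' \<and> F' \<subseteq> mspace Xh \<and>
    (\<forall>y\<in>mspace Xh. (\<exists>c\<in>F. mdist Xh c y < 3 * \<delta> / 4) \<longrightarrow> (\<exists>z\<in>F'. mdist Xh z y < \<eta>))"
proof -
  note \<delta>D = local_radiusD[OF \<delta>]
  define \<epsilon> where "\<epsilon> = min \<eta> (\<delta> / 4)"
  have \<epsilon>: "0 < \<epsilon>" "\<epsilon> \<le> \<eta>" "\<epsilon> \<le> \<delta> / 4" using \<eta> \<delta>D(1) by (simp_all add: \<epsilon>_def)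
  obtain N where N: "finite N" "N \<subseteq> mspace X" "\<forall>x\<in>mspace X. \<exists>z\<in>N. mdist X z x < \<epsilon>"
    using base_net[OF \<epsilon>(1)] by (elim exE conjE)
  define lft where "lft c x = (SOME z. z \<in> mspace Xh \<and> q z = x \<and> mdist Xh c z < \<delta>)" for c x
  define F' where "F' = (\<lambda>(c, x). lft c x) ` (F \<times> N) \<inter> mspace Xh"
  have "\<exists>z\<in>F'. mdist Xh z y < \<eta>" if y: "y \<in> mspace Xh" and ex: "\<exists>c\<in>F. mdist Xh c y < 3 * \<delta> / 4" for y
  proof -
    obtain c where c: "c \<in> F" "mdist Xh c y < 3 * \<delta> / 4" using ex by (elim bexE)
    have cX: "c \<in> mspace Xh" using c(1) F(2) by (rule subsetD[rotated])
    obtain x where x: "x \<in> N" "mdist X x (q y) < \<epsilon>" using N(3)[rule_format, OF q_mspace[OF y]] by (elim bexE)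
    have xX: "x \<in> mspace X" using x(1) N(2) by (rule subsetD[rotated])
    have dx: "mdist X (q y) x < \<epsilon>" using x(2) by (simp only: mdist_sym[of X "q y"])
    have "mdist X (q y) x < \<delta>" using dx \<epsilon>(3) \<delta>D(1) by linarith
    from \<delta>D(2)[OF y xX this] obtain z where z: "z \<in> mspace Xh" "q z = x" "mdist Xh y z \<le> mdist X (q y) x"
      by (elim bexE conjE)
    have "mdist Xh c z \<le> mdist Xh c y + mdist Xh y z" by (rule mdist_triangle_le[OF cX y z(1)])
    then have cz: "mdist Xh c z < \<delta>" using c(2) z(3) dx \<epsilon>(3) by linarith
    let ?l = "lft c x"
    have "?l \<in> mspace Xh \<and> q ?l = x \<and> mdist Xh c ?l < \<delta>"
      unfolding lft_def by (rule someI[of _ z]) (intro conjI z cz)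
    then have "?l = z" using \<delta>D(3)[OF cX _ z(1) _ cz, of ?l] z(2) by simp
    then have "z \<in> F'" using c(1) x(1) z(1) unfolding F'_def by (intro IntI image_eqI[of _ _ "(c, x)"]) simp_all
    moreover have "mdist Xh z y < \<eta>" using z(3) dx \<epsilon>(2) by (simp add: mdist_sym[of Xh z])
    ultimately show ?thesis by (rule bexI[rotated])
  qed
  moreover have "finite F'" "F' \<subseteq> mspace Xh" using F N by (simp_all add: F'_def)
  ultimately show ?thesis by (intro exI[of _ F'] conjI ballI impI)
qed

text \<open>Induction on the radius in steps of \<open>\<delta> / 4\<close>. A
  \<open>\<delta> / 4\<close>-net of one ball is a \<open>3 * \<delta> / 4\<close>-net of the next
  by \<open>intermediate_point\<close>, and \<open>net_step\<close> refines it to any precision, so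
  the precision does not deteriorate.\<close>

lemma covering_finite_nets: "has_finite_nets Xh ph"
proof -
  obtain \<delta> where \<delta>: "local_radius \<delta>" using local_radius_exists by blast
  note \<delta>D = local_radiusD[OF \<delta>]
  define P where "P R \<longleftrightarrow> (\<forall>\<eta>>0. \<exists>F. finite F \<and> F \<subseteq> mspace Xh \<and>
     (\<forall>y\<in>mspace Xh. mdist Xh ph y < R \<longrightarrow> (\<exists>z\<in>F. mdist Xh z y < \<eta>)))" for R
  have step: "P (R + \<delta> / 4)" if R: "P R" "0 \<le> R" for R
    unfolding P_def
  proof (intro allI impI)
    fix \<eta> :: real assume \<eta>: "0 < \<eta>"
    have "0 < \<delta> / 4" using \<delta>D(1) by simp
    then obtain F where F: "finite F" "F \<subseteq> mspace Xh"
      "\<forall>y\<in>mspace Xh. mdist Xh ph y < R \<longrightarrow> (\<exists>z\<in>F. mdist Xh z y < \<delta> / 4)"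
      using R(1)[unfolded P_def, rule_format, OF \<open>0 < \<delta> / 4\<close>] by (elim exE conjE)
    \<comment> \<open>The base point is added for the case \<open>R = 0\<close>, in which the ball
      is empty and the net says nothing.\<close>
    obtain F' where F': "finite F'" "F' \<subseteq> mspace Xh"
      "\<forall>y\<in>mspace Xh. (\<exists>c\<in>insert ph F. mdist Xh c y < 3 * \<delta> / 4) \<longrightarrow> (\<exists>z\<in>F'. mdist Xh z y < \<eta>)"
      using net_step[OF \<delta> \<eta> finite.insertI[OF F(1)] insert_subsetI[OF ph F(2)]] by (elim exE conjE)
    have near: "\<exists>c\<in>insert ph F. mdist Xh c y < 3 * \<delta> / 4" if y: "y \<in> mspace Xh" "mdist Xh ph y < R + \<delta> / 4" for y
    proof (cases "R = 0")
      case True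
      then show ?thesis using y(2) \<delta>D(1) by (intro bexI[of _ ph]) simp_all
    next
      case False
      then have "0 < R" using R(2) by simp
      from intermediate_point[OF y(1) this \<open>0 < \<delta> / 4\<close> y(2)]
      obtain w where w: "w \<in> mspace Xh" "mdist Xh ph w < R" "mdist Xh w y < 2 * (\<delta> / 4)"
        by (elim bexE conjE)
      obtain z where z: "z \<in> F" "mdist Xh z w < \<delta> / 4" using F(3)[rule_format, OF w(1,2)] by (elim bexE)
      have "mdist Xh z y \<le> mdist Xh z w + mdist Xh w y"
        using z(1) F(2) by (intro mdist_triangle_le w(1) y(1)) auto
      then show ?thesis using z w(3) by (intro bexI[of _ z]) simp_all
    qed
    show "\<exists>F. finite F \<and> F \<subseteq> mspace Xh \<and>
     (\<forall>y\<in>mspace Xh. mdist Xh ph y < R + \<delta> / 4 \<longrightarrow> (\<exists>z\<in>F. mdist Xh z y < \<eta>))"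
    proof (rule exI[of _ F'], intro conjI F'(1,2) ballI impI)
      fix y assume y: "y \<in> mspace Xh" "mdist Xh ph y < R + \<delta> / 4"
      show "\<exists>z\<in>F'. mdist Xh z y < \<eta>" by (rule F'(3)[rule_format, OF y(1) near[OF y]])
    qed
  qed
  have "0 < \<delta> / 4" using \<delta>D(1) by simp
  have Pn: "P (real n * (\<delta> / 4))" for n
  proof (induction n)
    case 0
    have "\<not> mdist Xh ph y < 0" for y using mdist_ge_0[of Xh ph y] by linarith
    then show ?case unfolding P_def by (intro allI impI exI[of _ "{}"]) simp
  next
    case (Suc n)
    have "real (Suc n) * (\<delta> / 4) = real n * (\<delta> / 4) + \<delta> / 4" by (simp only: of_nat_Suc distrib_right mult_1 add.commute)
    then show ?case using step[OF Suc mult_nonneg_nonneg[OF of_nat_0_le_iff less_imp_le[OF \<open>0 < \<delta> / 4\<close>]]]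
      by (simp only:)
  qed
  show ?thesis
    unfolding has_finite_nets_def
  proof (intro allI impI)
    fix R \<eta> :: real assume \<eta>: "0 < \<eta>"
    obtain n :: nat where "R / (\<delta> / 4) < real n" by (rule exE[OF reals_Archimedean2])
    then have n: "R < real n * (\<delta> / 4)" by (rule iffD1[OF pos_divide_less_eq[OF \<open>0 < \<delta> / 4\<close>]])
    obtain F where F: "finite F" "F \<subseteq> mspace Xh"
      "\<forall>y\<in>mspace Xh. mdist Xh ph y < real n * (\<delta> / 4) \<longrightarrow> (\<exists>z\<in>F. mdist Xh z y < \<eta>)"
      using Pn[of n] \<eta> unfolding P_def by metis
    show "\<exists>F. finite F \<and> F \<subseteq> mspace Xh \<and> (\<forall>y\<in>mspace Xh. mdist Xh ph y < R \<longrightarrow> (\<exists>z\<in>F. mdist Xh z y < \<eta>))"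
    proof (rule exI[of _ F], intro conjI F(1,2) ballI impI)
      fix y assume y: "y \<in> mspace Xh" "mdist Xh ph y < R"
      show "\<exists>z\<in>F. mdist Xh z y < \<eta>"
        by (rule F(3)[rule_format, OF y(1) order_less_trans[OF y(2) n]])
    qed
  qed
qed

lemma disp_diff:
  assumes g: "g \<in> deck" and h: "h \<in> deck"
  shows "disp (inv\<^bsub>G\<^esub> h \<otimes>\<^bsub>G\<^esub> g) = mdist Xh (g ph) (h ph)"
proof -
  have "mdist Xh (g ph) (h ph) = mdist Xh ((inv\<^bsub>G\<^esub> h) (g ph)) ((inv\<^bsub>G\<^esub> h) (h ph))"
    by (rule deck_isometry[OF deck_inv_closed[OF h] deck_mspace[OF g ph] deck_mspace[OF h ph], symmetric])
  then show ?thesis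
    unfolding disp_def deck_mult[OF deck_inv_closed[OF h] g ph] deck_inv(1)[OF h ph] by simp
qed

text \<open>Images of the base point are coded by the points of a \<open>\<delta> / 2\<close>-net.
  Two transformations with the same code differ by one of displacement below \<delta>, which is
  trivial.\<close>

lemma finite_disp: "finite {g \<in> deck. disp g < R}"
proof -
  obtain \<delta> where \<delta>: "local_radius \<delta>" using local_radius_exists by blast
  note \<delta>D = local_radiusD[OF \<delta>]
  have "0 < \<delta> / 2" using \<delta>D(1) by simp
  then obtain F where F: "finite F" "F \<subseteq> mspace Xh"
    "\<forall>y\<in>mspace Xh. mdist Xh ph y < R \<longrightarrow> (\<exists>z\<in>F. mdist Xh z y < \<delta> / 2)"
    using covering_finite_nets[unfolded has_finite_nets_def, rule_format, OF \<open>0 < \<delta> / 2\<close>, of R]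
    by (elim exE conjE)
  define c where "c g = (SOME z. z \<in> F \<and> mdist Xh z (g ph) < \<delta> / 2)" for g
  have c: "c g \<in> F \<and> mdist Xh (c g) (g ph) < \<delta> / 2" if "g \<in> deck" "disp g < R" for g
  proof -
    have "mdist Xh ph (g ph) < R" using that(2) by (simp add: disp_def mdist_sym[of Xh ph])
    then have "\<exists>z. z \<in> F \<and> mdist Xh z (g ph) < \<delta> / 2" using F(3) deck_mspace[OF that(1) ph] by auto
    then show ?thesis unfolding c_def by (rule someI_ex)
  qed
  have "inj_on c {g \<in> deck. disp g < R}"
  proof (rule inj_onI)
    fix g h assume "g \<in> {g \<in> deck. disp g < R}" "h \<in> {g \<in> deck. disp g < R}" and eq: "c g = c h"
    then have g: "g \<in> deck" "disp g < R" and h: "h \<in> deck" "disp h < R" by auto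
    have cX: "c g \<in> mspace Xh" using c[OF g] F(2) by auto
    have "mdist Xh (g ph) (h ph) \<le> mdist Xh (g ph) (c g) + mdist Xh (c g) (h ph)"
      by (rule mdist_triangle_le[OF deck_mspace[OF g(1) ph] cX deck_mspace[OF h(1) ph]])
    then have "disp (inv\<^bsub>G\<^esub> h \<otimes>\<^bsub>G\<^esub> g) < \<delta>"
      using c[OF g] c[OF h] eq by (simp add: disp_diff[OF g(1) h(1)] mdist_sym[of Xh "g ph" "c h"])
    then have "inv\<^bsub>G\<^esub> h \<otimes>\<^bsub>G\<^esub> g = \<one>\<^bsub>G\<^esub>"
      using deck_displacement[OF \<delta> deck_mult_closed[OF deck_inv_closed[OF h(1)] g(1)] ph] by (simp add: disp_def)
    then have "inv\<^bsub>G\<^esub> (inv\<^bsub>G\<^esub> h) = g"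
      using G.inv_equality[of g "inv\<^bsub>G\<^esub> h"] G.inv_comm[of "inv\<^bsub>G\<^esub> h" g] g(1) deck_inv_closed[OF h(1)] by simp
    then show "g = h" using h(1) by simp
  qed
  moreover have "finite (c ` {g \<in> deck. disp g < R})"
    by (rule finite_subset[OF _ F(1)]) (use c in auto)
  ultimately show ?thesis by (rule finite_imageD[rotated])
qed

text \<open>Generation by small displacements: along a path from \<open>ph\<close> to
  \<open>g ph\<close>, consecutive points are less than 1 apart and each has orbit points within
  \<open>D + 1\<close>. Consecutive orbit points thus differ by a displacement below
  \<open>(D + 1) + 1 + (D + 1)\<close>.\<close>

lemma deck_induct:
  assumes g: "g \<in> deck" and one: "P \<one>\<^bsub>G\<^esub>"
    and step: "\<And>g s. g \<in> deck \<Longrightarrow> s \<in> deck \<Longrightarrow> P g \<Longrightarrow> disp s < 2 * D + 3 \<Longrightarrow> P (g \<otimes>\<^bsub>G\<^esub> s)"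
  shows "P g"
proof -
  obtain c where c: "pathin (mtopology_of Xh) c" "c 0 = ph" "c 1 = g ph"
    "curve_length X (q \<circ> c) < ennreal (mdist Xh ph (g ph) + 1)"
    by (rule short_path[OF ph deck_mspace[OF g ph], of "mdist Xh ph (g ph) + 1"]) auto
  obtain \<eta> where \<eta>: "\<eta> > 0" "\<forall>s\<in>{0..1}. \<forall>t\<in>{0..1}. dist s t < \<eta> \<longrightarrow> mdist Xh (c s) (c t) < 1"
    using uniform_continuity_into_metric[OF compact_Icc c(1)[unfolded pathin_def], of 1] by auto
  obtain m :: nat where m: "1 / \<eta> < real m" using reals_Archimedean2 by blast
  have m0: "0 < real m" using m \<eta>(1) by (meson less_trans zero_less_divide_1_iff)
  have st: "1 / real m < \<eta>" using m m0 \<eta>(1) by (simp add: field_simps)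
  define y where "y j = c (real j / real m)" for j
  have tj: "real j / real m \<in> {0..1}" if "j \<le> m" for j using that m0 by auto
  have yX: "y j \<in> mspace Xh" if "j \<le> m" for j unfolding y_def by (rule pathin_mspace[OF c(1) tj[OF that]])
  have yy: "mdist Xh (y j) (y (Suc j)) < 1" if "Suc j \<le> m" for j
  proof -
    have "real (Suc j) / real m - real j / real m = 1 / real m"
      by (simp add: diff_divide_distrib[symmetric])
    moreover have "0 < 1 / real m" using m0 by simp
    ultimately have "dist (real j / real m) (real (Suc j) / real m) < \<eta>"
      unfolding dist_real_def using st by linarith
    then show ?thesis unfolding y_def using \<eta>(2) tj[of j] tj[of "Suc j"] that by auto
  qed
  \<comment> \<open>Carried for every orbit point near \<open>y j\<close> rather than for a selected
    one, so that the next step may use any of them.\<close>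
  have main: "\<forall>h\<in>deck. mdist Xh (y j) (h ph) < D + 1 \<longrightarrow> P h" if "j \<le> m" for j
    using that
  proof (induction j)
    case 0
    show ?case
    proof (intro ballI impI)
      fix h assume h: "h \<in> deck" "mdist Xh (y 0) (h ph) < D + 1"
      have "disp h < 2 * D + 3" using h(2) c(2) D_nonneg by (simp add: y_def disp_def mdist_sym[of Xh ph])
      then have "P (\<one>\<^bsub>G\<^esub> \<otimes>\<^bsub>G\<^esub> h)" by (rule step[OF deck_one_closed h(1) one])
      then show "P h" using h(1) by simp
    qed
  next
    case (Suc j)
    show ?case
    proof (intro ballI impI)
      fix h assume h: "h \<in> deck" "mdist Xh (y (Suc j)) (h ph) < D + 1"
      obtain k where k: "k \<in> deck" "mdist Xh (y j) (k ph) < D + 1" using near_orbit[OF yX, of j] Suc.prems by auto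
      have Pk: "P k" using Suc k by auto
      note kX = deck_mspace[OF k(1) ph] and hX = deck_mspace[OF h(1) ph]
      have j: "j \<le> m" using Suc.prems by simp
      have "mdist Xh (h ph) (k ph) \<le> mdist Xh (h ph) (y (Suc j)) + mdist Xh (y (Suc j)) (k ph)"
        "mdist Xh (y (Suc j)) (k ph) \<le> mdist Xh (y (Suc j)) (y j) + mdist Xh (y j) (k ph)"
        by (rule mdist_triangle_le[OF hX yX[OF Suc.prems] kX], rule mdist_triangle_le[OF yX[OF Suc.prems] yX[OF j] kX])
      then have "mdist Xh (h ph) (k ph) < 2 * D + 3"
        using h(2) k(2) yy[OF Suc.prems] mdist_sym[of Xh "h ph" "y (Suc j)"] mdist_sym[of Xh "y (Suc j)" "y j"] by linarith
      then have "disp (inv\<^bsub>G\<^esub> k \<otimes>\<^bsub>G\<^esub> h) < 2 * D + 3" by (simp only: disp_diff[OF h(1) k(1)])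
      then have "P (k \<otimes>\<^bsub>G\<^esub> (inv\<^bsub>G\<^esub> k \<otimes>\<^bsub>G\<^esub> h))"
        by (rule step[OF k(1) deck_mult_closed[OF deck_inv_closed[OF k(1)] h(1)] Pk])
      moreover have "k \<otimes>\<^bsub>G\<^esub> (inv\<^bsub>G\<^esub> k \<otimes>\<^bsub>G\<^esub> h) = h" using k(1) h(1) by (simp add: G.m_assoc[symmetric] deck_inv_closed)
      ultimately show "P h" by simp
    qed
  qed
  have "y m = g ph" using c(3) m0 by (simp add: y_def)
  then have "mdist Xh (y m) (g ph) < D + 1" using mdist_self[OF deck_mspace[OF g ph]] D_nonneg by simp
  then show ?thesis using main[of m] g by simp
qed

end

section \<open>Periods of loops from partial homomorphisms\<close>

context pointed_length_covering
begin

lemma deck_eqI: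
  assumes g: "g \<in> deck" and h: "h \<in> deck" and y: "y \<in> mspace Xh" and eq: "g y = h y"
  shows "g = h"
proof -
  obtain \<delta> where \<delta>: "local_radius \<delta>" using local_radius_exists by blast
  note hi = deck_inv_closed[OF h]
  have "(inv\<^bsub>G\<^esub> h \<otimes>\<^bsub>G\<^esub> g) y = y"
    unfolding deck_mult[OF hi g y] eq by (rule deck_inv(1)[OF h y])
  then have "mdist Xh ((inv\<^bsub>G\<^esub> h \<otimes>\<^bsub>G\<^esub> g) y) y < \<delta>"
    using local_radiusD(1)[OF \<delta>] y by (simp add: mdist_self)
  from deck_displacement[OF \<delta> deck_mult_closed[OF hi g] y this]
  have "inv\<^bsub>G\<^esub> h \<otimes>\<^bsub>G\<^esub> g = \<one>\<^bsub>G\<^esub>" .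
  then have "h \<otimes>\<^bsub>G\<^esub> (inv\<^bsub>G\<^esub> h \<otimes>\<^bsub>G\<^esub> g) = h \<otimes>\<^bsub>G\<^esub> \<one>\<^bsub>G\<^esub>" by simp
  then show ?thesis using g h hi by (simp add: G.m_assoc[symmetric])
qed

text \<open>A set-theoretic section: continuity is impossible in general, and bounded distance from
  the base point is what matters. The normalisation at \<open>q ph\<close> lets the lift of a loop
  start at the identity.\<close>

lemma section_exists:
  "\<exists>\<sigma>. (\<forall>x\<in>mspace X. \<sigma> x \<in> mspace Xh \<and> q (\<sigma> x) = x \<and> mdist Xh (\<sigma> x) ph < D + 1) \<and> \<sigma> (q ph) = ph"
proof -
  have "\<exists>y. y \<in> mspace Xh \<and> q y = x \<and> mdist Xh y ph < D + 1" if x: "x \<in> mspace X" for x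
  proof -
    obtain y where y: "y \<in> mspace Xh" "q y = x" using q_surj[OF x] by (elim bexE)
    obtain g where g: "g \<in> deck" "mdist Xh y (g ph) < D + 1" using near_orbit[OF y(1)] by (elim bexE)
    note gi = deck_inv_closed[OF g(1)]
    have "mdist Xh ((inv\<^bsub>G\<^esub> g) y) ((inv\<^bsub>G\<^esub> g) (g ph)) = mdist Xh y (g ph)"
      by (rule deck_isometry[OF gi y(1) deck_mspace[OF g(1) ph]])
    then have "mdist Xh ((inv\<^bsub>G\<^esub> g) y) ph < D + 1" using g(2) unfolding deck_inv(1)[OF g(1) ph] by simp
    then show ?thesis using deck_mspace[OF gi y(1)] deck_q[OF gi y(1)] y(2)
      by (intro exI[of _ "(inv\<^bsub>G\<^esub> g) y"]) simp
  qed
  then obtain s where s: "\<forall>x\<in>mspace X. s x \<in> mspace Xh \<and> q (s x) = x \<and> mdist Xh (s x) ph < D + 1"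
    by metis
  have "ph \<in> mspace Xh \<and> q ph = q ph \<and> mdist Xh ph ph < D + 1"
    using ph D_nonneg by (simp add: mdist_self)
  then show ?thesis using s by (intro exI[of _ "\<lambda>x. if x = q ph then ph else s x"]) auto
qed

text \<open>Lifts of loops that represent \<open>g\<close>; the bound on the length confines them to
  a ball of radius \<open>disp g + 1\<close> about the base point.\<close>

definition deck_paths :: "('b \<Rightarrow> 'b) \<Rightarrow> (real \<Rightarrow> 'b) set" where
  "deck_paths g = {c. pathin (mtopology_of Xh) c \<and> c 0 = ph \<and> c 1 = g ph \<and> curve_length X (q \<circ> c) < ennreal (disp g + 1)}"

lemma deck_paths_nonempty:
  assumes g: "g \<in> deck"
  shows "\<exists>c. c \<in> deck_paths g"
proof -
  have gd: "mdist Xh ph (g ph) < disp g + 1" unfolding disp_def by (simp add: mdist_sym[of Xh ph])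
  obtain c where "pathin (mtopology_of Xh) c" "c 0 = ph" "c 1 = g ph"
    "curve_length X (q \<circ> c) < ennreal (disp g + 1)"
    by (rule short_path[OF ph deck_mspace[OF g ph] gd])
  then show ?thesis unfolding deck_paths_def by (intro exI CollectI conjI)
qed

lemma deck_path_loop:
  assumes g: "g \<in> deck" and c: "c \<in> deck_paths g"
  shows "q \<circ> c \<in> loops_at (mtopology_of X) (q ph)"
proof -
  have c: "pathin (mtopology_of Xh) c" "c 0 = ph" "c 1 = g ph" using c by (auto simp: deck_paths_def)
  show ?thesis
    using continuous_map_compose[OF c(1)[unfolded pathin_def] q_continuous] c(2,3) deck_q[OF g ph]
    unfolding loops_at_def pathin_def by simp
qed

text \<open>A function on the small deck transformations that is additive wherever this makes sense gives
  a local cocycle on the base, and hence a homomorphism on the fundamental group.\<close>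

lemma deck_cocycle_periods:
  fixes F :: "('b \<Rightarrow> 'b) \<Rightarrow> int"
  assumes r: "2 * D + 3 \<le> r"
    and F: "\<And>g h. \<lbrakk>g \<in> deck; h \<in> deck; disp g < r; disp h < r; disp (g \<otimes>\<^bsub>G\<^esub> h) < r\<rbrakk> \<Longrightarrow> F (g \<otimes>\<^bsub>G\<^esub> h) = F g + F h"
  shows "\<exists>\<omega> \<kappa>. local_cocycle X \<kappa> \<omega> \<and>
    (\<forall>g\<in>deck. disp g + D + 2 \<le> r \<longrightarrow> (\<forall>c\<in>deck_paths g. period \<omega> (q \<circ> c) = F g))"
proof -
  obtain \<delta> where \<delta>: "local_radius \<delta>" "\<delta> \<le> 1" using local_radius_exists by blast
  note \<delta>D = local_radiusD[OF \<delta>(1)]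
  obtain \<sigma> where \<sigma>: "\<forall>x\<in>mspace X. \<sigma> x \<in> mspace Xh \<and> q (\<sigma> x) = x \<and> mdist Xh (\<sigma> x) ph < D + 1"
    and \<sigma>p: "\<sigma> (q ph) = ph" using section_exists by (elim exE conjE)
  have \<sigma>X: "\<sigma> x \<in> mspace Xh" and \<sigma>q: "q (\<sigma> x) = x" and \<sigma>d: "mdist Xh (\<sigma> x) ph < D + 1"
    if "x \<in> mspace X" for x using \<sigma> that by auto
  \<comment> \<open>The transition of the section from \<open>x\<close> to \<open>y\<close>. Choice
    is harmless, because the transformation is unique at scale \<delta>.\<close>
  define \<gamma> where "\<gamma> x y = (SOME g. g \<in> deck \<and> mdist Xh (\<sigma> x) (g (\<sigma> y)) \<le> mdist X x y)" for x y
  have \<gamma>: "\<gamma> x y \<in> deck" "mdist Xh (\<sigma> x) (\<gamma> x y (\<sigma> y)) \<le> mdist X x y"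
    if x: "x \<in> mspace X" and y: "y \<in> mspace X" and d: "mdist X x y < \<delta>" for x y
  proof -
    have "mdist X (q (\<sigma> x)) y < \<delta>" using d \<sigma>q[OF x] by simp
    from \<delta>D(2)[OF \<sigma>X[OF x] y this]
    obtain z where z: "z \<in> mspace Xh" "q z = y" "mdist Xh (\<sigma> x) z \<le> mdist X (q (\<sigma> x)) y" by (elim bexE conjE)
    have "q (\<sigma> y) = q z" using \<sigma>q[OF y] z(2) by simp
    then obtain g where g: "g \<in> deck" "g (\<sigma> y) = z" using deck_transitive[OF \<sigma>X[OF y] z(1)] by auto
    have "g \<in> deck \<and> mdist Xh (\<sigma> x) (g (\<sigma> y)) \<le> mdist X x y" using g z(3) \<sigma>q[OF x] by simp
    then have "\<gamma> x y \<in> deck \<and> mdist Xh (\<sigma> x) (\<gamma> x y (\<sigma> y)) \<le> mdist X x y"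
      unfolding \<gamma>_def by (rule someI[of "\<lambda>g. g \<in> deck \<and> mdist Xh (\<sigma> x) (g (\<sigma> y)) \<le> mdist X x y"])
    then show "\<gamma> x y \<in> deck" "mdist Xh (\<sigma> x) (\<gamma> x y (\<sigma> y)) \<le> mdist X x y" by auto
  qed
  have \<gamma>_unique: "\<gamma> x y = g"
    if x: "x \<in> mspace X" and y: "y \<in> mspace X" and d: "mdist X x y < \<delta>"
      and g: "g \<in> deck" "mdist Xh (\<sigma> x) (g (\<sigma> y)) < \<delta>" for x y g
  proof (rule deck_eqI[OF \<gamma>(1)[OF x y d] g(1) \<sigma>X[OF y]])
    note gy = deck_mspace[OF \<gamma>(1)[OF x y d] \<sigma>X[OF y]] deck_mspace[OF g(1) \<sigma>X[OF y]]
    show "\<gamma> x y (\<sigma> y) = g (\<sigma> y)"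
      by (rule \<delta>D(3)[OF \<sigma>X[OF x] gy le_less_trans[OF \<gamma>(2)[OF x y d] d] g(2)])
        (simp only: deck_q[OF \<gamma>(1)[OF x y d] \<sigma>X[OF y]] deck_q[OF g(1) \<sigma>X[OF y]])
  qed
  \<comment> \<open>Each of the two section points contributes \<open>D + 1\<close>, and the step
    between them less than \<open>\<delta> \<le> 1\<close>; hence \<open>2 * D + 3\<close>.\<close>
  have \<gamma>_disp: "disp (\<gamma> x y) < r" if x: "x \<in> mspace X" and y: "y \<in> mspace X" and d: "mdist X x y < \<delta>" for x y
  proof -
    note g = \<gamma>[OF x y d]
    note gp = deck_mspace[OF g(1) ph] and gy = deck_mspace[OF g(1) \<sigma>X[OF y]]
    have "mdist Xh (\<gamma> x y ph) ph \<le> mdist Xh (\<gamma> x y ph) (\<gamma> x y (\<sigma> y)) + mdist Xh (\<gamma> x y (\<sigma> y)) ph"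
      "mdist Xh (\<gamma> x y (\<sigma> y)) ph \<le> mdist Xh (\<gamma> x y (\<sigma> y)) (\<sigma> x) + mdist Xh (\<sigma> x) ph"
      by (rule mdist_triangle_le[OF gp gy ph], rule mdist_triangle_le[OF gy \<sigma>X[OF x] ph])
    moreover have "mdist Xh (\<gamma> x y ph) (\<gamma> x y (\<sigma> y)) = mdist Xh (\<sigma> y) ph"
      unfolding deck_isometry[OF g(1) ph \<sigma>X[OF y]] by (rule mdist_sym)
    ultimately show ?thesis
      using g(2) d \<delta>(2) \<sigma>d[OF x] \<sigma>d[OF y] r mdist_sym[of Xh "\<gamma> x y (\<sigma> y)" "\<sigma> x"] unfolding disp_def by linarith
  qed
  define \<omega> where "\<omega> x y = F (\<gamma> x y)" for x y
  \<comment> \<open>Two steps below \<open>\<delta> / 3\<close> keep a composed transition inside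
    the radius of uniqueness, so transitions multiply; \<gamma> itself is an honest group-valued
    cocycle, of which \<open>F\<close> takes values.\<close>
  have "local_cocycle X (\<delta> / 3) \<omega>"
    unfolding local_cocycle_def
  proof (intro conjI ballI impI)
    show "0 < \<delta> / 3" using \<delta>D(1) by simp
    fix x y z assume x: "x \<in> mspace X" and y: "y \<in> mspace X" and z: "z \<in> mspace X"
      and d: "mdist X x y < \<delta> / 3" "mdist X y z < \<delta> / 3" "mdist X x z < \<delta> / 3"
    then have d': "mdist X x y < \<delta>" "mdist X y z < \<delta>" "mdist X x z < \<delta>" using \<delta>D(1) by auto
    note g1 = \<gamma>[OF x y d'(1)] and g2 = \<gamma>[OF y z d'(2)]
    note g1y = deck_mspace[OF g1(1) \<sigma>X[OF y]] and g2z = deck_mspace[OF g2(1) \<sigma>X[OF z]]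
    have "mdist Xh (\<sigma> x) (\<gamma> x y (\<gamma> y z (\<sigma> z))) \<le> mdist Xh (\<sigma> x) (\<gamma> x y (\<sigma> y)) + mdist Xh (\<gamma> x y (\<sigma> y)) (\<gamma> x y (\<gamma> y z (\<sigma> z)))"
      by (rule mdist_triangle_le[OF \<sigma>X[OF x] g1y deck_mspace[OF g1(1) g2z]])
    also have "mdist Xh (\<gamma> x y (\<sigma> y)) (\<gamma> x y (\<gamma> y z (\<sigma> z))) = mdist Xh (\<sigma> y) (\<gamma> y z (\<sigma> z))"
      by (rule deck_isometry[OF g1(1) \<sigma>X[OF y] g2z])
    finally have "mdist Xh (\<sigma> x) ((\<gamma> x y \<otimes>\<^bsub>G\<^esub> \<gamma> y z) (\<sigma> z)) < \<delta>"
      unfolding deck_mult[OF g1(1) g2(1) \<sigma>X[OF z]] using g1(2) g2(2) d \<delta>D(1) by linarith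
    from \<gamma>_unique[OF x z d'(3) deck_mult_closed[OF g1(1) g2(1)] this]
    have eq: "\<gamma> x z = \<gamma> x y \<otimes>\<^bsub>G\<^esub> \<gamma> y z" .
    show "\<omega> x z = \<omega> x y + \<omega> y z"
      unfolding \<omega>_def eq
      by (rule F[OF g1(1) g2(1) \<gamma>_disp[OF x y d'(1)] \<gamma>_disp[OF y z d'(2)]])
        (use \<gamma>_disp[OF x z d'(3)] eq in simp)
  qed
  moreover have "period \<omega> (q \<circ> c) = F g"
    if g: "g \<in> deck" and gr: "disp g + D + 2 \<le> r" and cg: "c \<in> deck_paths g" for g c
  proof -
    have c: "pathin (mtopology_of Xh) c" "c 0 = ph" "c 1 = g ph"
      "curve_length X (q \<circ> c) < ennreal (disp g + 1)" using cg by (auto simp: deck_paths_def)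
    have cX: "c t \<in> mspace Xh" if "t \<in> {0..1}" for t by (rule pathin_mspace[OF c(1) that])
    note qX = q_mspace[OF cX]
    have cd: "mdist Xh ph (c t) < disp g + 1" if t: "t \<in> {0..1}" for t
    proof -
      have "0 \<le> t" "t \<le> 1" using t by auto
      from le_less_trans[OF mdist_split_le[OF c(1) this] c(4)]
      have "mdist Xh (c 0) (c t) + mdist Xh (c t) (c 1) < disp g + 1"
        by (subst (asm) ennreal_less_iff) (intro add_nonneg_nonneg mdist_ge_0)
      then show ?thesis using mdist_ge_0[of Xh "c t" "c 1"] unfolding c(2) by linarith
    qed
    have "\<exists>h\<in>deck. h (\<sigma> (q (c t))) = c t" if t: "t \<in> {0..1}" for t
      by (rule deck_transitive[OF \<sigma>X[OF qX[OF t]] cX[OF t] \<sigma>q[OF qX[OF t]]])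
    then obtain h where h: "\<And>t. t \<in> {0..1} \<Longrightarrow> h t \<in> deck \<and> h t (\<sigma> (q (c t))) = c t" by metis
    \<comment> \<open>The section contributes \<open>D + 1\<close> and the path
      \<open>disp g + 1\<close>; this is the source of \<open>D + 2\<close> in the condition on
      \<open>g\<close>.\<close>
    have hdisp: "disp (h t) < r" if t: "t \<in> {0..1}" for t
    proof -
      note ht = conjunct1[OF h[OF t]] conjunct2[OF h[OF t]] and s = \<sigma>X[OF qX[OF t]]
      have "mdist Xh (h t ph) ph \<le> mdist Xh (h t ph) (c t) + mdist Xh (c t) ph"
        by (rule mdist_triangle_le[OF deck_mspace[OF ht(1) ph] cX[OF t] ph])
      moreover have "mdist Xh (h t ph) (c t) = mdist Xh (\<sigma> (q (c t))) ph"
        using deck_isometry[OF ht(1) ph s] unfolding ht(2) mdist_sym[of Xh ph "\<sigma> (q (c t))"] .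
      ultimately show ?thesis
        using \<sigma>d[OF qX[OF t]] cd[OF t] gr mdist_sym[of Xh ph "c t"] unfolding disp_def by linarith
    qed
    obtain \<eta> where \<eta>: "\<eta> > 0" "\<forall>s\<in>{0..1}. \<forall>t\<in>{0..1}. dist s t < \<eta> \<longrightarrow> mdist Xh (c s) (c t) < \<delta>"
      using uniform_continuity_into_metric[OF compact_Icc c(1)[unfolded pathin_def] \<delta>D(1)] by (elim exE conjE)
    \<comment> \<open>Here \<open>h t\<close> tells on which translate of the section the path lies
      at time \<open>t\<close>. The quotient of two nearby values is the transition \<gamma>, so
      \<open>F\<close> of it is a potential, rising from the identity to \<open>g\<close>.\<close>
    have pot: "potential_on {0..1} (\<lambda>s t. \<omega> ((q \<circ> c) s) ((q \<circ> c) t)) (\<lambda>t. F (h t))"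
      unfolding potential_on_def
    proof (rule exI[of _ \<eta>], intro conjI \<eta>(1) ballI impI)
      fix s t :: real assume s: "s \<in> {0..1}" and t: "t \<in> {0..1}" and st: "dist s t < \<eta>"
      have d: "mdist Xh (c s) (c t) < \<delta>" using \<eta>(2) s t st by simp
      have qd: "mdist X (q (c s)) (q (c t)) < \<delta>"
        by (rule le_less_trans[OF q_nonexpansive[OF cX[OF s] cX[OF t]] d])
      note hs = conjunct1[OF h[OF s]] conjunct2[OF h[OF s]] and ht = conjunct1[OF h[OF t]] conjunct2[OF h[OF t]]
      note ss = \<sigma>X[OF qX[OF s]] and st = \<sigma>X[OF qX[OF t]]
      note hsi = deck_inv_closed[OF hs(1)]
      have "mdist Xh ((inv\<^bsub>G\<^esub> (h s)) (c s)) ((inv\<^bsub>G\<^esub> (h s)) (c t)) = mdist Xh (c s) (c t)"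
        by (rule deck_isometry[OF hsi cX[OF s] cX[OF t]])
      moreover have "(inv\<^bsub>G\<^esub> (h s)) (c s) = \<sigma> (q (c s))"
        using deck_inv(1)[OF hs(1) ss] hs(2) by simp
      moreover have "(inv\<^bsub>G\<^esub> (h s)) (c t) = (inv\<^bsub>G\<^esub> (h s) \<otimes>\<^bsub>G\<^esub> h t) (\<sigma> (q (c t)))"
        unfolding deck_mult[OF hsi ht(1) st] ht(2) ..
      ultimately have "mdist Xh (\<sigma> (q (c s))) ((inv\<^bsub>G\<^esub> (h s) \<otimes>\<^bsub>G\<^esub> h t) (\<sigma> (q (c t)))) < \<delta>"
        using d by simp
      from \<gamma>_unique[OF qX[OF s] qX[OF t] qd deck_mult_closed[OF hsi ht(1)] this]
      have eq: "\<gamma> (q (c s)) (q (c t)) = inv\<^bsub>G\<^esub> (h s) \<otimes>\<^bsub>G\<^esub> h t" .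
      note gd = \<gamma>(1)[OF qX[OF s] qX[OF t] qd]
      have ht_eq: "h s \<otimes>\<^bsub>G\<^esub> \<gamma> (q (c s)) (q (c t)) = h t"
        unfolding eq using hs(1) ht(1) hsi by (simp add: G.m_assoc[symmetric])
      have "F (h s \<otimes>\<^bsub>G\<^esub> \<gamma> (q (c s)) (q (c t))) = F (h s) + F (\<gamma> (q (c s)) (q (c t)))"
        by (rule F[OF hs(1) gd hdisp[OF s] \<gamma>_disp[OF qX[OF s] qX[OF t] qd]]) (simp only: ht_eq hdisp[OF t])
      then show "F (h t) - F (h s) = \<omega> ((q \<circ> c) s) ((q \<circ> c) t)"
        unfolding ht_eq \<omega>_def o_def by simp
    qed
    have i: "(0::real) \<in> {0..1}" "(1::real) \<in> {0..1}" by auto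
    have "h 0 = \<one>\<^bsub>G\<^esub>"
      using h[OF i(1)] c(2) \<sigma>p by (intro deck_eqI[OF _ deck_one_closed ph]) (simp_all add: deck_one[OF ph])
    moreover have "h 1 = g"
      using h[OF i(2)] c(3) \<sigma>p deck_q[OF g ph] by (intro deck_eqI[OF _ g ph]) simp_all
    moreover have "F \<one>\<^bsub>G\<^esub> = 0"
    proof -
      have "disp \<one>\<^bsub>G\<^esub> < r" using r D_nonneg disp_one by simp
      then have "F (\<one>\<^bsub>G\<^esub> \<otimes>\<^bsub>G\<^esub> \<one>\<^bsub>G\<^esub>) = F \<one>\<^bsub>G\<^esub> + F \<one>\<^bsub>G\<^esub>"
        by (intro F deck_one_closed) (simp_all only: G.l_one[OF G.one_closed])
      then show ?thesis unfolding G.l_one[OF G.one_closed] by simp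
    qed
    ultimately show "period \<omega> (q \<circ> c) = F g" using period_eq[of \<omega> "q \<circ> c", OF pot] by simp
  qed
  ultimately show ?thesis by (intro exI[of _ \<omega>] exI[of _ "\<delta> / 3"] conjI ballI impI)
qed

end

section \<open>Almost equivariant maps\<close>

text \<open>Ordered products, because \<open>C\<close>, and with it the limit group, may be
  noncommutative. Only on the deck group, which is abelian, are they additive in the
  exponents.\<close>

primrec zprod :: "('a, 'b) monoid_scheme \<Rightarrow> (nat \<Rightarrow> 'a) \<Rightarrow> nat \<Rightarrow> (nat \<Rightarrow> int) \<Rightarrow> 'a" where
  "zprod G e 0 a = \<one>\<^bsub>G\<^esub>"
| "zprod G e (Suc n) a = zprod G e n a \<otimes>\<^bsub>G\<^esub> e n [^]\<^bsub>G\<^esub> a n"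

lemma (in group) zprod_closed: "(\<And>j. j < n \<Longrightarrow> e j \<in> carrier G) \<Longrightarrow> zprod G e n a \<in> carrier G"
  by (induction n) auto

lemma zprod_cong: "(\<And>j. j < n \<Longrightarrow> a j = b j) \<Longrightarrow> zprod G e n a = zprod G e n b"
  by (induction n) auto

lemma (in comm_group) zprod_add:
  "(\<And>j. j < n \<Longrightarrow> e j \<in> carrier G) \<Longrightarrow> zprod G e n (\<lambda>j. a j + b j) = zprod G e n a \<otimes> zprod G e n b"
proof (induction n)
  case (Suc n)
  have c: "zprod G e n a \<in> carrier G" "zprod G e n b \<in> carrier G" "e n \<in> carrier G"
    using Suc.prems by (auto intro: zprod_closed)
  have IH: "zprod G e n (\<lambda>j. a j + b j) = zprod G e n a \<otimes> zprod G e n b" using Suc by simp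
  show ?case using c by (simp add: IH int_pow_mult m_ac)
qed simp

lemma (in group) zprod_unit:
  assumes "\<And>j. j < n \<Longrightarrow> e j \<in> carrier G" "i < n"
  shows "zprod G e n (\<lambda>j. if j = i then 1 else 0) = e i"
proof -
  have "zprod G e m (\<lambda>j. if j = i then 1 else 0) = (if i < m then e i else \<one>)" if "m \<le> n" for m
    using that assms by (induction m) (auto simp: less_Suc_eq)
  then show ?thesis using assms(2) by simp
qed

lemma isometriesD:
  assumes "h \<in> isometries Z"
  shows "h \<in> Bij (mspace Z)" "\<And>x. x \<in> mspace Z \<Longrightarrow> h x \<in> mspace Z"
    "\<And>x y. x \<in> mspace Z \<Longrightarrow> y \<in> mspace Z \<Longrightarrow> mdist Z (h x) (h y) = mdist Z x y"
  using assms unfolding isometries_def Bij_def by (auto simp: bij_betw_def)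

lemma subgroup_isometries: "subgroup (isometries Z) (BijGroup (mspace Z))"
proof (rule subgroup.intro)
  let ?S = "mspace Z" and ?B = "BijGroup (mspace Z)"
  show "isometries Z \<subseteq> carrier ?B" using isometriesD(1) by (auto simp: BijGroup_def)
  fix g h assume g: "g \<in> isometries Z" and h: "h \<in> isometries Z"
  note gD = isometriesD[OF g] and hD = isometriesD[OF h]
  have gh: "g \<otimes>\<^bsub>?B\<^esub> h = compose ?S g h" using gD(1) hD(1) by (simp add: BijGroup_def)
  show "g \<otimes>\<^bsub>?B\<^esub> h \<in> isometries Z"
    unfolding gh isometries_def using compose_Bij[OF gD(1) hD(1)] gD(3) hD(2,3) by (simp add: compose_def)
next
  show "\<one>\<^bsub>BijGroup (mspace Z)\<^esub> \<in> isometries Z" by (simp add: BijGroup_def isometries_def id_Bij)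
next
  let ?S = "mspace Z"
  fix h assume h: "h \<in> isometries Z"
  note hD = isometriesD[OF h]
  have bij: "bij_betw h ?S ?S" using hD(1) by (simp add: Bij_def)
  have i: "inv_into ?S h x \<in> ?S" "h (inv_into ?S h x) = x" if "x \<in> ?S" for x
    using bij that by (auto simp: bij_betw_def f_inv_into_f inv_into_into)
  show "inv\<^bsub>BijGroup ?S\<^esub> h \<in> isometries Z"
    unfolding inv_BijGroup[OF hD(1)] isometries_def
  proof (simp add: restrict_inv_into_Bij[OF hD(1)], intro ballI)
    fix x y assume xy: "x \<in> ?S" "y \<in> ?S"
    show "mdist Z (inv_into ?S h x) (inv_into ?S h y) = mdist Z x y"
      using hD(3)[OF i(1)[OF xy(1)] i(1)[OF xy(2)]] unfolding i(2)[OF xy(1)] i(2)[OF xy(2)] by (rule sym)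
  qed
qed

lemma group_isometry_group: "group (isometry_group Z)"
  unfolding isometry_group_def by (rule group.subgroup_imp_group[OF group_BijGroup subgroup_isometries])

locale isometric_action =
  fixes Y :: "'c metric" and yh :: 'c and H :: "('c \<Rightarrow> 'c) set"
  assumes yh: "yh \<in> mspace Y" and subgroup_H: "subgroup H (isometry_group Y)"
begin

abbreviation "HG \<equiv> isometry_group Y \<lparr>carrier := H\<rparr>"

sublocale HG: group HG
  by (rule group.subgroup_imp_group[OF group_isometry_group subgroup_H])

lemma H_isometries: "h \<in> H \<Longrightarrow> h \<in> isometries Y"
  using subgroup.subset[OF subgroup_H] by (auto simp: isometry_group_def)

lemma H_mspace: "h \<in> H \<Longrightarrow> y \<in> mspace Y \<Longrightarrow> h y \<in> mspace Y"
  by (rule isometriesD(2)[OF H_isometries])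

lemma H_isometry: "h \<in> H \<Longrightarrow> x \<in> mspace Y \<Longrightarrow> y \<in> mspace Y \<Longrightarrow> mdist Y (h x) (h y) = mdist Y x y"
  by (rule isometriesD(3)[OF H_isometries])

lemma H_mult: "g \<in> H \<Longrightarrow> h \<in> H \<Longrightarrow> y \<in> mspace Y \<Longrightarrow> (g \<otimes>\<^bsub>HG\<^esub> h) y = g (h y)"
  using isometriesD(1)[OF H_isometries, of g] isometriesD(1)[OF H_isometries, of h]
  by (simp add: isometry_group_def BijGroup_def compose_def)

lemma H_one: "y \<in> mspace Y \<Longrightarrow> \<one>\<^bsub>HG\<^esub> y = y"
  by (simp add: isometry_group_def BijGroup_def)

lemma H_mult_closed: "g \<in> H \<Longrightarrow> h \<in> H \<Longrightarrow> g \<otimes>\<^bsub>HG\<^esub> h \<in> H"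
  using HG.m_closed[of g h] by simp

lemma H_inv_closed: "h \<in> H \<Longrightarrow> inv\<^bsub>HG\<^esub> h \<in> H"
  using HG.inv_closed[of h] by simp

lemma H_one_closed: "\<one>\<^bsub>HG\<^esub> \<in> H"
  using HG.one_closed by simp

lemma H_inv: "h \<in> H \<Longrightarrow> y \<in> mspace Y \<Longrightarrow> (inv\<^bsub>HG\<^esub> h) (h y) = y"
  using H_mult[OF H_inv_closed, of h h y] HG.l_inv[of h] H_one[of y] by simp

definition dispY :: "('c \<Rightarrow> 'c) \<Rightarrow> real" where
  "dispY h = mdist Y (h yh) yh"

end

locale approximated_action = pointed_length_covering X Xh q ph D + isometric_action Y yh H
  for X :: "'a metric" and Xh :: "'b metric" and q :: "'b \<Rightarrow> 'a" and ph D
    and Y :: "'c metric" and yh :: 'c and H +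
  fixes \<epsilon> :: real and f :: "'b \<Rightarrow> 'c" and \<phi> :: "('b \<Rightarrow> 'b) \<Rightarrow> ('c \<Rightarrow> 'c)" and \<psi> :: "('c \<Rightarrow> 'c) \<Rightarrow> ('b \<Rightarrow> 'b)"
  assumes \<epsilon>: "0 < \<epsilon>"
    and approx: "eGH_approximation \<epsilon> Xh ph deck Y yh H f \<phi> \<psi>"
begin

lemma f_mspace: "z \<in> mspace Xh \<Longrightarrow> mdist Xh z ph < 1 / \<epsilon> \<Longrightarrow> f z \<in> mspace Y"
  using approx ph unfolding eGH_approximation_def Let_def
  by (auto simp: Pi_iff in_mball_of mdist_sym[of Xh ph])

lemma f_ph: "f ph = yh"
  using approx unfolding eGH_approximation_def Let_def by simp

lemma f_distortion:
  assumes "z \<in> mspace Xh" "mdist Xh z ph < 1 / \<epsilon>" "w \<in> mspace Xh" "mdist Xh w ph < 1 / \<epsilon>"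
  shows "\<bar>mdist Y (f z) (f w) - mdist Xh z w\<bar> \<le> \<epsilon>"
proof -
  have "\<forall>x1\<in>mball_of Xh ph (1 / \<epsilon>). \<forall>x2\<in>mball_of Xh ph (1 / \<epsilon>). \<bar>mdist Y (f x1) (f x2) - mdist Xh x1 x2\<bar> \<le> \<epsilon>"
    using approx unfolding eGH_approximation_def Let_def by simp
  then show ?thesis using assms ph by (simp add: in_mball_of mdist_sym[of Xh ph])
qed

text \<open>Here \<alpha> is the error and \<beta> a displacement budget: the estimate is claimed
  only at points that \<open>g\<close> keeps inside the domain of \<open>f\<close>. The maps \<phi>
  and \<psi> need not be homomorphisms; instead, pairs related by \<open>f\<close> are multiplied,
  and errors and budgets add.\<close>

definition almost_equivariant :: "('b \<Rightarrow> 'b) \<Rightarrow> ('c \<Rightarrow> 'c) \<Rightarrow> real \<Rightarrow> real \<Rightarrow> bool" where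
  "almost_equivariant g h \<alpha> \<beta> \<longleftrightarrow> g \<in> deck \<and> h \<in> H \<and> disp g \<le> \<beta> \<and>
     (\<forall>z\<in>mspace Xh. mdist Xh z ph + \<beta> < 1 / \<epsilon> \<longrightarrow> mdist Y (h (f z)) (f (g z)) \<le> \<alpha>)"

lemma almost_equivariantD:
  assumes "almost_equivariant g h \<alpha> \<beta>"
  shows "g \<in> deck" "h \<in> H" "disp g \<le> \<beta>" "0 \<le> \<beta>"
    "\<And>z. z \<in> mspace Xh \<Longrightarrow> mdist Xh z ph + \<beta> < 1 / \<epsilon> \<Longrightarrow> mdist Y (h (f z)) (f (g z)) \<le> \<alpha>"
proof -
  show "g \<in> deck" "h \<in> H" and b: "disp g \<le> \<beta>" using assms unfolding almost_equivariant_def by auto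
  show "0 \<le> \<beta>" using b mdist_ge_0[of Xh "g ph" ph] unfolding disp_def by linarith
  show "\<And>z. z \<in> mspace Xh \<Longrightarrow> mdist Xh z ph + \<beta> < 1 / \<epsilon> \<Longrightarrow> mdist Y (h (f z)) (f (g z)) \<le> \<alpha>"
    using assms unfolding almost_equivariant_def by simp
qed

lemma almost_equivariant_mono: "almost_equivariant g h \<alpha> \<beta> \<Longrightarrow> \<alpha> \<le> \<alpha>' \<Longrightarrow> \<beta> \<le> \<beta>' \<Longrightarrow> almost_equivariant g h \<alpha>' \<beta>'"
  unfolding almost_equivariant_def by (fastforce intro: order_trans)

lemma deck_displaced:
  assumes g: "g \<in> deck" and z: "z \<in> mspace Xh"
  shows "mdist Xh (g z) ph \<le> mdist Xh z ph + disp g"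
  using mdist_triangle_le[OF deck_mspace[OF g z] deck_mspace[OF g ph] ph]
  unfolding deck_isometry[OF g z ph] disp_def .

lemma almost_equivariant_mult:
  assumes 1: "almost_equivariant g h \<alpha> \<beta>" and 2: "almost_equivariant g' h' \<alpha>' \<beta>'"
  shows "almost_equivariant (g \<otimes>\<^bsub>G\<^esub> g') (h \<otimes>\<^bsub>HG\<^esub> h') (\<alpha> + \<alpha>') (\<beta> + \<beta>')"
  unfolding almost_equivariant_def
proof (intro conjI ballI impI)
  note a = almost_equivariantD[OF 1] and b = almost_equivariantD[OF 2]
  show "g \<otimes>\<^bsub>G\<^esub> g' \<in> deck" by (rule deck_mult_closed[OF a(1) b(1)])
  show "h \<otimes>\<^bsub>HG\<^esub> h' \<in> H" by (rule H_mult_closed[OF a(2) b(2)])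
  show "disp (g \<otimes>\<^bsub>G\<^esub> g') \<le> \<beta> + \<beta>'" using disp_mult[OF a(1) b(1)] a(3) b(3) by linarith
  fix z assume z: "z \<in> mspace Xh" and d: "mdist Xh z ph + (\<beta> + \<beta>') < 1 / \<epsilon>"
  have gz: "g' z \<in> mspace Xh" by (rule deck_mspace[OF b(1) z])
  have d1: "mdist Xh (g' z) ph + \<beta> < 1 / \<epsilon>" using deck_displaced[OF b(1) z] b(3) d by linarith
  have d2: "mdist Xh z ph + \<beta>' < 1 / \<epsilon>" using d a(4) by linarith
  have fz: "f z \<in> mspace Y" using d a(4) b(4) by (intro f_mspace[OF z]) linarith
  have fgz: "f (g' z) \<in> mspace Y" using d1 a(4) by (intro f_mspace[OF gz]) linarith
  have ggz: "g (g' z) \<in> mspace Xh" by (rule deck_mspace[OF a(1) gz])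
  have fggz: "f (g (g' z)) \<in> mspace Y"
    using deck_displaced[OF a(1) gz] a(3) d1 by (intro f_mspace[OF ggz]) linarith
  have "mdist Y (h (h' (f z))) (f (g (g' z))) \<le> mdist Y (h (h' (f z))) (h (f (g' z))) + mdist Y (h (f (g' z))) (f (g (g' z)))"
    by (rule mdist_triangle_le[OF H_mspace[OF a(2) H_mspace[OF b(2) fz]] H_mspace[OF a(2) fgz] fggz])
  also have "mdist Y (h (h' (f z))) (h (f (g' z))) = mdist Y (h' (f z)) (f (g' z))"
    by (rule H_isometry[OF a(2) H_mspace[OF b(2) fz] fgz])
  finally show "mdist Y ((h \<otimes>\<^bsub>HG\<^esub> h') (f z)) (f ((g \<otimes>\<^bsub>G\<^esub> g') z)) \<le> \<alpha> + \<alpha>'"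
    unfolding H_mult[OF a(2) b(2) fz] deck_mult[OF a(1) b(1) z]
    using a(5)[OF gz d1] b(5)[OF z d2] by linarith
qed

text \<open>The estimate for \<open>g\<close> is applied at the preimage of \<open>z\<close>, which
  is up to \<beta> further out and needs a further \<beta> of room; hence the doubled budget and the
  unchanged error.\<close>

lemma almost_equivariant_inv:
  assumes 1: "almost_equivariant g h \<alpha> \<beta>"
  shows "almost_equivariant (inv\<^bsub>G\<^esub> g) (inv\<^bsub>HG\<^esub> h) \<alpha> (2 * \<beta>)"
  unfolding almost_equivariant_def
proof (intro conjI ballI impI)
  note a = almost_equivariantD[OF 1]
  show "inv\<^bsub>G\<^esub> g \<in> deck" by (rule deck_inv_closed[OF a(1)])
  show "inv\<^bsub>HG\<^esub> h \<in> H" by (rule H_inv_closed[OF a(2)])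
  show "disp (inv\<^bsub>G\<^esub> g) \<le> 2 * \<beta>" using disp_inv[OF a(1)] a(3,4) by linarith
  fix z assume z: "z \<in> mspace Xh" and d: "mdist Xh z ph + 2 * \<beta> < 1 / \<epsilon>"
  let ?w = "(inv\<^bsub>G\<^esub> g) z"
  have w: "?w \<in> mspace Xh" by (rule deck_mspace[OF deck_inv_closed[OF a(1)] z])
  have dw: "mdist Xh ?w ph + \<beta> < 1 / \<epsilon>"
    using deck_displaced[OF deck_inv_closed[OF a(1)] z] disp_inv[OF a(1)] a(3) d by linarith
  have fw: "f ?w \<in> mspace Y" using dw a(4) by (intro f_mspace[OF w]) linarith
  have fz: "f z \<in> mspace Y" using d a(4) by (intro f_mspace[OF z]) linarith
  have "mdist Y (h (f ?w)) (f z) \<le> \<alpha>" using a(5)[OF w dw] unfolding deck_inv(2)[OF a(1) z] .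
  moreover have "mdist Y ((inv\<^bsub>HG\<^esub> h) (h (f ?w))) ((inv\<^bsub>HG\<^esub> h) (f z)) = mdist Y (h (f ?w)) (f z)"
    by (rule H_isometry[OF H_inv_closed[OF a(2)] H_mspace[OF a(2) fw] fz])
  ultimately have "mdist Y (f ?w) ((inv\<^bsub>HG\<^esub> h) (f z)) \<le> \<alpha>" unfolding H_inv[OF a(2) fw] by simp
  then show "mdist Y ((inv\<^bsub>HG\<^esub> h) (f z)) (f ?w) \<le> \<alpha>" unfolding mdist_sym[of Y "f ?w"] .
qed

lemma almost_equivariant_one: "almost_equivariant \<one>\<^bsub>G\<^esub> \<one>\<^bsub>HG\<^esub> 0 0"
  unfolding almost_equivariant_def
proof (intro conjI ballI impI)
  fix z assume z: "z \<in> mspace Xh" and d: "mdist Xh z ph + 0 < 1 / \<epsilon>"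
  then have "f z \<in> mspace Y" by (intro f_mspace) auto
  then show "mdist Y (\<one>\<^bsub>HG\<^esub> (f z)) (f (\<one>\<^bsub>G\<^esub> z)) \<le> 0"
    unfolding deck_one[OF z] by (simp only: H_one mdist_self order_refl)
qed (simp_all only: deck_one_closed H_one_closed disp_one order_refl)

lemma almost_equivariant_pow: "almost_equivariant g h \<alpha> \<beta> \<Longrightarrow> almost_equivariant (g [^]\<^bsub>G\<^esub> n) (h [^]\<^bsub>HG\<^esub> n) (real n * \<alpha>) (real n * \<beta>)"
proof (induction n)
  case 0
  then show ?case using almost_equivariant_one by simp
next
  case (Suc n)
  from almost_equivariant_mult[OF Suc.IH[OF Suc.prems] Suc.prems] show ?case by (simp add: algebra_simps)
qed

lemma almost_equivariant_int_pow:
  assumes 1: "almost_equivariant g h \<alpha> \<beta>" and \<alpha>: "0 \<le> \<alpha>" and k: "\<bar>k\<bar> \<le> int K"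
  shows "almost_equivariant (g [^]\<^bsub>G\<^esub> (k::int)) (h [^]\<^bsub>HG\<^esub> k) (real K * \<alpha>) (real K * (2 * \<beta>))"
proof (cases k rule: int_cases2)
  case (nonneg m)
  have m: "real m \<le> real K" using k nonneg by simp
  have "almost_equivariant (g [^]\<^bsub>G\<^esub> k) (h [^]\<^bsub>HG\<^esub> k) (real m * \<alpha>) (real m * \<beta>)"
    using almost_equivariant_pow[OF 1, of m] unfolding nonneg by (simp only: int_pow_int)
  then show ?thesis
    by (rule almost_equivariant_mono) (use m \<alpha> almost_equivariantD(4)[OF 1] in \<open>auto intro!: mult_mono\<close>)
next
  case (nonpos m)
  have m: "real m \<le> real K" using k nonpos by simp
  have "almost_equivariant (inv\<^bsub>G\<^esub> g [^]\<^bsub>G\<^esub> m) (inv\<^bsub>HG\<^esub> h [^]\<^bsub>HG\<^esub> m) (real m * \<alpha>) (real m * (2 * \<beta>))"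
    by (rule almost_equivariant_pow[OF almost_equivariant_inv[OF 1]])
  moreover have "inv\<^bsub>G\<^esub> g [^]\<^bsub>G\<^esub> m = g [^]\<^bsub>G\<^esub> k"
    unfolding nonpos using almost_equivariantD(1)[OF 1] by (simp add: G.int_pow_neg G.nat_pow_inv int_pow_int)
  moreover have "inv\<^bsub>HG\<^esub> h [^]\<^bsub>HG\<^esub> m = h [^]\<^bsub>HG\<^esub> k"
    unfolding nonpos using almost_equivariantD(2)[OF 1] by (simp add: HG.int_pow_neg HG.nat_pow_inv int_pow_int)
  ultimately have "almost_equivariant (g [^]\<^bsub>G\<^esub> k) (h [^]\<^bsub>HG\<^esub> k) (real m * \<alpha>) (real m * (2 * \<beta>))" by simp
  then show ?thesis
    by (rule almost_equivariant_mono) (use m \<alpha> almost_equivariantD(4)[OF 1] in \<open>auto intro!: mult_mono\<close>)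
qed

lemma almost_equivariant_zprod:
  assumes e: "\<And>j. j < n \<Longrightarrow> almost_equivariant (e' j) (e j) \<alpha> \<beta>" and \<alpha>: "0 \<le> \<alpha>" and a: "\<And>j. j < n \<Longrightarrow> \<bar>a j\<bar> \<le> int K"
  shows "almost_equivariant (zprod G e' n a) (zprod HG e n a) (real (n * K) * \<alpha>) (real (n * K) * (2 * \<beta>))"
  using e a
proof (induction n)
  case 0
  then show ?case using almost_equivariant_one by simp
next
  case (Suc n)
  have 1: "almost_equivariant (zprod G e' n a) (zprod HG e n a) (real (n * K) * \<alpha>) (real (n * K) * (2 * \<beta>))"
    using Suc by simp
  have 2: "almost_equivariant (e' n [^]\<^bsub>G\<^esub> a n) (e n [^]\<^bsub>HG\<^esub> a n) (real K * \<alpha>) (real K * (2 * \<beta>))"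
    by (rule almost_equivariant_int_pow[OF Suc.prems(1) \<alpha> Suc.prems(2)]) simp_all
  from almost_equivariant_mult[OF 1 2] show ?case by (simp add: algebra_simps)
qed

lemma almost_equivariant_phi:
  assumes g: "g \<in> deck" and d: "disp g < 1 / \<epsilon>"
  shows "almost_equivariant g (\<phi> g) \<epsilon> (disp g)"
proof -
  have \<phi>: "\<phi> \<in> small_displacement Xh ph deck (1 / \<epsilon>) \<rightarrow> small_displacement Y yh H (1 / \<epsilon>)"
    and eq: "\<forall>h\<in>small_displacement Xh ph deck (1 / \<epsilon>). \<forall>x\<in>mball_of Xh ph (1 / \<epsilon>).
       h x \<in> mball_of Xh ph (1 / \<epsilon>) \<longrightarrow> mdist Y (\<phi> h (f x)) (f (h x)) < \<epsilon>"
    using approx unfolding eGH_approximation_def Let_def by auto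
  have gs: "g \<in> small_displacement Xh ph deck (1 / \<epsilon>)"
    using g d unfolding small_displacement_def disp_def by simp
  show ?thesis
    unfolding almost_equivariant_def
  proof (intro conjI ballI impI g order_refl)
    show "\<phi> g \<in> H" using \<phi> gs by (auto simp: Pi_iff small_displacement_def)
    fix z assume z: "z \<in> mspace Xh" and dz: "mdist Xh z ph + disp g < 1 / \<epsilon>"
    have "0 \<le> disp g" by (simp add: disp_def mdist_ge_0)
    then have "z \<in> mball_of Xh ph (1 / \<epsilon>)" using z dz ph by (simp add: in_mball_of mdist_sym[of Xh ph])
    moreover have "g z \<in> mball_of Xh ph (1 / \<epsilon>)"
      using deck_displaced[OF g z] dz ph deck_mspace[OF g z] by (simp add: in_mball_of mdist_sym[of Xh ph])
    ultimately show "mdist Y (\<phi> g (f z)) (f (g z)) \<le> \<epsilon>" using eq gs by (simp add: less_imp_le)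
  qed
qed

text \<open>At the base point the equivariance error \<alpha> and the distortion \<epsilon> are all
  that separates the two displacements.\<close>

lemma almost_equivariant_disp:
  assumes 1: "almost_equivariant g h \<alpha> \<beta>" and \<beta>: "\<beta> < 1 / \<epsilon>"
  shows "\<bar>disp g - dispY h\<bar> \<le> \<alpha> + \<epsilon>"
proof -
  note a = almost_equivariantD[OF 1]
  have gp: "g ph \<in> mspace Xh" by (rule deck_mspace[OF a(1) ph])
  have b: "mdist Xh ph ph + \<beta> < 1 / \<epsilon>" using \<beta> by (simp add: mdist_self[OF ph])
  have 0: "mdist Xh ph ph < 1 / \<epsilon>" using b a(4) by linarith
  have gp': "mdist Xh (g ph) ph < 1 / \<epsilon>" using a(3) \<beta> unfolding disp_def by linarith
  note fg = f_mspace[OF gp gp']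
  have 2: "mdist Y (h yh) (f (g ph)) \<le> \<alpha>" using a(5)[OF ph b] unfolding f_ph .
  have 3: "\<bar>mdist Y (f (g ph)) yh - disp g\<bar> \<le> \<epsilon>"
    using f_distortion[OF gp gp' ph 0] unfolding f_ph disp_def .
  have "mdist Y (h yh) yh \<le> mdist Y (h yh) (f (g ph)) + mdist Y (f (g ph)) yh"
    "mdist Y (f (g ph)) yh \<le> mdist Y (f (g ph)) (h yh) + mdist Y (h yh) yh"
    by (rule mdist_triangle_le[OF H_mspace[OF a(2) yh] fg yh], rule mdist_triangle_le[OF fg H_mspace[OF a(2) yh] yh])
  then show ?thesis using 2 3 mdist_sym[of Y "f (g ph)" "h yh"] unfolding dispY_def by linarith
qed

lemma almost_equivariant_psi:
  assumes h: "h \<in> H" and d: "dispY h < 1 / \<epsilon>"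
  shows "almost_equivariant (\<psi> h) h \<epsilon> (dispY h + 2 * \<epsilon>)"
proof -
  have \<psi>: "\<psi> \<in> small_displacement Y yh H (1 / \<epsilon>) \<rightarrow> small_displacement Xh ph deck (1 / \<epsilon>)"
    and eq: "\<forall>k\<in>small_displacement Y yh H (1 / \<epsilon>). \<forall>x\<in>mball_of Xh ph (1 / \<epsilon>).
       \<psi> k x \<in> mball_of Xh ph (1 / \<epsilon>) \<longrightarrow> mdist Y (k (f x)) (f (\<psi> k x)) < \<epsilon>"
    using approx unfolding eGH_approximation_def Let_def by auto
  have hs: "h \<in> small_displacement Y yh H (1 / \<epsilon>)"
    using h d unfolding small_displacement_def dispY_def by simp
  have "\<psi> h \<in> small_displacement Xh ph deck (1 / \<epsilon>)" using \<psi> hs by (simp add: Pi_iff)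
  then have g: "\<psi> h \<in> deck" "disp (\<psi> h) < 1 / \<epsilon>" by (simp_all add: small_displacement_def disp_def)
  have main: "mdist Y (h (f z)) (f (\<psi> h z)) \<le> \<epsilon>"
    if z: "z \<in> mspace Xh" and dz: "mdist Xh z ph + disp (\<psi> h) < 1 / \<epsilon>" for z
  proof -
    have "0 \<le> disp (\<psi> h)" by (simp add: disp_def mdist_ge_0)
    then have "z \<in> mball_of Xh ph (1 / \<epsilon>)" using z dz ph by (simp add: in_mball_of mdist_sym[of Xh ph])
    moreover have "\<psi> h z \<in> mball_of Xh ph (1 / \<epsilon>)"
      using deck_displaced[OF g(1) z] dz ph deck_mspace[OF g(1) z] by (simp add: in_mball_of mdist_sym[of Xh ph])
    ultimately show ?thesis using eq hs by (simp add: less_imp_le)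
  qed
  then have 1: "almost_equivariant (\<psi> h) h \<epsilon> (disp (\<psi> h))" unfolding almost_equivariant_def using g(1) h by simp
  have "disp (\<psi> h) \<le> dispY h + 2 * \<epsilon>" using almost_equivariant_disp[OF 1 g(2)] by linarith
  then show ?thesis by (rule almost_equivariant_mono[OF 1 order_refl])
qed

end

section \<open>The limit group\<close>

lemma topspace_isometry_topology: "topspace (isometry_topology Z) = isometries Z"
proof
  show "topspace (isometry_topology Z) \<subseteq> isometries Z"
    unfolding isometry_topology_def topology_generated_by_topspace by auto
  \<comment> \<open>The subbasic set for empty \<open>K\<close> and empty \<open>U\<close> is the
    whole group.\<close>
  have "{h\<in>isometries Z. h ` {} \<subseteq> {}} \<subseteq> topspace (isometry_topology Z)"
    unfolding isometry_topology_def topology_generated_by_topspace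
    by (rule Union_upper) (auto intro!: exI[of _ "{}"])
  then show "isometries Z \<subseteq> topspace (isometry_topology Z)" by simp
qed

text \<open>Near the identity, the compact-open topology on isometries is controlled by finitely
  many points. A compact \<open>K\<close> inside \<open>U\<close> is covered by finitely many balls
  of half the admissible radius, and an isometry that moves their centres little moves all of
  \<open>K\<close> little.\<close>

lemma isometry_topology_nbhd:
  assumes W: "openin (isometry_topology Z) W" and one: "(\<lambda>x\<in>mspace Z. x) \<in> W"
  shows "\<exists>P \<eta>. finite P \<and> P \<subseteq> mspace Z \<and> 0 < \<eta> \<and>
    (\<forall>h\<in>isometries Z. (\<forall>y\<in>P. mdist Z (h y) y < \<eta>) \<longrightarrow> h \<in> W)"
proof -
  have "generate_topology_on {{h\<in>isometries Z. h ` K \<subseteq> U} | K U. compactin (mtopology_of Z) K \<and> openin (mtopology_of Z) U} W"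
    using W unfolding isometry_topology_def openin_topology_generated_by_iff .
  then show ?thesis using one
  proof (induction rule: generate_topology_on.induct)
    case Empty
    then show ?case by simp
  next
    case (Int a b)
    obtain P \<eta> where P: "finite P" "P \<subseteq> mspace Z" "0 < \<eta>"
      "\<forall>h\<in>isometries Z. (\<forall>y\<in>P. mdist Z (h y) y < \<eta>) \<longrightarrow> h \<in> a"
      using Int.IH(1) Int.prems by auto
    obtain P' \<eta>' where P': "finite P'" "P' \<subseteq> mspace Z" "0 < \<eta>'"
      "\<forall>h\<in>isometries Z. (\<forall>y\<in>P'. mdist Z (h y) y < \<eta>') \<longrightarrow> h \<in> b"
      using Int.IH(2) Int.prems by auto
    show ?case
      using P P' by (intro exI[of _ "P \<union> P'"] exI[of _ "min \<eta> \<eta>'"]) simp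
  next
    case (UN \<K>)
    from UN.prems obtain k where k: "k \<in> \<K>" "(\<lambda>x\<in>mspace Z. x) \<in> k" by (rule UnionE)
    obtain P \<eta> where P: "finite P" "P \<subseteq> mspace Z" "0 < \<eta>"
      "\<forall>h\<in>isometries Z. (\<forall>y\<in>P. mdist Z (h y) y < \<eta>) \<longrightarrow> h \<in> k"
      using UN.IH[OF k] by (elim exE conjE)
    show ?case
      by (intro exI[of _ P] exI[of _ \<eta>] conjI ballI impI P(1-3) UnionI[OF k(1)] P(4)[rule_format]) auto
  next
    case (Basis s)
    then obtain K U where s: "s = {h\<in>isometries Z. h ` K \<subseteq> U}"
      and K: "compactin (mtopology_of Z) K" and U: "openin (mtopology_of Z) U" by (elim CollectE exE conjE)
    have KZ: "K \<subseteq> mspace Z" using compactin_subset_topspace[OF K] by simp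
    have KU: "K \<subseteq> U"
    proof
      fix x assume x: "x \<in> K"
      have "(\<lambda>x\<in>mspace Z. x) ` K \<subseteq> U" using Basis.prems unfolding s by simp
      then have "(\<lambda>x\<in>mspace Z. x) x \<in> U" using x by blast
      then show "x \<in> U" using x KZ by (simp add: subset_iff)
    qed
    have balls: "\<forall>x. x \<in> U \<longrightarrow> (\<exists>r>0. mball_of Z x r \<subseteq> U)"
      using U unfolding mtopology_of_def Metric_space.openin_mtopology[OF Metric_space_mspace_mdist] mball_of_def
      by (rule conjunct2)
    define r where "r = (\<lambda>x. SOME r. 0 < r \<and> mball_of Z x r \<subseteq> U)"
    have r: "0 < r x" "mball_of Z x (r x) \<subseteq> U" if "x \<in> K" for x
      using someI_ex[OF balls[rule_format, OF subsetD[OF KU that]]] unfolding r_def by (rule conjunct1, rule conjunct2)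
    let ?b = "\<lambda>x. mball_of Z x (r x / 2)"
    have op: "openin (mtopology_of Z) B" if "B \<in> ?b ` K" for B using that by (elim imageE) (simp only: openin_mball_of)
    have cov: "K \<subseteq> \<Union> (?b ` K)"
    proof
      fix x assume x: "x \<in> K"
      then have "x \<in> mspace Z" using KZ by (rule rev_subsetD)
      then have "x \<in> ?b x" using r(1)[OF x] by (simp add: in_mball_of mdist_self)
      then show "x \<in> \<Union> (?b ` K)" by (rule UN_I[OF x])
    qed
    have "\<exists>\<F>. finite \<F> \<and> \<F> \<subseteq> ?b ` K \<and> K \<subseteq> \<Union>\<F>"
  by (rule compactinD[OF K _ cov]) (rule op)
    then obtain \<F> where \<F>: "finite \<F>" "\<F> \<subseteq> ?b ` K" "K \<subseteq> \<Union>\<F>" by (elim exE conjE)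
          obtain P where P: "P \<subseteq> K" "finite P" "\<F> = ?b ` P"
      using finite_subset_image[OF \<F>(1,2)] by (elim exE conjE)
    define \<eta> where "\<eta> = Min (insert 1 ((\<lambda>x. r x / 2) ` P))"
    have \<eta>: "0 < \<eta>" unfolding \<eta>_def using P(1,2) r(1) by (subst Min_gr_iff) auto
    have \<eta>r: "\<eta> \<le> r x / 2" if "x \<in> P" for x
      unfolding \<eta>_def using P(2) that by (intro Min_le) auto
    have "h \<in> s" if h: "h \<in> isometries Z" and d: "\<forall>y\<in>P. mdist Z (h y) y < \<eta>" for h
    proof -
      note hD = isometriesD[OF h]
      have "h y \<in> U" if y: "y \<in> K" for y
      proof -
        have "y \<in> \<Union> (?b ` P)" using \<F>(3) y unfolding P(3) by (rule subsetD)
        then obtain x where x: "x \<in> P" "y \<in> ?b x" by (rule UN_E)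
        then have xK: "x \<in> K" and xy: "mdist Z x y < r x / 2" using P(1) by (auto simp: in_mball_of)
        have xZ: "x \<in> mspace Z" and yZ: "y \<in> mspace Z" using xK y KZ by auto
        have "mdist Z x (h y) \<le> mdist Z x (h x) + mdist Z (h x) (h y)"
          by (rule mdist_triangle_le[OF xZ hD(2)[OF xZ] hD(2)[OF yZ]])
        moreover have "mdist Z x (h x) < r x / 2"
          using d[rule_format, OF x(1)] \<eta>r[OF x(1)] mdist_sym[of Z x "h x"] by linarith
        ultimately have "mdist Z x (h y) < r x" using xy hD(3)[OF xZ yZ] by linarith
        then have "h y \<in> mball_of Z x (r x)" using xZ hD(2)[OF yZ] by (simp add: in_mball_of)
        then show ?thesis by (rule subsetD[OF r(2)[OF xK]])
      qed
      then show ?thesis unfolding s by (intro CollectI conjI h image_subsetI)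
    qed
    then show ?case by (intro exI[of _ P] exI[of _ \<eta>] conjI ballI impI P(2) subset_trans[OF P(1) KZ] \<eta>)
  qed
qed

context isometric_action
begin

text \<open>A replacement for Arzela-Ascoli, since elements of bounded displacement are not known to
  form a compact set. Each is coded by net points near the images of the finite set
  \<open>P\<close>. Equal codes mean a quotient close to the identity, on which \<rho> is below 1,
  and there are finitely many codes.\<close>

lemma bounded_on_displacement:
  fixes \<rho> :: "('c \<Rightarrow> 'c) \<Rightarrow> real"
  assumes nets: "has_finite_nets Y yh"
    and hom: "\<And>g h. g \<in> H \<Longrightarrow> h \<in> H \<Longrightarrow> \<rho> (g \<otimes>\<^bsub>HG\<^esub> h) = \<rho> g + \<rho> h"
    and op: "openin (subtopology (isometry_topology Y) H) {h\<in>H. \<bar>\<rho> h\<bar> < 1}"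
  shows "\<exists>B. \<forall>h\<in>H. dispY h \<le> R \<longrightarrow> \<bar>\<rho> h\<bar> \<le> B"
proof -
  obtain W where W: "openin (isometry_topology Y) W" "{h\<in>H. \<bar>\<rho> h\<bar> < 1} = W \<inter> H"
    using op unfolding openin_subtopology by (elim exE conjE)
  have \<rho>1: "\<rho> \<one>\<^bsub>HG\<^esub> = 0" using hom[OF H_one_closed H_one_closed] HG.r_one[OF HG.one_closed] by simp
  then have "\<one>\<^bsub>HG\<^esub> \<in> {h\<in>H. \<bar>\<rho> h\<bar> < 1}" using H_one_closed by simp
  then have "\<one>\<^bsub>HG\<^esub> \<in> W" unfolding W(2) by (rule IntD1)
  then have "(\<lambda>x\<in>mspace Y. x) \<in> W" by (simp add: isometry_group_def BijGroup_def)
  from isometry_topology_nbhd[OF W(1) this] obtain P \<eta> where P: "finite P" "P \<subseteq> mspace Y" and \<eta>: "0 < \<eta>"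
    and PW: "\<forall>h\<in>isometries Y. (\<forall>y\<in>P. mdist Y (h y) y < \<eta>) \<longrightarrow> h \<in> W" by (elim exE conjE)
  define M where "M = Max (insert 0 ((\<lambda>y. mdist Y yh y) ` P))"
  have M: "mdist Y yh y \<le> M" if "y \<in> P" for y unfolding M_def using P(1) that by (intro Max_ge) auto
  have "0 < \<eta> / 2" using \<eta> by simp
  then obtain F where F: "finite F" "F \<subseteq> mspace Y"
    and net: "\<forall>y\<in>mspace Y. mdist Y yh y < M + R + 1 \<longrightarrow> (\<exists>z\<in>F. mdist Y z y < \<eta> / 2)"
    using nets unfolding has_finite_nets_def by (elim allE[of _ "M + R + 1"] allE[of _ "\<eta> / 2"] impE exE conjE)
  define S where "S = {h\<in>H. dispY h \<le> R}"
  have near: "\<exists>z\<in>F. mdist Y z (h y) < \<eta> / 2" if h: "h \<in> S" and y: "y \<in> P" for h y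
  proof -
    have hH: "h \<in> H" and hR: "dispY h \<le> R" using h by (auto simp: S_def)
    have yY: "y \<in> mspace Y" using P(2) y by auto
    have "mdist Y yh (h y) \<le> mdist Y yh (h yh) + mdist Y (h yh) (h y)"
      by (rule mdist_triangle_le[OF yh H_mspace[OF hH yh] H_mspace[OF hH yY]])
    also have "\<dots> \<le> R + M"
      using hR M[OF y] H_isometry[OF hH yh yY] mdist_sym[of Y yh "h yh"] unfolding dispY_def by linarith
    finally show ?thesis by (intro net[rule_format] H_mspace[OF hH yY]) linarith
  qed
  define code where "code = (\<lambda>h. \<lambda>y\<in>P. SOME z. z \<in> F \<and> mdist Y z (h y) < \<eta> / 2)"
  have code: "code h y \<in> F" "mdist Y (code h y) (h y) < \<eta> / 2" if h: "h \<in> S" and y: "y \<in> P" for h y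
  proof -
    have "\<exists>z. z \<in> F \<and> mdist Y z (h y) < \<eta> / 2" using near[OF h y] by auto
    from someI_ex[OF this] show "code h y \<in> F" "mdist Y (code h y) (h y) < \<eta> / 2"
      unfolding code_def using y by auto
  qed
  have "code ` S \<subseteq> (\<Pi>\<^sub>E y\<in>P. F)" using code(1) by (auto simp: code_def)
  then have fin: "finite (code ` S)" by (rule finite_subset) (intro finite_PiE P(1) F(1))
  obtain S' where S': "S' \<subseteq> S" "finite S'" "code ` S = code ` S'"
    using finite_subset_image[OF fin order_refl] by blast
  define B where "B = Max (insert 0 ((\<lambda>h. \<bar>\<rho> h\<bar>) ` S')) + 1"
  have "\<bar>\<rho> h\<bar> \<le> B" if h: "h \<in> H" "dispY h \<le> R" for h
  proof -
    have hS: "h \<in> S" using h by (simp add: S_def)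
    then have "code h \<in> code ` S'" using S'(3) by blast
    then obtain g where g: "g \<in> S'" "code h = code g" by blast
    have gS: "g \<in> S" and gH: "g \<in> H" using g(1) S'(1) by (auto simp: S_def)
    let ?k = "inv\<^bsub>HG\<^esub> g \<otimes>\<^bsub>HG\<^esub> h"
    have kH: "?k \<in> H" by (rule H_mult_closed[OF H_inv_closed[OF gH] h(1)])
    have "mdist Y (?k y) y < \<eta>" if y: "y \<in> P" for y
    proof -
      have yY: "y \<in> mspace Y" using P(2) y by auto
      have z: "code g y \<in> mspace Y" using code(1)[OF gS y] F(2) by auto
      note hy = H_mspace[OF h(1) yY] and gy = H_mspace[OF gH yY]
      have "mdist Y (?k y) y = mdist Y ((inv\<^bsub>HG\<^esub> g) (h y)) ((inv\<^bsub>HG\<^esub> g) (g y))"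
        unfolding H_mult[OF H_inv_closed[OF gH] h(1) yY] H_inv[OF gH yY] ..
      also have "\<dots> = mdist Y (h y) (g y)" by (rule H_isometry[OF H_inv_closed[OF gH] hy gy])
      also have "\<dots> \<le> mdist Y (h y) (code g y) + mdist Y (code g y) (g y)"
        by (rule mdist_triangle_le[OF hy z gy])
      also have "\<dots> < \<eta>"
        using code(2)[OF hS y] code(2)[OF gS y] mdist_sym[of Y "h y" "code g y"] unfolding g(2) by linarith
      finally show ?thesis .
    qed
    then have "?k \<in> W" using PW[rule_format, OF H_isometries[OF kH]] by blast
    then have "\<bar>\<rho> ?k\<bar> < 1" using kH W(2) by blast
    moreover have "\<rho> (g \<otimes>\<^bsub>HG\<^esub> ?k) = \<rho> g + \<rho> ?k" by (rule hom[OF gH kH])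
    moreover have "g \<otimes>\<^bsub>HG\<^esub> ?k = h"
    proof -
      have "g \<in> carrier HG" "h \<in> carrier HG" using gH h(1) by simp_all
      then show ?thesis 
        using iffD1[OF HG.inv_solve_left[OF HG.m_closed[OF HG.inv_closed]] refl] by metis
    qed
    moreover have "\<bar>\<rho> g\<bar> \<le> Max (insert 0 ((\<lambda>h. \<bar>\<rho> h\<bar>) ` S'))"
      using S'(2) g(1) by (intro Max_ge) auto
    ultimately show ?thesis unfolding B_def by simp
  qed
  then show ?thesis by blast
qed

lemma displacement_bounded_on_compact:
  assumes K: "compactin (subtopology (isometry_topology Y) H) K"
  shows "\<exists>B. \<forall>h\<in>K. dispY h < B"
proof -
  have KH: "K \<subseteq> H" and KY: "compactin (isometry_topology Y) K"
    using K by (auto simp: compactin_subtopology)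
  let ?U = "\<lambda>n::nat. {h\<in>isometries Y. h ` {yh} \<subseteq> mball_of Y yh (real n)}"
  have "openin (isometry_topology Y) (?U n)" for n
    unfolding isometry_topology_def
  proof (rule topology_generated_by_Basis)
    have "compactin (mtopology_of Y) {yh}" using yh by simp
    then show "?U n \<in> {{h\<in>isometries Y. h ` K \<subseteq> U} | K U. compactin (mtopology_of Y) K \<and> openin (mtopology_of Y) U}"
      by (intro CollectI exI[of _ "{yh}"] exI[of _ "mball_of Y yh (real n)"] conjI refl openin_mball_of)
  qed
  then have op: "openin (isometry_topology Y) B" if "B \<in> range ?U" for B using that by (elim imageE) (simp only:)
  have cov: "K \<subseteq> \<Union> (range ?U)"
  proof
    fix h assume "h \<in> K"
    then have h: "h \<in> H" using KH by auto
    obtain n :: nat where "mdist Y yh (h yh) < real n" using reals_Archimedean2 by blast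
    then have "h \<in> ?U n" using H_isometries[OF h] H_mspace[OF h yh] yh by (simp add: in_mball_of)
    then show "h \<in> \<Union> (range ?U)" by (rule UN_I[OF UNIV_I])
  qed
  have "\<exists>\<F>. finite \<F> \<and> \<F> \<subseteq> range ?U \<and> K \<subseteq> \<Union>\<F>"
  by (rule compactinD[OF KY _ cov]) (rule op)
    then obtain \<F> where \<F>: "finite \<F>" "\<F> \<subseteq> range ?U" "K \<subseteq> \<Union>\<F>" by (elim exE conjE)
      obtain I where I: "finite I" "\<F> = ?U ` I" using finite_subset_image[OF \<F>(1,2)] by (elim exE conjE)
  have "dispY h < real (Max (insert 0 I)) + 1" if "h \<in> K" for h
  proof -
    have "h \<in> \<Union> (?U ` I)" using \<F>(3) that unfolding I(2) by (rule subsetD)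
    then obtain n where n: "n \<in> I" "h \<in> ?U n" by (rule UN_E)
    then have "mdist Y yh (h yh) < real n" by (simp add: in_mball_of)
    moreover have "n \<le> Max (insert 0 I)" using I(1) n(1) by (intro Max_ge) auto
    ultimately show ?thesis unfolding dispY_def mdist_sym[of Y "h yh" yh] by linarith
  qed
  then show ?thesis by (intro exI ballI)
qed

end

text \<open>Integer coordinates are read as reals, so that rounding down treats all
  \<open>k1 + k2\<close> coordinates alike.\<close>

definition RZC_coordinate :: "nat \<Rightarrow> (nat \<Rightarrow> real) \<times> (nat \<Rightarrow> int) \<times> 'g \<Rightarrow> nat \<Rightarrow> real" where
  "RZC_coordinate k1 x j = (if j < k1 then fst x j else real_of_int (fst (snd x) (j - k1)))"

lemma RZC_coordinate_continuous:
  assumes j: "j < k1 + k2"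
  shows "continuous_map (RZC_topology k1 k2 TC) euclideanreal (\<lambda>x. RZC_coordinate k1 x j)"
proof (cases "j < k1")
  case True
  have "continuous_map (RZC_topology k1 k2 TC) euclideanreal ((\<lambda>x. x j) \<circ> fst)"
    unfolding RZC_topology_def
    by (rule continuous_map_compose[OF continuous_map_fst continuous_map_product_projection]) (use True in simp)
  then show ?thesis using True by (simp add: RZC_coordinate_def comp_def)
next
  case False
  have "continuous_map (RZC_topology k1 k2 TC) euclideanreal (real_of_int \<circ> ((\<lambda>x. x (j - k1)) \<circ> (fst \<circ> snd)))"
    unfolding RZC_topology_def
    by (rule continuous_map_compose[OF continuous_map_compose[OF continuous_map_compose[OF continuous_map_snd continuous_map_fst]
          continuous_map_product_projection]]) (use False j in auto)
  then show ?thesis using False by (simp add: RZC_coordinate_def comp_def)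
qed

text \<open>The integer coordinates in the box take only the values 0 and 1, and the remaining
  factor is the compact group.\<close>

lemma RZC_box_compact:
  assumes "compact_space TC"
  shows "compactin (RZC_topology k1 k2 TC) {x \<in> topspace (RZC_topology k1 k2 TC). \<forall>j<k1+k2. 0 \<le> RZC_coordinate k1 x j \<and> RZC_coordinate k1 x j \<le> 1}"
    (is "compactin ?T ?B")
proof -
  have "?B = (\<Pi>\<^sub>E i\<in>{..<k1}. {0..1}) \<times> ((\<Pi>\<^sub>E i\<in>{..<k2}. {0,1}) \<times> topspace TC)" (is "_ = ?C")
  proof (intro subset_antisym subsetI)
    fix x assume x: "x \<in> ?B"
    then have c: "\<And>j. j < k1 + k2 \<Longrightarrow> 0 \<le> RZC_coordinate k1 x j \<and> RZC_coordinate k1 x j \<le> 1" by blast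
    have "fst x i \<in> {0..1}" if "i < k1" for i using c[of i] that by (simp add: RZC_coordinate_def)
    moreover have "fst (snd x) i \<in> {0,1}" if "i < k2" for i
      using c[of "k1 + i"] that by (auto simp: RZC_coordinate_def)
    ultimately show "x \<in> ?C" using x by (auto simp: RZC_topology_def PiE_iff mem_Times_iff)
  next
    fix x assume x: "x \<in> ?C"
    have "0 \<le> RZC_coordinate k1 x j \<and> RZC_coordinate k1 x j \<le> 1" if j: "j < k1 + k2" for j
    proof (cases "j < k1")
      case True
      then show ?thesis using x by (auto simp: RZC_coordinate_def PiE_iff mem_Times_iff)
    next
      case False
      then have "j - k1 < k2" using j by simp
      then have "fst (snd x) (j - k1) \<in> {0,1}" using x by (auto simp: PiE_iff mem_Times_iff)
      then show ?thesis using False by (auto simp: RZC_coordinate_def)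
    qed
    moreover have "x \<in> topspace ?T" using x by (auto simp: RZC_topology_def PiE_iff mem_Times_iff)
    ultimately show "x \<in> ?B" by blast
  qed
  moreover have "compactin ?T ?C"
    unfolding RZC_topology_def compactin_Times compactin_PiE using assms
    by (auto simp: compact_space_def finite_imp_compactin)
  ultimately show ?thesis by simp
qed

context isometric_action
begin

text \<open>Turns the topological isomorphism into two comparisons with displacement. Coordinates in
  the unit box bound the displacement, by compactness; a bound on the displacement bounds the
  coordinates, by \<open>bounded_on_displacement\<close>.\<close>

lemma RZC_coordinates:
  fixes C :: "'g monoid"
  assumes nets: "has_finite_nets Y yh" and C: "compact_group C TC"
    and iso: "topological_group_isomorphic HG (subtopology (isometry_topology Y) H)
      (RZC_group k1 k2 C) (RZC_topology k1 k2 TC)"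
  obtains \<rho> :: "('c \<Rightarrow> 'c) \<Rightarrow> nat \<Rightarrow> real" and e
  where "\<And>g h j. g \<in> H \<Longrightarrow> h \<in> H \<Longrightarrow> j < k1 + k2 \<Longrightarrow> \<rho> (g \<otimes>\<^bsub>HG\<^esub> h) j = \<rho> g j + \<rho> h j"
    "\<And>i. i < k1 + k2 \<Longrightarrow> e i \<in> H"
    "\<And>i j. i < k1 + k2 \<Longrightarrow> j < k1 + k2 \<Longrightarrow> \<rho> (e i) j = (if i = j then 1 else 0)"
    "\<exists>r. \<forall>h\<in>H. (\<forall>j<k1+k2. 0 \<le> \<rho> h j \<and> \<rho> h j \<le> 1) \<longrightarrow> dispY h < r"
    "\<And>R. \<exists>B. \<forall>h\<in>H. dispY h \<le> R \<longrightarrow> (\<forall>j<k1+k2. \<bar>\<rho> h j\<bar> \<le> B)"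
proof -
  let ?d = "k1 + k2" and ?S = "subtopology (isometry_topology Y) H" and ?T = "RZC_topology k1 k2 TC"
  let ?R = "RZC_group k1 k2 C"
  have C': "group C" "topspace TC = carrier C" "compact_space TC"
    using C unfolding compact_group_def topological_group_def by auto
  obtain \<Phi> where \<Phi>: "\<Phi> \<in> iso HG ?R" "homeomorphic_map ?S ?T \<Phi>"
    using iso unfolding topological_group_isomorphic_def by blast
  have top_S: "topspace ?S = H" using H_isometries topspace_isometry_topology[of Y] by auto
  have car: "carrier ?R = topspace ?T"
    using C'(2) by (simp add: RZC_group_def RZC_topology_def real_group_def)
  have bij: "bij_betw \<Phi> H (carrier ?R)" and hom: "\<And>g h. g \<in> H \<Longrightarrow> h \<in> H \<Longrightarrow> \<Phi> (g \<otimes>\<^bsub>HG\<^esub> h) = \<Phi> g \<otimes>\<^bsub>?R\<^esub> \<Phi> h"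
    using \<Phi>(1) by (auto simp: iso_def hom_def)
  have \<Phi>_car: "\<Phi> h \<in> carrier ?R" if "h \<in> H" for h using bij that by (auto simp: bij_betw_def)
  define \<rho> where "\<rho> h j = RZC_coordinate k1 (\<Phi> h) j" for h j
  have add: "RZC_coordinate k1 (x \<otimes>\<^bsub>?R\<^esub> y) j = RZC_coordinate k1 x j + RZC_coordinate k1 y j"
    if "j < ?d" for x y j
    using that by (cases x; cases y) (auto simp: RZC_group_def RZC_coordinate_def real_group_def integer_group_def)
  have \<rho>_hom: "\<rho> (g \<otimes>\<^bsub>HG\<^esub> h) j = \<rho> g j + \<rho> h j" if "g \<in> H" "h \<in> H" "j < ?d" for g h j
    unfolding \<rho>_def hom[OF that(1,2)] by (rule add[OF that(3)])
  define u where "u i = ((\<lambda>j\<in>{..<k1}. if i = j then 1 else 0 :: real),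
     (\<lambda>j\<in>{..<k2}. if i = j + k1 then 1 else 0 :: int), \<one>\<^bsub>C\<^esub>)" for i
  have u: "u i \<in> carrier ?R" for i
    using group.is_monoid[OF C'(1)] by (auto simp: u_def RZC_group_def real_group_def integer_group_def monoid.one_closed)
  have u_coord: "RZC_coordinate k1 (u i) j = (if i = j then 1 else 0)" if "j < ?d" for i j
    using that by (auto simp: u_def RZC_coordinate_def)
  define e where "e i = inv_into H \<Phi> (u i)" for i
  have e: "e i \<in> H" "\<Phi> (e i) = u i" for i
    unfolding e_def using u[of i] bij by (auto simp: bij_betw_def f_inv_into_f inv_into_into)
  have cont: "continuous_map ?S euclideanreal (\<lambda>h. \<rho> h j)" if j: "j < ?d" for j
    using continuous_map_compose[OF homeomorphic_imp_continuous_map[OF \<Phi>(2)] RZC_coordinate_continuous[OF j]]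
    by (simp add: \<rho>_def comp_def)
  show ?thesis
  proof (rule that[of \<rho> e])
    show "\<And>g h j. g \<in> H \<Longrightarrow> h \<in> H \<Longrightarrow> j < ?d \<Longrightarrow> \<rho> (g \<otimes>\<^bsub>HG\<^esub> h) j = \<rho> g j + \<rho> h j" by (rule \<rho>_hom)
    show "\<And>i. e i \<in> H" by (rule e(1))
    show "\<rho> (e i) j = (if i = j then 1 else 0)" if "j < ?d" for i j
      unfolding \<rho>_def e(2) by (rule u_coord[OF that])
    obtain \<Psi> where \<Psi>: "homeomorphic_maps ?S ?T \<Phi> \<Psi>" using \<Phi>(2) unfolding homeomorphic_map_maps by blast
    let ?B = "{x \<in> topspace ?T. \<forall>j<?d. 0 \<le> RZC_coordinate k1 x j \<and> RZC_coordinate k1 x j \<le> 1}"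
    have "compactin ?S (\<Psi> ` ?B)"
      using \<Psi> by (intro image_compactin[OF RZC_box_compact[OF C'(3)]]) (simp add: homeomorphic_maps_def)
    then obtain r where r: "\<forall>h\<in>\<Psi> ` ?B. dispY h < r" using displacement_bounded_on_compact by blast
    have "dispY h < r" if h: "h \<in> H" and b: "\<forall>j<?d. 0 \<le> \<rho> h j \<and> \<rho> h j \<le> 1" for h
    proof -
      have "\<Phi> h \<in> ?B" using \<Phi>_car[OF h] b unfolding car \<rho>_def by blast
      moreover have "\<Psi> (\<Phi> h) = h" using \<Psi> h top_S unfolding homeomorphic_maps_def by blast
      ultimately have "h \<in> \<Psi> ` ?B" by (intro image_eqI[of h \<Psi> "\<Phi> h"]) simp_all
      then show ?thesis by (rule r[rule_format])
    qed
    then show "\<exists>r. \<forall>h\<in>H. (\<forall>j<?d. 0 \<le> \<rho> h j \<and> \<rho> h j \<le> 1) \<longrightarrow> dispY h < r" by blast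
    fix R
    have "\<exists>B. \<forall>h\<in>H. dispY h \<le> R \<longrightarrow> \<bar>\<rho> h j\<bar> \<le> B" if j: "j < ?d" for j
    proof (rule bounded_on_displacement[OF nets])
      show "\<And>g h. g \<in> H \<Longrightarrow> h \<in> H \<Longrightarrow> \<rho> (g \<otimes>\<^bsub>HG\<^esub> h) j = \<rho> g j + \<rho> h j" by (rule \<rho>_hom[OF _ _ j])
      have "openin ?S {h \<in> topspace ?S. \<rho> h j \<in> {-1<..<1}}"
        by (rule openin_continuous_map_preimage[OF cont[OF j]]) simp
      moreover have "{h \<in> topspace ?S. \<rho> h j \<in> {-1<..<1}} = {h\<in>H. \<bar>\<rho> h j\<bar> < 1}"
        unfolding top_S by (auto simp: abs_less_iff)
      ultimately show "openin ?S {h\<in>H. \<bar>\<rho> h j\<bar> < 1}" by simp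
    qed
    then have "\<forall>j. \<exists>B. j < ?d \<longrightarrow> (\<forall>h\<in>H. dispY h \<le> R \<longrightarrow> \<bar>\<rho> h j\<bar> \<le> B)" by simp
    from choice[OF this] obtain B where B: "\<forall>j. j < ?d \<longrightarrow> (\<forall>h\<in>H. dispY h \<le> R \<longrightarrow> \<bar>\<rho> h j\<bar> \<le> B j)" by (rule exE)
    have "\<bar>\<rho> h j\<bar> \<le> Max (B ` {..<?d})" if "h \<in> H" "dispY h \<le> R" "j < ?d" for h j
    proof -
      have "\<bar>\<rho> h j\<bar> \<le> B j" by (rule B[rule_format, OF that(3,1,2)])
      also have "\<dots> \<le> Max (B ` {..<?d})" using that(3) by (intro Max_ge) auto
      finally show ?thesis .
    qed
    then show "\<exists>B. \<forall>h\<in>H. dispY h \<le> R \<longrightarrow> (\<forall>j<?d. \<bar>\<rho> h j\<bar> \<le> B)"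
      by (intro exI[of _ "Max (B ` {..<?d})"] ballI impI allI)
  qed
qed

end

section \<open>The rank of the deck transformation group\<close>

text \<open>The constants are chosen in the order \<open>M\<close>, \<open>r0\<close>, \<open>r\<close>, \<open>A\<close>, \<open>\<epsilon>\<close>; only the last depends on the member of
  the sequence.\<close>

locale lattice_approximation = approximated_action X Xh q ph D Y yh H \<epsilon> f \<phi> \<psi>
  for X :: "'a metric" and Xh :: "'b metric" and q :: "'b \<Rightarrow> 'a" and ph D
    and Y :: "'c metric" and yh :: 'c and H \<epsilon> f \<phi> \<psi> +
  fixes \<rho> :: "('c \<Rightarrow> 'c) \<Rightarrow> nat \<Rightarrow> real" and e :: "nat \<Rightarrow> 'c \<Rightarrow> 'c" and d :: nat
    and r r0 M :: real and A :: nat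
  assumes comm_G: "comm_group G"
    and \<rho>_mult: "\<And>g h j. g \<in> H \<Longrightarrow> h \<in> H \<Longrightarrow> j < d \<Longrightarrow> \<rho> (g \<otimes>\<^bsub>HG\<^esub> h) j = \<rho> g j + \<rho> h j"
    and e_closed: "\<And>i. i < d \<Longrightarrow> e i \<in> H"
    and \<rho>_e: "\<And>i j. i < d \<Longrightarrow> j < d \<Longrightarrow> \<rho> (e i) j = (if i = j then 1 else 0)"
    and disp_e: "\<And>i. i < d \<Longrightarrow> dispY (e i) + 1 \<le> M" and M_nonneg: "0 \<le> M"
    and unit_cell: "\<And>h. h \<in> H \<Longrightarrow> (\<forall>j<d. 0 \<le> \<rho> h j \<and> \<rho> h j \<le> 1) \<Longrightarrow> dispY h + 1 < r0"
    and \<rho>_bound: "\<And>h j. h \<in> H \<Longrightarrow> dispY h \<le> 2 * r0 + r + 1 \<Longrightarrow> j < d \<Longrightarrow> \<bar>\<rho> h j\<bar> + 1 \<le> real A"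
    and A_pos: "1 \<le> A"
    and r: "2 * D + 3 \<le> r" "M + D + 2 \<le> r"
    and \<epsilon>_small: "\<epsilon> \<le> 1 / 2" "real (d * (8 * A)) * \<epsilon> + 2 * \<epsilon> \<le> 1"
      "real (d * (8 * A)) * (2 * M) + 2 * r0 + r < 1 / \<epsilon>"
begin

lemma \<rho>_one: "j < d \<Longrightarrow> \<rho> \<one>\<^bsub>HG\<^esub> j = 0"
  using \<rho>_mult[OF H_one_closed H_one_closed, of j] HG.r_one[OF HG.one_closed] by simp

lemma r0_pos: "0 < r0"
proof -
  have "dispY \<one>\<^bsub>HG\<^esub> = 0" unfolding dispY_def H_one[OF yh] by (rule mdist_self[OF yh])
  then show ?thesis using unit_cell[OF H_one_closed] \<rho>_one by simp
qed

lemma \<rho>_inv: "h \<in> H \<Longrightarrow> j < d \<Longrightarrow> \<rho> (inv\<^bsub>HG\<^esub> h) j = - \<rho> h j"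
proof -
  assume h: "h \<in> H" and j: "j < d"
  have "\<rho> (inv\<^bsub>HG\<^esub> h \<otimes>\<^bsub>HG\<^esub> h) j = \<rho> (inv\<^bsub>HG\<^esub> h) j + \<rho> h j"
    by (rule \<rho>_mult[OF H_inv_closed[OF h] h j])
  moreover have "inv\<^bsub>HG\<^esub> h \<otimes>\<^bsub>HG\<^esub> h = \<one>\<^bsub>HG\<^esub>" using h by (intro HG.l_inv) simp
  ultimately show ?thesis using \<rho>_one[OF j] by simp
qed

lemma H_pow_closed: "h \<in> H \<Longrightarrow> h [^]\<^bsub>HG\<^esub> (n::nat) \<in> H"
  using HG.nat_pow_closed[of h n] by simp

lemma \<rho>_pow: "h \<in> H \<Longrightarrow> j < d \<Longrightarrow> \<rho> (h [^]\<^bsub>HG\<^esub> (n::nat)) j = real n * \<rho> h j"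
proof (induction n)
  case 0
  then show ?case using \<rho>_one by simp
next
  case (Suc n)
  have "\<rho> (h [^]\<^bsub>HG\<^esub> n \<otimes>\<^bsub>HG\<^esub> h) j = \<rho> (h [^]\<^bsub>HG\<^esub> n) j + \<rho> h j"
    by (rule \<rho>_mult[OF H_pow_closed[OF Suc.prems(1)] Suc.prems])
  then show ?case using Suc by (simp add: algebra_simps)
qed

lemma \<rho>_int_pow: "h \<in> H \<Longrightarrow> j < d \<Longrightarrow> \<rho> (h [^]\<^bsub>HG\<^esub> (k::int)) j = real_of_int k * \<rho> h j"
proof (cases k rule: int_cases2)
  case (nonneg n)
  assume "h \<in> H" "j < d"
  then show ?thesis using \<rho>_pow unfolding nonneg by (simp add: int_pow_int)
next
  case (nonpos n)
  assume h: "h \<in> H" and j: "j < d"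
  have "h [^]\<^bsub>HG\<^esub> k = inv\<^bsub>HG\<^esub> (h [^]\<^bsub>HG\<^esub> n)" using h unfolding nonpos by (simp add: HG.int_pow_neg int_pow_int)
  then show ?thesis using \<rho>_inv[OF H_pow_closed[OF h] j] \<rho>_pow[OF h j] unfolding nonpos by simp
qed

lemma zprod_H_closed: "n \<le> d \<Longrightarrow> zprod HG e n a \<in> H"
  using HG.zprod_closed[of n e a] e_closed by simp

lemma \<rho>_zprod:
  assumes j: "j < d"
  shows "\<rho> (zprod HG e d a) j = real_of_int (a j)"
proof -
  have "\<rho> (zprod HG e n a) j = (if j < n then real_of_int (a j) else 0)" if "n \<le> d" for n
    using that
  proof (induction n)
    case 0
    then show ?case using \<rho>_one[OF j] by simp
  next
    case (Suc n)
    have en: "e n \<in> H" using Suc.prems by (intro e_closed) simp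
    have pn: "e n [^]\<^bsub>HG\<^esub> a n \<in> H" using HG.int_pow_closed[of "e n" "a n"] en by simp
    have "\<rho> (zprod HG e n a \<otimes>\<^bsub>HG\<^esub> e n [^]\<^bsub>HG\<^esub> a n) j = \<rho> (zprod HG e n a) j + \<rho> (e n [^]\<^bsub>HG\<^esub> a n) j"
      by (rule \<rho>_mult[OF zprod_H_closed pn j]) (use Suc.prems in simp)
    moreover have "\<rho> (e n [^]\<^bsub>HG\<^esub> a n) j = (if n = j then real_of_int (a j) else 0)"
      using \<rho>_int_pow[OF en j, of "a n"] \<rho>_e[of n j] Suc.prems j by simp
    ultimately show ?case using Suc by simp
  qed
  then show ?thesis using j by simp
qed

definition e' :: "nat \<Rightarrow> 'b \<Rightarrow> 'b" where "e' j = \<psi> (e j)"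

definition E :: "(nat \<Rightarrow> int) \<Rightarrow> 'b \<Rightarrow> 'b" where "E a = zprod G e' d a"

definition T :: "('b \<Rightarrow> 'b) set" where "T = {g \<in> deck. disp g < r0}"

lemma almost_equivariant_e: assumes j: "j < d" shows "almost_equivariant (e' j) (e j) \<epsilon> M"
proof -
  have "0 \<le> real (d * (8 * A)) * (2 * M)" using M_nonneg by simp
  then have "dispY (e j) < 1 / \<epsilon>" using disp_e[OF j] r r0_pos D_nonneg \<epsilon>_small(3) by linarith
  from almost_equivariant_psi[OF e_closed[OF j] this] show ?thesis
    unfolding e'_def by (rule almost_equivariant_mono) (use disp_e[OF j] \<epsilon>_small(1) in auto)
qed

lemma e'_deck: "j < d \<Longrightarrow> e' j \<in> deck"
  by (rule almost_equivariantD(1)[OF almost_equivariant_e])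

lemma almost_equivariant_E:
  assumes "\<And>j. j < d \<Longrightarrow> \<bar>a j\<bar> \<le> int K"
  shows "almost_equivariant (E a) (zprod HG e d a) (real (d * K) * \<epsilon>) (real (d * K) * (2 * M))"
  unfolding E_def by (rule almost_equivariant_zprod[OF almost_equivariant_e _ assms]) (use \<epsilon> in simp_all)

lemma E_deck: "E a \<in> deck"
  using G.zprod_closed[of d e' a] e'_deck unfolding E_def by simp

lemma E_minus: "E a \<otimes>\<^bsub>G\<^esub> E (\<lambda>j. - a j) = \<one>\<^bsub>G\<^esub>"
proof -
  interpret C: comm_group G by (rule comm_G)
  have c: "\<And>j. j < d \<Longrightarrow> e' j \<in> carrier G" using e'_deck by simp
  have "E a \<otimes>\<^bsub>G\<^esub> E (\<lambda>j. - a j) = E (\<lambda>j. a j + - a j)"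
    unfolding E_def by (rule C.zprod_add[OF c, symmetric])
  also have "\<dots> = \<one>\<^bsub>G\<^esub>"
  proof -
    have "zprod G e' n (\<lambda>j. 0) = \<one>\<^bsub>G\<^esub>" for n
      by (induction n) (simp_all add: G.l_one[OF G.one_closed])
    then show ?thesis unfolding E_def by simp
  qed
  finally show ?thesis .
qed

lemma mult_mono_A: "K \<le> 8 * A \<Longrightarrow> 0 \<le> x \<Longrightarrow> real (d * K) * x \<le> real (d * (8 * A)) * x"
  by (intro mult_right_mono) (simp_all only: of_nat_le_iff mult_le_mono2)

text \<open>Rounding: removing the integer parts of the coordinates of \<open>\<phi> g\<close>
  leaves an element of the unit box, of displacement below \<open>r0 - 1\<close>. The corresponding
  deck transformation \<open>t\<close> differs from it in displacement by at most 1, so it lies in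
  \<open>T\<close>.\<close>

lemma translate:
  assumes g: "g \<in> deck" and dg: "disp g < r0 + r"
  shows "\<exists>a t. t \<in> T \<and> (\<forall>j<d. \<bar>a j\<bar> \<le> int A) \<and> g = E a \<otimes>\<^bsub>G\<^esub> t"
proof -
  have M8: "0 \<le> real (d * (8 * A)) * (2 * M)" using M_nonneg by simp
  have dg': "disp g < 1 / \<epsilon>" using dg \<epsilon>_small(3) r0_pos M8 by linarith
  note 1 = almost_equivariant_phi[OF g dg']
  note h = almost_equivariantD(2)[OF 1]
  have "dispY (\<phi> g) \<le> 2 * r0 + r + 1" using almost_equivariant_disp[OF 1 dg'] dg r0_pos \<epsilon>_small(1) by linarith
  note bd = \<rho>_bound[OF h this]
  define a where "a j = \<lfloor>\<rho> (\<phi> g) j\<rfloor>" for j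
  have a: "\<bar>a j\<bar> \<le> int A" if "j < d" for j
  proof -
    have "\<bar>real_of_int (a j)\<bar> \<le> real A" using bd[OF that] unfolding a_def by linarith
    then show ?thesis by linarith
  qed
  define t where "t = E (\<lambda>j. - a j) \<otimes>\<^bsub>G\<^esub> g"
  have t: "t \<in> deck" unfolding t_def by (rule deck_mult_closed[OF E_deck g])
  let ?h = "zprod HG e d (\<lambda>j. - a j) \<otimes>\<^bsub>HG\<^esub> \<phi> g"
  have 2: "almost_equivariant t ?h (real (d * A) * \<epsilon> + \<epsilon>) (real (d * A) * (2 * M) + disp g)"
    unfolding t_def by (rule almost_equivariant_mult[OF almost_equivariant_E 1]) (use a in simp)
  have h': "?h \<in> H" by (rule almost_equivariantD(2)[OF 2])
  have "dispY ?h + 1 < r0"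
  proof (rule unit_cell[OF h'], intro allI impI)
    fix j assume j: "j < d"
    have "\<rho> ?h j = \<rho> (\<phi> g) j - real_of_int (a j)"
      unfolding \<rho>_mult[OF zprod_H_closed[OF order_refl] h j] \<rho>_zprod[OF j] by simp
    then show "0 \<le> \<rho> ?h j \<and> \<rho> ?h j \<le> 1" unfolding a_def by linarith
  qed
  moreover have "\<bar>disp t - dispY ?h\<bar> \<le> (real (d * A) * \<epsilon> + \<epsilon>) + \<epsilon>"
    by (rule almost_equivariant_disp[OF 2]) (use mult_mono_A[of A "2 * M"] M_nonneg dg \<epsilon>_small(3) r0_pos in linarith)
  moreover have "real (d * A) * \<epsilon> \<le> real (d * (8 * A)) * \<epsilon>" by (rule mult_mono_A) (use \<epsilon> in simp_all)
  ultimately have "disp t < r0" using \<epsilon>_small(2) by linarith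
  then have "t \<in> T" using t by (simp add: T_def)
  moreover have "g = E a \<otimes>\<^bsub>G\<^esub> t"
    unfolding t_def using E_minus[of a] E_deck g by (simp add: G.m_assoc[symmetric])
  ultimately show ?thesis using a by (intro exI[of _ a] exI[of _ t] conjI allI impI)
qed

text \<open>Up to coefficients \<open>8 * A\<close> the approximation is still accurate. Both
  elements of \<open>T\<close> being small, \<open>E a\<close> has displacement below
  \<open>2 * r0\<close>; then so has its counterpart in \<open>H\<close>, up to an error, and the
  coordinates of that counterpart are the entries of \<open>a\<close>.\<close>

lemma bounded_translation:
  assumes t: "t \<in> T" and Et: "E a \<otimes>\<^bsub>G\<^esub> t \<in> T" and a: "\<forall>j<d. \<bar>a j\<bar> \<le> 8 * int A"
  shows "\<forall>j<d. \<bar>a j\<bar> \<le> int A"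
proof (intro allI impI)
  fix j assume j: "j < d"
  let ?h = "zprod HG e d a"
  have 1: "almost_equivariant (E a) ?h (real (d * (8 * A)) * \<epsilon>) (real (d * (8 * A)) * (2 * M))"
    by (rule almost_equivariant_E) (use a in simp)
  have td: "t \<in> deck" using t by (simp add: T_def)
  have "E a = (E a \<otimes>\<^bsub>G\<^esub> t) \<otimes>\<^bsub>G\<^esub> inv\<^bsub>G\<^esub> t"
    using E_deck[of a] td deck_mult_closed[OF E_deck[of a] td] by (intro iffD2[OF G.inv_solve_right]) simp_all
  then have "disp (E a) \<le> disp (E a \<otimes>\<^bsub>G\<^esub> t) + disp (inv\<^bsub>G\<^esub> t)"
    using disp_mult[OF deck_mult_closed[OF E_deck[of a] td] deck_inv_closed[OF td]] by simp
  then have "disp (E a) < 2 * r0" using t Et disp_inv[OF td] by (simp add: T_def)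
  moreover have "\<bar>disp (E a) - dispY ?h\<bar> \<le> real (d * (8 * A)) * \<epsilon> + \<epsilon>"
    by (rule almost_equivariant_disp[OF 1]) (use \<epsilon>_small(3) r0_pos r D_nonneg in linarith)
  ultimately have "dispY ?h \<le> 2 * r0 + r + 1" using \<epsilon>_small(2) \<epsilon> r D_nonneg by linarith
  from \<rho>_bound[OF zprod_H_closed[OF order_refl] this j] show "\<bar>a j\<bar> \<le> int A"
    unfolding \<rho>_zprod[OF j] by linarith
qed

sublocale translates: bounded_translates G d E "int A" T
proof -
  interpret C: comm_group G by (rule comm_G)
  have c: "\<And>j. j < d \<Longrightarrow> e' j \<in> carrier G" using e'_deck by simp
  show "bounded_translates G d E (int A) T"
  proof
    show "E a \<in> carrier G" for a using E_deck by simp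
    show "E (\<lambda>j. a j + b j) = E a \<otimes>\<^bsub>G\<^esub> E b" for a b unfolding E_def by (rule C.zprod_add[OF c])
    show "E a = E b" if "\<And>j. j < d \<Longrightarrow> a j = b j" for a b unfolding E_def by (rule zprod_cong[OF that])
    show "T \<subseteq> carrier G" by (auto simp: T_def)
    show "finite T" unfolding T_def by (rule finite_disp)
    show "\<one>\<^bsub>G\<^esub> \<in> T" using deck_one_closed r0_pos disp_one by (simp add: T_def)
    show "1 \<le> int A" using A_pos by simp
    show "\<forall>j<d. \<bar>a j\<bar> \<le> int A" if "t \<in> T" "E a \<otimes>\<^bsub>G\<^esub> t \<in> T" "\<forall>j<d. \<bar>a j\<bar> \<le> 8 * int A" for t a
      by (rule bounded_translation[OF that])
  qed
qed

text \<open>An element of \<open>T\<close> times a generator of displacement below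
  \<open>2 * D + 3\<close> has displacement below \<open>r0 + r\<close>, so \<open>translate\<close>
  writes it again as a translation times an element of \<open>T\<close>. Hence translations and
  \<open>T\<close> exhaust the group.\<close>

lemma card_deck_independent_le:
  assumes S: "Z_independent G S"
  shows "card S \<le> d"
proof (rule translates.card_Z_independent_le[OF _ S])
  interpret C: comm_group G by (rule comm_G)
  fix g assume "g \<in> carrier G"
  then have g: "g \<in> deck" by simp
  show "\<exists>a t. t \<in> T \<and> g = E a \<otimes>\<^bsub>G\<^esub> t"
  proof (rule deck_induct[OF g])
    have "\<one>\<^bsub>G\<^esub> = E (\<lambda>j. 0) \<otimes>\<^bsub>G\<^esub> \<one>\<^bsub>G\<^esub>"
      unfolding translates.E_zero by (rule G.l_one[OF G.one_closed, symmetric])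
    then show "\<exists>a t. t \<in> T \<and> \<one>\<^bsub>G\<^esub> = E a \<otimes>\<^bsub>G\<^esub> t" using translates.one_T by (intro exI conjI)
  next
    fix g s assume g: "g \<in> deck" and s: "s \<in> deck" "disp s < 2 * D + 3"
      and ex: "\<exists>a t. t \<in> T \<and> g = E a \<otimes>\<^bsub>G\<^esub> t"
    from ex obtain a t where t: "t \<in> T" "g = E a \<otimes>\<^bsub>G\<^esub> t" by (elim exE conjE)
    have td: "t \<in> deck" "disp t < r0" using t(1) by (auto simp: T_def)
    have "disp (t \<otimes>\<^bsub>G\<^esub> s) < r0 + r" using disp_mult[OF td(1) s(1)] td(2) s(2) r(1) by linarith
    from translate[OF deck_mult_closed[OF td(1) s(1)] this]
    obtain b u where u: "u \<in> T" "t \<otimes>\<^bsub>G\<^esub> s = E b \<otimes>\<^bsub>G\<^esub> u" by (elim exE conjE)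
    have ud: "u \<in> deck" using u(1) by (simp add: T_def)
    have "g \<otimes>\<^bsub>G\<^esub> s = E a \<otimes>\<^bsub>G\<^esub> (t \<otimes>\<^bsub>G\<^esub> s)"
      unfolding t(2) using td s E_deck by (simp add: G.m_assoc)
    also have "\<dots> = E (\<lambda>j. a j + b j) \<otimes>\<^bsub>G\<^esub> u"
      unfolding u(2) translates.E_add using ud E_deck by (simp add: G.m_assoc)
    finally show "\<exists>a t. t \<in> T \<and> g \<otimes>\<^bsub>G\<^esub> s = E a \<otimes>\<^bsub>G\<^esub> t" using u(1) by (intro exI conjI)
  qed
qed

text \<open>Each coordinate of the transfer, on the ball of radius \<open>r\<close>, is a partial
  homomorphism and yields a homomorphism on the fundamental group. The loops below paths from
  \<open>ph\<close> to its images under the \<open>e' j\<close> pair with these homomorphisms to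
  \<open>n\<close> times the identity matrix.\<close>

lemma first_homology_independent:
  "\<exists>S. Z_independent (first_homology (mtopology_of X) (q ph)) S \<and> card S = d"
proof -
  let ?p = "q ph" and ?T = "mtopology_of X"
  have p: "?p \<in> mspace X" by (rule q_mspace[OF ph])
  let ?S = "{g \<in> deck. disp g < r}"
  have Sc: "?S \<subseteq> carrier G" by auto
  have cover: "\<exists>a t. t \<in> T \<and> (\<forall>j<d. \<bar>a j\<bar> \<le> int A) \<and> x \<otimes>\<^bsub>G\<^esub> u = E a \<otimes>\<^bsub>G\<^esub> t" if x: "x \<in> ?S" and u: "u \<in> T" for x u
  proof (rule translate)
    have xu: "x \<in> deck" "u \<in> deck" "disp x < r" "disp u < r0" using x u by (auto simp: T_def)
    show "x \<otimes>\<^bsub>G\<^esub> u \<in> deck" by (rule deck_mult_closed[OF xu(1,2)])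
    show "disp (x \<otimes>\<^bsub>G\<^esub> u) < r0 + r" using disp_mult[OF xu(1,2)] xu(3,4) by linarith
  qed
  obtain F n where n: "(0::nat) < n"
    and F: "\<And>x y j. x \<in> ?S \<Longrightarrow> y \<in> ?S \<Longrightarrow> x \<otimes>\<^bsub>G\<^esub> y \<in> ?S \<Longrightarrow> j < d \<Longrightarrow> F (x \<otimes>\<^bsub>G\<^esub> y) j = F x j + F y j"
    and FE: "\<And>a j. E a \<in> ?S \<Longrightarrow> (\<And>j. j < d \<Longrightarrow> \<bar>a j\<bar> \<le> int A) \<Longrightarrow> j < d \<Longrightarrow> F (E a) j = int n * a j"
  proof (rule translates.transfer[OF Sc])
    fix x u assume "x \<in> ?S" "u \<in> T"
    then show "\<exists>a t. t \<in> T \<and> (\<forall>j<d. \<bar>a j\<bar> \<le> int A) \<and> x \<otimes>\<^bsub>G\<^esub> u = E a \<otimes>\<^bsub>G\<^esub> t" by (rule cover)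
  next
    fix F n
    assume "(0::nat) < n" "\<And>x y j. x \<in> ?S \<Longrightarrow> y \<in> ?S \<Longrightarrow> x \<otimes>\<^bsub>G\<^esub> y \<in> ?S \<Longrightarrow> j < d \<Longrightarrow> F (x \<otimes>\<^bsub>G\<^esub> y) j = F x j + F y j"
      "\<And>a j. E a \<in> ?S \<Longrightarrow> (\<And>j. j < d \<Longrightarrow> \<bar>a j\<bar> \<le> int A) \<Longrightarrow> j < d \<Longrightarrow> F (E a) j = int n * a j"
    then show thesis by (rule that)
  qed
  have Fe: "F (e' j) l = (if l = j then int n else 0)" if j: "j < d" and l: "l < d" for j l
  proof -
    have Ej: "E (\<lambda>i. if i = j then 1 else 0) = e' j"
      unfolding E_def by (rule G.zprod_unit[OF _ j]) (use e'_deck in simp)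
    have "disp (e' j) \<le> M" by (rule almost_equivariantD(3)[OF almost_equivariant_e[OF j]])
    then have "e' j \<in> ?S" using e'_deck[OF j] r(2) D_nonneg by simp
    then have "E (\<lambda>i. if i = j then 1 else 0) \<in> ?S" unfolding Ej .
    from FE[OF this _ l] have "F (e' j) l = int n * (if l = j then 1 else 0)" unfolding Ej using A_pos by simp
    then show ?thesis by simp
  qed
  define c where "c j = (SOME c. c \<in> deck_paths (e' j))" for j
  have c: "c j \<in> deck_paths (e' j)" if "j < d" for j
    unfolding c_def by (rule someI_ex[OF deck_paths_nonempty[OF e'_deck[OF that]]])
  define x where "x j = loop_homotopic ?T ?p `` {q \<circ> c j}" for j
  have loop: "q \<circ> c j \<in> loops_at ?T ?p" if "j < d" for j by (rule deck_path_loop[OF e'_deck[OF that] c[OF that]])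
  have ex: "\<exists>\<theta>. \<theta> \<in> hom (fundamental_group ?T ?p) integer_group \<and> (\<forall>j<d. \<theta> (x j) = (if l = j then int n else 0))"
    if l: "l < d" for l
  proof -
    have add: "F (g \<otimes>\<^bsub>G\<^esub> h) l = F g l + F h l"
      if "g \<in> deck" "h \<in> deck" "disp g < r" "disp h < r" "disp (g \<otimes>\<^bsub>G\<^esub> h) < r" for g h
      by (rule F[OF _ _ _ l]) (use that deck_mult_closed[OF that(1,2)] in simp_all)
    have "\<exists>\<omega> \<kappa>. local_cocycle X \<kappa> \<omega> \<and>
      (\<forall>g\<in>deck. disp g + D + 2 \<le> r \<longrightarrow> (\<forall>c\<in>deck_paths g. period \<omega> (q \<circ> c) = F g l))"
      by (rule deck_cocycle_periods[OF r(1)]) (rule add)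
    then obtain \<omega> \<kappa> where \<omega>: "local_cocycle X \<kappa> \<omega>"
      and per: "\<forall>g\<in>deck. disp g + D + 2 \<le> r \<longrightarrow> (\<forall>c\<in>deck_paths g. period \<omega> (q \<circ> c) = F g l)"
      by (elim exE conjE)
    from period_hom[OF \<omega> p] obtain \<theta> where \<theta>: "\<theta> \<in> hom (fundamental_group ?T ?p) integer_group"
      "\<forall>f\<in>loops_at ?T ?p. \<theta> (loop_homotopic ?T ?p `` {f}) = period \<omega> f" by (elim bexE)
    have "\<theta> (x j) = (if l = j then int n else 0)" if j: "j < d" for j
    proof -
      \<comment> \<open>This is the reason for requiring \<open>M + D + 2 \<le> r\<close>.\<close>
      have "disp (e' j) + D + 2 \<le> r" using almost_equivariantD(3)[OF almost_equivariant_e[OF j]] r(2) by linarith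
      then have "period \<omega> (q \<circ> c j) = F (e' j) l" by (rule per[rule_format, OF e'_deck[OF j] _ c[OF j]])
      then show ?thesis unfolding x_def \<theta>(2)[rule_format, OF loop[OF j]] Fe[OF j l] by simp
    qed
    then show ?thesis using \<theta>(1) by (intro exI[of _ \<theta>] conjI allI impI)
  qed
  define \<theta> where "\<theta> l = (SOME \<theta>. \<theta> \<in> hom (fundamental_group ?T ?p) integer_group \<and> (\<forall>j<d. \<theta> (x j) = (if l = j then int n else 0)))" for l
  have \<theta>: "\<theta> l \<in> hom (fundamental_group ?T ?p) integer_group \<and> (\<forall>j<d. \<theta> l (x j) = (if l = j then int n else 0))"
    if "l < d" for l
    unfolding \<theta>_def by (rule someI_ex[OF ex[OF that]])
  show ?thesis
    unfolding first_homology_def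
  proof (rule Z_independent_abelianization[of "fundamental_group ?T ?p" "int n" d \<theta> x])
    show "x j \<in> carrier (fundamental_group ?T ?p)" if "j < d" for j
      using loop[OF that] unfolding x_def fundamental_group_def by (simp add: quotientI)
    show "group (fundamental_group ?T ?p)" using p by (intro group_fundamental_group) simp
    show "(0::int) < int n" using n by simp
    show "\<theta> l \<in> hom (fundamental_group ?T ?p) integer_group" if "l < d" for l by (rule conjunct1[OF \<theta>[OF that]])
    show "\<theta> l (x j) = (if l = j then int n else 0)" if "l < d" "j < d" for l j
      by (rule conjunct2[OF \<theta>[OF that(1)], rule_format, OF that(2)])
  qed
qed

end

section \<open>Choice of one member of the sequence, and the conclusion\<close>

lemma eGH_convergesD:
  assumes "eGH_converges X p H Y q K" and \<epsilon>0: "0 < \<epsilon>0"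
  shows "\<exists>i \<epsilon> f \<phi> \<psi>. 0 < \<epsilon> \<and> \<epsilon> < \<epsilon>0 \<and> eGH_approximation \<epsilon> (X i) (p i) (H i) Y q K f \<phi> \<psi>"
proof -
  have "\<forall>\<^sub>F i in sequentially. eGH_dist (X i) (p i) (H i) Y q K < ereal \<epsilon>0"
    by (rule order_tendstoD(2)[OF assms(1)[unfolded eGH_converges_def]]) (use \<epsilon>0 in simp)
  then obtain i where "eGH_dist (X i) (p i) (H i) Y q K < ereal \<epsilon>0"
    unfolding eventually_sequentially by auto
  then obtain u where u: "u \<in> {ereal \<epsilon> | \<epsilon>. 0 < \<epsilon> \<and> (\<exists>f \<phi> \<psi>. eGH_approximation \<epsilon> (X i) (p i) (H i) Y q K f \<phi> \<psi>)}"
    "u < ereal \<epsilon>0"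
    unfolding eGH_dist_def Inf_less_iff by (elim bexE)
  from u(1) obtain \<epsilon> f \<phi> \<psi> where "u = ereal \<epsilon>" "0 < \<epsilon>" "eGH_approximation \<epsilon> (X i) (p i) (H i) Y q K f \<phi> \<psi>"
    by (elim CollectE exE conjE)
  then show ?thesis using u(2)
    by (intro exI[of _ i] exI[of _ \<epsilon>] exI[of _ f] exI[of _ \<phi>] exI[of _ \<psi>] conjI) simp_all
qed

text \<open>The image of an \<open>\<eta> / 4\<close>-net under \<open>f\<close> is an \<eta>-net:
  the distortion adds \<epsilon> and the density of the image \<open>2 * \<epsilon>\<close>, with
  \<open>\<epsilon> < \<eta> / 4\<close>. The condition on \<open>R\<close> keeps the net points
  used in the domain of \<open>f\<close>.\<close>

lemma (in approximated_action) target_net: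
  assumes \<eta>: "0 < \<eta>" "\<epsilon> < \<eta> / 4" and R: "R + \<eta> < 1 / \<epsilon>"
  shows "\<exists>F. finite F \<and> F \<subseteq> mspace Y \<and> (\<forall>y\<in>mspace Y. mdist Y yh y < R \<longrightarrow> (\<exists>z\<in>F. mdist Y z y < \<eta>))"
proof -
  have dense: "\<forall>y\<in>mball_of Y yh (1 / \<epsilon> + \<epsilon>). \<exists>x\<in>mball_of Xh ph (1 / \<epsilon>). mdist Y (f x) y < 2 * \<epsilon>"
    using approx unfolding eGH_approximation_def Let_def by simp
  have "0 < \<eta> / 4" using \<eta>(1) by simp
  then obtain F where F: "finite F" "F \<subseteq> mspace Xh"
    and net: "\<forall>y\<in>mspace Xh. mdist Xh ph y < 1 / \<epsilon> \<longrightarrow> (\<exists>z\<in>F. mdist Xh z y < \<eta> / 4)"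
    using covering_finite_nets unfolding has_finite_nets_def by (elim allE[of _ "1 / \<epsilon>"] allE[of _ "\<eta> / 4"] impE exE conjE)
  let ?F = "f ` {z \<in> F. mdist Xh z ph < 1 / \<epsilon>}"
  have "\<exists>z\<in>?F. mdist Y z y < \<eta>" if y: "y \<in> mspace Y" and d: "mdist Y yh y < R" for y
  proof -
    have "y \<in> mball_of Y yh (1 / \<epsilon> + \<epsilon>)" using y d R yh \<eta>(1) \<epsilon> by (simp add: in_mball_of)
    from dense[rule_format, OF this]
    obtain x where x: "x \<in> mball_of Xh ph (1 / \<epsilon>)" "mdist Y (f x) y < 2 * \<epsilon>" by (elim bexE)
    have xX: "x \<in> mspace Xh" and xp: "mdist Xh x ph < 1 / \<epsilon>" and px: "mdist Xh ph x < 1 / \<epsilon>"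
      using x(1) mdist_sym[of Xh x ph] by (simp_all add: in_mball_of)
    have "0 < 1 / \<epsilon>" using \<epsilon> by simp
    then have pp: "mdist Xh ph ph < 1 / \<epsilon>" by (simp only: mdist_self[OF ph])
    note fx = f_mspace[OF xX xp]
    have "mdist Y (f x) yh \<le> mdist Y (f x) y + mdist Y y yh" by (rule mdist_triangle_le[OF fx y yh])
    moreover have "\<bar>mdist Y (f x) yh - mdist Xh x ph\<bar> \<le> \<epsilon>" using f_distortion[OF xX xp ph pp] unfolding f_ph .
    ultimately have xR: "mdist Xh x ph < R + 3 * \<epsilon>" using x(2) d mdist_sym[of Y y yh] by linarith
    obtain z where z: "z \<in> F" "mdist Xh z x < \<eta> / 4" using net xX px by auto
    have zX: "z \<in> mspace Xh" using z(1) F(2) by auto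
    have "mdist Xh z ph \<le> mdist Xh z x + mdist Xh x ph" by (rule mdist_triangle_le[OF zX xX ph])
    then have zp: "mdist Xh z ph < 1 / \<epsilon>" using z(2) xR \<eta> R by linarith
    have "mdist Y (f z) y \<le> mdist Y (f z) (f x) + mdist Y (f x) y"
      by (rule mdist_triangle_le[OF f_mspace[OF zX zp] fx y])
    also have "\<dots> < \<eta>" using f_distortion[OF zX zp xX xp] z(2) x(2) \<eta>(2) by linarith
    finally show ?thesis using z(1) zp by (intro bexI[of _ "f z"]) simp_all
  qed
  moreover have "finite ?F" "?F \<subseteq> mspace Y" using F f_mspace by auto
  ultimately show ?thesis by (intro exI[of _ ?F] conjI ballI impI)
qed

lemma RCD_length_covering:
  assumes RCD: "RCD (-1) N X m" and D: "\<And>x y. x \<in> mspace X \<Longrightarrow> y \<in> mspace X \<Longrightarrow> mdist X x y \<le> D"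
    and cov: "homology_cover Xh ph X p q"
  shows "pointed_length_covering X Xh q ph D"
proof
  have mms: "metric_measure_space X m" and CD: "CD (-1) N X m" using RCD by (auto simp: RCD_def)
  show "compact_space (mtopology_of X)" by (rule CD_compact[OF mms CD]) (rule D)
  show "approx_midpoints X" unfolding approx_midpoints_def
  proof (intro ballI allI impI)
    fix x y L assume "x \<in> mspace X" "y \<in> mspace X" "mdist X x y < L"
    then show "\<exists>z\<in>mspace X. mdist X x z < L / 2 \<and> mdist X z y < L / 2"
      by (intro CD_approximate_midpoint[OF mms CD D])
  qed
  show "normal_covering (mtopology_of Xh) (mtopology_of X) q" "lifted_metric Xh X q" "ph \<in> mspace Xh"
    using cov by (simp_all add: homology_cover_def)
  show "\<And>x y. x \<in> mspace X \<Longrightarrow> y \<in> mspace X \<Longrightarrow> mdist X x y \<le> D" by (rule D)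
qed

lemma comm_group_first_homology: "p \<in> topspace T \<Longrightarrow> comm_group (first_homology T p)"
  unfolding first_homology_def abelianization_def
  by (rule group.derived_quot_is_comm_group[OF group_fundamental_group])

lemma hom_finprod_comm_group:
  assumes "comm_group G" "comm_group K" and h: "h \<in> hom G K"
  shows "finite S \<Longrightarrow> f ` S \<subseteq> carrier G \<Longrightarrow> h (finprod G f S) = finprod K (\<lambda>s. h (f s)) S"
proof (induction S rule: finite_induct)
  interpret G: comm_group G by fact
  interpret K: comm_group K by fact
  interpret h: group_hom G K h by unfold_locales (rule h)
  case empty
  then show ?case by simp
next
  interpret G: comm_group G by fact
  interpret K: comm_group K by fact
  interpret h: group_hom G K h by unfold_locales (rule h)
  case (insert s S)
  have c: "f \<in> S \<rightarrow> carrier G" "f s \<in> carrier G" using insert.prems by auto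
  have c': "(\<lambda>s. h (f s)) \<in> S \<rightarrow> carrier K" by (intro funcsetI h.hom_closed funcset_mem[OF c(1)])
  have "h (finprod G f (insert s S)) = h (f s \<otimes>\<^bsub>G\<^esub> finprod G f S)"
    using insert.hyps c by simp
  also have "\<dots> = h (f s) \<otimes>\<^bsub>K\<^esub> h (finprod G f S)" using c by simp
  also have "h (finprod G f S) = finprod K (\<lambda>s. h (f s)) S" using insert by simp
  also have "h (f s) \<otimes>\<^bsub>K\<^esub> finprod K (\<lambda>s. h (f s)) S = finprod K (\<lambda>s. h (f s)) (insert s S)"
    using insert.hyps c c' by simp
  finally show ?case .
qed

lemma Z_independent_iso:
  assumes G: "comm_group G" and K: "comm_group K" and h: "h \<in> iso G K" and S: "Z_independent G S"
  shows "Z_independent K (h ` S)" "card (h ` S) = card S"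
proof -
  interpret G: comm_group G by fact
  interpret K: comm_group K by fact
  have hom: "h \<in> hom G K" and inj: "inj_on h (carrier G)" using h by (auto simp: iso_def bij_betw_def)
  interpret h: group_hom G K h by unfold_locales (rule hom)
  have S': "finite S" "S \<subseteq> carrier G" and ind: "\<forall>c :: _ \<Rightarrow> int. finprod G (\<lambda>s. s [^]\<^bsub>G\<^esub> c s) S = \<one>\<^bsub>G\<^esub> \<longrightarrow> (\<forall>s\<in>S. c s = 0)"
    using S by (auto simp: Z_independent_def)
  have injS: "inj_on h S" using inj S'(2) by (rule inj_on_subset)
  then show "card (h ` S) = card S" by (rule card_image)
  have "c (h s) = 0" if one: "finprod K (\<lambda>y. y [^]\<^bsub>K\<^esub> c y) (h ` S) = \<one>\<^bsub>K\<^esub>" and s: "s \<in> S" for c :: "_ \<Rightarrow> int" and s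
  proof -
    have cl: "(\<lambda>s. s [^]\<^bsub>G\<^esub> c (h s)) ` S \<subseteq> carrier G" using S'(2) by auto
    have "h (finprod G (\<lambda>s. s [^]\<^bsub>G\<^esub> c (h s)) S) = finprod K (\<lambda>s. h (s [^]\<^bsub>G\<^esub> c (h s))) S"
      by (rule hom_finprod_comm_group[OF G K hom S'(1) cl])
    also have "\<dots> = finprod K (\<lambda>s. h s [^]\<^bsub>K\<^esub> c (h s)) S"
      by (rule K.finprod_cong') (use S'(2) in \<open>auto simp: h.hom_int_pow\<close>)
    also have "\<dots> = finprod K (\<lambda>y. y [^]\<^bsub>K\<^esub> c y) (h ` S)"
      by (rule K.finprod_reindex[symmetric]) (use S'(2) injS in auto)
    also have "\<dots> = h \<one>\<^bsub>G\<^esub>" using one by simp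
    finally have "finprod G (\<lambda>s. s [^]\<^bsub>G\<^esub> c (h s)) S = \<one>\<^bsub>G\<^esub>"
      by (rule inj_onD[OF inj]) (use cl in \<open>auto intro!: G.finprod_closed\<close>)
    then show ?thesis using ind[rule_format, of "\<lambda>s. c (h s)" s] s by simp
  qed
  then show "Z_independent K (h ` S)" using S' unfolding Z_independent_def by auto
qed

theorem theorem1p9:
  fixes k k1 k2 :: nat and N D :: real
    and X :: "nat \<Rightarrow> 'a metric" and p :: "nat \<Rightarrow> 'a" and m :: "nat \<Rightarrow> 'a measure"
    and Xh :: "nat \<Rightarrow> 'b metric" and ph :: "nat \<Rightarrow> 'b" and q :: "nat \<Rightarrow> 'b \<Rightarrow> 'a"
    and Y :: "'c metric" and yh :: 'c and H :: "('c \<Rightarrow> 'c) set"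
    and C :: "'g monoid" and TC :: "'g topology"
  assumes "1 \<le> N" and "real k \<le> N" and "0 < D"
    and "\<And>i. RCD (-1) N (X i) (m i)"
    and "\<And>i. p i \<in> mspace (X i)"
    and "\<And>i. first_betti (mtopology_of (X i)) (p i) = enat k"
    and "\<And>i x y. x \<in> mspace (X i) \<Longrightarrow> y \<in> mspace (X i) \<Longrightarrow> mdist (X i) x y \<le> D"
    and "\<And>i. homology_cover (Xh i) (ph i) (X i) (p i) (q i)"
    and "yh \<in> mspace Y"
    and "closed_isometry_subgroup H Y"
    and "eGH_converges Xh ph (\<lambda>i. deck_transformations (mtopology_of (Xh i)) (q i)) Y yh H"
    and "compact_group C TC"
    and "topological_group_isomorphic
           (isometry_group Y \<lparr>carrier := H\<rparr>) (subtopology (isometry_topology Y) H)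
           (RZC_group k1 k2 C) (RZC_topology k1 k2 TC)"
  shows "k = k1 + k2"
proof -
  let ?d = "k1 + k2"
  have plc: "pointed_length_covering (X i) (Xh i) (q i) (ph i) D" for i
    by (rule RCD_length_covering[OF assms(4) assms(7) assms(8)])
  interpret Y: isometric_action Y yh H
    using assms(9,10) unfolding closed_isometry_subgroup_def by (intro isometric_action.intro) simp_all
  have approx: "approximated_action (X i) (Xh i) (q i) (ph i) D Y yh H \<epsilon> f \<phi> \<psi>"
    if "0 < \<epsilon>" "eGH_approximation \<epsilon> (Xh i) (ph i) (deck_transformations (mtopology_of (Xh i)) (q i)) Y yh H f \<phi> \<psi>"
    for i \<epsilon> f \<phi> \<psi>
    by (intro approximated_action.intro approximated_action_axioms.intro plc Y.isometric_action_axioms that)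
  have nets: "has_finite_nets Y yh"
    unfolding has_finite_nets_def
  proof (intro allI impI)
    fix R \<eta> :: real assume \<eta>: "0 < \<eta>"
    define \<epsilon>0 where "\<epsilon>0 = min (\<eta> / 4) (1 / (\<bar>R\<bar> + \<eta>))"
    have "0 < \<epsilon>0" unfolding \<epsilon>0_def using \<eta> by simp
    from eGH_convergesD[OF assms(11) this] obtain i \<epsilon> f \<phi> \<psi> where \<epsilon>b: "0 < \<epsilon>" "\<epsilon> < \<epsilon>0"
      and a: "eGH_approximation \<epsilon> (Xh i) (ph i) (deck_transformations (mtopology_of (Xh i)) (q i)) Y yh H f \<phi> \<psi>"
      by (elim exE conjE)
    interpret approximated_action "X i" "Xh i" "q i" "ph i" D Y yh H \<epsilon> f \<phi> \<psi> by (rule approx[OF \<epsilon>b(1) a])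
    have "\<epsilon> < 1 / (\<bar>R\<bar> + \<eta>)" using \<epsilon>b(2) unfolding \<epsilon>0_def by simp
    then have "\<bar>R\<bar> + \<eta> < 1 / \<epsilon>" using \<eta> \<epsilon>b(1) by (simp add: less_divide_eq mult.commute)
    then show "\<exists>F. finite F \<and> F \<subseteq> mspace Y \<and> (\<forall>y\<in>mspace Y. mdist Y yh y < R \<longrightarrow> (\<exists>z\<in>F. mdist Y z y < \<eta>))"
      by (intro target_net \<eta>) (use \<epsilon>b(2) in \<open>auto simp: \<epsilon>0_def\<close>)
  qed
  obtain \<rho> :: "('c \<Rightarrow> 'c) \<Rightarrow> nat \<Rightarrow> real" and e where \<rho>: "\<And>g h j. g \<in> H \<Longrightarrow> h \<in> H \<Longrightarrow> j < ?d \<Longrightarrow> \<rho> (g \<otimes>\<^bsub>Y.HG\<^esub> h) j = \<rho> g j + \<rho> h j"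
    and e: "\<And>i. i < ?d \<Longrightarrow> e i \<in> H" "\<And>i j. i < ?d \<Longrightarrow> j < ?d \<Longrightarrow> \<rho> (e i) j = (if i = j then 1 else 0)"
    and box: "\<exists>r. \<forall>h\<in>H. (\<forall>j<?d. 0 \<le> \<rho> h j \<and> \<rho> h j \<le> 1) \<longrightarrow> Y.dispY h < r"
    and bound: "\<And>R. \<exists>B. \<forall>h\<in>H. Y.dispY h \<le> R \<longrightarrow> (\<forall>j<?d. \<bar>\<rho> h j\<bar> \<le> B)"
  proof (rule Y.RZC_coordinates[OF nets assms(12,13)], goal_cases)
    case (1 \<rho> e)
    then show thesis by (intro that[of \<rho> e])
  qed
  from box obtain rb where rb: "\<And>h. h \<in> H \<Longrightarrow> \<forall>j<?d. 0 \<le> \<rho> h j \<and> \<rho> h j \<le> 1 \<Longrightarrow> Y.dispY h < rb" by auto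
  \<comment> \<open>The summand 1 absorbs the \<open>2 * \<epsilon>\<close> lost when a basis
    element is replaced by its image under \<psi>; inserting 0 covers the case of no
    coordinates.\<close>
  define M where "M = Max (insert 0 ((\<lambda>i. Y.dispY (e i)) ` {..<?d})) + 1"
  have eM: "Y.dispY (e i) + 1 \<le> M" if "i < ?d" for i unfolding M_def using that by (simp add: Max_ge)
  have M0: "0 \<le> M" using Max_ge[of "insert 0 ((\<lambda>i. Y.dispY (e i)) ` {..<?d})" 0] unfolding M_def by simp
  define r where "r = max (2 * D + 3) (M + D + 2)"
  define r0 where "r0 = rb + 1"
  from bound[of "2 * r0 + r + 1"] obtain B where B: "\<forall>h\<in>H. Y.dispY h \<le> 2 * r0 + r + 1 \<longrightarrow> (\<forall>j<?d. \<bar>\<rho> h j\<bar> \<le> B)" by (rule exE)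
  obtain A :: nat where A: "1 \<le> A" "B + 1 \<le> real A"
  proof -
    obtain A' :: nat where "B + 1 \<le> real A'" using real_arch_simple by blast
    then show thesis by (intro that[of "Suc A'"]) simp_all
  qed
  \<comment> \<open>The largest number of factors in a word \<open>E a\<close> with entries up to
    \<open>8 * A\<close>.\<close>
  define n where "n = real (?d * (8 * A))"
  have n0: "0 \<le> n" by (simp add: n_def)
  \<comment> \<open>The absolute value gives a positive bound without knowing the sign of
    \<open>r0\<close>.\<close>
  define L where "L = \<bar>n * (2 * M) + 2 * r0 + r\<bar> + 1"
  have L0: "0 < L" by (simp add: L_def)
  \<comment> \<open>The first bound keeps the error accumulated along such a word, together with two
    further errors \<epsilon>, at most 1; the second keeps all words used inside the ball where the
    approximation is defined.\<close>
  define \<epsilon>0 where "\<epsilon>0 = min (1 / (n + 2)) (1 / L)"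
  have "0 < \<epsilon>0" unfolding \<epsilon>0_def using n0 L0 by simp
  from eGH_convergesD[OF assms(11) this] obtain i \<epsilon> f \<phi> \<psi> where \<epsilon>b: "0 < \<epsilon>" "\<epsilon> < \<epsilon>0"
    and a: "eGH_approximation \<epsilon> (Xh i) (ph i) (deck_transformations (mtopology_of (Xh i)) (q i)) Y yh H f \<phi> \<psi>"
    by (elim exE conjE)
  interpret approximated_action "X i" "Xh i" "q i" "ph i" D Y yh H \<epsilon> f \<phi> \<psi> by (rule approx[OF \<epsilon>b(1) a])
  have cov: "deck_group (mtopology_of (Xh i)) (q i) \<cong> first_homology (mtopology_of (X i)) (p i)" and qp: "q i (ph i) = p i"
    using assms(8) by (simp_all add: homology_cover_def)
  let ?H1 = "first_homology (mtopology_of (X i)) (p i)"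
  interpret H1: comm_group ?H1 by (rule comm_group_first_homology) (use assms(5) in simp)
  have iso: "?H1 \<cong> G" by (rule G.iso_sym[OF cov])
  have comm: "comm_group G" by (rule H1.iso_imp_comm_group[OF iso G.is_monoid])
  have \<epsilon>n: "n * \<epsilon> + 2 * \<epsilon> \<le> 1"
  proof -
    have "\<epsilon> \<le> 1 / (n + 2)" using \<epsilon>b(2) unfolding \<epsilon>0_def by simp
    then show ?thesis using n0 by (simp add: le_divide_eq distrib_left mult.commute)
  qed
  interpret lattice_approximation "X i" "Xh i" "q i" "ph i" D Y yh H \<epsilon> f \<phi> \<psi> \<rho> e ?d r r0 M A
  proof
    show "\<And>x y. x \<in> carrier G \<Longrightarrow> y \<in> carrier G \<Longrightarrow> x \<otimes>\<^bsub>G\<^esub> y = y \<otimes>\<^bsub>G\<^esub> x"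
      by (rule comm_monoid.m_comm[OF comm_group.axioms(1)[OF comm]])
    show "\<And>g h j. g \<in> H \<Longrightarrow> h \<in> H \<Longrightarrow> j < ?d \<Longrightarrow> \<rho> (g \<otimes>\<^bsub>Y.HG\<^esub> h) j = \<rho> g j + \<rho> h j" by (rule \<rho>)
    show "\<And>i. i < ?d \<Longrightarrow> e i \<in> H" by (rule e(1))
    show "\<And>i j. i < ?d \<Longrightarrow> j < ?d \<Longrightarrow> \<rho> (e i) j = (if i = j then 1 else 0)" by (rule e(2))
    show "\<And>i. i < ?d \<Longrightarrow> Y.dispY (e i) + 1 \<le> M" by (rule eM)
    show "0 \<le> M" by (rule M0)
    show "Y.dispY h + 1 < r0" if "h \<in> H" "\<forall>j<?d. 0 \<le> \<rho> h j \<and> \<rho> h j \<le> 1" for h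
      using rb[OF that] by (simp add: r0_def)
    show "\<bar>\<rho> h j\<bar> + 1 \<le> real A" if "h \<in> H" "Y.dispY h \<le> 2 * r0 + r + 1" "j < ?d" for h j
      using B[rule_format, OF that] A(2) by linarith
    show "1 \<le> A" by (rule A(1))
    show "2 * D + 3 \<le> r" "M + D + 2 \<le> r" by (simp_all add: r_def)
    have "0 \<le> n * \<epsilon>" using n0 \<epsilon>b(1) by simp
    then show "\<epsilon> \<le> 1 / 2" using \<epsilon>n by linarith
    show "real (?d * (8 * A)) * \<epsilon> + 2 * \<epsilon> \<le> 1" using \<epsilon>n unfolding n_def .
    have "\<epsilon> < 1 / L" using \<epsilon>b(2) unfolding \<epsilon>0_def by simp
    then have "L < 1 / \<epsilon>" using \<epsilon>b(1) L0 by (simp add: less_divide_eq mult.commute)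
    then show "real (?d * (8 * A)) * (2 * M) + 2 * r0 + r < 1 / \<epsilon>" unfolding L_def n_def by linarith
  qed
  have betti: "(SUP S\<in>{S. Z_independent ?H1 S}. enat (card S)) = enat k"
    using assms(6)[of i] unfolding first_betti_def abelian_group_rank_def .
  obtain S where S: "Z_independent ?H1 S" "card S = ?d" using first_homology_independent unfolding qp by (elim exE conjE)
  have "enat ?d \<le> enat k" unfolding betti[symmetric] S(2)[symmetric] by (rule SUP_upper) (use S(1) in simp)
  moreover have "enat k \<le> enat ?d"
    unfolding betti[symmetric]
  proof (rule SUP_least)
    fix S assume "S \<in> {S. Z_independent ?H1 S}"
    then have S: "Z_independent ?H1 S" by simp
    obtain h where h: "h \<in> iso ?H1 G" using iso unfolding is_iso_def by auto
    note hS = Z_independent_iso[OF H1.comm_group_axioms comm h S]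
    show "enat (card S) \<le> enat ?d" using card_deck_independent_le[OF hS(1)] unfolding hS(2) by simp
  qed
  ultimately show ?thesis by simp
qed

end
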